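(* Let $\operatorname{E}$ be the intersection of all maximal Hardy fields, $\operatorname{E}^\infty(\mathbb{Q})$ the intersection of all maximal smooth Hardy fields, $\operatorname{E}^\omega(\mathbb{Q})$ the intersection of all maximal analytic Hardy fields, and $\operatorname{D}(\mathbb{Q})$ the intersection of all $\operatorname{d}$-maximal Hardy fields. Then $$\operatorname{E}=\operatorname{E}^\infty(\mathbb{Q})=\operatorname{E}^\omega(\mathbb{Q})=\operatorname{D}(\mathbb{Q}).$$ In particular, every germ lying in all maximal analytic Hardy fields also lies in all maximal Hardy fields.
   Context: $\mathcal{C}^r$ ($r\in\mathbb{N}\cup\{\infty,\omega\}$) denotes the ring of germs at $+\infty$ of real-valued $\mathcal{C}^r$-functions on half-lines $(a,+\infty)$ ($\omega$ meaning real analytic), and $\mathcal{C}^{<\infty}=\bigcap_n\mathcal{C}^n$, a differential ring. A Hardy field is a subfield of $\mathcal{C}^{<\infty}$ closed under the derivation. It is smooth (resp. analytic) if it is contained in $\mathcal{C}^\infty$ (resp. $\mathcal{C}^\omega$). A Hardy field is maximal if it has no proper Hardy field extension; maximal smooth (resp. maximal analytic) if it has no proper smooth (resp. analytic) Hardy field extension; $\operatorname{d}$-maximal if it has no proper Hardy field extension that is differentially algebraic over it. The Hardy field $\mathbb{Q}$ is contained in all of these. *)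

theory Defs
  imports "HOL-Analysis.Analysis"
begin

text \<open>Germs at +\<infinity> are represented by total functions real \<Rightarrow> real; a set of germs is
represented by a set of functions that is saturated under eventual equality at +\<infinity>.\<close>

definition germ_eq :: "(real \<Rightarrow> real) \<Rightarrow> (real \<Rightarrow> real) \<Rightarrow> bool" where
  "germ_eq f g \<longleftrightarrow> eventually (\<lambda>x. f x = g x) at_top"

definition saturated :: "(real \<Rightarrow> real) set \<Rightarrow> bool" where
  "saturated H \<longleftrightarrow> (\<forall>f g. f \<in> H \<and> germ_eq f g \<longrightarrow> g \<in> H)"

definition Cn_on :: "nat \<Rightarrow> real set \<Rightarrow> (real \<Rightarrow> real) \<Rightarrow> bool" where
  "Cn_on n S f \<longleftrightarrow>
     (\<forall>k<n. \<forall>x\<in>S. ((deriv ^^ k) f has_real_derivative (deriv ^^ Suc k) f x) (at x))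
     \<and> continuous_on S ((deriv ^^ n) f)"

definition real_analytic_on :: "real set \<Rightarrow> (real \<Rightarrow> real) \<Rightarrow> bool" where
  "real_analytic_on S f \<longleftrightarrow>
     (\<forall>x\<in>S. \<exists>r>0. \<exists>c::nat \<Rightarrow> real.
        \<forall>y. \<bar>y - x\<bar> < r \<longrightarrow> (\<lambda>n. c n * (y - x) ^ n) sums f y)"

definition germ_Cn :: "nat \<Rightarrow> (real \<Rightarrow> real) set" where
  "germ_Cn n = {f. \<exists>a. Cn_on n {a<..} f}"

definition germ_C_lt_inf :: "(real \<Rightarrow> real) set" where
  "germ_C_lt_inf = (\<Inter>n. germ_Cn n)"

definition germ_C_inf :: "(real \<Rightarrow> real) set" where
  "germ_C_inf = {f. \<exists>a. \<forall>n. Cn_on n {a<..} f}"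

definition germ_C_omega :: "(real \<Rightarrow> real) set" where
  "germ_C_omega = {f. \<exists>a. real_analytic_on {a<..} f}"

definition hardy_field :: "(real \<Rightarrow> real) set \<Rightarrow> bool" where
  "hardy_field H \<longleftrightarrow>
     saturated H \<and> H \<subseteq> germ_C_lt_inf \<and>
     (\<lambda>x. 0) \<in> H \<and> (\<lambda>x. 1) \<in> H \<and>
     (\<forall>f\<in>H. \<forall>g\<in>H. (\<lambda>x. f x + g x) \<in> H) \<and>
     (\<forall>f\<in>H. (\<lambda>x. - f x) \<in> H) \<and>
     (\<forall>f\<in>H. \<forall>g\<in>H. (\<lambda>x. f x * g x) \<in> H) \<and>
     (\<forall>f\<in>H. \<not> germ_eq f (\<lambda>x. 0) \<longrightarrow> (\<exists>g\<in>H. germ_eq (\<lambda>x. f x * g x) (\<lambda>x. 1))) \<and>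
     (\<forall>f\<in>H. deriv f \<in> H)"

definition smooth_hardy_field :: "(real \<Rightarrow> real) set \<Rightarrow> bool" where
  "smooth_hardy_field H \<longleftrightarrow> hardy_field H \<and> H \<subseteq> germ_C_inf"

definition analytic_hardy_field :: "(real \<Rightarrow> real) set \<Rightarrow> bool" where
  "analytic_hardy_field H \<longleftrightarrow> hardy_field H \<and> H \<subseteq> germ_C_omega"

definition maximal_hardy_field :: "(real \<Rightarrow> real) set \<Rightarrow> bool" where
  "maximal_hardy_field H \<longleftrightarrow> hardy_field H \<and>
     (\<forall>H'. hardy_field H' \<and> H \<subseteq> H' \<longrightarrow> H' = H)"

definition maximal_smooth_hardy_field :: "(real \<Rightarrow> real) set \<Rightarrow> bool" where
  "maximal_smooth_hardy_field H \<longleftrightarrow> smooth_hardy_field H \<and>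
     (\<forall>H'. smooth_hardy_field H' \<and> H \<subseteq> H' \<longrightarrow> H' = H)"

definition maximal_analytic_hardy_field :: "(real \<Rightarrow> real) set \<Rightarrow> bool" where
  "maximal_analytic_hardy_field H \<longleftrightarrow> analytic_hardy_field H \<and>
     (\<forall>H'. analytic_hardy_field H' \<and> H \<subseteq> H' \<longrightarrow> H' = H)"

text \<open>f is differentially algebraic over H: P(f, f', ..., f^(n)) = 0 (as germs) for some nonzero
polynomial P in n+1 variables with coefficients in H.  P is given by a finite set M of exponent
vectors (supported in {0..n}) and coefficients c \<alpha> \<in> H, at least one of them a nonzero germ.\<close>
definition d_algebraic_over :: "(real \<Rightarrow> real) set \<Rightarrow> (real \<Rightarrow> real) \<Rightarrow> bool" where
  "d_algebraic_over H f \<longleftrightarrow>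
     (\<exists>n::nat. \<exists>M::(nat \<Rightarrow> nat) set. \<exists>c::(nat \<Rightarrow> nat) \<Rightarrow> real \<Rightarrow> real.
        finite M \<and> (\<forall>\<alpha>\<in>M. \<forall>i>n. \<alpha> i = 0) \<and> (\<forall>\<alpha>\<in>M. c \<alpha> \<in> H) \<and>
        (\<exists>\<alpha>\<in>M. \<not> germ_eq (c \<alpha>) (\<lambda>x. 0)) \<and>
        germ_eq (\<lambda>x. \<Sum>\<alpha>\<in>M. c \<alpha> x * (\<Prod>i\<le>n. ((deriv ^^ i) f x) ^ \<alpha> i)) (\<lambda>x. 0))"

definition d_maximal_hardy_field :: "(real \<Rightarrow> real) set \<Rightarrow> bool" where
  "d_maximal_hardy_field H \<longleftrightarrow> hardy_field H \<and>
     (\<forall>H'. hardy_field H' \<and> H \<subseteq> H' \<and> (\<forall>f\<in>H'. d_algebraic_over H f) \<longrightarrow> H' = H)"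

end

theory Submission
  imports Defs "HOL-Complex_Analysis.Complex_Analysis" "HOL-Probability.Probability" "HOL-Real_Asymp.Real_Asymp"
begin

text \<open>Call a germ \<open>f\<close> adjoinable if every analytic Hardy field lies in some Hardy field that contains \<open>f\<close>.
By Zorn's lemma the germs in all maximal, in all maximal smooth, or in all maximal analytic Hardy
fields are adjoinable, and a maximal Hardy field is d-maximal. So it suffices that an
adjoinable \<open>f\<close> is analytic and lies in every d-maximal Hardy field \<open>H\<close>: for a maximal smooth
(analytic) \<open>M\<close>, a maximal Hardy field above \<open>M\<close> meets the smooth (analytic) germs exactly in \<open>M\<close>.

The tool is that a countable Hardy field \<open>K\<close> has an analytic copy \<open>K*\<close> which is
closer to \<open>K\<close> than every power of \<open>exp (- E)\<close>, where \<open>E\<close> grows as fast as we like. The copy is built one germ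
\<open>y\<close> at a time: if \<open>y\<close> is differentially transcendental, any sufficiently close analytic
approximation serves as \<open>y*\<close>; otherwise \<open>y*\<close> is the solution close to \<open>y\<close> of the copied differential equation.

If some \<open>p\<close> in \<open>H[f, f', ...]\<close> changed sign at arbitrarily large arguments, so would the same differential
polynomial \<open>p*\<close> in \<open>f\<close> with copied coefficients, though \<open>p*\<close> lies in a Hardy field together with \<open>f\<close>. Hence
\<open>H\<close> and \<open>f\<close> generate a Hardy field \<open>F\<close>. Suppose \<open>z = P(f) / Q(f)\<close> in \<open>F\<close> were differentially
transcendental over \<open>H\<close>. Then \<open>z\<close> may be copied to an analytic \<open>g\<close> close to \<open>z\<close> plus a tiny
bump of alternating sign, while the coefficients are copied with an error that is tiny even compared with this bump;
thus \<open>P*(f) - g Q*(f)\<close> changes sign infinitely often, but lies in a Hardy field. So \<open>F\<close> is differentially algebraic over \<open>H\<close>,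
and \<open>f \<in> H\<close> if \<open>H\<close> is d-maximal. For \<open>H\<close> the rational constants this yields an algebraic differential
equation with nonvanishing separant for \<open>f\<close>, so \<open>f\<close> is analytic.\<close>

section \<open>Germs and Hardy fields\<close>

text \<open>Adjoinability tests \<open>f\<close> only against analytic Hardy fields, while
  \<open>H\<close> is arbitrary; this gap is what the copies bridge. They need countability because
  a sequence of germs is always dominated by a single \<open>E\<close>. Once \<open>E\<close>
  dominates \<open>K\<close>, every nonzero a in \<open>K\<close> satisfies eventually \<bar>a\<bar>
  \<ge> 1 / E, because 1 / a is in \<open>K\<close> too; so an error below all powers of exp (- E)
  can neither annihilate a nor change its sign. Only finitely many coefficients enter a statement
  about one differential polynomial, hence a countable subfield of \<open>H\<close> suffices each
  time. \<open>E\<close> is chosen after the points at which the polynomial in question is positive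
  or negative; thus an oscillation survives copying. In the algebraic case the solution of the
  copied equation is obtained by integrating from infinity, and dividing by the separant, which is
  nonzero by minimality of the equation, puts that equation into explicit form. In the
  transcendental case no relation constrains the copy, and this freedom makes room for the
  bump.\<close>

lemma Cn_on_0: "Cn_on 0 S f \<longleftrightarrow> continuous_on S f"
  unfolding Cn_on_def by simp

lemma Cn_on_Suc:
  "Cn_on (Suc n) S f \<longleftrightarrow> (\<forall>x\<in>S. (f has_real_derivative deriv f x) (at x)) \<and> Cn_on n S (deriv f)"
proof -
  have e: "(deriv ^^ k) (deriv f) = (deriv ^^ Suc k) f" for k by (simp only: funpow_Suc_right o_apply)
  have "(\<forall>k<Suc n. P k) \<longleftrightarrow> P 0 \<and> (\<forall>k<n. P (Suc k))" for P :: "nat \<Rightarrow> bool"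
    by (auto simp: less_Suc_eq_0_disj)
  then show ?thesis unfolding Cn_on_def e by auto
qed

text \<open>\<open>deriv\<close> looks at a neighbourhood, so pointwise agreement on
  \<open>S\<close> passes to iterated derivatives because \<open>S\<close> is open. The second
  conclusion is also used by itself, to compare derivatives of functions that agree locally.\<close>

lemma Cn_on_cong:
  assumes "open S" "\<And>x. x \<in> S \<Longrightarrow> f x = g x" "Cn_on n S f"
  shows "Cn_on n S g" and "\<And>x k. x \<in> S \<Longrightarrow> (deriv ^^ k) f x = (deriv ^^ k) g x"
proof -
  show e: "(deriv ^^ k) f x = (deriv ^^ k) g x" if "x \<in> S" for x k
    using that
  proof (induction k arbitrary: x)
    case (Suc k)
    have "eventually (\<lambda>y. y \<in> S) (nhds x)" using assms(1) Suc.prems by (rule eventually_nhds_in_open)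
    then have "eventually (\<lambda>y. (deriv ^^ k) f y = (deriv ^^ k) g y) (nhds x)"
      by eventually_elim (rule Suc.IH)
    then show ?case by (auto intro: deriv_cong_ev)
  qed (use assms in auto)
  show "Cn_on n S g"
    unfolding Cn_on_def
  proof (intro conjI allI impI ballI)
    fix k x assume "k < n" and x: "x \<in> S"
    then have "((deriv ^^ k) f has_real_derivative (deriv ^^ Suc k) f x) (at x)"
      using assms(3) unfolding Cn_on_def by blast
    then have "((deriv ^^ k) g has_real_derivative (deriv ^^ Suc k) f x) (at x)"
      by (rule has_field_derivative_transform_within_open[OF _ assms(1) x]) (rule e)
    then show "((deriv ^^ k) g has_real_derivative (deriv ^^ Suc k) g x) (at x)"
      by (simp only: e[OF x])
  next
    have "continuous_on S ((deriv ^^ n) f)" using assms(3) unfolding Cn_on_def by blast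
    then show "continuous_on S ((deriv ^^ n) g)" by (rule continuous_on_eq) (rule e)
  qed
qed

lemma Cn_on_derivI:
  assumes "open S" "\<And>x. x \<in> S \<Longrightarrow> (f has_real_derivative g x) (at x)" "Cn_on n S g"
  shows "Cn_on (Suc n) S f"
proof -
  have "Cn_on n S (deriv f)"
    by (rule Cn_on_cong(1)[OF assms(1) _ assms(3)]) (use assms(2) DERIV_imp_deriv in force)
  moreover have "(f has_real_derivative deriv f x) (at x)" if "x \<in> S" for x
    using assms(2)[OF that] by (simp add: DERIV_imp_deriv)
  ultimately show ?thesis unfolding Cn_on_Suc by blast
qed

lemma Cn_on_SucD: "Cn_on (Suc n) S f \<Longrightarrow> Cn_on n S f"
proof -
  assume f: "Cn_on (Suc n) S f"
  then have "continuous_on S ((deriv ^^ n) f)"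
    unfolding Cn_on_def by (intro continuous_at_imp_continuous_on ballI) (blast intro: DERIV_isCont)
  then show ?thesis using f unfolding Cn_on_def by auto
qed

lemma Cn_on_le: "m \<le> n \<Longrightarrow> Cn_on n S f \<Longrightarrow> Cn_on m S f"
  by (induction n rule: dec_induct) (auto dest: Cn_on_SucD)

lemma Cn_on_subset: "Cn_on n S f \<Longrightarrow> T \<subseteq> S \<Longrightarrow> Cn_on n T f"
  unfolding Cn_on_def using continuous_on_subset by blast

lemma Cn_on_const: "open S \<Longrightarrow> Cn_on n S (\<lambda>x. c)"
proof (induction n arbitrary: c)
  case 0 then show ?case by (simp add: Cn_on_0)
next
  case (Suc n) then show ?case by (intro Cn_on_derivI[where g = "\<lambda>x. 0"]) auto
qed

lemma Cn_on_add: "open S \<Longrightarrow> Cn_on n S f \<Longrightarrow> Cn_on n S g \<Longrightarrow> Cn_on n S (\<lambda>x. f x + g x)"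
proof (induction n arbitrary: f g)
  case 0 then show ?case by (auto simp: Cn_on_0 intro: continuous_on_add)
next
  case (Suc n)
  then show ?case
    by (intro Cn_on_derivI[where g = "\<lambda>x. deriv f x + deriv g x"]) (auto simp: Cn_on_Suc intro: DERIV_add)
qed

lemma Cn_on_mult: "open S \<Longrightarrow> Cn_on n S f \<Longrightarrow> Cn_on n S g \<Longrightarrow> Cn_on n S (\<lambda>x. f x * g x)"
proof (induction n arbitrary: f g)
  case 0 then show ?case by (auto simp: Cn_on_0 intro: continuous_on_mult)
next
  case (Suc n)
  have "Cn_on n S f" "Cn_on n S g" using Suc.prems Cn_on_SucD by auto
  then have "Cn_on n S (\<lambda>x. deriv f x * g x + deriv g x * f x)"
    using Suc.prems by (intro Cn_on_add Suc.IH) (auto simp: Cn_on_Suc)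
  then show ?case using Suc.prems
    by (intro Cn_on_derivI[where g = "\<lambda>x. deriv f x * g x + deriv g x * f x"]) (auto simp: Cn_on_Suc intro: DERIV_mult)
qed

lemma Cn_on_inverse: "open S \<Longrightarrow> Cn_on n S f \<Longrightarrow> (\<And>x. x \<in> S \<Longrightarrow> f x \<noteq> 0) \<Longrightarrow> Cn_on n S (\<lambda>x. inverse (f x))"
proof (induction n arbitrary: f)
  case 0 then show ?case by (auto simp: Cn_on_0 intro: continuous_on_inverse)
next
  case (Suc n)
  have i: "Cn_on n S (\<lambda>x. inverse (f x))" using Suc.prems Cn_on_SucD by (intro Suc.IH) auto
  show ?case
  proof (rule Cn_on_derivI[where g = "\<lambda>x. (-1) * deriv f x * (inverse (f x) * inverse (f x))"])
    show "Cn_on n S (\<lambda>x. (-1) * deriv f x * (inverse (f x) * inverse (f x)))"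
      using Suc.prems i by (intro Cn_on_mult Cn_on_const) (auto simp: Cn_on_Suc)
    fix x assume x: "x \<in> S"
    have "(f has_real_derivative deriv f x) (at x)" using Suc.prems x by (auto simp: Cn_on_Suc)
    then show "((\<lambda>x. inverse (f x)) has_real_derivative (-1) * deriv f x * (inverse (f x) * inverse (f x))) (at x)"
      using Suc.prems(3)[OF x] by (auto intro!: derivative_eq_intros simp: power2_eq_square)
  qed (use Suc.prems in auto)
qed

text \<open>Used as a coinduction principle: a family closed under differentiation consists of C^n
  functions for every n. It is applied to the family of polynomial expressions in the solution of a
  differential equation.\<close>

lemma Cn_on_coinduct:
  assumes op: "open A" and step: "\<And>f. f \<in> S \<Longrightarrow> \<exists>g\<in>S. \<forall>x\<in>A. (f has_real_derivative g x) (at x)"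
  shows "f \<in> S \<Longrightarrow> Cn_on n A f"
proof (induction n arbitrary: f)
  case 0
  then obtain g where "\<forall>x\<in>A. (f has_real_derivative g x) (at x)" using step by blast
  then show ?case unfolding Cn_on_0 by (blast intro: continuous_at_imp_continuous_on DERIV_isCont)
next
  case (Suc n)
  then obtain g where "g \<in> S" "\<forall>x\<in>A. (f has_real_derivative g x) (at x)" using step by blast
  then show ?case using Suc.IH by (blast intro: Cn_on_derivI[OF op])
qed

lemma DERIV_ev_transfer:
  fixes f g :: "real \<Rightarrow> real"
  assumes "(f has_real_derivative D) (at x)" "eventually (\<lambda>y. f y = g y) (nhds x)"
  shows "(g has_real_derivative D) (at x)"
  using DERIV_cong_ev[OF refl assms(2) refl] assms(1) by simp

section \<open>Real analytic functions through holomorphic extensions\<close>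

text \<open>Analyticity is handled through a local holomorphic extension \<open>F\<close> on a
  complex ball around the real point \<open>x\<close>; closure under products, inverses and
  derivatives then comes from complex analysis.\<close>

definition real_holo :: "(real \<Rightarrow> real) \<Rightarrow> (complex \<Rightarrow> complex) \<Rightarrow> real \<Rightarrow> real \<Rightarrow> bool" where
  "real_holo f F x r \<longleftrightarrow> r > 0 \<and> F holomorphic_on ball (of_real x) r \<and>
     (\<forall>y. \<bar>y - x\<bar> < r \<longrightarrow> F (of_real y) = of_real (f y))"

lemma real_mem_ball: "\<bar>y - x\<bar> < r \<longleftrightarrow> complex_of_real y \<in> ball (of_real x) r"
  by (simp add: dist_of_real dist_real_def abs_minus_commute)

text \<open>A power series that converges at a real point at distance \<rho> from the centre
  converges on the complex disc of radius \<rho>, which extends \<open>f\<close> holomorphically.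
  Conversely the Taylor coefficients of an extension at a real centre may be replaced by their real
  parts, because the values at real arguments are real.\<close>

lemma real_analytic_on_iff:
  "real_analytic_on S f \<longleftrightarrow> (\<forall>x\<in>S. \<exists>F r. real_holo f F x r)"
proof
  assume f: "real_analytic_on S f"
  show "\<forall>x\<in>S. \<exists>F r. real_holo f F x r"
  proof
    fix x assume "x \<in> S"
    then obtain r c where r: "r > 0" and s: "\<And>y. \<bar>y - x\<bar> < r \<Longrightarrow> (\<lambda>n. c n * (y - x) ^ n) sums f y"
      using f unfolding real_analytic_on_def by blast
    define F where "F z = (\<Sum>n. complex_of_real (c n) * (z - of_real x) ^ n)" for z
    have sm: "summable (\<lambda>n. complex_of_real (c n) * (z - of_real x) ^ n)" if "z \<in> ball (of_real x) r" for z
    proof -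
      \<comment> \<open>Halfway between the distance of \<open>z\<close> and the radius: convergence
        of the real series at \<open>x + \<rho>\<close> gives convergence at the strictly closer
        point \<open>z\<close>.\<close>
      define \<rho> where "\<rho> = (cmod (z - of_real x) + r) / 2"
      have z: "cmod (z - of_real x) < r" using that by (simp add: dist_norm norm_minus_commute)
      have \<rho>: "cmod (z - of_real x) < \<rho>" "\<rho> < r" "\<rho> \<ge> 0" using z r by (auto simp: \<rho>_def)
      have "summable (\<lambda>n. c n * \<rho> ^ n)" using s[of "x + \<rho>"] \<rho> by (auto simp: sums_iff)
      then have "summable (\<lambda>n. complex_of_real (c n * \<rho> ^ n))" by (rule summable_of_real)
      then have "summable (\<lambda>n. complex_of_real (c n) * (of_real \<rho>) ^ n)" by simp
      then show ?thesis by (rule powser_inside) (use \<rho> in simp)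
    qed
    have "F holomorphic_on ball (of_real x) r"
      by (rule power_series_holomorphic[of _ _ "\<lambda>n. complex_of_real (c n)"]) (use sm in \<open>auto simp: F_def summable_sums\<close>)
    moreover have "F (of_real y) = of_real (f y)" if "\<bar>y - x\<bar> < r" for y
    proof -
      have "(\<lambda>n. complex_of_real (c n * (y - x) ^ n)) sums of_real (f y)" using s[OF that] by (rule sums_of_real)
      then show ?thesis by (simp add: F_def sums_iff)
    qed
    ultimately have "real_holo f F x r" unfolding real_holo_def using r by blast
    then show "\<exists>F r. real_holo f F x r" by blast
  qed
next
  assume R: "\<forall>x\<in>S. \<exists>F r. real_holo f F x r"
  show "real_analytic_on S f" unfolding real_analytic_on_def
  proof
    fix x assume "x \<in> S"
    then obtain F r where "real_holo f F x r" using R by blast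
    then have r: "r > 0" and F: "F holomorphic_on ball (of_real x) r"
      and eq: "\<And>y. \<bar>y - x\<bar> < r \<Longrightarrow> F (of_real y) = of_real (f y)" unfolding real_holo_def by auto
    define c where "c n = Re ((deriv ^^ n) F (of_real x) / fact n)" for n
    have "(\<lambda>n. c n * (y - x) ^ n) sums f y" if y: "\<bar>y - x\<bar> < r" for y
    proof -
      have "(\<lambda>n. (deriv ^^ n) F (of_real x) / fact n * (of_real y - of_real x) ^ n) sums F (of_real y)"
        by (rule holomorphic_power_series[OF F]) (use y real_mem_ball in blast)
      then have "(\<lambda>n. Re ((deriv ^^ n) F (of_real x) / fact n * (of_real y - of_real x) ^ n)) sums Re (F (of_real y))"
        by (rule sums_Re)
      moreover have "Re ((deriv ^^ n) F (of_real x) / fact n * (of_real y - of_real x) ^ n) = c n * (y - x) ^ n" for n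
      proof -
        have "(complex_of_real y - of_real x) ^ n = of_real ((y - x) ^ n)" by simp
        then show ?thesis unfolding c_def by (simp only: Re_complex_of_real Im_complex_of_real times_complex.sel mult_zero_right diff_zero)
      qed
      ultimately show ?thesis using eq[OF y] by simp
    qed
    then show "\<exists>r>0. \<exists>c. \<forall>y. \<bar>y - x\<bar> < r \<longrightarrow> (\<lambda>n. c n * (y - x) ^ n) sums f y" using r by blast
  qed
qed

lemma real_holo_shrink: "real_holo f F x r \<Longrightarrow> 0 < s \<Longrightarrow> s \<le> r \<Longrightarrow> real_holo f F x s"
  unfolding real_holo_def by (auto intro: holomorphic_on_subset[OF _ subset_ball])

text \<open>The restriction of \<open>F\<close> to the real axis is differentiated as a curve in the
  complex plane. Its real part is \<open>f\<close> and its imaginary part vanishes, so the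
  derivative of \<open>F\<close> at real points is real and equals that of \<open>f\<close>.\<close>

lemma real_holo_has_derivative:
  assumes "real_holo f F x r" "\<bar>y - x\<bar> < r"
  shows "(f has_real_derivative Re (deriv F (of_real y))) (at y)" "Im (deriv F (of_real y)) = 0"
proof -
  have F: "F holomorphic_on ball (of_real x) r"
      and eq: "\<And>y. \<bar>y - x\<bar> < r \<Longrightarrow> F (of_real y) = of_real (f y)" using assms(1) unfolding real_holo_def by auto
  have "(F has_field_derivative deriv F (of_real y)) (at (of_real y))"
    using holomorphic_derivI[OF F open_ball] assms(2) real_mem_ball by blast
  then have v: "((\<lambda>y. F (of_real y)) has_vector_derivative deriv F (of_real y)) (at y)"
    by (rule has_vector_derivative_real_field)
  have nb: "eventually (\<lambda>z. \<bar>z - x\<bar> < r) (nhds y)"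
  proof -
    have "eventually (\<lambda>z. z \<in> {z. \<bar>z - x\<bar> < r}) (nhds y)"
      by (rule eventually_nhds_in_open) (use assms(2) in \<open>auto intro!: open_Collect_less continuous_intros\<close>)
    then show ?thesis by simp
  qed
  have "((\<lambda>y. Re (F (of_real y))) has_real_derivative Re (deriv F (of_real y))) (at y)"
    using bounded_linear.has_vector_derivative[OF bounded_linear_Re v] by (simp add: has_real_derivative_iff_has_vector_derivative)
  moreover have "eventually (\<lambda>z. Re (F (of_real z)) = f z) (nhds y)"
    using nb by eventually_elim (simp add: eq)
  ultimately show "(f has_real_derivative Re (deriv F (of_real y))) (at y)"
    by (rule DERIV_ev_transfer)
  have "((\<lambda>y. Im (F (of_real y))) has_real_derivative Im (deriv F (of_real y))) (at y)"
    using bounded_linear.has_vector_derivative[OF bounded_linear_Im v] by (simp add: has_real_derivative_iff_has_vector_derivative)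
  moreover have "eventually (\<lambda>z. Im (F (of_real z)) = 0) (nhds y)"
    using nb by eventually_elim (simp add: eq)
  ultimately have "((\<lambda>y. 0) has_real_derivative Im (deriv F (of_real y))) (at y)"
    by (rule DERIV_ev_transfer)
  then show "Im (deriv F (of_real y)) = 0" using DERIV_unique[OF _ DERIV_const] by blast
qed

lemma real_holo_deriv:
  assumes "real_holo f F x r"
  shows "real_holo (deriv f) (deriv F) x r"
proof -
  have "deriv F (of_real y) = of_real (deriv f y)" if "\<bar>y - x\<bar> < r" for y
    using real_holo_has_derivative[OF assms that] by (auto simp: complex_eq_iff DERIV_imp_deriv)
  then show ?thesis using assms unfolding real_holo_def by (auto intro: holomorphic_deriv)
qed

lemma real_holo_derivs: "real_holo f F x r \<Longrightarrow> real_holo ((deriv ^^ k) f) ((deriv ^^ k) F) x r"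
  by (induction k) (auto intro: real_holo_deriv)

lemma real_analytic_on_const: "real_analytic_on S (\<lambda>x. c)"
  unfolding real_analytic_on_iff real_holo_def by (intro ballI exI[of _ "\<lambda>z. of_real c"] exI[of _ 1]) auto

lemma real_analytic_on_deriv: "real_analytic_on S f \<Longrightarrow> real_analytic_on S (deriv f)"
  unfolding real_analytic_on_iff using real_holo_deriv by blast

text \<open>\<open>H\<close> is the complex form of the real operation \<open>h\<close>; the two
  extensions are combined on the smaller ball.\<close>

lemma real_analytic_on_binop:
  assumes f: "real_analytic_on S f" and g: "real_analytic_on S g"
    and h: "\<And>F G A. F holomorphic_on A \<Longrightarrow> G holomorphic_on A \<Longrightarrow> (\<lambda>z. H (F z) (G z)) holomorphic_on A"
    and e: "\<And>a b. H (complex_of_real a) (complex_of_real b) = of_real (h a b)"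
  shows "real_analytic_on S (\<lambda>x. h (f x) (g x))"
  unfolding real_analytic_on_iff
proof
  fix x assume x: "x \<in> S"
  obtain F r where F: "real_holo f F x r" using f x unfolding real_analytic_on_iff by blast
  obtain G s where G: "real_holo g G x s" using g x unfolding real_analytic_on_iff by blast
  define t where "t = min r s"
  have t: "0 < t" "t \<le> r" "t \<le> s" using F G unfolding t_def real_holo_def by auto
  have "real_holo (\<lambda>x. h (f x) (g x)) (\<lambda>z. H (F z) (G z)) x t"
    using real_holo_shrink[OF F t(1,2)] real_holo_shrink[OF G t(1,3)] h e unfolding real_holo_def by auto
  then show "\<exists>F r. real_holo (\<lambda>x. h (f x) (g x)) F x r" by blast
qed

lemma real_analytic_on_add: "real_analytic_on S f \<Longrightarrow> real_analytic_on S g \<Longrightarrow> real_analytic_on S (\<lambda>x. f x + g x)"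
  by (rule real_analytic_on_binop[where H = "(+)"]) (auto intro: holomorphic_on_add)

lemma real_analytic_on_mult: "real_analytic_on S f \<Longrightarrow> real_analytic_on S g \<Longrightarrow> real_analytic_on S (\<lambda>x. f x * g x)"
  by (rule real_analytic_on_binop[where H = "(*)"]) (auto intro: holomorphic_on_mult)

text \<open>The extension is nonzero at the real centre, hence on a smaller ball by
  continuity.\<close>

lemma real_analytic_on_inverse:
  assumes f: "real_analytic_on S f" and nz: "\<And>x. x \<in> S \<Longrightarrow> f x \<noteq> 0"
  shows "real_analytic_on S (\<lambda>x. inverse (f x))"
  unfolding real_analytic_on_iff
proof
  fix x assume x: "x \<in> S"
  obtain F r where F: "real_holo f F x r" using f x unfolding real_analytic_on_iff by blast
  then have r: "r > 0" and hol: "F holomorphic_on ball (of_real x) r"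
      and eq: "\<And>y. \<bar>y - x\<bar> < r \<Longrightarrow> F (of_real y) = of_real (f y)" unfolding real_holo_def by auto
  have "F (of_real x) \<noteq> 0" using eq[of x] r nz[OF x] by simp
  moreover have "continuous_on (ball (of_real x) r) F" by (rule holomorphic_on_imp_continuous_on[OF hol])
  ultimately obtain e where e: "e > 0" "\<And>z. dist (of_real x) z < e \<Longrightarrow> z \<in> ball (of_real x) r \<Longrightarrow> F z \<noteq> 0"
    using continuous_on_avoid[of "ball (of_real x) r" F "of_real x" 0] r by auto
  define t where "t = min r e"
  have t: "0 < t" "t \<le> r" "t \<le> e" using r e(1) unfolding t_def by auto
  have "real_holo (\<lambda>x. inverse (f x)) (\<lambda>z. inverse (F z)) x t"
    using real_holo_shrink[OF F t(1,2)] e(2) t unfolding real_holo_def by (auto intro!: holomorphic_on_inverse)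
  then show "\<exists>F r. real_holo (\<lambda>x. inverse (f x)) F x r" by blast
qed

lemma real_analytic_on_subset: "real_analytic_on S f \<Longrightarrow> T \<subseteq> S \<Longrightarrow> real_analytic_on T f"
  unfolding real_analytic_on_def by blast

lemma real_analytic_on_cong:
  assumes "open S" "\<And>x. x \<in> S \<Longrightarrow> f x = g x" "real_analytic_on S f"
  shows "real_analytic_on S g"
  unfolding real_analytic_on_iff
proof
  fix x assume x: "x \<in> S"
  obtain F r where F: "real_holo f F x r" using assms(3) x unfolding real_analytic_on_iff by blast
  obtain e where e: "e > 0" "ball x e \<subseteq> S" using assms(1) x openE by blast
  define t where "t = min r e"
  have t: "0 < t" "t \<le> r" "t \<le> e" using F e(1) unfolding t_def real_holo_def by auto
  have "y \<in> S" if "\<bar>y - x\<bar> < t" for y using e(2) t that by (auto simp: dist_real_def subset_iff)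
  then have "real_holo g F x t"
    using real_holo_shrink[OF F t(1,2)] assms(2) unfolding real_holo_def by auto
  then show "\<exists>F r. real_holo g F x r" by blast
qed

lemma real_analytic_on_has_derivative:
  assumes "real_analytic_on S f" "x \<in> S"
  shows "(f has_real_derivative deriv f x) (at x)"
proof -
  obtain F r where F: "real_holo f F x r" using assms unfolding real_analytic_on_iff by blast
  have "\<bar>x - x\<bar> < r" using F unfolding real_holo_def by simp
  from real_holo_has_derivative(1)[OF F this] show ?thesis by (simp add: DERIV_imp_deriv)
qed

lemma real_analytic_on_derivs: "real_analytic_on S f \<Longrightarrow> real_analytic_on S ((deriv ^^ k) f)"
  by (induction k) (auto intro: real_analytic_on_deriv)

lemma Cn_on_real_analytic: "real_analytic_on S f \<Longrightarrow> Cn_on n S f"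
  unfolding Cn_on_def
  using real_analytic_on_has_derivative[OF real_analytic_on_derivs]
  by (auto intro!: continuous_at_imp_continuous_on DERIV_isCont)

section \<open>Eventual properties and classes of germs\<close>

text \<open>A derivative at \<open>x\<close> depends on a neighbourhood of \<open>x\<close>. A
  property of all large arguments also holds throughout a neighbourhood of every large argument, and
  this makes differentiation well defined on germs.\<close>

lemma eventually_at_top_nhds:
  fixes P :: "real \<Rightarrow> bool"
  assumes "eventually P at_top"
  shows "eventually (\<lambda>x. eventually P (nhds x)) at_top"
proof -
  obtain N where N: "\<And>x. x \<ge> N \<Longrightarrow> P x" using assms by (auto simp: eventually_at_top_linorder)
  show ?thesis
    using eventually_gt_at_top[of N]
  proof eventually_elim
    case (elim x)
    then have "eventually (\<lambda>y. y \<in> {N<..}) (nhds x)"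
      by (intro eventually_nhds_in_open) auto
    then show ?case by eventually_elim (auto intro: N)
  qed
qed

lemma has_real_derivative_ev_cong:
  fixes f g :: "real \<Rightarrow> real"
  assumes "eventually (\<lambda>x. f x = g x) at_top"
  shows "eventually (\<lambda>x. (f has_real_derivative D x) (at x) \<longleftrightarrow> (g has_real_derivative D x) (at x)) at_top"
  using eventually_at_top_nhds[OF assms]
  by eventually_elim (rule DERIV_cong_ev, auto)

lemma deriv_ev_cong:
  fixes f g :: "real \<Rightarrow> real"
  assumes "eventually (\<lambda>x. f x = g x) at_top"
  shows "eventually (\<lambda>x. deriv f x = deriv g x) at_top"
  using eventually_at_top_nhds[OF assms]
  by eventually_elim (auto intro!: deriv_cong_ev)

definition ev_deriv :: "(real \<Rightarrow> real) \<Rightarrow> (real \<Rightarrow> real) \<Rightarrow> bool" where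
  "ev_deriv f g \<longleftrightarrow> eventually (\<lambda>x. (f has_real_derivative g x) (at x)) at_top"

lemma ev_deriv_imp_deriv: "ev_deriv f g \<Longrightarrow> eventually (\<lambda>x. deriv f x = g x) at_top"
  unfolding ev_deriv_def by (auto elim: eventually_mono simp: DERIV_imp_deriv)

lemma ev_deriv_cong:
  assumes "eventually (\<lambda>x. f x = g x) at_top" "eventually (\<lambda>x. f' x = g' x) at_top"
  shows "ev_deriv f f' \<longleftrightarrow> ev_deriv g g'"
proof -
  have "eventually (\<lambda>x. (f has_real_derivative f' x) (at x) \<longleftrightarrow> (g has_real_derivative g' x) (at x)) at_top"
    using has_real_derivative_ev_cong[OF assms(1), of f'] assms(2) by eventually_elim simp
  then show ?thesis unfolding ev_deriv_def by (auto elim: eventually_elim2)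
qed

lemma ev_deriv_cong1:
  assumes "eventually (\<lambda>x. f x = g x) at_top" "ev_deriv g D"
  shows "ev_deriv f D"
  using ev_deriv_cong[OF assms(1), of D D] assms(2) by simp

lemma eventually_at_top_greaterThan:
  fixes P :: "real \<Rightarrow> bool"
  assumes "eventually P at_top" shows "eventually (\<lambda>a. \<forall>x\<in>{a<..}. P x) at_top"
proof -
  obtain N where "\<And>x. x \<ge> N \<Longrightarrow> P x" using assms by (auto simp: eventually_at_top_linorder)
  then show ?thesis by (auto simp: eventually_at_top_linorder intro!: exI[of _ N])
qed

text \<open>Turns existence of a half-line into a property of all large endpoints, so that several
  half-lines can be intersected by combining eventual statements.\<close>

lemma ex_iff_eventually_at_top:
  fixes P :: "real \<Rightarrow> bool"
  assumes "\<And>a b. a \<le> b \<Longrightarrow> P a \<Longrightarrow> P b" shows "(\<exists>a. P a) \<longleftrightarrow> eventually P at_top"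
  using assms by (auto simp: eventually_at_top_linorder)

lemma germ_C_lt_inf_ev: "f \<in> germ_C_lt_inf \<longleftrightarrow> (\<forall>n. eventually (\<lambda>a. Cn_on n {a<..} f) at_top)"
proof -
  have "(\<exists>a. Cn_on n {a<..} f) \<longleftrightarrow> eventually (\<lambda>a. Cn_on n {a<..} f) at_top" for n
    by (rule ex_iff_eventually_at_top) (auto elim: Cn_on_subset)
  then show ?thesis unfolding germ_C_lt_inf_def germ_Cn_def by simp
qed

lemma germ_C_inf_ev: "f \<in> germ_C_inf \<longleftrightarrow> eventually (\<lambda>a. \<forall>n. Cn_on n {a<..} f) at_top"
proof -
  have "(\<exists>a. \<forall>n. Cn_on n {a<..} f) \<longleftrightarrow> eventually (\<lambda>a. \<forall>n. Cn_on n {a<..} f) at_top"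
    by (rule ex_iff_eventually_at_top) (auto elim: Cn_on_subset)
  then show ?thesis unfolding germ_C_inf_def by simp
qed

lemma germ_C_omega_ev: "f \<in> germ_C_omega \<longleftrightarrow> eventually (\<lambda>a. real_analytic_on {a<..} f) at_top"
proof -
  have "(\<exists>a. real_analytic_on {a<..} f) \<longleftrightarrow> eventually (\<lambda>a. real_analytic_on {a<..} f) at_top"
    by (rule ex_iff_eventually_at_top) (auto elim: real_analytic_on_subset)
  then show ?thesis unfolding germ_C_omega_def by simp
qed

lemma germ_C_lt_inf_add: "f \<in> germ_C_lt_inf \<Longrightarrow> g \<in> germ_C_lt_inf \<Longrightarrow> (\<lambda>x. f x + g x) \<in> germ_C_lt_inf"
  and germ_C_lt_inf_mult: "f \<in> germ_C_lt_inf \<Longrightarrow> g \<in> germ_C_lt_inf \<Longrightarrow> (\<lambda>x. f x * g x) \<in> germ_C_lt_inf"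
  unfolding germ_C_lt_inf_ev
  by (intro allI, elim allE, erule (1) eventually_elim2, rule Cn_on_add Cn_on_mult, simp_all)+

lemma germ_C_lt_inf_inverse:
  assumes "f \<in> germ_C_lt_inf" "eventually (\<lambda>x. f x \<noteq> 0) at_top" shows "(\<lambda>x. inverse (f x)) \<in> germ_C_lt_inf"
  unfolding germ_C_lt_inf_ev
proof
  fix n
  have "eventually (\<lambda>a. Cn_on n {a<..} f) at_top" using assms(1) unfolding germ_C_lt_inf_ev by blast
  then show "eventually (\<lambda>a. Cn_on n {a<..} (\<lambda>x. inverse (f x))) at_top"
    using eventually_at_top_greaterThan[OF assms(2)] by eventually_elim (auto intro: Cn_on_inverse)
qed

lemma germ_C_lt_inf_cong:
  assumes "f \<in> germ_C_lt_inf" "eventually (\<lambda>x. f x = g x) at_top" shows "g \<in> germ_C_lt_inf"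
  unfolding germ_C_lt_inf_ev
proof
  fix n
  have "eventually (\<lambda>a. Cn_on n {a<..} f) at_top" using assms(1) unfolding germ_C_lt_inf_ev by blast
  then show "eventually (\<lambda>a. Cn_on n {a<..} g) at_top"
    using eventually_at_top_greaterThan[OF assms(2)] by eventually_elim (auto intro: Cn_on_cong(1))
qed

lemma germ_C_lt_inf_deriv: "f \<in> germ_C_lt_inf \<Longrightarrow> deriv f \<in> germ_C_lt_inf"
  unfolding germ_C_lt_inf_ev by (intro allI, drule spec[of _ "Suc _"]) (auto simp: Cn_on_Suc elim: eventually_mono)

lemma germ_C_lt_inf_derivs: "f \<in> germ_C_lt_inf \<Longrightarrow> (deriv ^^ k) f \<in> germ_C_lt_inf"
  by (induction k) (auto intro: germ_C_lt_inf_deriv)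

lemma germ_C_lt_inf_ev_deriv:
  assumes "f \<in> germ_C_lt_inf" shows "ev_deriv f (deriv f)"
proof -
  obtain a where "Cn_on (Suc 0) {a<..} f" using assms unfolding germ_C_lt_inf_def germ_Cn_def by blast
  then show ?thesis unfolding ev_deriv_def
    by (intro eventually_mono[OF eventually_gt_at_top[of a]]) (simp add: Cn_on_Suc)
qed

lemma germ_C_inf_add: "f \<in> germ_C_inf \<Longrightarrow> g \<in> germ_C_inf \<Longrightarrow> (\<lambda>x. f x + g x) \<in> germ_C_inf"
  and germ_C_inf_mult: "f \<in> germ_C_inf \<Longrightarrow> g \<in> germ_C_inf \<Longrightarrow> (\<lambda>x. f x * g x) \<in> germ_C_inf"
  unfolding germ_C_inf_ev by (erule (1) eventually_elim2, simp add: Cn_on_add Cn_on_mult)+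

lemma germ_C_inf_inverse:
  assumes "f \<in> germ_C_inf" "eventually (\<lambda>x. f x \<noteq> 0) at_top" shows "(\<lambda>x. inverse (f x)) \<in> germ_C_inf"
  using assms(1) eventually_at_top_greaterThan[OF assms(2)] unfolding germ_C_inf_ev
  by eventually_elim (auto intro: Cn_on_inverse)

lemma germ_C_inf_cong:
  assumes "f \<in> germ_C_inf" "eventually (\<lambda>x. f x = g x) at_top" shows "g \<in> germ_C_inf"
  using assms(1) eventually_at_top_greaterThan[OF assms(2)] unfolding germ_C_inf_ev
  by eventually_elim (auto intro: Cn_on_cong(1))

lemma germ_C_inf_deriv: "f \<in> germ_C_inf \<Longrightarrow> deriv f \<in> germ_C_inf"
  unfolding germ_C_inf_ev by (erule eventually_mono) (metis Cn_on_Suc)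

lemma germ_C_omega_const: "(\<lambda>x. c) \<in> germ_C_omega"
  unfolding germ_C_omega_def using real_analytic_on_const by blast

lemma germ_C_omega_deriv: "f \<in> germ_C_omega \<Longrightarrow> deriv f \<in> germ_C_omega"
  unfolding germ_C_omega_def using real_analytic_on_deriv by blast

lemma germ_C_omega_add: "f \<in> germ_C_omega \<Longrightarrow> g \<in> germ_C_omega \<Longrightarrow> (\<lambda>x. f x + g x) \<in> germ_C_omega"
  and germ_C_omega_mult: "f \<in> germ_C_omega \<Longrightarrow> g \<in> germ_C_omega \<Longrightarrow> (\<lambda>x. f x * g x) \<in> germ_C_omega"
  unfolding germ_C_omega_ev by (erule (1) eventually_elim2, simp add: real_analytic_on_add real_analytic_on_mult)+

lemma germ_C_omega_inverse:
  assumes "f \<in> germ_C_omega" "eventually (\<lambda>x. f x \<noteq> 0) at_top" shows "(\<lambda>x. inverse (f x)) \<in> germ_C_omega"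
  using assms(1) eventually_at_top_greaterThan[OF assms(2)] unfolding germ_C_omega_ev
  by eventually_elim (auto intro: real_analytic_on_inverse)

lemma germ_C_omega_cong:
  assumes "f \<in> germ_C_omega" "eventually (\<lambda>x. f x = g x) at_top" shows "g \<in> germ_C_omega"
  using assms(1) eventually_at_top_greaterThan[OF assms(2)] unfolding germ_C_omega_ev
  by eventually_elim (auto intro: real_analytic_on_cong)

lemma germ_C_omega_subset_C_inf: "germ_C_omega \<subseteq> germ_C_inf"
  unfolding germ_C_omega_def germ_C_inf_def using Cn_on_real_analytic by blast

lemma germ_C_inf_subset: "germ_C_inf \<subseteq> germ_C_lt_inf"
  unfolding germ_C_inf_def germ_C_lt_inf_def germ_Cn_def by blast

lemma germ_C_omega_subset: "germ_C_omega \<subseteq> germ_C_lt_inf"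
  using germ_C_omega_subset_C_inf germ_C_inf_subset by blast

lemma ev_deriv_add: "ev_deriv f f' \<Longrightarrow> ev_deriv g g' \<Longrightarrow> ev_deriv (\<lambda>x. f x + g x) (\<lambda>x. f' x + g' x)"
  unfolding ev_deriv_def by (erule (1) eventually_elim2) (rule DERIV_add)

lemma ev_deriv_mult: "ev_deriv f f' \<Longrightarrow> ev_deriv g g' \<Longrightarrow> ev_deriv (\<lambda>x. f x * g x) (\<lambda>x. f' x * g x + g' x * f x)"
  unfolding ev_deriv_def by (erule (1) eventually_elim2) (rule DERIV_mult)

lemma ev_deriv_inverse:
  "ev_deriv f f' \<Longrightarrow> eventually (\<lambda>x. f x \<noteq> 0) at_top \<Longrightarrow>
     ev_deriv (\<lambda>x. inverse (f x)) (\<lambda>x. -1 * f' x * (inverse (f x) * inverse (f x)))"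
  unfolding ev_deriv_def
  by (erule (1) eventually_elim2) (auto intro!: derivative_eq_intros simp: power2_eq_square)

lemma germ_C_lt_inf_isCont:
  assumes "f \<in> germ_C_lt_inf" shows "eventually (\<lambda>x. isCont f x) at_top"
  using germ_C_lt_inf_ev_deriv[OF assms] unfolding ev_deriv_def
  by (auto elim: eventually_mono dest: DERIV_isCont)

text \<open>By the intermediate value theorem a continuous function without zeros on a half-line
  keeps its sign.\<close>

lemma ev_nonzero_sign:
  fixes f :: "real \<Rightarrow> real"
  assumes "eventually (\<lambda>x. isCont f x) at_top" "eventually (\<lambda>x. f x \<noteq> 0) at_top"
  shows "eventually (\<lambda>x. f x > 0) at_top \<or> eventually (\<lambda>x. f x < 0) at_top"
proof -
  have "eventually (\<lambda>x. isCont f x \<and> f x \<noteq> 0) at_top" using assms by eventually_elim simp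
  then obtain a where a: "\<And>x. x \<ge> a \<Longrightarrow> isCont f x \<and> f x \<noteq> 0" by (auto simp: eventually_at_top_linorder)
  have neg: False if "x \<ge> a" "f a > 0" "f x < 0" for x
    using IVT2[of f x 0 a] a that by (metis less_imp_le)
  have pos: False if "x \<ge> a" "f a < 0" "f x > 0" for x
    using IVT[of f a 0 x] a that by (metis less_imp_le)
  have "(\<forall>x\<ge>a. f x > 0) \<or> (\<forall>x\<ge>a. f x < 0)"
  proof (cases "f a > 0")
    case True
    then have "f x > 0" if "x \<ge> a" for x using neg[OF that True] a[OF that] by fastforce
    then show ?thesis by blast
  next
    case False
    then have fa: "f a < 0" using a[of a] by auto
    have "f x < 0" if "x \<ge> a" for x using pos[OF that fa] a[OF that] by fastforce
    then show ?thesis by blast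
  qed
  then show ?thesis unfolding eventually_at_top_linorder by blast
qed

section \<open>Hardy fields, fraction fields and maximal extensions\<close>

lemma hardy_fieldD:
  assumes "hardy_field H"
  shows "\<And>f g. f \<in> H \<Longrightarrow> eventually (\<lambda>x. f x = g x) at_top \<Longrightarrow> g \<in> H"
    and "\<And>f. f \<in> H \<Longrightarrow> f \<in> germ_C_lt_inf"
    and "(\<lambda>x. 0) \<in> H" "(\<lambda>x. 1) \<in> H"
    and "\<And>f g. f \<in> H \<Longrightarrow> g \<in> H \<Longrightarrow> (\<lambda>x. f x + g x) \<in> H"
    and "\<And>f g. f \<in> H \<Longrightarrow> g \<in> H \<Longrightarrow> (\<lambda>x. f x * g x) \<in> H"
    and "\<And>f. f \<in> H \<Longrightarrow> (\<lambda>x. - f x) \<in> H"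
    and "\<And>f. f \<in> H \<Longrightarrow> deriv f \<in> H"
  using assms unfolding hardy_field_def saturated_def germ_eq_def by blast+

lemma hardy_field_zero_or_nonzero:
  assumes "hardy_field H" "f \<in> H"
  shows "eventually (\<lambda>x. f x = 0) at_top \<or> eventually (\<lambda>x. f x \<noteq> 0) at_top"
proof (cases "eventually (\<lambda>x. f x = 0) at_top")
  case False
  then obtain g where "g \<in> H" and g: "eventually (\<lambda>x. f x * g x = 1) at_top"
    using assms unfolding hardy_field_def germ_eq_def by blast
  have "eventually (\<lambda>x. f x \<noteq> 0) at_top" using g by eventually_elim auto
  then show ?thesis ..
qed auto

text \<open>The zero germ is included: there the totalised inverse is the zero germ again. Closure
  under \<open>inverse\<close> thus needs no case distinction later.\<close>

lemma hardy_field_inverse: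
  assumes "hardy_field H" "f \<in> H"
  shows "(\<lambda>x. inverse (f x)) \<in> H"
proof (cases "eventually (\<lambda>x. f x = 0) at_top")
  case True
  then have "eventually (\<lambda>x. 0 = inverse (f x)) at_top" by eventually_elim simp
  then show ?thesis by (rule hardy_fieldD(1)[OF assms(1) hardy_fieldD(3)[OF assms(1)]])
next
  case False
  then obtain g where "g \<in> H" and g: "eventually (\<lambda>x. f x * g x = 1) at_top"
    using assms unfolding hardy_field_def germ_eq_def by blast
  have "eventually (\<lambda>x. g x = inverse (f x)) at_top" using g by eventually_elim (metis inverse_unique)
  then show ?thesis by (rule hardy_fieldD(1)[OF assms(1) \<open>g \<in> H\<close>])
qed

lemma hardy_field_sign:
  assumes "hardy_field H" "f \<in> H"
  shows "eventually (\<lambda>x. f x = 0) at_top \<or> eventually (\<lambda>x. f x > 0) at_top \<or> eventually (\<lambda>x. f x < 0) at_top"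
  using hardy_field_zero_or_nonzero[OF assms] ev_nonzero_sign germ_C_lt_inf_isCont hardy_fieldD(2)[OF assms] by blast

lemma hardy_fieldI:
  assumes "\<And>f g. f \<in> H \<Longrightarrow> eventually (\<lambda>x. f x = g x) at_top \<Longrightarrow> g \<in> H"
    and "\<And>f. f \<in> H \<Longrightarrow> f \<in> germ_C_lt_inf"
    and "(\<lambda>x. 0) \<in> H" "(\<lambda>x. 1) \<in> H"
    and "\<And>f g. f \<in> H \<Longrightarrow> g \<in> H \<Longrightarrow> (\<lambda>x. f x + g x) \<in> H"
    and "\<And>f g. f \<in> H \<Longrightarrow> g \<in> H \<Longrightarrow> (\<lambda>x. f x * g x) \<in> H"
    and "\<And>f. f \<in> H \<Longrightarrow> (\<lambda>x. - f x) \<in> H"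
    and "\<And>f. f \<in> H \<Longrightarrow> deriv f \<in> H"
    and zn: "\<And>f. f \<in> H \<Longrightarrow> eventually (\<lambda>x. f x = 0) at_top \<or> eventually (\<lambda>x. f x \<noteq> 0) at_top"
    and inv: "\<And>f. f \<in> H \<Longrightarrow> eventually (\<lambda>x. f x \<noteq> 0) at_top \<Longrightarrow> (\<lambda>x. inverse (f x)) \<in> H"
  shows "hardy_field H"
proof -
  have "\<exists>g\<in>H. eventually (\<lambda>x. f x * g x = 1) at_top"
    if "f \<in> H" "\<not> eventually (\<lambda>x. f x = 0) at_top" for f
  proof -
    have nz: "eventually (\<lambda>x. f x \<noteq> 0) at_top" using zn that by blast
    then have "eventually (\<lambda>x. f x * inverse (f x) = 1) at_top" by eventually_elim simp
    then show ?thesis using inv[OF that(1) nz] by (rule bexI[of _ "\<lambda>x. inverse (f x)"])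
  qed
  moreover have "saturated H" unfolding saturated_def germ_eq_def using assms(1) by blast
  ultimately show ?thesis
    unfolding hardy_field_def germ_eq_def using assms(3,4)
    by (intro conjI ballI impI subsetI) (auto intro: assms(2) assms(5)[of _ _] assms(6)[of _ _] assms(7)[of _] assms(8))
qed

definition fractions :: "(real \<Rightarrow> real) set \<Rightarrow> (real \<Rightarrow> real) set" where
  "fractions R = {h. \<exists>p\<in>R. \<exists>q\<in>R. eventually (\<lambda>x. q x \<noteq> 0) at_top \<and> eventually (\<lambda>x. h x = p x * inverse (q x)) at_top}"

lemma fractionsI:
  "p \<in> R \<Longrightarrow> q \<in> R \<Longrightarrow> eventually (\<lambda>x. q x \<noteq> 0) at_top \<Longrightarrow> eventually (\<lambda>x. h x = p x * inverse (q x)) at_top \<Longrightarrow> h \<in> fractions R"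
  unfolding fractions_def by blast

text \<open>A differential ring of germs has a Hardy field of fractions as soon as none of its
  elements has arbitrarily large zeros without being eventually zero. This dichotomy,
  \<open>zn\<close>, is the substantial condition to be checked for the rings below. Derivatives are
  required only up to eventual equality, since formal derivatives agree with \<open>deriv\<close>
  only far out.\<close>

lemma hardy_field_fractions:
  assumes C: "R \<subseteq> germ_C_lt_inf" and one: "(\<lambda>x. 1) \<in> R"
    and add: "\<And>f g. f \<in> R \<Longrightarrow> g \<in> R \<Longrightarrow> (\<lambda>x. f x + g x) \<in> R"
    and mult: "\<And>f g. f \<in> R \<Longrightarrow> g \<in> R \<Longrightarrow> (\<lambda>x. f x * g x) \<in> R"
    and minus: "\<And>f. f \<in> R \<Longrightarrow> (\<lambda>x. - f x) \<in> R"
    and der: "\<And>f. f \<in> R \<Longrightarrow> \<exists>g\<in>R. ev_deriv f g"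
    and zn: "\<And>f. f \<in> R \<Longrightarrow> eventually (\<lambda>x. f x = 0) at_top \<or> eventually (\<lambda>x. f x \<noteq> 0) at_top"
  shows "hardy_field (fractions R)" "R \<subseteq> fractions R"
proof -
  have zero: "(\<lambda>x. 0) \<in> R" using add[OF one minus[OF one]] by simp
  show sub: "R \<subseteq> fractions R"
  proof
    fix f assume "f \<in> R"
    then show "f \<in> fractions R" by (rule fractionsI[OF _ one]) auto
  qed
  show "hardy_field (fractions R)"
  proof (rule hardy_fieldI)
    fix f g :: "real \<Rightarrow> real" assume f: "f \<in> fractions R" and fg: "eventually (\<lambda>x. f x = g x) at_top"
    from f obtain p q where pq: "p \<in> R" "q \<in> R" "eventually (\<lambda>x. q x \<noteq> 0) at_top" "eventually (\<lambda>x. f x = p x * inverse (q x)) at_top"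
      unfolding fractions_def by blast
    show "g \<in> fractions R" by (rule fractionsI[OF pq(1-3)]) (use pq(4) fg in eventually_elim, simp)
  next
    fix f assume "f \<in> fractions R"
    then obtain p q where pq: "p \<in> R" "q \<in> R" "eventually (\<lambda>x. q x \<noteq> 0) at_top" "eventually (\<lambda>x. f x = p x * inverse (q x)) at_top"
      unfolding fractions_def by blast
    show "f \<in> germ_C_lt_inf"
      by (rule germ_C_lt_inf_cong[of "\<lambda>x. p x * inverse (q x)"])
        (use pq C in \<open>auto intro!: germ_C_lt_inf_mult[of p "\<lambda>x. inverse (q x)"] germ_C_lt_inf_inverse[of q] elim: eventually_mono\<close>)
    show "(\<lambda>x. - f x) \<in> fractions R"
      by (rule fractionsI[OF minus[OF pq(1)] pq(2,3)]) (use pq(4) in eventually_elim, simp)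
    obtain p' q' where d: "p' \<in> R" "q' \<in> R" "ev_deriv p p'" "ev_deriv q q'" using der pq by meson
    have "ev_deriv (\<lambda>x. p x * inverse (q x)) (\<lambda>x. p' x * inverse (q x) + (-1 * q' x * (inverse (q x) * inverse (q x))) * p x)"
      by (rule ev_deriv_mult[OF d(3) ev_deriv_inverse[OF d(4) pq(3)]])
    then have "ev_deriv f (\<lambda>x. p' x * inverse (q x) + (-1 * q' x * (inverse (q x) * inverse (q x))) * p x)"
      by (rule ev_deriv_cong1[OF pq(4)])
    then have e: "eventually (\<lambda>x. deriv f x = p' x * inverse (q x) + (-1 * q' x * (inverse (q x) * inverse (q x))) * p x) at_top"
      by (rule ev_deriv_imp_deriv)
    show "deriv f \<in> fractions R"
    proof (rule fractionsI)
      show "(\<lambda>x. p' x * q x + - (q' x * p x)) \<in> R" by (rule add[OF mult[OF d(1) pq(2)] minus[OF mult[OF d(2) pq(1)]]])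
      show "(\<lambda>x. q x * q x) \<in> R" by (rule mult[OF pq(2) pq(2)])
      show "eventually (\<lambda>x. q x * q x \<noteq> 0) at_top" using pq(3) by eventually_elim simp
      show "eventually (\<lambda>x. deriv f x = (p' x * q x + - (q' x * p x)) * inverse (q x * q x)) at_top"
        using e pq(3) by eventually_elim (simp add: field_simps)
    qed
    show "eventually (\<lambda>x. f x = 0) at_top \<or> eventually (\<lambda>x. f x \<noteq> 0) at_top"
      using zn[OF pq(1)]
    proof
      assume "eventually (\<lambda>x. p x = 0) at_top"
      with pq(4) have "eventually (\<lambda>x. f x = 0) at_top" by eventually_elim simp
      then show ?thesis ..
    next
      assume "eventually (\<lambda>x. p x \<noteq> 0) at_top"
      with pq(4,3) have "eventually (\<lambda>x. f x \<noteq> 0) at_top" by eventually_elim simp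
      then show ?thesis ..
    qed
    show "(\<lambda>x. inverse (f x)) \<in> fractions R" if nz: "eventually (\<lambda>x. f x \<noteq> 0) at_top"
    proof (rule fractionsI[OF pq(2,1)])
      show "eventually (\<lambda>x. p x \<noteq> 0) at_top" using nz pq(4) by eventually_elim auto
      show "eventually (\<lambda>x. inverse (f x) = q x * inverse (p x)) at_top" using pq(4) by eventually_elim simp
    qed
  next
    fix f g assume "f \<in> fractions R" "g \<in> fractions R"
    then obtain p q r s where pq: "p \<in> R" "q \<in> R" "eventually (\<lambda>x. q x \<noteq> 0) at_top" "eventually (\<lambda>x. f x = p x * inverse (q x)) at_top"
      and rs: "r \<in> R" "s \<in> R" "eventually (\<lambda>x. s x \<noteq> 0) at_top" "eventually (\<lambda>x. g x = r x * inverse (s x)) at_top"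
      unfolding fractions_def by blast
    have nz: "eventually (\<lambda>x. q x * s x \<noteq> 0) at_top" using pq(3) rs(3) by eventually_elim simp
    show "(\<lambda>x. f x * g x) \<in> fractions R"
      by (rule fractionsI[OF mult[OF pq(1) rs(1)] mult[OF pq(2) rs(2)] nz]) (use pq(4) rs(4) in eventually_elim, simp)
    show "(\<lambda>x. f x + g x) \<in> fractions R"
      by (rule fractionsI[OF add[OF mult[OF pq(1) rs(2)] mult[OF rs(1) pq(2)]] mult[OF pq(2) rs(2)] nz])
        (use pq(3,4) rs(3,4) in eventually_elim, simp add: field_simps)
  qed (use sub zero one in auto)
qed

lemma hardy_field_chain_Union:
  assumes ne: "C \<noteq> {}" and ch: "\<And>A B. A \<in> C \<Longrightarrow> B \<in> C \<Longrightarrow> A \<subseteq> B \<or> B \<subseteq> A" and hf: "\<And>A. A \<in> C \<Longrightarrow> hardy_field A"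
  shows "hardy_field (\<Union>C)"
proof -
  obtain A0 where A0: "A0 \<in> C" using ne by blast
  have two: "\<exists>A\<in>C. f \<in> A \<and> g \<in> A" if "f \<in> \<Union>C" "g \<in> \<Union>C" for f g
  proof -
    from that(1) obtain A where A: "f \<in> A" "A \<in> C" by (rule UnionE)
    from that(2) obtain B where B: "g \<in> B" "B \<in> C" by (rule UnionE)
    from A B ch[OF A(2) B(2)] show ?thesis by (elim disjE) (auto intro: bexI[of _ A] bexI[of _ B])
  qed
  show ?thesis
  proof (rule hardy_fieldI)
    show "(\<lambda>x. 0) \<in> \<Union>C" "(\<lambda>x. 1) \<in> \<Union>C" using hardy_fieldD(3,4)[OF hf[OF A0]] A0 by blast+
    fix f assume "f \<in> \<Union>C"
    then obtain A where A: "f \<in> A" "A \<in> C" by (rule UnionE)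
    note A = A(2,1)
    note h = hf[OF A(1)]
    show "f \<in> germ_C_lt_inf" by (rule hardy_fieldD(2)[OF h A(2)])
    show "(\<lambda>x. - f x) \<in> \<Union>C" by (rule UnionI[OF A(1) hardy_fieldD(7)[OF h A(2)]])
    show "deriv f \<in> \<Union>C" by (rule UnionI[OF A(1) hardy_fieldD(8)[OF h A(2)]])
    show "eventually (\<lambda>x. f x = 0) at_top \<or> eventually (\<lambda>x. f x \<noteq> 0) at_top"
      by (rule hardy_field_zero_or_nonzero[OF h A(2)])
    show "(\<lambda>x. inverse (f x)) \<in> \<Union>C" by (rule UnionI[OF A(1) hardy_field_inverse[OF h A(2)]])
    show "g \<in> \<Union>C" if "eventually (\<lambda>x. f x = g x) at_top" for g
      by (rule UnionI[OF A(1) hardy_fieldD(1)[OF h A(2) that]])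
  next
    fix f g assume "f \<in> \<Union>C" "g \<in> \<Union>C"
    then have "\<exists>A\<in>C. f \<in> A \<and> g \<in> A" by (rule two)
    then obtain A where A: "A \<in> C" "f \<in> A \<and> g \<in> A" by (rule bexE)
    note A = A(1) conjunct1[OF A(2)] conjunct2[OF A(2)]
    note h = hf[OF A(1)]
    show "(\<lambda>x. f x + g x) \<in> \<Union>C" by (rule UnionI[OF A(1) hardy_fieldD(5)[OF h A(2,3)]])
    show "(\<lambda>x. f x * g x) \<in> \<Union>C" by (rule UnionI[OF A(1) hardy_fieldD(6)[OF h A(2,3)]])
  qed
qed

text \<open>Zorn's lemma inside a class \<open>U\<close> of germs. With \<open>U\<close> the class
  \<open>germ_C_lt_inf\<close>, \<open>germ_C_inf\<close> or \<open>germ_C_omega\<close> one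
  statement serves three notions of maximality.\<close>

lemma hardy_field_maximal_extension:
  assumes "hardy_field H" "H \<subseteq> U"
  obtains M where "hardy_field M" "M \<subseteq> U" "H \<subseteq> M" "\<And>H'. hardy_field H' \<Longrightarrow> H' \<subseteq> U \<Longrightarrow> M \<subseteq> H' \<Longrightarrow> H' = M"
proof -
  define F where "F = {A. hardy_field A \<and> A \<subseteq> U \<and> H \<subseteq> A}"
  have "\<exists>M\<in>F. \<forall>X\<in>F. M \<subseteq> X \<longrightarrow> X = M"
  proof (rule subset_Zorn_nonempty)
    show "F \<noteq> {}" using assms unfolding F_def by blast
    fix C assume C: "C \<noteq> {}" "subset.chain F C"
    have sub: "C \<subseteq> F" and ch: "\<And>A B. A \<in> C \<Longrightarrow> B \<in> C \<Longrightarrow> A \<subseteq> B \<or> B \<subseteq> A"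
      using C(2) by (simp_all add: subset_chain_def)
    have "hardy_field (\<Union>C)" by (rule hardy_field_chain_Union[OF C(1) ch]) (use sub F_def in \<open>auto simp: subset_iff\<close>)
    moreover have "\<Union>C \<subseteq> U" using sub unfolding F_def by blast
    moreover have "H \<subseteq> \<Union>C" using sub C(1) unfolding F_def by blast
    ultimately show "\<Union>C \<in> F" unfolding F_def by simp
  qed
  then obtain M where M: "M \<in> F" and max: "\<forall>X\<in>F. M \<subseteq> X \<longrightarrow> X = M" by (rule bexE)
  have "H' = M" if "hardy_field H'" "H' \<subseteq> U" "M \<subseteq> H'" for H'
  proof -
    have "H' \<in> F" using M that unfolding F_def by blast
    then show ?thesis using max that(3) by simp
  qed
  then show ?thesis using M unfolding F_def by (intro that[of M]) simp_all
qed

section \<open>Analyticity of solutions of algebraic differential equations\<close>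

text \<open>Differential polynomials are kept as terms rather than as functions, because one and the
  same term is evaluated with coefficients from a Hardy field, with their copies, and in formal
  power series. Variable \<open>j\<close> usually stands for a \<open>j\<close>-th
  derivative.\<close>

datatype (coefs: 'c) ex = Cf 'c | Vr nat | Ad "'c ex" "'c ex" | Ml "'c ex" "'c ex"

primrec vars :: "'c ex \<Rightarrow> nat set" where
  "vars (Cf c) = {}"
| "vars (Vr j) = {j}"
| "vars (Ad p q) = vars p \<union> vars q"
| "vars (Ml p q) = vars p \<union> vars q"

primrec ev :: "('c \<Rightarrow> 'a::comm_ring_1) \<Rightarrow> (nat \<Rightarrow> 'a) \<Rightarrow> 'c ex \<Rightarrow> 'a" where
  "ev k v (Cf c) = k c"
| "ev k v (Vr j) = v j"
| "ev k v (Ad p q) = ev k v p + ev k v q"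
| "ev k v (Ml p q) = ev k v p * ev k v q"

text \<open>\<open>d\<close> differentiates coefficients and \<open>s j\<close> is a term for the
  derivative of variable \<open>j\<close>: a shift of variables for jets, the right-hand side for a
  system of differential equations.\<close>

primrec Dx :: "('c \<Rightarrow> 'c) \<Rightarrow> (nat \<Rightarrow> 'c ex) \<Rightarrow> 'c ex \<Rightarrow> 'c ex" where
  "Dx d s (Cf c) = Cf (d c)"
| "Dx d s (Vr j) = s j"
| "Dx d s (Ad p q) = Ad (Dx d s p) (Dx d s q)"
| "Dx d s (Ml p q) = Ad (Ml (Dx d s p) q) (Ml p (Dx d s q))"

lemma finite_coefs: "finite (coefs e)" by (induction e) auto
lemma finite_vars: "finite (vars e)" by (induction e) auto

lemma ev_cong: "(\<And>c. c \<in> coefs e \<Longrightarrow> k c = k' c) \<Longrightarrow> (\<And>j. j \<in> vars e \<Longrightarrow> v j = v' j) \<Longrightarrow> ev k v e = ev k' v' e"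
  by (induction e) auto

lemma ev_map: "ev k v (map_ex h e) = ev (\<lambda>c. k (h c)) v e"
  by (induction e) auto
lemma vars_map: "vars (map_ex h e) = vars e"
  by (induction e) auto
lemma vars_Dx: "vars (Dx d s e) \<subseteq> vars e \<union> (\<Union>j\<in>vars e. vars (s j))"
  by (induction e) auto
lemma coefs_Dx: "coefs (Dx d s e) \<subseteq> coefs e \<union> d ` coefs e \<union> (\<Union>j\<in>vars e. coefs (s j))"
  by (induction e) auto

lemma ev_has_real_derivative:
  fixes k :: "'c \<Rightarrow> real \<Rightarrow> real"
  assumes "\<And>c. c \<in> coefs e \<Longrightarrow> (k c has_real_derivative k (d c) x) (at x)"
    and "\<And>j. j \<in> vars e \<Longrightarrow> (z j has_real_derivative ev (\<lambda>c. k c x) (\<lambda>i. z i x) (s j)) (at x)"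
  shows "((\<lambda>x. ev (\<lambda>c. k c x) (\<lambda>i. z i x) e) has_real_derivative ev (\<lambda>c. k c x) (\<lambda>i. z i x) (Dx d s e)) (at x)"
  using assms
proof (induction e)
  case (Ml p q)
  have "((\<lambda>x. ev (\<lambda>c. k c x) (\<lambda>i. z i x) p) has_real_derivative ev (\<lambda>c. k c x) (\<lambda>i. z i x) (Dx d s p)) (at x)"
    "((\<lambda>x. ev (\<lambda>c. k c x) (\<lambda>i. z i x) q) has_real_derivative ev (\<lambda>c. k c x) (\<lambda>i. z i x) (Dx d s q)) (at x)"
    using Ml by auto
  from DERIV_mult[OF this] show ?case by (simp add: algebra_simps)
qed (auto intro!: DERIV_add)

text \<open>\<open>U x\<close> is the formal Taylor series of \<open>f\<close> at \<open>x\<close>.\<close>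

definition jet :: "real set \<Rightarrow> (real \<Rightarrow> real) \<Rightarrow> (real \<Rightarrow> real fps) \<Rightarrow> bool" where
  "jet I f U \<longleftrightarrow> (\<forall>x\<in>I. fps_nth (U x) 0 = f x \<and>
     (\<forall>n. ((\<lambda>x. fps_nth (U x) n) has_real_derivative fps_nth (fps_deriv (U x)) n) (at x)))"

lemma jet_nth_0: "jet I f U \<Longrightarrow> x \<in> I \<Longrightarrow> fps_nth (U x) 0 = f x"
  unfolding jet_def by blast

lemma jet_nth_derivative:
  "jet I f U \<Longrightarrow> x \<in> I \<Longrightarrow> ((\<lambda>x. fps_nth (U x) n) has_real_derivative fps_nth (fps_deriv (U x)) n) (at x)"
  unfolding jet_def by blast

lemma jet_add:
  assumes "jet I f U" "jet I g V" shows "jet I (\<lambda>x. f x + g x) (\<lambda>x. U x + V x)"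
  unfolding jet_def
proof (intro ballI conjI allI)
  fix x n assume x: "x \<in> I"
  show "fps_nth (U x + V x) 0 = f x + g x" using assms x by (simp add: jet_nth_0)
  show "((\<lambda>x. fps_nth (U x + V x) n) has_real_derivative fps_nth (fps_deriv (U x + V x)) n) (at x)"
    unfolding fps_deriv_add fps_add_nth
    by (rule DERIV_add[OF jet_nth_derivative[OF assms(1) x] jet_nth_derivative[OF assms(2) x]])
qed

lemma jet_mult:
  assumes "jet I f U" "jet I g V" shows "jet I (\<lambda>x. f x * g x) (\<lambda>x. U x * V x)"
  unfolding jet_def
proof (intro ballI conjI allI)
  fix x n assume x: "x \<in> I"
  show "fps_nth (U x * V x) 0 = f x * g x" using assms x by (simp add: jet_def)
  have "((\<lambda>x. \<Sum>i=0..n. fps_nth (U x) i * fps_nth (V x) (n - i)) has_real_derivative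
      (\<Sum>i=0..n. fps_nth (fps_deriv (U x)) i * fps_nth (V x) (n - i) + fps_nth (fps_deriv (V x)) (n - i) * fps_nth (U x) i)) (at x)"
    by (rule DERIV_sum) (rule DERIV_mult[OF jet_nth_derivative[OF assms(1) x] jet_nth_derivative[OF assms(2) x]])
  also have "(\<Sum>i=0..n. fps_nth (fps_deriv (U x)) i * fps_nth (V x) (n - i) + fps_nth (fps_deriv (V x)) (n - i) * fps_nth (U x) i)
    = fps_nth (fps_deriv (U x * V x)) n"
    unfolding fps_deriv_mult fps_add_nth fps_mult_nth by (simp add: sum.distrib mult.commute)
  finally show "((\<lambda>x. fps_nth (U x * V x) n) has_real_derivative fps_nth (fps_deriv (U x * V x)) n) (at x)"
    by (simp add: fps_mult_nth)
qed

lemma jet_ev: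
  assumes "\<And>c. c \<in> coefs e \<Longrightarrow> jet I (k c) (K c)" "\<And>j. j \<in> vars e \<Longrightarrow> jet I (z j) (Z j)"
  shows "jet I (\<lambda>x. ev (\<lambda>c. k c x) (\<lambda>j. z j x) e) (\<lambda>x. ev (\<lambda>c. K c x) (\<lambda>j. Z j x) e)"
  using assms by (induction e) (auto intro!: jet_add jet_mult)

lemma DERIV_transfer_open:
  fixes f g :: "real \<Rightarrow> real"
  assumes "(f has_real_derivative D) (at x)" "open I" "x \<in> I" "\<And>y. y \<in> I \<Longrightarrow> f y = g y"
  shows "(g has_real_derivative D) (at x)"
  using has_field_derivative_transform_within_open[OF assms(1,2,3)] assms(4) by blast

text \<open>The coefficient of index n + 1 is, up to the factor n + 1, the derivative along
  \<open>I\<close> of the coefficient of index n, so a jet is determined by its constant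
  coefficients.\<close>

lemma jet_unique:
  assumes "open I" "jet I f U" "jet I f V" "x \<in> I" shows "U x = V x"
proof -
  have "\<forall>x\<in>I. fps_nth (U x) n = fps_nth (V x) n" for n
  proof (induction n)
    case 0 show ?case using assms by (simp add: jet_def)
  next
    case (Suc n)
    show ?case
    proof
      fix x assume x: "x \<in> I"
      have u: "((\<lambda>x. fps_nth (U x) n) has_real_derivative fps_nth (fps_deriv (U x)) n) (at x)"
       and v: "((\<lambda>x. fps_nth (V x) n) has_real_derivative fps_nth (fps_deriv (V x)) n) (at x)"
        using assms x by (auto simp: jet_def)
      have "((\<lambda>x. fps_nth (V x) n) has_real_derivative fps_nth (fps_deriv (U x)) n) (at x)"
        by (rule DERIV_transfer_open[OF u assms(1) x]) (use Suc in blast)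
      from DERIV_unique[OF this v] show "fps_nth (U x) (Suc n) = fps_nth (V x) (Suc n)" by simp
    qed
  qed
  then show ?thesis using assms(4) by (simp add: fps_eq_iff)
qed

lemma jet_deriv:
  assumes "open I" "jet I f U" "\<And>x. x \<in> I \<Longrightarrow> (f has_real_derivative g x) (at x)"
  shows "jet I g (\<lambda>x. fps_deriv (U x))"
  unfolding jet_def
proof (intro ballI conjI allI)
  fix x n assume x: "x \<in> I"
  have u: "((\<lambda>x. fps_nth (U x) n) has_real_derivative fps_nth (fps_deriv (U x)) n) (at x)" for n
    using assms x by (auto simp: jet_def)
  have "(f has_real_derivative fps_nth (fps_deriv (U x)) 0) (at x)"
    by (rule DERIV_transfer_open[OF u[of 0] assms(1) x]) (use assms(2) in \<open>simp add: jet_def\<close>)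
  from DERIV_unique[OF this assms(3)[OF x]] show "fps_nth (fps_deriv (U x)) 0 = g x" .
  have "((\<lambda>x. of_nat (n + 1) * fps_nth (U x) (n + 1)) has_real_derivative of_nat (n + 1) * fps_nth (fps_deriv (U x)) (n + 1)) (at x)"
    by (intro DERIV_cmult u)
  then show "((\<lambda>x. fps_nth (fps_deriv (U x)) n) has_real_derivative fps_nth (fps_deriv (fps_deriv (U x))) n) (at x)"
    by (simp add: fps_deriv_nth)
qed

definition taylor_fps :: "(real \<Rightarrow> real) \<Rightarrow> real \<Rightarrow> real fps" where
  "taylor_fps f x = Abs_fps (\<lambda>n. (deriv ^^ n) f x / fact n)"

lemma jet_taylor_fps:
  assumes "\<And>k x. x \<in> I \<Longrightarrow> ((deriv ^^ k) f has_real_derivative (deriv ^^ Suc k) f x) (at x)"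
  shows "jet I f (taylor_fps f)"
  unfolding jet_def
proof (intro ballI conjI allI)
  fix x n assume x: "x \<in> I"
  show "fps_nth (taylor_fps f x) 0 = f x" by (simp add: taylor_fps_def)
  have "((\<lambda>x. (deriv ^^ n) f x / fact n) has_real_derivative (deriv ^^ Suc n) f x / fact n) (at x)"
    by (intro DERIV_cdivide assms x)
  moreover have "(deriv ^^ Suc n) f x / fact n = fps_nth (fps_deriv (taylor_fps f x)) n"
    by (simp add: taylor_fps_def fps_deriv_nth field_simps del: funpow.simps of_nat_Suc)
  ultimately show "((\<lambda>x. fps_nth (taylor_fps f x) n) has_real_derivative fps_nth (fps_deriv (taylor_fps f x)) n) (at x)"
    by (simp add: taylor_fps_def)
qed

text \<open>This norm is submultiplicative, and its derivative in \<open>s\<close> is the norm of the derivative. Along a polynomial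
differential equation it therefore satisfies a differential inequality in \<open>s\<close>, which bounds it up to
a radius that does not depend on the truncation order \<open>N\<close>.\<close>

definition wnorm :: "nat \<Rightarrow> real \<Rightarrow> real fps \<Rightarrow> real" where
  "wnorm N s u = (\<Sum>k\<le>N. \<bar>fps_nth u k\<bar> * s ^ k)"

lemma wnorm_nonneg: "s \<ge> 0 \<Longrightarrow> wnorm N s u \<ge> 0"
  unfolding wnorm_def by (intro sum_nonneg) auto

lemma wnorm_mono: "0 \<le> s \<Longrightarrow> s \<le> t \<Longrightarrow> wnorm N s u \<le> wnorm N t u"
  unfolding wnorm_def by (intro sum_mono mult_left_mono power_mono) auto

lemma wnorm_add: "s \<ge> 0 \<Longrightarrow> wnorm N s (u + v) \<le> wnorm N s u + wnorm N s v"
proof -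
  assume s: "s \<ge> 0"
  have "wnorm N s (u + v) \<le> (\<Sum>k\<le>N. \<bar>fps_nth u k\<bar> * s ^ k + \<bar>fps_nth v k\<bar> * s ^ k)"
    unfolding wnorm_def
  proof (intro sum_mono)
    fix k
    have "\<bar>fps_nth (u + v) k\<bar> * s ^ k \<le> (\<bar>fps_nth u k\<bar> + \<bar>fps_nth v k\<bar>) * s ^ k"
      by (intro mult_right_mono) (use s in auto)
    then show "\<bar>fps_nth (u + v) k\<bar> * s ^ k \<le> \<bar>fps_nth u k\<bar> * s ^ k + \<bar>fps_nth v k\<bar> * s ^ k"
      by (simp add: algebra_simps)
  qed
  then show ?thesis by (simp add: wnorm_def sum.distrib)
qed

text \<open>Product coefficients of index at most \<open>N\<close> only involve index pairs in the
  triangle i + j \<le> N, which lies in the square of pairs counted by the product of the norms.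
  Truncation therefore does not spoil submultiplicativity.\<close>

lemma wnorm_mult: "s \<ge> 0 \<Longrightarrow> wnorm N s (u * v) \<le> wnorm N s u * wnorm N s v"
proof -
  assume s: "s \<ge> 0"
  define g where "g i j = (\<bar>fps_nth u i\<bar> * s ^ i) * (\<bar>fps_nth v j\<bar> * s ^ j)" for i j
  have "wnorm N s (u * v) \<le> (\<Sum>k\<le>N. \<Sum>i\<le>k. g i (k - i))"
    unfolding wnorm_def
  proof (intro sum_mono)
    fix k
    have "\<bar>fps_nth (u * v) k\<bar> \<le> (\<Sum>i\<le>k. \<bar>fps_nth u i * fps_nth v (k - i)\<bar>)"
      unfolding fps_mult_nth atLeast0AtMost by (rule sum_abs)
    then have "\<bar>fps_nth (u * v) k\<bar> * s ^ k \<le> (\<Sum>i\<le>k. \<bar>fps_nth u i * fps_nth v (k - i)\<bar>) * s ^ k"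
      by (rule mult_right_mono) (use s in auto)
    also have "\<dots> = (\<Sum>i\<le>k. g i (k - i))"
      unfolding sum_distrib_right
    proof (intro sum.cong refl)
      fix i assume "i \<in> {..k}"
      then have "s ^ k = s ^ i * s ^ (k - i)" by (simp add: power_add[symmetric])
      then show "\<bar>fps_nth u i * fps_nth v (k - i)\<bar> * s ^ k = g i (k - i)" by (simp add: g_def abs_mult)
    qed
    finally show "\<bar>fps_nth (u * v) k\<bar> * s ^ k \<le> (\<Sum>i\<le>k. g i (k - i))" .
  qed
  also have "\<dots> = sum (\<lambda>(i, j). g i j) {(i, j). i + j \<le> N}"
    by (rule sum.triangle_reindex_eq[symmetric])
  also have "\<dots> \<le> sum (\<lambda>(i, j). g i j) ({..N} \<times> {..N})"
    by (intro sum_mono2) (auto simp: g_def s)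
  also have "\<dots> = wnorm N s u * wnorm N s v"
    unfolding wnorm_def g_def sum_product sum.cartesian_product ..
  finally show ?thesis .
qed

text \<open>The point is the order of quantifiers: \<open>C\<close> depends on the term and on
  \<open>B\<close>, but not on the truncation order \<open>N\<close> or the radius
  \<open>s\<close>.\<close>

lemma wnorm_ev_bound:
  assumes "B \<ge> 0"
  shows "\<exists>C\<ge>0. \<forall>N s k z. s \<ge> 0 \<and> (\<forall>c\<in>coefs e. wnorm N s (k c) \<le> B) \<and> (\<forall>j\<in>vars e. wnorm N s (z j) \<le> B) \<longrightarrow> wnorm N s (ev k z e) \<le> C"
proof (induction e)
  case (Ad p q)
  then obtain C D where "C \<ge> 0" "D \<ge> 0" and
    C: "\<And>N s k z. s \<ge> 0 \<and> (\<forall>c\<in>coefs p. wnorm N s (k c) \<le> B) \<and> (\<forall>j\<in>vars p. wnorm N s (z j) \<le> B) \<Longrightarrow> wnorm N s (ev k z p) \<le> C" and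
    D: "\<And>N s k z. s \<ge> 0 \<and> (\<forall>c\<in>coefs q. wnorm N s (k c) \<le> B) \<and> (\<forall>j\<in>vars q. wnorm N s (z j) \<le> B) \<Longrightarrow> wnorm N s (ev k z q) \<le> D"
    by blast
  have "wnorm N s (ev k z p + ev k z q) \<le> C + D"
    if "s \<ge> 0" "wnorm N s (ev k z p) \<le> C" "wnorm N s (ev k z q) \<le> D" for N s k z
    using wnorm_add[OF that(1), of N "ev k z p" "ev k z q"] that by linarith
  then show ?case using C D \<open>C \<ge> 0\<close> \<open>D \<ge> 0\<close> by (intro exI[of _ "C + D"]) auto
next
  case (Ml p q)
  then obtain C D where CD: "C \<ge> 0" "D \<ge> 0" and
    C: "\<And>N s k z. s \<ge> 0 \<and> (\<forall>c\<in>coefs p. wnorm N s (k c) \<le> B) \<and> (\<forall>j\<in>vars p. wnorm N s (z j) \<le> B) \<Longrightarrow> wnorm N s (ev k z p) \<le> C" and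
    D: "\<And>N s k z. s \<ge> 0 \<and> (\<forall>c\<in>coefs q. wnorm N s (k c) \<le> B) \<and> (\<forall>j\<in>vars q. wnorm N s (z j) \<le> B) \<Longrightarrow> wnorm N s (ev k z q) \<le> D"
    by blast
  have "wnorm N s (ev k z p * ev k z q) \<le> C * D"
    if "s \<ge> 0" "wnorm N s (ev k z p) \<le> C" "wnorm N s (ev k z q) \<le> D" for N s k z
  proof -
    have "wnorm N s (ev k z p) * wnorm N s (ev k z q) \<le> C * D"
      by (rule mult_mono[OF that(2,3) CD(1) wnorm_nonneg[OF that(1)]])
    then show ?thesis using wnorm_mult[OF that(1), of N "ev k z p" "ev k z q"] by linarith
  qed
  then show ?case using C D CD by (intro exI[of _ "C * D"]) auto
qed (use assms in \<open>auto intro!: exI[of _ B]\<close>)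

lemma wnorm_has_derivative: "((\<lambda>s. wnorm (Suc N) s u) has_real_derivative wnorm N s (fps_deriv u)) (at s)"
proof -
  have "((\<lambda>s. \<Sum>k\<le>Suc N. \<bar>fps_nth u k\<bar> * s ^ k) has_real_derivative (\<Sum>k\<le>Suc N. \<bar>fps_nth u k\<bar> * (of_nat k * s ^ (k - 1)))) (at s)"
    by (intro DERIV_sum DERIV_cmult) (use DERIV_pow in simp)
  also have "(\<Sum>k\<le>Suc N. \<bar>fps_nth u k\<bar> * (of_nat k * s ^ (k - 1))) = (\<Sum>k\<le>N. \<bar>fps_nth u (Suc k)\<bar> * (of_nat (Suc k) * s ^ k))"
    by (subst sum.atMost_Suc_shift) simp
  also have "\<dots> = wnorm N s (fps_deriv u)"
    unfolding wnorm_def by (intro sum.cong) (auto simp: fps_deriv_nth abs_mult simp del: of_nat_Suc)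
  finally show ?thesis unfolding wnorm_def .
qed

text \<open>Lagrange's remainder of order n is at most B q^n with q = \<bar>y - x0\<bar> / s below
  1. This is why the derivatives are bounded at all points near \<open>x0\<close> and not only at
  the centre.\<close>

lemma real_power_series_of_bound:
  assumes d: "\<And>k x. \<bar>x - x0\<bar> < \<epsilon> \<Longrightarrow> ((deriv ^^ k) f has_real_derivative (deriv ^^ Suc k) f x) (at x)"
    and b: "\<And>k x. \<bar>x - x0\<bar> < \<epsilon> \<Longrightarrow> \<bar>(deriv ^^ k) f x\<bar> / fact k * s ^ k \<le> B" and s: "s > 0"
    and y: "\<bar>y - x0\<bar> < \<epsilon>" "\<bar>y - x0\<bar> < s"
  shows "(\<lambda>n. (deriv ^^ n) f x0 / fact n * (y - x0) ^ n) sums f y"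
proof (cases "y = x0")
  case True
  have "(\<lambda>n. (deriv ^^ n) f x0 / fact n * 0 ^ n) sums ((deriv ^^ 0) f x0 / fact 0)" by (rule powser_sums_zero)
  then show ?thesis using True by simp
next
  case False
  define q where "q = \<bar>y - x0\<bar> / s"
  have q: "0 \<le> q" "q < 1" using s y by (auto simp: q_def)
  have "\<epsilon> > 0" using y(1) by linarith
  then have B: "B \<ge> 0" using b[of x0 0] by auto
  have est: "\<bar>f y - (\<Sum>m<n. (deriv ^^ m) f x0 / fact m * (y - x0) ^ m)\<bar> \<le> B * q ^ n" if n: "n > 0" for n
  proof -
    define a c where "a = min y x0" and "c = max y x0"
    have "\<exists>t. (if y < x0 then y < t \<and> t < x0 else x0 < t \<and> t < y) \<and>
        f y = (\<Sum>m<n. (deriv ^^ m) f x0 / fact m * (y - x0) ^ m) + (deriv ^^ n) f t / fact n * (y - x0) ^ n"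
      by (rule Taylor[where a = a and b = c])
        (use n False y in \<open>auto simp: a_def c_def simp del: funpow.simps intro!: d\<close>)
    then obtain t where t: "(if y < x0 then y < t \<and> t < x0 else x0 < t \<and> t < y)"
      and eq: "f y = (\<Sum>m<n. (deriv ^^ m) f x0 / fact m * (y - x0) ^ m) + (deriv ^^ n) f t / fact n * (y - x0) ^ n" by blast
    have "\<bar>t - x0\<bar> < \<epsilon>" using t y by (auto split: if_splits)
    from b[OF this, of n] have "\<bar>(deriv ^^ n) f t\<bar> / fact n * s ^ n * q ^ n \<le> B * q ^ n"
      using q by (intro mult_right_mono) auto
    also have "\<bar>(deriv ^^ n) f t\<bar> / fact n * s ^ n * q ^ n = \<bar>(deriv ^^ n) f t / fact n * (y - x0) ^ n\<bar>"
      using s by (simp add: q_def abs_mult power_divide power_abs)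
    finally show ?thesis using eq by simp
  qed
  have "(\<lambda>n. B * q ^ n) \<longlonglongrightarrow> 0" using LIMSEQ_realpow_zero[OF q] by (rule tendsto_mult_right_zero)
  moreover have "eventually (\<lambda>n. norm (f y - (\<Sum>m<n. (deriv ^^ m) f x0 / fact m * (y - x0) ^ m)) \<le> B * q ^ n) sequentially"
    using eventually_gt_at_top[of 0] by eventually_elim (use est in auto)
  ultimately have "(\<lambda>n. f y - (\<Sum>m<n. (deriv ^^ m) f x0 / fact m * (y - x0) ^ m)) \<longlonglongrightarrow> 0"
    by (rule Lim_null_comparison[rotated])
  then have "(\<lambda>n. f y - (f y - (\<Sum>m<n. (deriv ^^ m) f x0 / fact m * (y - x0) ^ m))) \<longlonglongrightarrow> f y - 0"
    by (intro tendsto_intros)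
  then show ?thesis by (simp add: sums_def)
qed

text \<open>Cauchy's estimates on discs of one radius around all real points near \<open>x0\<close>.
  Neighbourhood, radius and bound are tied to the single parameter \<epsilon>, so that decreasing
  \<epsilon> keeps the statement true and finitely many functions can share it.\<close>

lemma taylor_fps_bound:
  assumes "real_analytic_on I f" "x0 \<in> I"
  shows "\<exists>\<epsilon>>0. \<forall>x. \<bar>x - x0\<bar> < \<epsilon> \<longrightarrow> (\<forall>N. wnorm N \<epsilon> (taylor_fps f x) \<le> 1 / \<epsilon>)"
proof -
  obtain F r where F: "real_holo f F x0 r" using assms unfolding real_analytic_on_iff by blast
  have r: "r > 0" and hol: "F holomorphic_on ball (of_real x0) r" using F unfolding real_holo_def by auto
  define \<rho> where "\<rho> = r / 2"
  have \<rho>: "0 < \<rho>" "\<rho> < r" using r by (auto simp: \<rho>_def)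
  have "cball (complex_of_real x0) \<rho> \<subseteq> ball (of_real x0) r" using \<rho> by auto
  then have "continuous_on (cball (complex_of_real x0) \<rho>) F"
    by (rule continuous_on_subset[OF holomorphic_on_imp_continuous_on[OF hol]])
  then have "bounded (F ` cball (complex_of_real x0) \<rho>)"
    by (intro compact_imp_bounded compact_continuous_image) auto
  then obtain M where M: "M > 0" "\<And>z. z \<in> cball (of_real x0) \<rho> \<Longrightarrow> cmod (F z) \<le> M"
    unfolding bounded_pos by blast
  \<comment> \<open>Discs of radius \<open>\<rho> / 2\<close> about points within
    \<open>\<rho> / 4\<close> of \<open>x0\<close> stay in the disc of radius \<rho>. Weights up to
    \<open>\<rho> / 4\<close> then give a geometric series of ratio 1/2, whose sum is covered by
    \<open>2 * M \<le> 1 / \<epsilon>\<close>.\<close>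
  define \<epsilon> where "\<epsilon> = min (\<rho> / 4) (1 / (2 * M))"
  have \<epsilon>: "\<epsilon> > 0" "\<epsilon> \<le> \<rho> / 4" "2 * M \<le> 1 / \<epsilon>"
    using \<rho> M by (auto simp: \<epsilon>_def min_def field_simps)
  show ?thesis
  proof (intro exI[of _ \<epsilon>] conjI allI impI \<epsilon>)
    fix x N assume x: "\<bar>x - x0\<bar> < \<epsilon>"
    have sub: "cball (complex_of_real x) (\<rho> / 2) \<subseteq> cball (of_real x0) \<rho>"
    proof
      fix z assume "z \<in> cball (complex_of_real x) (\<rho> / 2)"
      moreover have "dist (complex_of_real x0) (of_real x) \<le> \<rho> / 4"
        unfolding dist_of_real dist_real_def using x \<epsilon>(1,2) abs_minus_commute[of x0 x] by linarith
      ultimately show "z \<in> cball (of_real x0) \<rho>"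
        using dist_triangle[of "of_real x0" z "of_real x"] \<rho> by auto
    qed
    have sub2: "cball (complex_of_real x) (\<rho> / 2) \<subseteq> ball (of_real x0) r" using sub \<rho> by auto
    have a: "\<bar>fps_nth (taylor_fps f x) n\<bar> \<le> M / (\<rho> / 2) ^ n" for n
    proof -
      have "cmod ((deriv ^^ n) F (of_real x)) \<le> fact n * M / (\<rho> / 2) ^ n"
      proof (rule Cauchy_inequality)
        show "F holomorphic_on ball (complex_of_real x) (\<rho> / 2)"
          by (rule holomorphic_on_subset[OF hol]) (use sub2 ball_subset_cball in blast)
        show "continuous_on (cball (complex_of_real x) (\<rho> / 2)) F"
          by (rule continuous_on_subset[OF holomorphic_on_imp_continuous_on[OF hol] sub2])
        show "0 < \<rho> / 2" using \<rho> by simp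
        fix z assume "cmod (of_real x - z) = \<rho> / 2"
        then have "z \<in> cball (complex_of_real x) (\<rho> / 2)" by (simp add: dist_norm)
        then show "cmod (F z) \<le> M" using sub M by blast
      qed
      moreover have "(deriv ^^ n) F (of_real x) = of_real ((deriv ^^ n) f x)"
        using real_holo_derivs[OF F, of n] x \<epsilon> \<rho> unfolding real_holo_def by auto
      ultimately have "\<bar>(deriv ^^ n) f x\<bar> \<le> fact n * M / (\<rho> / 2) ^ n" by simp
      then show ?thesis by (simp add: taylor_fps_def field_simps)
    qed
    have "wnorm N \<epsilon> (taylor_fps f x) \<le> (\<Sum>k\<le>N. M * (1 / 2) ^ k)"
      unfolding wnorm_def
    proof (intro sum_mono)
      fix k
      have "\<bar>fps_nth (taylor_fps f x) k\<bar> * \<epsilon> ^ k \<le> M / (\<rho> / 2) ^ k * (\<rho> / 4) ^ k"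
        by (intro mult_mono a power_mono) (use \<epsilon> M \<rho> in auto)
      also have "\<dots> = M * ((\<rho> / 4) / (\<rho> / 2)) ^ k" by (simp only: power_divide) simp
      also have "(\<rho> / 4) / (\<rho> / 2) = 1 / 2" using \<rho> by simp
      finally show "\<bar>fps_nth (taylor_fps f x) k\<bar> * \<epsilon> ^ k \<le> M * (1 / 2) ^ k" .
    qed
    also have "\<dots> = M * (\<Sum>k\<le>N. (1 / 2) ^ k)" by (simp add: sum_distrib_left)
    also have "(\<Sum>k\<le>N. (1 / 2 :: real) ^ k) \<le> 2"
      by (subst sum_gp0) auto
    finally have "wnorm N \<epsilon> (taylor_fps f x) \<le> M * 2" using M by simp
    then show "wnorm N \<epsilon> (taylor_fps f x) \<le> 1 / \<epsilon>" using \<epsilon> by linarith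
  qed
qed

lemma taylor_fps_bound_finite:
  assumes "finite A" "\<And>f. f \<in> A \<Longrightarrow> real_analytic_on I f" "x0 \<in> I"
  shows "\<exists>\<epsilon>>0. \<forall>f\<in>A. \<forall>x. \<bar>x - x0\<bar> < \<epsilon> \<longrightarrow> (\<forall>N. wnorm N \<epsilon> (taylor_fps f x) \<le> 1 / \<epsilon>)"
  using assms(1,2)
proof (induction A rule: finite_induct)
  case empty then show ?case by (intro exI[of _ 1]) auto
next
  case (insert f A)
  obtain \<delta> where \<delta>: "\<delta> > 0" "\<And>g x N. g \<in> A \<Longrightarrow> \<bar>x - x0\<bar> < \<delta> \<Longrightarrow> wnorm N \<delta> (taylor_fps g x) \<le> 1 / \<delta>"
    using insert by auto
  obtain \<eta> where \<eta>: "\<eta> > 0" "\<And>x N. \<bar>x - x0\<bar> < \<eta> \<Longrightarrow> wnorm N \<eta> (taylor_fps f x) \<le> 1 / \<eta>"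
    using taylor_fps_bound[of I f x0] insert.prems assms(3) by auto
  define \<epsilon> where "\<epsilon> = min \<delta> \<eta>"
  have \<epsilon>: "\<epsilon> > 0" "\<epsilon> \<le> \<delta>" "\<epsilon> \<le> \<eta>" "1 / \<delta> \<le> 1 / \<epsilon>" "1 / \<eta> \<le> 1 / \<epsilon>"
    using \<delta> \<eta> by (auto simp: \<epsilon>_def frac_le)
  have "wnorm N \<epsilon> (taylor_fps g x) \<le> 1 / \<epsilon>" if g: "g \<in> insert f A" and x: "\<bar>x - x0\<bar> < \<epsilon>" for g x N
  proof (cases "g = f")
    case True
    have "wnorm N \<eta> (taylor_fps f x) \<le> 1 / \<eta>" using \<eta>(2) x \<epsilon> by auto
    then show ?thesis using wnorm_mono[of \<epsilon> \<eta> N "taylor_fps f x"] \<epsilon> unfolding True by linarith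
  next
    case False
    then have "wnorm N \<delta> (taylor_fps g x) \<le> 1 / \<delta>" using \<delta>(2)[of g x N] x \<epsilon> g by auto
    then show ?thesis using wnorm_mono[of \<epsilon> \<delta> N "taylor_fps g x"] \<epsilon> by linarith
  qed
  then show ?case using \<epsilon>(1) by blast
qed

text \<open>The derivative of a polynomial expression in the solution is again such an expression,
  with analytic coefficients; so the family \<open>S\<close> of these expressions is closed under
  differentiation.\<close>

lemma poly_ode_smooth:
  fixes e :: "nat \<Rightarrow> (real \<Rightarrow> real) ex"
  assumes I: "open I"
    and ode: "\<And>i x. i < m \<Longrightarrow> x \<in> I \<Longrightarrow> (z i has_real_derivative ev (\<lambda>c. c x) (\<lambda>j. z j x) (e i)) (at x)"
    and vars: "\<And>i. i < m \<Longrightarrow> vars (e i) \<subseteq> {..<m}"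
    and coefs: "\<And>i c. i < m \<Longrightarrow> c \<in> coefs (e i) \<Longrightarrow> real_analytic_on I c"
    and i: "i < m" and x: "x \<in> I"
  shows "((deriv ^^ k) (z i) has_real_derivative (deriv ^^ Suc k) (z i) x) (at x)"
proof -
  define S where "S = {\<lambda>x. ev (\<lambda>c. c x) (\<lambda>j. z j x) p | p. (\<forall>c\<in>coefs p. real_analytic_on I c) \<and> vars p \<subseteq> {..<m}}"
  have "Cn_on (Suc k) I (z i)"
  proof (rule Cn_on_coinduct[OF I, where S = S])
    show "z i \<in> S" unfolding S_def using i by (intro CollectI exI[of _ "Vr i"]) auto
    fix f assume "f \<in> S"
    then obtain p where p: "f = (\<lambda>x. ev (\<lambda>c. c x) (\<lambda>j. z j x) p)" "\<forall>c\<in>coefs p. real_analytic_on I c" "vars p \<subseteq> {..<m}"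
      unfolding S_def by blast
    show "\<exists>g\<in>S. \<forall>x\<in>I. (f has_real_derivative g x) (at x)"
    proof (intro bexI ballI)
      fix x assume x: "x \<in> I"
      show "(f has_real_derivative ev (\<lambda>c. c x) (\<lambda>j. z j x) (Dx deriv e p)) (at x)"
        unfolding p(1)
      proof (rule ev_has_real_derivative[where k = "\<lambda>c. c" and d = deriv and s = e and z = z])
        show "(c has_real_derivative deriv c x) (at x)" if "c \<in> coefs p" for c
          using p(2) that x by (intro real_analytic_on_has_derivative[of I]) auto
        show "(z j has_real_derivative ev (\<lambda>c. c x) (\<lambda>i. z i x) (e j)) (at x)" if "j \<in> vars p" for j
          by (rule ode) (use that p(3) x in auto)
      qed
    next
      have "\<forall>c\<in>coefs (Dx deriv e p). real_analytic_on I c"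
      proof
        fix c assume "c \<in> coefs (Dx deriv e p)"
        then consider "c \<in> coefs p" | d where "d \<in> coefs p" "c = deriv d" | j where "j \<in> vars p" "c \<in> coefs (e j)"
          using coefs_Dx[of deriv e p] by auto
        then show "real_analytic_on I c"
        proof cases
          case 1 then show ?thesis using p(2) by simp
        next
          case 2 then show ?thesis using p(2) real_analytic_on_deriv by simp
        next
          case 3 then show ?thesis using p(3) coefs[of j c] by auto
        qed
      qed
      moreover have "vars (Dx deriv e p) \<subseteq> {..<m}"
      proof -
        have "(\<Union>j\<in>vars p. vars (e j)) \<subseteq> {..<m}" using p(3) vars by blast
        then show ?thesis using p(3) by (intro order_trans[OF vars_Dx] Un_least)
      qed
      ultimately show "(\<lambda>x. ev (\<lambda>c. c x) (\<lambda>j. z j x) (Dx deriv e p)) \<in> S" unfolding S_def by blast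
    qed
  qed
  then show ?thesis using x unfolding Cn_on_def by auto
qed

text \<open>The formal Taylor series of a solution obey the same polynomial system. Hence the norm
  of order N + 1 at radius t exceeds its value at radius 0 by at most t times a bound for the norm
  of order N of the right-hand side. By induction on N all norms stay below one constant at a fixed
  radius, which bounds the Taylor coefficients geometrically and uniformly near
  \<open>x0\<close>.\<close>

lemma poly_ode_analytic:
  fixes e :: "nat \<Rightarrow> (real \<Rightarrow> real) ex"
  assumes I: "open I"
    and ode: "\<And>i x. i < m \<Longrightarrow> x \<in> I \<Longrightarrow> (z i has_real_derivative ev (\<lambda>c. c x) (\<lambda>j. z j x) (e i)) (at x)"
    and vars: "\<And>i. i < m \<Longrightarrow> vars (e i) \<subseteq> {..<m}"
    and coefs: "\<And>i c. i < m \<Longrightarrow> c \<in> coefs (e i) \<Longrightarrow> real_analytic_on I c"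
    and i: "i < m"
  shows "real_analytic_on I (z i)"
  unfolding real_analytic_on_def
proof
  fix x0 assume x0: "x0 \<in> I"
  have sm: "((deriv ^^ k) (z i) has_real_derivative (deriv ^^ Suc k) (z i) x) (at x)" if "i < m" "x \<in> I" for i k x
    using poly_ode_smooth[where m = m and e = e and z = z, OF I ode vars coefs that] by auto
  have jz: "jet I (z i) (taylor_fps (z i))" if "i < m" for i
    by (rule jet_taylor_fps) (rule sm[OF that])
  have jc: "jet I c (taylor_fps c)" if "i < m" "c \<in> coefs (e i)" for i c
    by (rule jet_taylor_fps)
      (use real_analytic_on_has_derivative[OF real_analytic_on_derivs[OF coefs[OF that]]] in simp)
  \<comment> \<open>Both sides are jets of the derivative of \<open>z i\<close>, so uniqueness of
    jets replaces a comparison of coefficients.\<close>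
  have eqn: "fps_deriv (taylor_fps (z i) x) = ev (\<lambda>c. taylor_fps c x) (\<lambda>j. taylor_fps (z j) x) (e i)"
    if i: "i < m" and x: "x \<in> I" for i x
  proof (rule jet_unique[OF I _ _ x])
    show "jet I (\<lambda>x. ev (\<lambda>c. c x) (\<lambda>j. z j x) (e i)) (\<lambda>x. fps_deriv (taylor_fps (z i) x))"
      by (rule jet_deriv[OF I jz[OF i]]) (rule ode[OF i])
    show "jet I (\<lambda>x. ev (\<lambda>c. c x) (\<lambda>j. z j x) (e i)) (\<lambda>x. ev (\<lambda>c. taylor_fps c x) (\<lambda>j. taylor_fps (z j) x) (e i))"
      by (rule jet_ev) (use jc[OF i] jz vars[OF i] in auto)
  qed
  obtain \<rho> where \<rho>: "\<rho> > 0" "cball x0 \<rho> \<subseteq> I" using I x0 open_contains_cball by blast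
  have "\<exists>B0. \<forall>i<m. \<forall>x\<in>cball x0 \<rho>. \<bar>z i x\<bar> \<le> B0"
  proof -
    have "\<forall>i\<in>{..<m}. \<exists>B0. \<forall>x\<in>cball x0 \<rho>. \<bar>z i x\<bar> \<le> B0"
    proof
      fix i assume i: "i \<in> {..<m}"
      have "continuous_on (cball x0 \<rho>) (z i)"
        by (intro continuous_at_imp_continuous_on ballI DERIV_isCont[OF ode]) (use i \<rho> in auto)
      then have "bounded (z i ` cball x0 \<rho>)" by (intro compact_imp_bounded compact_continuous_image) auto
      then show "\<exists>B0. \<forall>x\<in>cball x0 \<rho>. \<bar>z i x\<bar> \<le> B0" unfolding bounded_iff by auto
    qed
    then obtain b where b: "\<forall>i\<in>{..<m}. \<forall>x\<in>cball x0 \<rho>. \<bar>z i x\<bar> \<le> b i" using bchoice[of "{..<m}"] by metis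
    have "\<bar>z i x\<bar> \<le> (\<Sum>j<m. \<bar>b j\<bar>)" if "i < m" "x \<in> cball x0 \<rho>" for i x
    proof -
      have "\<bar>z i x\<bar> \<le> b i" using b that by auto
      then have "\<bar>z i x\<bar> \<le> \<bar>b i\<bar>" by linarith
      also have "\<dots> \<le> (\<Sum>j<m. \<bar>b j\<bar>)" by (rule member_le_sum) (use that in auto)
      finally show ?thesis .
    qed
    then show ?thesis by blast
  qed
  then obtain B0 where B0: "\<And>i x. i < m \<Longrightarrow> x \<in> cball x0 \<rho> \<Longrightarrow> \<bar>z i x\<bar> \<le> B0" by blast
  have "finite (\<Union>i<m. coefs (e i))" by (intro finite_UN_I finite_coefs) auto
  then obtain \<epsilon> where \<epsilon>: "\<epsilon> > 0" and cb: "\<And>i c x N. i < m \<Longrightarrow> c \<in> coefs (e i) \<Longrightarrow> \<bar>x - x0\<bar> < \<epsilon> \<Longrightarrow> wnorm N \<epsilon> (taylor_fps c x) \<le> 1 / \<epsilon>"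
    using taylor_fps_bound_finite[of "\<Union>i<m. coefs (e i)" I x0] coefs x0 by fastforce
  \<comment> \<open>\<open>1 / \<epsilon>\<close> covers the coefficients; the 1 added to the bound
    for the values is the growth allowed between radius 0 and radius \<open>s\<close>.\<close>
  define B where "B = max (1 / \<epsilon>) (\<bar>B0\<bar> + 1)"
  have B: "B \<ge> 1 / \<epsilon>" "B \<ge> \<bar>B0\<bar> + 1" "B \<ge> 0" using \<epsilon> by (auto simp: B_def)
  have "\<exists>C\<ge>0. \<forall>i<m. \<forall>N s k z. s \<ge> 0 \<and> (\<forall>c\<in>coefs (e i). wnorm N s (k c) \<le> B) \<and> (\<forall>j\<in>vars (e i). wnorm N s (z j) \<le> B) \<longrightarrow> wnorm N s (ev k z (e i)) \<le> C"
  proof -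
    have "\<forall>i. \<exists>C\<ge>0. \<forall>N s k z. s \<ge> 0 \<and> (\<forall>c\<in>coefs (e i). wnorm N s (k c) \<le> B) \<and> (\<forall>j\<in>vars (e i). wnorm N s (z j) \<le> B) \<longrightarrow> wnorm N s (ev k z (e i)) \<le> C"
      using wnorm_ev_bound[OF B(3)] by blast
    then obtain C where C: "\<And>i. C i \<ge> 0" "\<And>i N s k z. s \<ge> 0 \<and> (\<forall>c\<in>coefs (e i). wnorm N s (k c) \<le> B) \<and> (\<forall>j\<in>vars (e i). wnorm N s (z j) \<le> B) \<Longrightarrow> wnorm N s (ev k z (e i)) \<le> C i"
      by metis
    have "C i \<le> (\<Sum>j<m. C j)" if "i < m" for i by (rule member_le_sum) (use that C in auto)
    then have "\<forall>i<m. \<forall>N s k z. s \<ge> 0 \<and> (\<forall>c\<in>coefs (e i). wnorm N s (k c) \<le> B) \<and> (\<forall>j\<in>vars (e i). wnorm N s (z j) \<le> B) \<longrightarrow> wnorm N s (ev k z (e i)) \<le> (\<Sum>j<m. C j)"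
      using C(2) order_trans by blast
    moreover have "(\<Sum>j<m. C j) \<ge> 0" by (intro sum_nonneg C)
    ultimately show ?thesis by blast
  qed
  then obtain C where C': "C \<ge> 0 \<and> (\<forall>i<m. \<forall>N s k z. s \<ge> 0 \<and> (\<forall>c\<in>coefs (e i). wnorm N s (k c) \<le> B) \<and> (\<forall>j\<in>vars (e i). wnorm N s (z j) \<le> B) \<longrightarrow> wnorm N s (ev k z (e i)) \<le> C)"
    by (rule exE)
  note C = conjunct1[OF C']
  have evb: "wnorm N s (ev k z (e i)) \<le> C"
    if "i < m" "s \<ge> 0" "\<And>c. c \<in> coefs (e i) \<Longrightarrow> wnorm N s (k c) \<le> B" "\<And>j. j \<in> vars (e i) \<Longrightarrow> wnorm N s (z j) \<le> B" for i N s k z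
    using conjunct2[OF C', rule_format, OF that(1), of s N k z] that(2-4) by simp
  \<comment> \<open>Small enough that the growth \<open>s * C\<close> stays within this allowance of
    1.\<close>
  define s where "s = min \<epsilon> (1 / (C + 1))"
  have s: "s > 0" "s \<le> \<epsilon>" "s * C \<le> 1" using \<epsilon> C by (auto simp: s_def min_def field_simps)
  have main: "wnorm N t (taylor_fps (z i) x) \<le> B"
    if x: "\<bar>x - x0\<bar> < min \<rho> \<epsilon>" and "i < m" "0 \<le> t" "t \<le> s" for N i t x
    using that(2-)
  proof (induction N arbitrary: i t)
    case 0
    have "\<bar>z i x\<bar> \<le> B0" by (rule B0) (use 0 x in \<open>auto simp: dist_real_def\<close>)
    then show ?case using B by (simp add: wnorm_def taylor_fps_def)
  next
    case (Suc N)
    have xI: "x \<in> I" using x \<rho> by (auto simp: dist_real_def subset_iff)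
    have der: "wnorm N u (fps_deriv (taylor_fps (z i) x)) \<le> C" if u: "0 \<le> u" "u \<le> s" for u
      unfolding eqn[OF Suc.prems(1) xI]
    proof (rule evb[OF Suc.prems(1) u(1)])
      fix c assume c: "c \<in> coefs (e i)"
      have "wnorm N u (taylor_fps c x) \<le> wnorm N \<epsilon> (taylor_fps c x)" by (rule wnorm_mono) (use u s in auto)
      also have "\<dots> \<le> 1 / \<epsilon>" by (rule cb[OF Suc.prems(1) c]) (use x in auto)
      finally show "wnorm N u (taylor_fps c x) \<le> B" using B by linarith
    next
      fix j assume "j \<in> vars (e i)"
      then have "j < m" using vars Suc.prems by auto
      then show "wnorm N u (taylor_fps (z j) x) \<le> B" by (rule Suc.IH[OF _ u])
    qed
    have z0: "wnorm (Suc N) 0 (taylor_fps (z i) x) \<le> B0"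
    proof -
      have "wnorm (Suc N) 0 (taylor_fps (z i) x) = \<bar>z i x\<bar>"
        unfolding wnorm_def by (subst sum.atMost_Suc_shift) (simp add: taylor_fps_def)
      also have "\<dots> \<le> B0" by (rule B0) (use Suc x in \<open>auto simp: dist_real_def\<close>)
      finally show ?thesis .
    qed
    show ?case
    proof (cases "t = 0")
      case True then show ?thesis using z0 B by simp
    next
      case False
      then have t: "0 < t" using Suc.prems by simp
      obtain \<xi> where \<xi>: "0 < \<xi>" "\<xi> < t" "wnorm (Suc N) t (taylor_fps (z i) x) - wnorm (Suc N) 0 (taylor_fps (z i) x) = (t - 0) * wnorm N \<xi> (fps_deriv (taylor_fps (z i) x))"
        using MVT2[OF t, of "\<lambda>s. wnorm (Suc N) s (taylor_fps (z i) x)" "\<lambda>s. wnorm N s (fps_deriv (taylor_fps (z i) x))"] wnorm_has_derivative by blast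
      have "t * wnorm N \<xi> (fps_deriv (taylor_fps (z i) x)) \<le> s * C"
        by (intro mult_mono der wnorm_nonneg) (use \<xi> Suc.prems s in auto)
      then show ?thesis using \<xi>(3) z0 s(3) B by simp
    qed
  qed
  define \<delta> where "\<delta> = min \<rho> \<epsilon>"
  have \<delta>: "\<delta> > 0" using \<rho> \<epsilon> by (simp add: \<delta>_def)
  have inI: "x \<in> I" if "\<bar>x - x0\<bar> < \<delta>" for x using that \<rho> by (auto simp: dist_real_def subset_iff \<delta>_def)
  have "\<bar>(deriv ^^ k) (z i) x\<bar> / fact k * s ^ k \<le> B" if "\<bar>x - x0\<bar> < \<delta>" for k x
  proof -
    have "\<bar>fps_nth (taylor_fps (z i) x) k\<bar> * s ^ k \<le> wnorm k s (taylor_fps (z i) x)"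
      unfolding wnorm_def by (rule member_le_sum) (use s in auto)
    also have "\<dots> \<le> B" by (rule main) (use that i s in \<open>auto simp: \<delta>_def\<close>)
    finally show ?thesis by (simp add: taylor_fps_def)
  qed
  note bd = this
  have "(\<lambda>n. (deriv ^^ n) (z i) x0 / fact n * (y - x0) ^ n) sums z i y" if "\<bar>y - x0\<bar> < min \<delta> s" for y
    by (rule real_power_series_of_bound[where \<epsilon> = \<delta> and s = s and B = B])
      (use sm[OF i inI] bd s that in \<open>auto simp del: funpow.simps\<close>)
  then show "\<exists>r>0. \<exists>c. \<forall>y. \<bar>y - x0\<bar> < r \<longrightarrow> (\<lambda>n. c n * (y - x0) ^ n) sums z i y"
    using \<delta> s(1)
    by (intro exI[of _ "min \<delta> s"] conjI exI[of _ "\<lambda>n. (deriv ^^ n) (z i) x0 / fact n"] allI impI) auto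
qed

text \<open>The reciprocal \<open>W\<close> of the denominator becomes an additional unknown of
  index \<open>Suc r\<close>. Its derivative is - W^2 times the derivative of the denominator, which
  turns the rational equation into a polynomial system.\<close>

lemma rational_ode_analytic:
  fixes A S :: "(real \<Rightarrow> real) ex"
  assumes Y: "\<And>j x. j < r \<Longrightarrow> x > a \<Longrightarrow> (Y j has_real_derivative Y (Suc j) x) (at x)"
    and Yr: "\<And>x. x > a \<Longrightarrow> (Y r has_real_derivative - ev (\<lambda>c. c x) (\<lambda>j. Y j x) A / ev (\<lambda>c. c x) (\<lambda>j. Y j x) S) (at x)"
    and S: "\<And>x. x > a \<Longrightarrow> ev (\<lambda>c. c x) (\<lambda>j. Y j x) S \<noteq> 0"
    and vars: "vars A \<subseteq> {..r}" "vars S \<subseteq> {..r}"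
    and coefs: "\<And>c. c \<in> coefs A \<union> coefs S \<Longrightarrow> real_analytic_on {a<..} c"
    and j: "j \<le> r"
  shows "real_analytic_on {a<..} (Y j)"
proof -
  define W where "W x = inverse (ev (\<lambda>c. c x) (\<lambda>j. Y j x) S)" for x
  define z where "z i = (if i \<le> r then Y i else W)" for i
  \<comment> \<open>\<open>e0\<close> is kept apart from \<open>e\<close> because the equation for
    \<open>W\<close> uses it to differentiate \<open>S\<close>.\<close>
  define e0 where "e0 i = (if i < r then Vr (Suc i) else Ml (Cf (\<lambda>x. -1)) (Ml A (Vr (Suc r))))" for i
  define e where "e i = (if i \<le> r then e0 i else Ml (Cf (\<lambda>x. -1)) (Ml (Ml (Vr (Suc r)) (Vr (Suc r))) (Dx deriv e0 S)))" for i
  have evz: "ev (\<lambda>c. c x) (\<lambda>j. z j x) p = ev (\<lambda>c. c x) (\<lambda>j. Y j x) p" if "vars p \<subseteq> {..r}" for p :: "(real \<Rightarrow> real) ex" and x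
    by (rule ev_cong) (use that in \<open>auto simp: z_def\<close>)
  have e0: "(z i has_real_derivative ev (\<lambda>c. c x) (\<lambda>j. z j x) (e0 i)) (at x)" if "i \<le> r" "x > a" for i x
  proof (cases "i < r")
    case True then show ?thesis using Y[OF True that(2)] by (simp add: z_def e0_def)
  next
    case False
    then have "i = r" using that by simp
    then show ?thesis using Yr[OF that(2)] evz[OF vars(1), of x] by (simp add: z_def e0_def W_def divide_inverse)
  qed
  have "real_analytic_on {a<..} (z j)"
  proof (rule poly_ode_analytic[where m = "r + 2" and e = e])
    show "open {a<..}" by simp
    show "j < r + 2" using j by simp
  next
    fix i x assume i: "i < r + 2" and "x \<in> {a<..}"
    then have x: "x > a" by simp
    show "(z i has_real_derivative ev (\<lambda>c. c x) (\<lambda>j. z j x) (e i)) (at x)"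
    proof (cases "i \<le> r")
      case True then show ?thesis using e0[OF True x] by (simp add: e_def)
    next
      case False
      have "((\<lambda>x. ev (\<lambda>c. c x) (\<lambda>j. z j x) S) has_real_derivative ev (\<lambda>c. c x) (\<lambda>j. z j x) (Dx deriv e0 S)) (at x)"
        by (rule ev_has_real_derivative[where k = "\<lambda>c. c" and d = deriv and s = e0 and z = z]) (use coefs real_analytic_on_has_derivative x e0 vars in auto)
      then have d: "((\<lambda>x. ev (\<lambda>c. c x) (\<lambda>j. Y j x) S) has_real_derivative ev (\<lambda>c. c x) (\<lambda>j. z j x) (Dx deriv e0 S)) (at x)"
        by (simp add: evz[OF vars(2)])
      have "(W has_real_derivative - (ev (\<lambda>c. c x) (\<lambda>j. z j x) (Dx deriv e0 S) * (W x * W x))) (at x)"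
        using DERIV_inverse_fun[OF d S[OF x]] unfolding W_def by (simp add: power2_eq_square mult.assoc numeral_2_eq_2)
      then show ?thesis using False by (simp add: z_def e_def mult.commute)
    qed
  next
    fix i assume i: "i < r + 2"
    have "vars (Dx deriv e0 S) \<subseteq> {..<r + 2}" using vars_Dx[of deriv e0 S] vars by (fastforce simp: e0_def split: if_splits)
    then show "vars (e i) \<subseteq> {..<r + 2}" using i vars by (auto simp: e_def e0_def)
    fix c assume c: "c \<in> coefs (e i)"
    have 0: "real_analytic_on {a<..} c" if "c \<in> coefs (e0 j)" for c j
      using that coefs real_analytic_on_const by (auto simp: e0_def split: if_splits)
    have 1: "real_analytic_on {a<..} c" if "c \<in> coefs (Dx deriv e0 S)" for c
      using coefs_Dx[of deriv e0 S] that 0 coefs real_analytic_on_deriv by blast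
    show "real_analytic_on {a<..} c"
      using c 0 1 real_analytic_on_const by (auto simp: e_def split: if_splits)
  qed
  then show ?thesis using j by (simp add: z_def)
qed

section \<open>Approximation by analytic germs\<close>

lemma derivs_add:
  "open S \<Longrightarrow> Cn_on n S f \<Longrightarrow> Cn_on n S g \<Longrightarrow> k \<le> n \<Longrightarrow> x \<in> S \<Longrightarrow>
     (deriv ^^ k) (\<lambda>x. f x + g x) x = (deriv ^^ k) f x + (deriv ^^ k) g x"
proof (induction k arbitrary: n f g x)
  case (Suc k)
  then obtain n' where n: "n = Suc n'" by (cases n) auto
  have c: "Cn_on n' S (deriv f)" "Cn_on n' S (deriv g)" using Suc.prems n by (auto simp: Cn_on_Suc)
  have "Cn_on n' S (\<lambda>x. deriv f x + deriv g x)" by (rule Cn_on_add[OF Suc.prems(1) c])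
  moreover have "deriv f x + deriv g x = deriv (\<lambda>x. f x + g x) x" if "x \<in> S" for x
    using Suc.prems n that by (intro DERIV_imp_deriv[symmetric] DERIV_add) (auto simp: Cn_on_Suc)
  ultimately have "(deriv ^^ k) (\<lambda>x. deriv f x + deriv g x) x = (deriv ^^ k) (deriv (\<lambda>x. f x + g x)) x"
    using Cn_on_cong(2)[OF Suc.prems(1), of "\<lambda>x. deriv f x + deriv g x" "deriv (\<lambda>x. f x + g x)" n' x k] Suc.prems(5) by blast
  moreover have "(deriv ^^ k) (\<lambda>x. deriv f x + deriv g x) x = (deriv ^^ k) (deriv f) x + (deriv ^^ k) (deriv g) x"
    using Suc.IH[OF Suc.prems(1) c] Suc.prems n by auto
  ultimately show ?case by (simp only: funpow_Suc_right o_apply)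
qed auto

lemma Cn_on_diff: "open S \<Longrightarrow> Cn_on n S f \<Longrightarrow> Cn_on n S g \<Longrightarrow> Cn_on n S (\<lambda>x. f x - g x)"
  using Cn_on_add[of S n f "\<lambda>x. (-1) * g x"] Cn_on_mult[of S n "\<lambda>x. -1" g] Cn_on_const[of S n "-1"] by simp

lemma derivs_diff:
  "open S \<Longrightarrow> Cn_on n S f \<Longrightarrow> Cn_on n S g \<Longrightarrow> k \<le> n \<Longrightarrow> x \<in> S \<Longrightarrow>
     (deriv ^^ k) (\<lambda>x. f x - g x) x = (deriv ^^ k) f x - (deriv ^^ k) g x"
proof (induction k arbitrary: n f g x)
  case (Suc k)
  then obtain n' where n: "n = Suc n'" by (cases n) auto
  have c: "Cn_on n' S (deriv f)" "Cn_on n' S (deriv g)" using Suc.prems n by (auto simp: Cn_on_Suc)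
  have "Cn_on n' S (\<lambda>x. deriv f x - deriv g x)" by (rule Cn_on_diff[OF Suc.prems(1) c])
  moreover have "deriv f x - deriv g x = deriv (\<lambda>x. f x - g x) x" if "x \<in> S" for x
    using Suc.prems n that by (intro DERIV_imp_deriv[symmetric] DERIV_diff) (auto simp: Cn_on_Suc)
  ultimately have "(deriv ^^ k) (\<lambda>x. deriv f x - deriv g x) x = (deriv ^^ k) (deriv (\<lambda>x. f x - g x)) x"
    using Cn_on_cong(2)[OF Suc.prems(1), of "\<lambda>x. deriv f x - deriv g x" "deriv (\<lambda>x. f x - g x)" n' x k] Suc.prems(5) by blast
  moreover have "(deriv ^^ k) (\<lambda>x. deriv f x - deriv g x) x = (deriv ^^ k) (deriv f) x - (deriv ^^ k) (deriv g) x"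
    using Suc.IH[OF Suc.prems(1) c] Suc.prems n by auto
  ultimately show ?case by (simp only: funpow_Suc_right o_apply)
qed auto

text \<open>Leibniz' rule in crude form: the derivative of a product is a sum of two products of the
  same kind, so each differentiation doubles the bound.\<close>

lemma derivs_mult_bound:
  assumes "open S" "Cn_on n S f" "Cn_on n S g" "k \<le> n" "x \<in> S"
    and "\<And>i x. i \<le> k \<Longrightarrow> x \<in> S \<Longrightarrow> \<bar>(deriv ^^ i) f x\<bar> \<le> A" "\<And>i x. i \<le> k \<Longrightarrow> x \<in> S \<Longrightarrow> \<bar>(deriv ^^ i) g x\<bar> \<le> B"
  shows "\<bar>(deriv ^^ k) (\<lambda>x. f x * g x) x\<bar> \<le> 2 ^ k * A * B"
  using assms
proof (induction k arbitrary: n f g x A B)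
  case 0
  have "\<bar>f x\<bar> * \<bar>g x\<bar> \<le> A * B" using 0(5) 0(6)[of 0 x] 0(7)[of 0 x] by (intro mult_mono) auto
  then show ?case by (simp add: abs_mult)
next
  case (Suc k)
  obtain n' where n: "n = Suc n'" "k \<le> n'" using Suc.prems(4) by (cases n) auto
  have "Cn_on n' S f" "Cn_on n' S g" using Suc.prems(2,3) n Cn_on_SucD by auto
  then have c: "Cn_on n' S (deriv f)" "Cn_on n' S (deriv g)" "Cn_on n' S f" "Cn_on n' S g"
    using Suc.prems n by (auto simp: Cn_on_Suc)
  have s: "(deriv ^^ i) (deriv h) = (deriv ^^ Suc i) h" for i and h :: "real \<Rightarrow> real" by (simp only: funpow_Suc_right o_apply)
  have "Cn_on n' S (\<lambda>x. deriv f x * g x + deriv g x * f x)"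
    using c Suc.prems(1) by (intro Cn_on_add Cn_on_mult)
  moreover have "deriv f x * g x + deriv g x * f x = deriv (\<lambda>x. f x * g x) x" if "x \<in> S" for x
    using Suc.prems(1-3) n that by (intro DERIV_imp_deriv[symmetric] DERIV_mult) (auto simp: Cn_on_Suc)
  ultimately have "(deriv ^^ k) (deriv (\<lambda>x. f x * g x)) x = (deriv ^^ k) (\<lambda>x. deriv f x * g x + deriv g x * f x) x"
    using Cn_on_cong(2)[OF Suc.prems(1), of "\<lambda>x. deriv f x * g x + deriv g x * f x" "deriv (\<lambda>x. f x * g x)" n' x k] Suc.prems(5) by simp
  also have "\<dots> = (deriv ^^ k) (\<lambda>x. deriv f x * g x) x + (deriv ^^ k) (\<lambda>x. deriv g x * f x) x"
    by (rule derivs_add[OF Suc.prems(1) _ _ n(2) Suc.prems(5)]) (intro Cn_on_mult c Suc.prems(1))+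
  finally have e: "(deriv ^^ Suc k) (\<lambda>x. f x * g x) x = (deriv ^^ k) (\<lambda>x. deriv f x * g x) x + (deriv ^^ k) (\<lambda>x. deriv g x * f x) x"
    by (simp only: s)
  have b1: "\<bar>(deriv ^^ i) (deriv f) x\<bar> \<le> A" "\<bar>(deriv ^^ i) f x\<bar> \<le> A"
    and b2: "\<bar>(deriv ^^ i) (deriv g) x\<bar> \<le> B" "\<bar>(deriv ^^ i) g x\<bar> \<le> B" if "i \<le> k" "x \<in> S" for i x
    using Suc.prems(6)[of "Suc i" x] Suc.prems(6)[of i x] Suc.prems(7)[of "Suc i" x] Suc.prems(7)[of i x] that unfolding s by auto
  have "\<bar>(deriv ^^ k) (\<lambda>x. deriv f x * g x) x\<bar> \<le> 2 ^ k * A * B"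
    by (rule Suc.IH[OF Suc.prems(1) c(1,4) n(2) Suc.prems(5) b1(1) b2(2)])
  moreover have "\<bar>(deriv ^^ k) (\<lambda>x. deriv g x * f x) x\<bar> \<le> 2 ^ k * B * A"
    by (rule Suc.IH[OF Suc.prems(1) c(2,3) n(2) Suc.prems(5) b2(1) b1(2)])
  ultimately have "\<bar>(deriv ^^ Suc k) (\<lambda>x. f x * g x) x\<bar> \<le> 2 ^ k * A * B + 2 ^ k * B * A" unfolding e by linarith
  also have "\<dots> = 2 ^ Suc k * A * B" by simp
  finally show ?case .
qed

lemma Cn_on_Un: "Cn_on n S f \<Longrightarrow> Cn_on n T f \<Longrightarrow> open S \<Longrightarrow> open T \<Longrightarrow> Cn_on n (S \<union> T) f"
  unfolding Cn_on_def by (auto intro: continuous_on_open_Un)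

text \<open>The truncated power of smoothness C^n; the exponent is one larger than \<open>n\<close>,
  so that already \<open>n = 0\<close> gives a continuous function. Finite smoothness is enough for
  cutoffs, since on each piece only finitely many derivatives are controlled.\<close>

definition pos_pow :: "nat \<Rightarrow> real \<Rightarrow> real" where
  "pos_pow n t = (max 0 t) ^ Suc n"

lemma pos_pow_has_derivative:
  "(pos_pow (Suc n) has_real_derivative of_nat (n + 2) * pos_pow n t) (at t)"
proof (cases "t = 0")
  case True
  have "((\<lambda>h. (pos_pow (Suc n) (0 + h) - pos_pow (Suc n) 0) / h) \<longlongrightarrow> 0) (at 0)"
  proof (rule Lim_null_comparison)
    have "\<bar>pos_pow (Suc n) h / h\<bar> \<le> \<bar>h\<bar> ^ Suc n" for h
    proof (cases "h > 0")
      case False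
      then have "pos_pow (Suc n) h = 0" by (simp add: pos_pow_def)
      then show ?thesis using zero_le_power[of "\<bar>h\<bar>" "Suc n"] by (simp del: power_Suc)
    qed (auto simp: pos_pow_def)
    moreover have "pos_pow (Suc n) 0 = 0" by (simp add: pos_pow_def)
    ultimately show "eventually (\<lambda>h. norm ((pos_pow (Suc n) (0 + h) - pos_pow (Suc n) 0) / h) \<le> \<bar>h\<bar> ^ Suc n) (at 0)"
      by (simp del: power_Suc)
    have "((\<lambda>h. \<bar>h\<bar> ^ Suc n) \<longlongrightarrow> \<bar>0::real\<bar> ^ Suc n) (at 0)" by (intro tendsto_intros)
    then show "((\<lambda>h::real. \<bar>h\<bar> ^ Suc n) \<longlongrightarrow> 0) (at 0)" by simp
  qed
  then show ?thesis using True by (simp add: DERIV_def pos_pow_def)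
next
  case False
  show ?thesis
  proof (cases "t > 0")
    case True
    have "((\<lambda>t. t ^ Suc (Suc n)) has_real_derivative of_nat (n + 2) * t ^ Suc n) (at t)"
      using DERIV_pow[of "Suc (Suc n)" t] by simp
    then have "(pos_pow (Suc n) has_real_derivative of_nat (n + 2) * t ^ Suc n) (at t)"
      by (rule has_field_derivative_transform_within_open[where S = "{0<..}"]) (use True in \<open>auto simp: pos_pow_def\<close>)
    then show ?thesis using True by (simp add: pos_pow_def)
  next
    case False
    with \<open>t \<noteq> 0\<close> have t: "t < 0" by simp
    have "((\<lambda>t. 0) has_real_derivative 0) (at t)" by simp
    then have "(pos_pow (Suc n) has_real_derivative 0) (at t)"
      by (rule has_field_derivative_transform_within_open[where S = "{..<0}"]) (use t in \<open>auto simp: pos_pow_def\<close>)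
    then show ?thesis using t by (simp add: pos_pow_def)
  qed
qed

lemma Cn_on_pos_pow: "s = 1 \<or> s = -1 \<Longrightarrow> Cn_on n UNIV (\<lambda>x. pos_pow n (s * x + a))"
proof (induction n)
  case 0
  then show ?case by (auto simp: Cn_on_0 pos_pow_def intro!: continuous_intros)
next
  case (Suc n)
  show ?case
  proof (rule Cn_on_derivI[where g = "\<lambda>x. (of_nat (n + 2) * s) * pos_pow n (s * x + a)"])
    show "Cn_on n UNIV (\<lambda>x. (of_nat (n + 2) * s) * pos_pow n (s * x + a))"
      by (intro Cn_on_mult Cn_on_const Suc.IH Suc.prems) auto
    fix x :: real
    have "((\<lambda>x. s * x + a) has_real_derivative s) (at x)" by (auto intro!: derivative_eq_intros)
    from DERIV_chain2[OF pos_pow_has_derivative this, of n]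
    show "((\<lambda>x. pos_pow (Suc n) (s * x + a)) has_real_derivative (of_nat (n + 2) * s) * pos_pow n (s * x + a)) (at x)"
      by (simp add: mult_ac)
  qed auto
qed

lemma pos_pow_nonneg: "pos_pow n t \<ge> 0" and pos_pow_pos: "t > 0 \<Longrightarrow> pos_pow n t > 0" and pos_pow_0: "t \<le> 0 \<Longrightarrow> pos_pow n t = 0"
  by (auto simp: pos_pow_def)

text \<open>The quotient p / (p + q) of two truncated powers whose supports cover the line because
  of \<open>a < b\<close>; the sign \<open>s\<close> yields rising and falling steps at
  once.\<close>

lemma Cn_step_exists:
  fixes a b :: real
  assumes "a < b" "s = 1 \<or> s = -1"
  shows "\<exists>f. Cn_on n UNIV f \<and> (\<forall>x. s * x \<le> a \<longrightarrow> f x = 0) \<and> (\<forall>x. s * x \<ge> b \<longrightarrow> f x = 1)"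
proof -
  define p q where "p x = pos_pow n (s * x + (- a))" and "q x = pos_pow n ((- s) * x + b)" for x
  have p: "Cn_on n UNIV p" unfolding p_def by (rule Cn_on_pos_pow[OF assms(2)])
  have q: "Cn_on n UNIV q" unfolding q_def by (rule Cn_on_pos_pow) (use assms(2) in auto)
  have pos: "p x + q x \<noteq> 0" for x
  proof (cases "s * x > a")
    case True then have "p x > 0" by (simp add: p_def pos_pow_pos)
    then show ?thesis using pos_pow_nonneg[of n "(- s) * x + b"] by (simp add: q_def)
  next
    case False then have "q x > 0" using assms(1) by (simp add: q_def pos_pow_pos)
    then show ?thesis using pos_pow_nonneg[of n "s * x + (- a)"] by (simp add: p_def)
  qed
  have "Cn_on n UNIV (\<lambda>x. p x * inverse (p x + q x))"
    by (intro Cn_on_mult Cn_on_inverse Cn_on_add p q) (use pos in auto)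
  moreover have "p x * inverse (p x + q x) = 0" if "s * x \<le> a" for x using that by (simp add: p_def pos_pow_0)
  moreover have "p x * inverse (p x + q x) = 1" if "s * x \<ge> b" for x
  proof -
    have "q x = 0" using that by (simp add: q_def pos_pow_0)
    then show ?thesis using pos[of x] by simp
  qed
  ultimately show ?thesis by (intro exI[of _ "\<lambda>x. p x * inverse (p x + q x)"]) auto
qed

lemma Cn_cutoff_exists:
  fixes a b c d :: real
  assumes "a < b" "c < d"
  shows "\<exists>f. Cn_on n UNIV f \<and> (\<forall>x. x \<le> a \<or> x \<ge> d \<longrightarrow> f x = 0) \<and> (\<forall>x. b \<le> x \<and> x \<le> c \<longrightarrow> f x = 1)"
proof -
  obtain f where f: "Cn_on n UNIV f" "\<forall>x. x \<le> a \<longrightarrow> f x = 0" "\<forall>x. x \<ge> b \<longrightarrow> f x = 1"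
    using Cn_step_exists[OF assms(1), of 1 n] by auto
  obtain g where g: "Cn_on n UNIV g" "\<forall>x. - x \<le> - d \<longrightarrow> g x = 0" "\<forall>x. - x \<ge> - c \<longrightarrow> g x = 1"
    using Cn_step_exists[of "- d" "- c" "-1" n] assms(2) by auto
  have "Cn_on n UNIV (\<lambda>x. f x * g x)" by (intro Cn_on_mult f g) auto
  then show ?thesis using f g by (intro exI[of _ "\<lambda>x. f x * g x"]) auto
qed

lemma derivs_zero_outside:
  fixes u :: "real \<Rightarrow> real"
  assumes "\<And>x. x < a \<or> x > b \<Longrightarrow> u x = 0" "x < a \<or> x > b"
  shows "(deriv ^^ k) u x = 0"
proof -
  have o: "open ({..<a} \<union> {b<..})" by (intro open_Un) auto
  have "(deriv ^^ k) (\<lambda>x. 0) x = (deriv ^^ k) u x"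
    by (rule Cn_on_cong(2)[OF o _ Cn_on_const[OF o, of 0]]) (use assms in auto)
  moreover have "(deriv ^^ k) (\<lambda>x. 0 :: real) = (\<lambda>x. 0)" by (induction k) (auto simp: deriv_const)
  ultimately show ?thesis by simp
qed

section \<open>Convolution with Gaussian kernels\<close>

text \<open>Chebyshev's argument: near \<open>x\<close> the oscillation of \<open>w\<close> is at
  most \<epsilon> / 2 by uniform continuity, and elsewhere it is bounded by a multiple of the
  squared distance, whose mean is the variance. Compact support makes both bounds uniform in
  \<open>x\<close>.\<close>

lemma gauss_approx_identity:
  fixes w :: "real \<Rightarrow> real"
  assumes cont: "continuous_on UNIV w" and supp: "\<And>x. x < a \<or> x > b \<Longrightarrow> w x = 0" and \<epsilon>: "\<epsilon> > 0"
  shows "eventually (\<lambda>\<sigma>. \<forall>x. \<bar>(LINT t|lborel. normal_density x \<sigma> t * w t) - w x\<bar> \<le> \<epsilon>) (at_right 0)"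
proof -
  have "compact (w ` {a..b})" using cont by (intro compact_continuous_image continuous_on_subset[OF cont]) auto
  then obtain M where M: "M > 0" "\<And>x. x \<in> {a..b} \<Longrightarrow> \<bar>w x\<bar> \<le> M"
    using compact_imp_bounded bounded_pos[of "w ` {a..b}"] by auto
  have wM: "\<bar>w x\<bar> \<le> M" for x using M supp[of x] by (cases "x \<in> {a..b}") auto
  have "uniformly_continuous_on {a-1..b+1} w" by (intro compact_uniformly_continuous continuous_on_subset[OF cont]) auto
  then obtain \<delta> where \<delta>: "\<delta> > 0" "\<And>x y. x \<in> {a-1..b+1} \<Longrightarrow> y \<in> {a-1..b+1} \<Longrightarrow> dist y x < \<delta> \<Longrightarrow> dist (w y) (w x) < \<epsilon> / 2"
    unfolding uniformly_continuous_on_def using \<epsilon> half_gt_zero by metis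
  define \<eta> where "\<eta> = min \<delta> 1"
  have \<eta>: "\<eta> > 0" "\<eta> \<le> \<delta>" "\<eta> \<le> 1" using \<delta> by (auto simp: \<eta>_def)
  have osc: "\<bar>w t - w x\<bar> \<le> \<epsilon> / 2" if "\<bar>t - x\<bar> < \<eta>" for t x
  proof (cases "x \<in> {a-1..b+1} \<and> t \<in> {a-1..b+1}")
    case True then show ?thesis using \<delta>(2)[of x t] that \<eta> by (auto simp: dist_real_def)
  next
    case False
    then have "w x = 0" "w t = 0" using that \<eta> by (auto intro!: supp)
    then show ?thesis using \<epsilon> by simp
  qed
  have pw: "\<bar>w t - w x\<bar> \<le> \<epsilon> / 2 + 2 * M / \<eta>\<^sup>2 * (t - x)\<^sup>2" for t x
  proof (cases "\<bar>t - x\<bar> < \<eta>")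
    case True
    have "0 \<le> 2 * M / \<eta>\<^sup>2 * (t - x)\<^sup>2" using M by auto
    then show ?thesis using osc[OF True] by linarith
  next
    case False
    then have "\<eta>\<^sup>2 \<le> (t - x)\<^sup>2" using \<eta> by (metis abs_le_square_iff abs_of_pos not_less)
    then have "1 \<le> (t - x)\<^sup>2 / \<eta>\<^sup>2" using \<eta> by simp
    then have "2 * M * 1 \<le> 2 * M * ((t - x)\<^sup>2 / \<eta>\<^sup>2)" using M by (intro mult_left_mono) auto
    then show ?thesis using wM[of t] wM[of x] \<epsilon> by simp
  qed
  have meas: "w \<in> borel_measurable borel" by (rule borel_measurable_continuous_onI[OF cont])
  have main: "\<bar>(LINT t|lborel. normal_density x \<sigma> t * w t) - w x\<bar> \<le> \<epsilon> / 2 + 2 * M / \<eta>\<^sup>2 * \<sigma>\<^sup>2" if \<sigma>: "\<sigma> > 0" for x \<sigma>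
  proof -
    have i0: "integrable lborel (normal_density x \<sigma>)" using \<sigma> by (rule integrable_normal_density)
    have i1: "integrable lborel (\<lambda>t. normal_density x \<sigma> t * w t)"
      by (rule Bochner_Integration.integrable_bound[of _ "\<lambda>t. normal_density x \<sigma> t * M"])
        (use i0 meas wM M \<sigma> in \<open>auto simp: abs_mult intro!: AE_I2 mult_left_mono\<close>)
    have i2: "integrable lborel (\<lambda>t. normal_density x \<sigma> t * (t - x)\<^sup>2)"
      using integrable_normal_moment[OF \<sigma>, of x 2] .
    have m2: "(LINT t|lborel. normal_density x \<sigma> t * (t - x)\<^sup>2) = \<sigma>\<^sup>2"
      using integral_normal_moment_even[OF \<sigma>, of x 1] \<sigma> by (simp add: fact_numeral)
    have "(LINT t|lborel. normal_density x \<sigma> t * w t) - w x = (LINT t|lborel. normal_density x \<sigma> t * w t) - (LINT t|lborel. normal_density x \<sigma> t * w x)"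
      using integral_normal_density[OF \<sigma>, of x] by simp
    also have "\<dots> = (LINT t|lborel. normal_density x \<sigma> t * w t - normal_density x \<sigma> t * w x)"
      by (rule Bochner_Integration.integral_diff[symmetric, OF i1]) (use i0 in auto)
    also have "\<bar>\<dots>\<bar> \<le> (LINT t|lborel. \<bar>normal_density x \<sigma> t * w t - normal_density x \<sigma> t * w x\<bar>)"
      by (rule integral_abs_bound)
    also have "\<dots> \<le> (LINT t|lborel. normal_density x \<sigma> t * (\<epsilon> / 2) + (normal_density x \<sigma> t * (t - x)\<^sup>2) * (2 * M / \<eta>\<^sup>2))"
    proof (rule integral_mono)
      show "integrable lborel (\<lambda>t. \<bar>normal_density x \<sigma> t * w t - normal_density x \<sigma> t * w x\<bar>)"
        by (intro integrable_abs Bochner_Integration.integrable_diff i1 integrable_mult_left i0)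
      show "integrable lborel (\<lambda>t. normal_density x \<sigma> t * (\<epsilon> / 2) + (normal_density x \<sigma> t * (t - x)\<^sup>2) * (2 * M / \<eta>\<^sup>2))"
        by (intro Bochner_Integration.integrable_add integrable_mult_left i0 i2)
      fix t
      have "\<bar>normal_density x \<sigma> t * w t - normal_density x \<sigma> t * w x\<bar> = normal_density x \<sigma> t * \<bar>w t - w x\<bar>"
        using normal_density_nonneg[of x \<sigma> t] by (simp add: abs_mult right_diff_distrib[symmetric])
      also have "\<dots> \<le> normal_density x \<sigma> t * (\<epsilon> / 2 + 2 * M / \<eta>\<^sup>2 * (t - x)\<^sup>2)"
        by (intro mult_left_mono pw normal_density_nonneg)
      finally show "\<bar>normal_density x \<sigma> t * w t - normal_density x \<sigma> t * w x\<bar> \<le> normal_density x \<sigma> t * (\<epsilon> / 2) + (normal_density x \<sigma> t * (t - x)\<^sup>2) * (2 * M / \<eta>\<^sup>2)"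
        by (simp add: algebra_simps)
    qed
    also have "\<dots> = (LINT t|lborel. normal_density x \<sigma> t * (\<epsilon> / 2)) + (LINT t|lborel. (normal_density x \<sigma> t * (t - x)\<^sup>2) * (2 * M / \<eta>\<^sup>2))"
      by (intro Bochner_Integration.integral_add integrable_mult_left i0 i2)
    also have "\<dots> = \<epsilon> / 2 + 2 * M / \<eta>\<^sup>2 * \<sigma>\<^sup>2"
      using m2 integral_normal_density[OF \<sigma>, of x] by (simp add: mult.commute)
    finally show ?thesis .
  qed
  have "((\<lambda>\<sigma>. 2 * M / \<eta>\<^sup>2 * \<sigma>\<^sup>2) \<longlongrightarrow> 2 * M / \<eta>\<^sup>2 * 0\<^sup>2) (at_right (0::real))" by (intro tendsto_intros)
  then have "eventually (\<lambda>\<sigma>. 2 * M / \<eta>\<^sup>2 * \<sigma>\<^sup>2 < \<epsilon> / 2) (at_right (0::real))"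
    using \<epsilon> by (intro order_tendstoD(2)) auto
  moreover have "eventually (\<lambda>\<sigma>. \<sigma> > 0) (at_right (0::real))" by (rule eventually_at_right_less)
  ultimately show ?thesis
  proof eventually_elim
    case (elim \<sigma>)
    show ?case
    proof
      fix x
      show "\<bar>(LINT t|lborel. normal_density x \<sigma> t * w t) - w x\<bar> \<le> \<epsilon>"
        using main[OF elim(2), of x] elim(1) by linarith
    qed
  qed
qed

text \<open>The normal density of mean 0 continued to complex arguments; evaluated at
  \<open>z - of_real t\<close> it makes the convolution entire in \<open>z\<close>.\<close>

definition gauss_kernel :: "real \<Rightarrow> complex \<Rightarrow> complex" where
  "gauss_kernel \<sigma> z = of_real (1 / sqrt (2 * pi * \<sigma>\<^sup>2)) * exp (- z\<^sup>2 / of_real (2 * \<sigma>\<^sup>2))"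

lemma gauss_kernel_of_real: "gauss_kernel \<sigma> (of_real x - of_real t) = of_real (normal_density x \<sigma> t)"
proof -
  have "- (complex_of_real x - of_real t)\<^sup>2 / of_real (2 * \<sigma>\<^sup>2) = of_real (- (t - x)\<^sup>2 / (2 * \<sigma>\<^sup>2))"
    by (simp add: power2_commute[of "complex_of_real x" "complex_of_real t"])
  then show ?thesis unfolding gauss_kernel_def normal_density_def by (simp only: of_real_mult exp_of_real)
qed

definition gauss_conv :: "real \<Rightarrow> real \<Rightarrow> real \<Rightarrow> (real \<Rightarrow> real) \<Rightarrow> complex \<Rightarrow> complex" where
  "gauss_conv a b \<sigma> u z = integral {a..b} (\<lambda>t. gauss_kernel \<sigma> (z - of_real t) * of_real (u t))"

definition real_gauss_conv :: "real \<Rightarrow> real \<Rightarrow> real \<Rightarrow> (real \<Rightarrow> real) \<Rightarrow> real \<Rightarrow> real" where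
  "real_gauss_conv a b \<sigma> u x = integral {a..b} (\<lambda>t. normal_density x \<sigma> t * u t)"

lemma gauss_kernel_has_derivative: "\<sigma> \<noteq> 0 \<Longrightarrow> (gauss_kernel \<sigma> has_field_derivative gauss_kernel \<sigma> z * (- z / of_real (\<sigma>\<^sup>2))) (at z within S)"
  unfolding gauss_kernel_def by (auto intro!: derivative_eq_intros simp: field_simps)

lemma continuous_on_gauss_kernel: "continuous_on A f \<Longrightarrow> continuous_on A (\<lambda>x. gauss_kernel \<sigma> (f x))"
  unfolding gauss_kernel_def divide_inverse by (intro continuous_intros)

lemma gauss_conv_holomorphic:
  assumes "continuous_on {a..b} u" and \<sigma>: "\<sigma> \<noteq> 0"
  shows "gauss_conv a b \<sigma> u holomorphic_on UNIV"
  unfolding gauss_conv_def interval_cbox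
proof (rule leibniz_rule_holomorphic[where fx = "\<lambda>z t. gauss_kernel \<sigma> (z - of_real t) * (- (z - of_real t) / of_real (\<sigma>\<^sup>2)) * of_real (u t)"])
  fix z :: complex and t :: real
  have "((\<lambda>z. gauss_kernel \<sigma> (z - of_real t)) has_field_derivative gauss_kernel \<sigma> (z - of_real t) * (- (z - of_real t) / of_real (\<sigma>\<^sup>2)) * 1) (at z)"
    by (rule DERIV_chain2[OF gauss_kernel_has_derivative[OF \<sigma>]]) (auto intro!: derivative_eq_intros)
  then show "((\<lambda>z. gauss_kernel \<sigma> (z - of_real t) * of_real (u t)) has_field_derivative gauss_kernel \<sigma> (z - of_real t) * (- (z - of_real t) / of_real (\<sigma>\<^sup>2)) * of_real (u t)) (at z within UNIV)"
    by (intro DERIV_cmult_right) simp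
next
  fix z :: complex
  show "(\<lambda>t. gauss_kernel \<sigma> (z - of_real t) * of_real (u t)) integrable_on cbox a b"
    using assms by (intro integrable_continuous continuous_intros continuous_on_gauss_kernel) auto
next
  have "continuous_on (UNIV \<times> cbox a b) (\<lambda>x. u (snd x))"
    by (rule continuous_on_compose2[OF assms(1)]) (auto intro!: continuous_intros)
  then show "continuous_on (UNIV \<times> cbox a b) (\<lambda>(z, t). gauss_kernel \<sigma> (z - of_real t) * (- (z - of_real t) / of_real (\<sigma>\<^sup>2)) * of_real (u t))"
    unfolding split_beta divide_inverse by (intro continuous_intros continuous_on_gauss_kernel)
qed auto

lemma continuous_on_normal_density:
  "continuous_on A f \<Longrightarrow> continuous_on A g \<Longrightarrow> continuous_on A (\<lambda>x. normal_density (f x) \<sigma> (g x))"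
  unfolding normal_density_def divide_inverse by (intro continuous_intros)

lemma gauss_conv_of_real:
  assumes "continuous_on {a..b} u"
  shows "gauss_conv a b \<sigma> u (of_real x) = of_real (real_gauss_conv a b \<sigma> u x)"
proof -
  have "(\<lambda>t. normal_density x \<sigma> t * u t) integrable_on {a..b}"
    by (intro integrable_continuous_real continuous_intros continuous_on_normal_density assms)
  then have "((\<lambda>t. normal_density x \<sigma> t * u t) has_integral real_gauss_conv a b \<sigma> u x) {a..b}"
    unfolding real_gauss_conv_def by (rule integrable_integral)
  from has_integral_linear[OF this bounded_linear_of_real[where 'a = complex]]
  have "((\<lambda>t. gauss_kernel \<sigma> (of_real x - of_real t) * of_real (u t)) has_integral of_real (real_gauss_conv a b \<sigma> u x)) {a..b}"
    by (simp add: o_def gauss_kernel_of_real)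
  then show ?thesis unfolding gauss_conv_def by (rule integral_unique)
qed

text \<open>At horizontal distance at least 1 from the interval and height at most 1/4 one has Re (z
  - t)^2 \<ge> 1 - 1/16 \<ge> 1/2, so the kernel is at most a multiple of exp (- 1 / (4 \<sigma>^2))
  / \<sigma>.\<close>

lemma gauss_conv_small:
  assumes u: "continuous_on {a..b} u" and ab: "a \<le> b" and \<epsilon>: "\<epsilon> > 0"
  shows "eventually (\<lambda>\<sigma>. \<forall>z. Re z \<le> a - 1 \<and> \<bar>Im z\<bar> \<le> 1 / 4 \<longrightarrow> cmod (gauss_conv a b \<sigma> u z) \<le> \<epsilon>) (at_right 0)"
proof -
  have "compact (u ` {a..b})" using u by (intro compact_continuous_image) auto
  then obtain M where M: "M > 0" "\<And>x. x \<in> {a..b} \<Longrightarrow> \<bar>u x\<bar> \<le> M"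
    using compact_imp_bounded bounded_pos[of "u ` {a..b}"] by auto
  have main: "cmod (gauss_conv a b \<sigma> u z) \<le> M * (b - a) * (1 / (sqrt (2 * pi) * \<sigma>) * exp (- (1 / (4 * \<sigma>\<^sup>2))))"
    if \<sigma>: "\<sigma> > 0" and z: "Re z \<le> a - 1" "\<bar>Im z\<bar> \<le> 1 / 4" for z \<sigma>
  proof -
    have "cmod (gauss_kernel \<sigma> (z - of_real t) * of_real (u t)) \<le> 1 / (sqrt (2 * pi) * \<sigma>) * exp (- (1 / (4 * \<sigma>\<^sup>2))) * M"
      if t: "t \<in> {a..b}" for t
    proof -
      have "1 \<le> \<bar>Re z - t\<bar>" using z t by auto
      then have "1\<^sup>2 \<le> \<bar>Re z - t\<bar>\<^sup>2" by (intro power_mono) auto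
      moreover have "\<bar>Im z\<bar>\<^sup>2 \<le> (1/4)\<^sup>2" using z by (intro power_mono) auto
      ultimately have re: "Re ((z - of_real t)\<^sup>2) \<ge> 1 / 2" by (simp add: power2_eq_square)
      have "Re (- (z - of_real t)\<^sup>2 / of_real (2 * \<sigma>\<^sup>2)) = - Re ((z - of_real t)\<^sup>2) / (2 * \<sigma>\<^sup>2)"
        by (simp only: Re_divide_of_real uminus_complex.sel)
      also have "\<dots> \<le> - (1 / 2) / (2 * \<sigma>\<^sup>2)" using re \<sigma> by (intro divide_right_mono) auto
      finally have "cmod (exp (- (z - of_real t)\<^sup>2 / of_real (2 * \<sigma>\<^sup>2))) \<le> exp (- (1 / (4 * \<sigma>\<^sup>2)))"
        unfolding norm_exp_eq_Re by simp
      moreover have "cmod (of_real (1 / sqrt (2 * pi * \<sigma>\<^sup>2))) = 1 / (sqrt (2 * pi) * \<sigma>)"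
        unfolding norm_of_real using \<sigma> by (simp add: real_sqrt_mult)
      ultimately have "cmod (gauss_kernel \<sigma> (z - of_real t)) \<le> 1 / (sqrt (2 * pi) * \<sigma>) * exp (- (1 / (4 * \<sigma>\<^sup>2)))"
        unfolding gauss_kernel_def norm_mult using \<sigma> by (simp add: mult_left_mono divide_right_mono)
      then show ?thesis unfolding norm_mult using M t \<sigma> by (intro mult_mono) auto
    qed
    then have "norm (integral {a..b} (\<lambda>t. gauss_kernel \<sigma> (z - of_real t) * of_real (u t))) \<le> 1 / (sqrt (2 * pi) * \<sigma>) * exp (- (1 / (4 * \<sigma>\<^sup>2))) * M * (b - a)"
      by (intro integral_bound[OF ab]) (use u in \<open>auto intro!: continuous_intros continuous_on_gauss_kernel\<close>)
    then show ?thesis unfolding gauss_conv_def by (simp add: mult_ac)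
  qed
  have "((\<lambda>\<sigma>. 1 / (sqrt (2 * pi) * \<sigma>) * exp (- (1 / (4 * \<sigma>\<^sup>2)))) \<longlongrightarrow> 0) (at_right (0::real))"
    by real_asymp
  then have "((\<lambda>\<sigma>. M * (b - a) * (1 / (sqrt (2 * pi) * \<sigma>) * exp (- (1 / (4 * \<sigma>\<^sup>2))))) \<longlongrightarrow> 0) (at_right (0::real))"
    by (rule tendsto_mult_right_zero)
  then have "eventually (\<lambda>\<sigma>. M * (b - a) * (1 / (sqrt (2 * pi) * \<sigma>) * exp (- (1 / (4 * \<sigma>\<^sup>2)))) < \<epsilon>) (at_right (0::real))"
    using \<epsilon> by (rule order_tendstoD(2))
  moreover have "eventually (\<lambda>\<sigma>. \<sigma> > 0) (at_right (0::real))" by (rule eventually_at_right_less)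
  ultimately show ?thesis
  proof eventually_elim
    case (elim \<sigma>)
    show ?case
    proof (intro allI impI)
      fix z assume "Re z \<le> a - 1 \<and> \<bar>Im z\<bar> \<le> 1 / 4"
      then show "cmod (gauss_conv a b \<sigma> u z) \<le> \<epsilon>" using main[OF elim(2), of z] elim(1) by linarith
    qed
  qed
qed

text \<open>Links the Henstock-Kurzweil integral, in which differentiation with respect to the
  parameter is done, with the Lebesgue integral, in which the moments of the normal density are
  available.\<close>

lemma real_gauss_conv_eq_LINT:
  assumes cont: "continuous_on UNIV w" and supp: "\<And>x. x < a \<or> x > b \<Longrightarrow> w x = 0"
  shows "real_gauss_conv a b \<sigma> w x = (LINT t|lborel. normal_density x \<sigma> t * w t)"
proof -
  have c: "continuous_on {a..b} (\<lambda>t. normal_density x \<sigma> t * w t)"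
    by (intro continuous_intros continuous_on_normal_density continuous_on_subset[OF cont]) auto
  have si: "set_integrable lborel {a..b} (\<lambda>t. normal_density x \<sigma> t * w t)"
    by (rule borel_integrable_compact[OF _ c, folded set_integrable_def, simplified])
  have "(LINT t|lborel. normal_density x \<sigma> t * w t) = (LINT t:{a..b}|lborel. normal_density x \<sigma> t * w t)"
    unfolding set_lebesgue_integral_def
  proof (rule Bochner_Integration.integral_cong)
    show "normal_density x \<sigma> t * w t = indicat_real {a..b} t *\<^sub>R (normal_density x \<sigma> t * w t)" for t
      using supp[of t] by (cases "t \<in> {a..b}") auto
  qed simp
  also have "\<dots> = integral {a..b} (\<lambda>t. normal_density x \<sigma> t * w t)"
    by (rule set_borel_integral_eq_integral(2)[OF si])
  finally show ?thesis unfolding real_gauss_conv_def by simp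
qed

lemma normal_density_has_derivative:
  assumes "\<sigma> \<noteq> 0"
  shows "((\<lambda>x. normal_density x \<sigma> t) has_real_derivative normal_density x \<sigma> t * ((t - x) / \<sigma>\<^sup>2)) (at x within S)"
  "((\<lambda>t. normal_density x \<sigma> t) has_real_derivative - normal_density x \<sigma> t * ((t - x) / \<sigma>\<^sup>2)) (at t within S)"
proof -
  have "((\<lambda>x. c * exp (- (t - x)\<^sup>2 / (2 * \<sigma>\<^sup>2))) has_real_derivative c * exp (- (t - x)\<^sup>2 / (2 * \<sigma>\<^sup>2)) * ((t - x) / \<sigma>\<^sup>2)) (at x within S)"
    "((\<lambda>t. c * exp (- (t - x)\<^sup>2 / (2 * \<sigma>\<^sup>2))) has_real_derivative - (c * exp (- (t - x)\<^sup>2 / (2 * \<sigma>\<^sup>2))) * ((t - x) / \<sigma>\<^sup>2)) (at t within S)" for c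
    using assms by (auto intro!: derivative_eq_intros simp: field_simps)
  then show "((\<lambda>x. normal_density x \<sigma> t) has_real_derivative normal_density x \<sigma> t * ((t - x) / \<sigma>\<^sup>2)) (at x within S)"
    "((\<lambda>t. normal_density x \<sigma> t) has_real_derivative - normal_density x \<sigma> t * ((t - x) / \<sigma>\<^sup>2)) (at t within S)"
    unfolding normal_density_def by blast+
qed

text \<open>Differentiation under the integral sign hits the kernel; integration by parts moves the
  derivative onto \<open>u\<close>, and the boundary terms vanish by \<open>u a = 0\<close> and
  \<open>u b = 0\<close>.\<close>

lemma real_gauss_conv_has_derivative:
  assumes ab: "a \<le> b" and u: "\<And>t. (u has_real_derivative u' t) (at t)" and u': "continuous_on UNIV u'"
    and z: "u a = 0" "u b = 0" and \<sigma>: "\<sigma> \<noteq> 0"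
  shows "(real_gauss_conv a b \<sigma> u has_real_derivative real_gauss_conv a b \<sigma> u' x) (at x)"
proof -
  have cu: "continuous_on A u" for A by (intro continuous_at_imp_continuous_on ballI DERIV_isCont[OF u])
  have cu': "continuous_on A u'" for A by (rule continuous_on_subset[OF u']) auto
  define D where "D x t = normal_density x \<sigma> t * ((t - x) / \<sigma>\<^sup>2) * u t" for x t
  have "((\<lambda>x. integral (cbox a b) (\<lambda>t. normal_density x \<sigma> t * u t)) has_real_derivative integral (cbox a b) (D x)) (at x within UNIV)"
  proof (rule leibniz_rule_field_derivative)
    fix x t
    show "((\<lambda>x. normal_density x \<sigma> t * u t) has_real_derivative D x t) (at x within UNIV)"
      unfolding D_def by (intro DERIV_cmult_right normal_density_has_derivative \<sigma>)
    show "(\<lambda>t. normal_density x \<sigma> t * u t) integrable_on cbox a b"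
      by (intro integrable_continuous continuous_intros continuous_on_normal_density cu)
    have "continuous_on (UNIV \<times> cbox a b) (\<lambda>x. u (snd x))"
      by (rule continuous_on_compose2[OF cu[of UNIV]]) (auto intro!: continuous_intros)
    then show "continuous_on (UNIV \<times> cbox a b) (\<lambda>(x, t). D x t)"
      unfolding D_def split_beta divide_inverse by (intro continuous_intros continuous_on_normal_density)
  qed auto
  then have 1: "(real_gauss_conv a b \<sigma> u has_real_derivative integral {a..b} (D x)) (at x)"
    unfolding real_gauss_conv_def by simp
  have "((\<lambda>t. normal_density x \<sigma> t * u' t - D x t) has_integral (normal_density x \<sigma> b * u b - normal_density x \<sigma> a * u a)) {a..b}"
  proof (rule fundamental_theorem_of_calculus[OF ab])
    fix t assume "t \<in> {a..b}"
    have "((\<lambda>t. normal_density x \<sigma> t * u t) has_real_derivative (- normal_density x \<sigma> t * ((t - x) / \<sigma>\<^sup>2)) * u t + u' t * normal_density x \<sigma> t) (at t within {a..b})"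
      by (intro DERIV_mult normal_density_has_derivative \<sigma> has_field_derivative_at_within[OF u])
    then show "((\<lambda>t. normal_density x \<sigma> t * u t) has_vector_derivative normal_density x \<sigma> t * u' t - D x t) (at t within {a..b})"
      unfolding D_def has_real_derivative_iff_has_vector_derivative[symmetric]
      by (simp add: algebra_simps diff_divide_distrib add_divide_distrib)
  qed
  then have "integral {a..b} (\<lambda>t. normal_density x \<sigma> t * u' t - D x t) = 0" using z by (simp add: integral_unique)
  moreover have "integral {a..b} (\<lambda>t. normal_density x \<sigma> t * u' t - D x t) = real_gauss_conv a b \<sigma> u' x - integral {a..b} (D x)"
    unfolding real_gauss_conv_def D_def divide_inverse
    by (rule integral_diff) (intro integrable_continuous_real continuous_intros continuous_on_normal_density cu cu')+
  ultimately show ?thesis using 1 by simp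
qed

text \<open>One width \<sigma> serves all orders up to \<open>n\<close>, because derivatives of the
  convolution are convolutions of derivatives, and it also makes the entire function small on the
  strip to the left of the support.\<close>

lemma gauss_piece:
  assumes u: "Cn_on n UNIV u" and supp: "\<And>x. x < a \<or> x > b \<Longrightarrow> u x = 0" and ab: "a \<le> b" and \<epsilon>: "\<epsilon> > 0"
  shows "\<exists>v vr. v holomorphic_on UNIV \<and> (\<forall>x. v (of_real x) = of_real (vr x)) \<and>
    (\<forall>j\<le>n. \<forall>x. \<bar>(deriv ^^ j) vr x - (deriv ^^ j) u x\<bar> \<le> \<epsilon>) \<and>
    (\<forall>z. Re z \<le> a - 2 \<and> \<bar>Im z\<bar> \<le> 1 / 4 \<longrightarrow> cmod (v z) \<le> \<epsilon>)"
proof -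
  \<comment> \<open>The derivatives are known to vanish strictly outside \<open>{a..b}\<close>, so
    the interval is widened by 1 to have them vanish at its ends. The strip bound then starts at
    \<open>A - 1\<close>, which is a - 2.\<close>
  define A B where "A = a - 1" and "B = b + 1"
  have c: "continuous_on UNIV ((deriv ^^ j) u)" if "j \<le> n" for j
    using Cn_on_le[OF that u] unfolding Cn_on_def by simp
  have z: "(deriv ^^ j) u x = 0" if "x < a \<or> x > b" for j x
    by (rule derivs_zero_outside[of a b]) (use supp that in auto)
  have "eventually (\<lambda>\<sigma>. \<forall>j\<in>{..n}. \<forall>x. \<bar>(LINT t|lborel. normal_density x \<sigma> t * (deriv ^^ j) u t) - (deriv ^^ j) u x\<bar> \<le> \<epsilon>) (at_right 0)"
    by (intro eventually_ball_finite ballI gauss_approx_identity[of _ a b]) (use c z \<epsilon> in auto)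
  moreover have "eventually (\<lambda>\<sigma>. \<forall>z. Re z \<le> A - 1 \<and> \<bar>Im z\<bar> \<le> 1 / 4 \<longrightarrow> cmod (gauss_conv A B \<sigma> u z) \<le> \<epsilon>) (at_right 0)"
    by (rule gauss_conv_small) (use c[of 0] ab \<epsilon> in \<open>auto simp: A_def B_def intro: continuous_on_subset\<close>)
  moreover have "eventually (\<lambda>\<sigma>. \<sigma> > 0) (at_right (0::real))" by (rule eventually_at_right_less)
  ultimately have "eventually (\<lambda>\<sigma>. (\<forall>j\<in>{..n}. \<forall>x. \<bar>(LINT t|lborel. normal_density x \<sigma> t * (deriv ^^ j) u t) - (deriv ^^ j) u x\<bar> \<le> \<epsilon>) \<and>
     (\<forall>z. Re z \<le> A - 1 \<and> \<bar>Im z\<bar> \<le> 1 / 4 \<longrightarrow> cmod (gauss_conv A B \<sigma> u z) \<le> \<epsilon>) \<and> \<sigma> > 0) (at_right 0)"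
    by eventually_elim simp
  from eventually_happens'[OF trivial_limit_at_right_real this] obtain \<sigma> where \<sigma>': "(\<forall>j\<in>{..n}. \<forall>x. \<bar>(LINT t|lborel. normal_density x \<sigma> t * (deriv ^^ j) u t) - (deriv ^^ j) u x\<bar> \<le> \<epsilon>) \<and>
     (\<forall>z. Re z \<le> A - 1 \<and> \<bar>Im z\<bar> \<le> 1 / 4 \<longrightarrow> cmod (gauss_conv A B \<sigma> u z) \<le> \<epsilon>) \<and> \<sigma> > 0" by (rule exE)
  have 1: "\<bar>(LINT t|lborel. normal_density x \<sigma> t * (deriv ^^ j) u t) - (deriv ^^ j) u x\<bar> \<le> \<epsilon>" if "j \<le> n" for j x
    using \<sigma>' that by simp
  have 2: "cmod (gauss_conv A B \<sigma> u z) \<le> \<epsilon>" if "Re z \<le> A - 1 \<and> \<bar>Im z\<bar> \<le> 1 / 4" for z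
    using \<sigma>' that by simp
  have \<sigma>: "\<sigma> > 0" using \<sigma>' by simp
  have cu: "continuous_on {A..B} u" using c[of 0] by (auto intro: continuous_on_subset)
  have d: "(deriv ^^ j) (real_gauss_conv A B \<sigma> u) = real_gauss_conv A B \<sigma> ((deriv ^^ j) u)" if "j \<le> n" for j
    using that
  proof (induction j)
    case (Suc j)
    have "(real_gauss_conv A B \<sigma> ((deriv ^^ j) u) has_real_derivative real_gauss_conv A B \<sigma> ((deriv ^^ Suc j) u) x) (at x)" for x
    proof (rule real_gauss_conv_has_derivative)
      show "((deriv ^^ j) u has_real_derivative (deriv ^^ Suc j) u t) (at t)" for t
        using u Suc.prems unfolding Cn_on_def by auto
      show "A \<le> B" "(deriv ^^ j) u A = 0" "(deriv ^^ j) u B = 0" "\<sigma> \<noteq> 0" using ab \<sigma> by (auto simp: A_def B_def intro!: z)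
      show "continuous_on UNIV ((deriv ^^ Suc j) u)" by (rule c[OF Suc.prems])
    qed
    then have "deriv (real_gauss_conv A B \<sigma> ((deriv ^^ j) u)) = real_gauss_conv A B \<sigma> ((deriv ^^ Suc j) u)"
      by (intro ext DERIV_imp_deriv)
    then show ?case using Suc by simp
  qed simp
  show ?thesis
  proof (intro exI conjI allI impI)
    show "gauss_conv A B \<sigma> u holomorphic_on UNIV" by (rule gauss_conv_holomorphic[OF cu]) (use \<sigma> in simp)
    show "gauss_conv A B \<sigma> u (of_real x) = of_real (real_gauss_conv A B \<sigma> u x)" for x by (rule gauss_conv_of_real[OF cu])
    fix j x assume j: "j \<le> n"
    have "real_gauss_conv A B \<sigma> ((deriv ^^ j) u) x = (LINT t|lborel. normal_density x \<sigma> t * (deriv ^^ j) u t)"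
      by (rule real_gauss_conv_eq_LINT[OF c[OF j]]) (auto simp: A_def B_def intro!: z)
    then show "\<bar>(deriv ^^ j) (real_gauss_conv A B \<sigma> u) x - (deriv ^^ j) u x\<bar> \<le> \<epsilon>"
      using 1[OF j, of x] d[OF j] by simp
  next
    fix z assume "Re z \<le> a - 2 \<and> \<bar>Im z\<bar> \<le> 1 / 4"
    then show "cmod (gauss_conv A B \<sigma> u z) \<le> \<epsilon>" by (intro 2) (auto simp: A_def)
  qed
qed

lemma entire_real_holo:
  assumes "v holomorphic_on UNIV" "\<And>x. v (of_real x) = of_real (vr x)"
  shows "real_holo vr v x 1"
  using assms unfolding real_holo_def by (auto intro: holomorphic_on_subset)

lemma entire_real_analytic:
  assumes "v holomorphic_on UNIV" "\<And>x. v (of_real x) = of_real (vr x)"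
  shows "real_analytic_on S vr"
  unfolding real_analytic_on_iff using entire_real_holo[OF assms] by blast

text \<open>A germ that is C^n for every n need not be C^\<infinity> on any half-line, because the
  half-lines may recede as n grows. The points \<open>p n\<close> record from where on n derivatives
  are at hand; summing the \<bar>a i\<bar> makes them increase.\<close>

lemma germ_C_lt_inf_breakpoints:
  assumes "y \<in> germ_C_lt_inf"
  obtains p :: "nat \<Rightarrow> real" where "\<And>n. p n \<ge> n" "\<And>n. p (Suc n) \<ge> p n + 1" "\<And>n. Cn_on n {p n - 1<..} y"
proof -
  have "\<forall>n. \<exists>a. Cn_on n {a<..} y" using assms unfolding germ_C_lt_inf_def germ_Cn_def by blast
  then obtain a where a: "\<And>n. Cn_on n {a n<..} y" by metis
  define p where "p n = real n + 1 + (\<Sum>i\<le>n. \<bar>a i\<bar>)" for n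
  have "a n \<le> p n - 1" for n
  proof -
    have "\<bar>a n\<bar> \<le> (\<Sum>i\<le>n. \<bar>a i\<bar>)" by (rule member_le_sum) auto
    then show ?thesis by (simp add: p_def)
  qed
  then have "Cn_on n {p n - 1<..} y" for n by (intro Cn_on_subset[OF a]) auto
  moreover have "p n \<ge> n" for n unfolding p_def by (simp add: sum_nonneg add_nonneg_nonneg)
  moreover have "p (Suc n) \<ge> p n + 1" for n by (simp add: p_def)
  ultimately show ?thesis using that by blast
qed

lemma Cn_on_bounded_derivs:
  assumes "Cn_on n UNIV f"
  shows "\<exists>C\<ge>1. \<forall>j\<le>n. \<forall>x\<in>{a..b}. \<bar>(deriv ^^ j) f x\<bar> \<le> C"
proof -
  have "\<forall>j\<in>{..n}. \<exists>C. \<forall>x\<in>{a..b}. \<bar>(deriv ^^ j) f x\<bar> \<le> C"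
  proof
    fix j assume "j \<in> {..n}"
    then have "Cn_on j UNIV f" using Cn_on_le[OF _ assms] by simp
    then have "continuous_on {a..b} ((deriv ^^ j) f)" unfolding Cn_on_def by (auto intro: continuous_on_subset)
    then have "bounded ((deriv ^^ j) f ` {a..b})" by (intro compact_imp_bounded compact_continuous_image) auto
    then show "\<exists>C. \<forall>x\<in>{a..b}. \<bar>(deriv ^^ j) f x\<bar> \<le> C" unfolding bounded_iff by auto
  qed
  then obtain C where C: "\<And>j x. j \<le> n \<Longrightarrow> x \<in> {a..b} \<Longrightarrow> \<bar>(deriv ^^ j) f x\<bar> \<le> C j" using bchoice[of "{..n}"] by (metis atMost_iff)
  have "\<bar>(deriv ^^ j) f x\<bar> \<le> 1 + (\<Sum>i\<le>n. \<bar>C i\<bar>)" if "j \<le> n" "x \<in> {a..b}" for j x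
  proof -
    have "\<bar>C j\<bar> \<le> (\<Sum>i\<le>n. \<bar>C i\<bar>)" by (rule member_le_sum) (use that in auto)
    then show ?thesis using C[OF that] by linarith
  qed
  then show ?thesis by (intro exI[of _ "1 + (\<Sum>i\<le>n. \<bar>C i\<bar>)"]) (auto intro: sum_nonneg)
qed

text \<open>From the function, one compactly supported piece after the other is approximated by its convolution with a Gaussian kernel
and subtracted, the next piece being cut out of the remainder. As the kernel is small on a complex strip to the left
of the piece, the sum of the entire functions so obtained converges near the real axis.\<close>

theorem analytic_approximation:
  fixes \<theta> :: "real \<Rightarrow> real"
  assumes y: "y \<in> germ_C_lt_inf" and anti: "\<And>s t. s \<le> t \<Longrightarrow> \<theta> t \<le> \<theta> s" and pos: "\<And>t. \<theta> t > 0"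
  obtains g where "g \<in> germ_C_omega" "\<And>j. eventually (\<lambda>x. \<bar>(deriv ^^ j) g x - (deriv ^^ j) y x\<bar> \<le> \<theta> x) at_top"
proof -
  obtain p where p: "\<And>n. p n \<ge> real n" "\<And>n. p (Suc n) \<ge> p n + 1" "\<And>n. Cn_on n {p n - 1<..} y"
    using germ_C_lt_inf_breakpoints[OF y] by metis
  have pmono: "p m \<le> p n" if "m \<le> n" for m n
    by (rule lift_Suc_mono_le[OF _ that]) (use p(2) in \<open>smt (verit)\<close>)
  \<comment> \<open>Consecutive cutoffs overlap: between p (m + 1) and p (m + 2) the cutoff of index
    m is 1, that of index m + 1 is in transition, and those of index m + 2 or more vanish.\<close>
  have "\<exists>f. Cn_on n UNIV f \<and> (\<forall>x. x \<le> p n \<or> x \<ge> p (n + 3) \<longrightarrow> f x = 0) \<and> (\<forall>x. p (n + 1) - 1/2 \<le> x \<and> x \<le> p (n + 2) + 1/2 \<longrightarrow> f x = 1)" for n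
    by (rule Cn_cutoff_exists) (use p(2)[of n] p(2)[of "n+1"] p(2)[of "n+2"] in \<open>auto simp: numeral_3_eq_3\<close>)
  then obtain \<kappa> where \<kappa>: "\<And>n. Cn_on n UNIV (\<kappa> n)" "\<And>n x. x \<le> p n \<or> x \<ge> p (n + 3) \<Longrightarrow> \<kappa> n x = 0"
     "\<And>n x. p (n + 1) - 1/2 \<le> x \<Longrightarrow> x \<le> p (n + 2) + 1/2 \<Longrightarrow> \<kappa> n x = 1" by metis
  define \<psi> where "\<psi> n x = 1 - \<kappa> n x" for n x
  have \<psi>: "Cn_on n UNIV (\<psi> n)" for n unfolding \<psi>_def by (intro Cn_on_diff Cn_on_const \<kappa>) auto
  have "\<forall>n. \<exists>C\<ge>1. \<forall>j\<le>n. \<forall>x\<in>{p n - 1 .. p (n + 1)}. \<bar>(deriv ^^ j) (\<psi> n) x\<bar> \<le> C"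
    using Cn_on_bounded_derivs[OF \<psi>] by blast
  then obtain C where C: "\<And>n. C n \<ge> 1" "\<And>n j x. j \<le> n \<Longrightarrow> x \<in> {p n - 1 .. p (n + 1)} \<Longrightarrow> \<bar>(deriv ^^ j) (\<psi> n) x\<bar> \<le> C n" by metis
  \<comment> \<open>\<open>C (Suc n)\<close> and a factor 2^n pay for multiplying an error by
    \<open>\<psi> (Suc n)\<close>; the power of 2 also makes the errors of all later pieces
    summable. \<theta> is taken at the far end p (n + 3) of the piece, where it is smallest.\<close>
  define \<epsilon> where "\<epsilon> n = \<theta> (p (n + 3)) / (2 ^ (n + 3) * C (Suc n))" for n
  have \<epsilon>: "\<epsilon> n > 0" for n using pos C(1)[of "Suc n"] by (auto simp: \<epsilon>_def intro!: divide_pos_pos mult_pos_pos)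
  have \<epsilon>1: "\<epsilon> n * (2 ^ n * C (Suc n)) = \<theta> (p (n + 3)) / 8" for n
    using C(1)[of "Suc n"] by (simp add: \<epsilon>_def field_simps power_add)
  have \<epsilon>2: "\<epsilon> n \<le> \<theta> (p (n + 3)) / 2 ^ (n + 3)" for n
    unfolding \<epsilon>_def using C(1)[of "Suc n"] pos[of "p (n + 3)"] by (intro divide_left_mono) auto
  \<comment> \<open>\<open>r\<close> is the remainder before piece \<open>n\<close> is removed,
    \<open>v\<close> the entire function that approximates the piece, and \<open>vr\<close> its
    restriction to the real line.\<close>
  define P where "P n s = (case s of (r, v, vr) \<Rightarrow> (n = 0 \<longrightarrow> r = y) \<and> (\<forall>k. Cn_on k {p k - 1<..} r) \<and> v holomorphic_on UNIV \<and> (\<forall>x. v (complex_of_real x) = of_real (vr x)) \<and>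
    (\<forall>j\<le>n. \<forall>x. \<bar>(deriv ^^ j) vr x - (deriv ^^ j) (\<lambda>x. \<kappa> n x * r x) x\<bar> \<le> \<epsilon> n) \<and>
    (\<forall>z. Re z \<le> p n - 2 \<and> \<bar>Im z\<bar> \<le> 1 / 4 \<longrightarrow> cmod (v z) \<le> \<epsilon> n))" for n and s :: "(real \<Rightarrow> real) \<times> (complex \<Rightarrow> complex) \<times> (real \<Rightarrow> real)"
  \<comment> \<open>The remainder is known to be C^n only beyond p n - 1, but to the left of p n the
    cutoff vanishes; the two open sets overlap and cover the line.\<close>
  have \<kappa>r: "Cn_on n UNIV (\<lambda>x. \<kappa> n x * r x)" if r: "\<And>k. Cn_on k {p k - 1<..} r" for n r
  proof -
    have 1: "Cn_on n {p n - 1<..} (\<lambda>x. \<kappa> n x * r x)"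
      by (intro Cn_on_mult r Cn_on_subset[OF \<kappa>(1)]) auto
    have 2: "Cn_on n {..<p n} (\<lambda>x. \<kappa> n x * r x)"
      by (rule Cn_on_cong(1)[OF _ _ Cn_on_const[of _ n 0]]) (use \<kappa>(2) in auto)
    have "Cn_on n ({p n - 1<..} \<union> {..<p n}) (\<lambda>x. \<kappa> n x * r x)" by (rule Cn_on_Un[OF 1 2]) auto
    moreover have "{p n - 1<..} \<union> {..<p n} = UNIV" by auto
    ultimately show ?thesis by simp
  qed
  have ex: "\<exists>v vr. P n (r, v, vr)" if r: "\<And>k. Cn_on k {p k - 1<..} r" and n0: "n = 0 \<longrightarrow> r = y" for n r
  proof -
    have "p n \<le> p (n + 3)" by (rule pmono) simp
    then have "\<exists>v vr. v holomorphic_on UNIV \<and> (\<forall>x. v (of_real x) = of_real (vr x)) \<and>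
    (\<forall>j\<le>n. \<forall>x. \<bar>(deriv ^^ j) vr x - (deriv ^^ j) (\<lambda>x. \<kappa> n x * r x) x\<bar> \<le> \<epsilon> n) \<and>
    (\<forall>z. Re z \<le> p n - 2 \<and> \<bar>Im z\<bar> \<le> 1 / 4 \<longrightarrow> cmod (v z) \<le> \<epsilon> n)"
      by (intro gauss_piece[where b = "p (n + 3)"] \<kappa>r[OF r] \<epsilon>) (use \<kappa>(2) in auto)
    then obtain v vr where "v holomorphic_on UNIV \<and> (\<forall>x. v (of_real x) = of_real (vr x)) \<and>
    (\<forall>j\<le>n. \<forall>x. \<bar>(deriv ^^ j) vr x - (deriv ^^ j) (\<lambda>x. \<kappa> n x * r x) x\<bar> \<le> \<epsilon> n) \<and>
    (\<forall>z. Re z \<le> p n - 2 \<and> \<bar>Im z\<bar> \<le> 1 / 4 \<longrightarrow> cmod (v z) \<le> \<epsilon> n)" by (elim exE)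
    then have "P n (r, v, vr)" unfolding P_def using r n0 by simp
    then show ?thesis by (intro exI)
  qed
  have "\<exists>f. \<forall>n. P n (f n) \<and> fst (f (Suc n)) = (\<lambda>x. fst (f n) x - snd (snd (f n)) x)"
  proof (rule dependent_nat_choice)
    show "\<exists>s. P 0 s" using ex[of y 0] p(3) by auto
    fix s n assume s: "P n s"
    obtain r v vr where s_eq: "s = (r, v, vr)" by (cases s) auto
    have hol: "v holomorphic_on UNIV" "\<And>x. v (complex_of_real x) = of_real (vr x)" and r: "\<And>k. Cn_on k {p k - 1<..} r"
      using s unfolding P_def s_eq by auto
    have "Cn_on k {p k - 1<..} (\<lambda>x. r x - vr x)" for k
      by (intro Cn_on_diff r Cn_on_real_analytic entire_real_analytic[OF hol]) auto
    then obtain v' vr' where "P (Suc n) (\<lambda>x. r x - vr x, v', vr')" using ex[of "\<lambda>x. r x - vr x" "Suc n"] by auto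
    then show "\<exists>t. P (Suc n) t \<and> fst t = (\<lambda>x. fst s x - snd (snd s) x)"
      by (intro exI[of _ "(\<lambda>x. r x - vr x, v', vr')"]) (simp add: s_eq)
  qed
  then obtain f where f: "\<And>n. P n (f n)" "\<And>n. fst (f (Suc n)) = (\<lambda>x. fst (f n) x - snd (snd (f n)) x)" by blast
  define r where "r n = fst (f n)" for n
  define v where "v n = fst (snd (f n))" for n
  define vr where "vr n = snd (snd (f n))" for n
  have Pn: "P n (r n, v n, vr n)" for n using f(1)[of n] by (simp add: r_def v_def vr_def)
  have r0: "r 0 = y" using Pn[of 0] by (simp add: P_def)
  have rS: "r (Suc n) = (\<lambda>x. r n x - vr n x)" for n using f(2) by (simp add: r_def vr_def)
  have rC: "Cn_on k {p k - 1<..} (r n)" for n k using Pn[of n] by (simp add: P_def)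
  have hol: "v n holomorphic_on UNIV" "v n (complex_of_real x) = of_real (vr n x)" for n x using Pn[of n] by (simp_all add: P_def)
  have app: "\<bar>(deriv ^^ j) (vr n) x - (deriv ^^ j) (\<lambda>x. \<kappa> n x * r n x) x\<bar> \<le> \<epsilon> n" if "j \<le> n" for j n x using Pn[of n] that by (simp add: P_def)
  have sm: "cmod (v n z) \<le> \<epsilon> n" if "Re z \<le> p n - 2" "\<bar>Im z\<bar> \<le> 1 / 4" for n z using Pn[of n] that by (simp add: P_def)
  have vrC: "Cn_on k S (vr n)" for k S n by (intro Cn_on_real_analytic entire_real_analytic[OF hol])
  have rsum: "r n x = y x - (\<Sum>k<n. vr k x)" for n x by (induction n) (simp_all add: r0 rS)

  \<comment> \<open>On this interval piece m is removed up to \<open>\<epsilon> m\<close>. Piece m +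
    1 removes the share \<open>\<kappa> (Suc m)\<close> of what is left, so the share
    \<open>\<psi> (Suc m)\<close> and one new error remain; every later piece adds only its own
    error there. The factor 1 - 1 / 2^n keeps room for all of these.\<close>
  have bound: "\<bar>(deriv ^^ j) (r n) x\<bar> \<le> \<theta> (p (m + 2)) * (1 - 1 / 2 ^ n)"
    if j: "j \<le> m" and x: "p (m + 1) \<le> x" "x < p (m + 2)" and n: "m + 2 \<le> n" for j m x n
  proof -
    define T where "T = \<theta> (p (m + 2))"
    have T: "T > 0" by (simp add: T_def pos)
    have \<theta>T: "\<theta> (p k) \<le> T" if "m + 2 \<le> k" for k unfolding T_def by (intro anti pmono that)
    \<comment> \<open>Open, and longer by 1/2 to the left, so that derivatives at the endpoint p (m
      + 1) can be compared as well.\<close>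
    define S1 where "S1 = {p (m + 1) - 1/2 <..< p (m + 2)}"
    have S1: "open S1" "x \<in> S1" using x by (auto simp: S1_def)
    have S1p: "S1 \<subseteq> {p m - 1<..}" using p(2)[of m] by (auto simp: S1_def)
    have S1p': "S1 \<subseteq> {p (Suc m) - 1<..}" by (auto simp: S1_def)
    have step1: "\<bar>(deriv ^^ i) (r (Suc m)) t\<bar> \<le> \<epsilon> m" if i: "i \<le> m" and t: "t \<in> S1" for i t
    proof -
      have "(deriv ^^ i) (r (Suc m)) t = (deriv ^^ i) (r m) t - (deriv ^^ i) (vr m) t"
        unfolding rS by (rule derivs_diff[OF S1(1) Cn_on_subset[OF rC S1p] vrC i t])
      moreover have "(deriv ^^ i) (\<lambda>x. \<kappa> m x * r m x) t = (deriv ^^ i) (r m) t"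
        by (rule Cn_on_cong(2)[OF S1(1) _ Cn_on_subset[OF \<kappa>r[OF rC] subset_UNIV] t])
          (use \<kappa>(3)[of m] in \<open>auto simp: S1_def\<close>)
      ultimately show ?thesis using app[OF i, of t] by linarith
    qed
    have jS: "j \<le> Suc m" using j by simp
    have rC': "Cn_on m S1 (r (Suc m))" "Cn_on m S1 (\<psi> (Suc m))"
      using Cn_on_le[OF _ Cn_on_subset[OF rC S1p']] Cn_on_le[OF _ Cn_on_subset[OF \<psi> subset_UNIV]] by auto
    have "\<bar>(deriv ^^ j) (\<lambda>x. \<psi> (Suc m) x * r (Suc m) x) x\<bar> \<le> 2 ^ j * C (Suc m) * \<epsilon> m"
      by (rule derivs_mult_bound[OF S1(1) rC'(2,1) j S1(2)])
        (use C(2)[of _ "Suc m"] j step1 in \<open>auto simp: S1_def\<close>)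
    also have "\<dots> \<le> 2 ^ m * C (Suc m) * \<epsilon> m"
      using \<epsilon>[of m] C(1)[of "Suc m"] j by (intro mult_right_mono power_increasing) auto
    also have "\<dots> = \<theta> (p (m + 3)) / 8" using \<epsilon>1[of m] by (simp add: mult_ac)
    also have "\<dots> \<le> T / 8" using \<theta>T[of "m + 3"] by simp
    finally have s2: "\<bar>(deriv ^^ j) (\<lambda>x. \<psi> (Suc m) x * r (Suc m) x) x\<bar> \<le> T / 8" .
    have "(deriv ^^ j) (r (Suc (Suc m))) x = (deriv ^^ j) (r (Suc m)) x - (deriv ^^ j) (vr (Suc m)) x"
      unfolding rS[of "Suc m"] by (rule derivs_diff[OF S1(1) rC'(1) vrC j S1(2)])
    moreover have "(deriv ^^ j) (r (Suc m)) x = (deriv ^^ j) (\<lambda>x. \<psi> (Suc m) x * r (Suc m) x) x + (deriv ^^ j) (\<lambda>x. \<kappa> (Suc m) x * r (Suc m) x) x"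
    proof -
      have c1: "Cn_on m S1 (\<lambda>x. \<psi> (Suc m) x * r (Suc m) x)" by (rule Cn_on_mult[OF S1(1) rC'(2,1)])
      have c2: "Cn_on m S1 (\<lambda>x. \<kappa> (Suc m) x * r (Suc m) x)"
        by (rule Cn_on_le[OF _ Cn_on_subset[OF \<kappa>r[OF rC] subset_UNIV]]) simp
      have "r (Suc m) = (\<lambda>x. \<psi> (Suc m) x * r (Suc m) x + \<kappa> (Suc m) x * r (Suc m) x)" by (auto simp: \<psi>_def algebra_simps)
      then have "(deriv ^^ j) (r (Suc m)) x = (deriv ^^ j) (\<lambda>x. \<psi> (Suc m) x * r (Suc m) x + \<kappa> (Suc m) x * r (Suc m) x) x" by simp
      also have "\<dots> = (deriv ^^ j) (\<lambda>x. \<psi> (Suc m) x * r (Suc m) x) x + (deriv ^^ j) (\<lambda>x. \<kappa> (Suc m) x * r (Suc m) x) x"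
        by (rule derivs_add[OF S1(1) c1 c2 j S1(2)])
      finally show ?thesis .
    qed
    moreover have "\<epsilon> (Suc m) \<le> T / 8"
    proof -
      have "\<epsilon> (Suc m) \<le> \<theta> (p (Suc m + 3)) / 2 ^ (Suc m + 3)" by (rule \<epsilon>2)
      also have "\<dots> \<le> T / 2 ^ 3" by (intro frac_le \<theta>T power_increasing) (use T in auto)
      finally show ?thesis by simp
    qed
    ultimately have base: "\<bar>(deriv ^^ j) (r (m + 2)) x\<bar> \<le> T / 4"
      using s2 app[OF jS, of x] unfolding add_2_eq_Suc' by linarith
    show ?thesis using n unfolding T_def[symmetric]
    proof (induction n rule: dec_induct)
      case base
      define q where "q = (1::real) / 2 ^ (m + 2)"
      have "(1::real) / 2 ^ (m + 2) \<le> 1 / 2 ^ 2" by (intro divide_left_mono power_increasing) auto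
      then have "q \<le> 1 / 4" by (simp add: q_def)
      then have "T * (1 / 4) \<le> T * (1 - q)" using T by (intro mult_left_mono) linarith+
      then show ?case using \<open>\<bar>(deriv ^^ j) (r (m + 2)) x\<bar> \<le> T / 4\<close> unfolding q_def by linarith
    next
      case (step n)
      have jn: "j \<le> n" using j step by simp
      have "(deriv ^^ j) (r (Suc n)) x = (deriv ^^ j) (r n) x - (deriv ^^ j) (vr n) x"
        unfolding rS[of n] by (rule derivs_diff[OF S1(1) Cn_on_subset[OF rC S1p] vrC j S1(2)])
      moreover have "(deriv ^^ j) (\<lambda>x. \<kappa> n x * r n x) x = 0"
        by (rule derivs_zero_outside[of "p n" "p (n + 3)"])
          (use \<kappa>(2) pmono[OF step(1)] x in auto)
      moreover have "\<epsilon> n \<le> T / 2 ^ (n + 1)"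
      proof -
        have "\<epsilon> n \<le> \<theta> (p (n + 3)) / 2 ^ (n + 3)" by (rule \<epsilon>2)
        also have "\<dots> \<le> T / 2 ^ (n + 1)" by (intro frac_le \<theta>T power_increasing) (use T step in auto)
        finally show ?thesis .
      qed
      ultimately have "\<bar>(deriv ^^ j) (r (Suc n)) x\<bar> \<le> T * (1 - 1 / 2 ^ n) + T / 2 ^ (n + 1)"
        using step.IH app[OF jn, of x] by linarith
      also have "\<dots> = T * (1 - 1 / 2 ^ Suc n)" by (simp add: field_simps)
      finally show ?case .
    qed
  qed

  define F where "F z = (\<Sum>k. v k z)" for z
  \<comment> \<open>On a strip cut off at R on the right, all pieces lying far enough to the right
    are small, which gives uniform convergence there for each R.\<close>
  define AR where "AR R = {z. \<bar>Im z\<bar> < 1 / 4 \<and> Re z < R}" for R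
  have AR_open: "open (AR R)" for R unfolding AR_def by (intro open_Collect_conj open_Collect_less continuous_intros)
  have ul: "uniform_limit (AR R) (\<lambda>n z. \<Sum>i<n. v i z) F sequentially" for R
    unfolding F_def
  proof (rule Weierstrass_m_test_ev)
    show "summable (\<lambda>n. \<theta> (p 0) * (1 / 2) ^ n)" by (intro summable_mult summable_geometric) simp
    obtain K :: nat where K: "real K \<ge> R + 2" using real_arch_simple by blast
    show "eventually (\<lambda>n. \<forall>z\<in>AR R. norm (v n z) \<le> \<theta> (p 0) * (1 / 2) ^ n) sequentially"
      using eventually_ge_at_top[of K]
    proof eventually_elim
      case (elim n)
      have "\<epsilon> n \<le> \<theta> (p (n + 3)) / 2 ^ (n + 3)" by (rule \<epsilon>2)
      also have "\<dots> \<le> \<theta> (p 0) / 2 ^ n" by (intro frac_le anti pmono power_increasing) (use pos[of "p 0"] in auto)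
      finally have e: "\<epsilon> n \<le> \<theta> (p 0) * (1 / 2) ^ n" by (simp add: power_divide)
      show ?case
      proof
        fix z assume "z \<in> AR R"
        then have "Re z \<le> p n - 2" "\<bar>Im z\<bar> \<le> 1 / 4" using K elim p(1)[of n] by (auto simp: AR_def)
        from sm[OF this] e show "norm (v n z) \<le> \<theta> (p 0) * (1 / 2) ^ n" by linarith
      qed
    qed
  qed
  have Fhol: "F holomorphic_on AR R" for R
  proof (rule holomorphic_uniform_sequence[OF AR_open])
    show "(\<lambda>z. \<Sum>i<n. v i z) holomorphic_on AR R" for n
      by (intro holomorphic_on_sum holomorphic_on_subset[OF hol(1)]) auto
    fix z assume "z \<in> AR R"
    then obtain d where "d > 0" "cball z d \<subseteq> AR R" using AR_open open_contains_cball by blast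
    then show "\<exists>d>0. cball z d \<subseteq> AR R \<and> uniform_limit (cball z d) (\<lambda>n z. \<Sum>i<n. v i z) F sequentially"
      using uniform_limit_on_subset[OF ul] by blast
  qed
  have vs: "(\<Sum>i<n. v i (complex_of_real x)) = of_real (\<Sum>i<n. vr i x)" for n x by (simp add: hol(2))
  define g where "g x = Re (F (of_real x))" for x
  have inAR: "complex_of_real x \<in> AR (x + 1)" for x by (simp add: AR_def)
  have Freal: "F (of_real x) = of_real (g x)" for x
  proof -
    have "(\<lambda>n. \<Sum>i<n. v i (complex_of_real x)) \<longlonglongrightarrow> F (of_real x)" by (rule tendsto_uniform_limitI[OF ul inAR])
    then have "(\<lambda>n. Im (\<Sum>i<n. v i (complex_of_real x))) \<longlonglongrightarrow> Im (F (of_real x))" by (rule tendsto_Im)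
    then have "Im (F (of_real x)) = 0" unfolding vs by (simp add: LIMSEQ_const_iff)
    then show ?thesis by (simp add: complex_eq_iff g_def)
  qed
  have gh: "real_holo g F x (1 / 4)" for x
  proof -
    have "ball (complex_of_real x) (1 / 4) \<subseteq> AR (x + 1)"
    proof
      fix z assume "z \<in> ball (complex_of_real x) (1 / 4)"
      then have "cmod (z - of_real x) < 1 / 4" by (simp add: dist_norm norm_minus_commute)
      then have "\<bar>Re z - x\<bar> < 1 / 4" "\<bar>Im z\<bar> < 1 / 4"
        using abs_Re_le_cmod[of "z - of_real x"] abs_Im_le_cmod[of "z - of_real x"] by auto
      moreover from this(1) have "Re z < x + 1" by linarith
      ultimately show "z \<in> AR (x + 1)" by (simp add: AR_def)
    qed
    then show ?thesis unfolding real_holo_def using Freal holomorphic_on_subset[OF Fhol] by auto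
  qed
  have ga: "real_analytic_on UNIV g" unfolding real_analytic_on_iff using gh by blast
  show ?thesis
  proof (rule that)
    show "g \<in> germ_C_omega" unfolding germ_C_omega_def using real_analytic_on_subset[OF ga] by blast
    fix j
    have key: "\<bar>(deriv ^^ j) g x - (deriv ^^ j) y x\<bar> \<le> \<theta> x" if m: "j \<le> m" and x: "p (m + 1) \<le> x" "x < p (m + 2)" for m x
    proof -
      \<comment> \<open>Derivatives of the partial sums converge because the convergence is uniform
        on an open complex set; for this the pieces had to be small off the real axis too.\<close>
      have "((\<lambda>n. (deriv ^^ j) (\<lambda>z. \<Sum>i<n. v i z) (of_real x)) \<longlongrightarrow> (deriv ^^ j) F (of_real x)) sequentially"
        by (rule higher_deriv_complex_uniform_limit[OF ul _ _ AR_open inAR])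
          (auto intro!: always_eventually holomorphic_on_sum holomorphic_on_subset[OF hol(1)])
      moreover have "(deriv ^^ j) (\<lambda>z. \<Sum>i<n. v i z) (of_real x) = of_real ((deriv ^^ j) (\<lambda>x. \<Sum>i<n. vr i x) x)" for n
      proof -
        have "real_holo (\<lambda>x. \<Sum>i<n. vr i x) (\<lambda>z. \<Sum>i<n. v i z) x 1"
          by (rule entire_real_holo) (auto intro!: holomorphic_on_sum hol simp: hol(2))
        from real_holo_derivs[OF this, of j] show ?thesis unfolding real_holo_def by auto
      qed
      moreover have "(deriv ^^ j) F (of_real x) = of_real ((deriv ^^ j) g x)"
        using real_holo_derivs[OF gh[of x], of j] unfolding real_holo_def by auto
      ultimately have lim: "(\<lambda>n. (deriv ^^ j) (\<lambda>x. \<Sum>i<n. vr i x) x) \<longlonglongrightarrow> (deriv ^^ j) g x"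
        by (simp add: tendsto_of_real_iff)
      have "(deriv ^^ j) (r n) x = (deriv ^^ j) y x - (deriv ^^ j) (\<lambda>x. \<Sum>i<n. vr i x) x" for n
      proof -
        have rn: "r n = (\<lambda>x. y x - (\<Sum>i<n. vr i x))" by (rule ext) (rule rsum)
        have "real_analytic_on {p m - 1<..} (\<lambda>x. \<Sum>i<n. vr i x)"
          by (rule entire_real_analytic[of "\<lambda>z. \<Sum>i<n. v i z"]) (auto intro!: holomorphic_on_sum hol simp: hol(2))
        then have "Cn_on m {p m - 1<..} (\<lambda>x. \<Sum>i<n. vr i x)" by (rule Cn_on_real_analytic)
        moreover have "x \<in> {p m - 1<..}" using x p(2)[of m] by simp
        ultimately show ?thesis unfolding rn using p(3)[of m] m by (intro derivs_diff[of "{p m - 1<..}" m]) auto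
      qed
      then have "(\<lambda>n. (deriv ^^ j) (r n) x) \<longlonglongrightarrow> (deriv ^^ j) y x - (deriv ^^ j) g x"
        by (simp only:) (intro tendsto_intros lim)
      then have "(\<lambda>n. \<bar>(deriv ^^ j) (r n) x\<bar>) \<longlonglongrightarrow> \<bar>(deriv ^^ j) y x - (deriv ^^ j) g x\<bar>" by (rule tendsto_rabs)
      moreover have "\<bar>(deriv ^^ j) (r n) x\<bar> \<le> \<theta> x" if n: "n \<ge> m + 2" for n
      proof -
        have "\<bar>(deriv ^^ j) (r n) x\<bar> \<le> \<theta> (p (m + 2)) * (1 - 1 / 2 ^ n)" by (rule bound[OF m x n])
        also have "\<dots> \<le> \<theta> (p (m + 2)) * 1" using pos[of "p (m + 2)"] by (intro mult_left_mono) auto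
        also have "\<dots> \<le> \<theta> x" using anti x by simp
        finally show ?thesis .
      qed
      ultimately have "\<bar>(deriv ^^ j) y x - (deriv ^^ j) g x\<bar> \<le> \<theta> x"
        by (intro LIMSEQ_le_const2) (auto intro!: exI[of _ "m + 2"])
      then show ?thesis by (simp add: abs_minus_commute)
    qed
    show "eventually (\<lambda>x. \<bar>(deriv ^^ j) g x - (deriv ^^ j) y x\<bar> \<le> \<theta> x) at_top"
      using eventually_ge_at_top[of "p (j + 1)"]
    proof eventually_elim
      case (elim x)
      \<comment> \<open>The first breakpoint beyond \<open>x\<close>; the index m of the interval
        containing \<open>x\<close> is N - 2, and it is at least \<open>j\<close> because
        \<open>x\<close> lies beyond p (j + 1).\<close>
      define N where "N = (LEAST N. x < p N)"
      have exN: "\<exists>N. x < p N"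
      proof -
        obtain N :: nat where "x < real N" using reals_Archimedean2 by blast
        then show ?thesis using p(1)[of N] by (intro exI[of _ N]) simp
      qed
      have N: "x < p N" unfolding N_def by (rule LeastI_ex[OF exN])
      have Nmin: "p k \<le> x" if "k < N" for k using not_less_Least[of k "\<lambda>N. x < p N"] that unfolding N_def by auto
      have "j + 1 < N" using N elim pmono[of N "j + 1"] by (cases "N \<le> j + 1") auto
      then obtain m where m: "N = m + 2" "j \<le> m" by (intro that[of "N - 2"]) auto
      show ?case by (rule key[OF m(2)]) (use N Nmin[of "m + 1"] m in auto)
    qed
  qed
qed

section \<open>Perturbed differential equations\<close>

text \<open>A gauge satisfies these conditions from some \<open>x0\<close> on. The bound 4 for
  \<open>E'\<close> lets the shift equations of a higher-order equation, whose Lipschitz constant is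
  1, obey the bound E' / 4 imposed on the last equation.\<close>

locale decay_weight =
  fixes E E' :: "real \<Rightarrow> real" and x0 :: real
  assumes E_deriv: "\<And>x. x \<ge> x0 \<Longrightarrow> (E has_real_derivative E' x) (at x)"
    and E'_ge: "\<And>x. x \<ge> x0 \<Longrightarrow> E' x \<ge> 4"
    and E_nonneg: "\<And>x. x \<ge> x0 \<Longrightarrow> E x \<ge> 0"
    and E_lim: "filterlim E at_top at_top"
begin

lemma weight_tendsto: "n > 0 \<Longrightarrow> ((\<lambda>x. d * exp (- real n * E x)) \<longlongrightarrow> 0) at_top"
proof -
  assume n: "n > 0"
  have "filterlim (\<lambda>x. real n * E x) at_top at_top"
    by (rule filterlim_tendsto_pos_mult_at_top[OF tendsto_const _ E_lim]) (use n in simp)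
  then have "filterlim (\<lambda>x. - (real n * E x)) at_bot at_top"
    by (simp add: filterlim_uminus_at_bot)
  then have "((\<lambda>x. exp (- (real n * E x))) \<longlongrightarrow> 0) at_top"
    by (rule filterlim_compose[OF exp_at_bot])
  then have "((\<lambda>x. d * exp (- (real n * E x))) \<longlongrightarrow> 0) at_top" by (rule tendsto_mult_right_zero)
  then show ?thesis by simp
qed

lemma weight_deriv: "x \<ge> x0 \<Longrightarrow> ((\<lambda>x. d * exp (- real n * E x)) has_real_derivative - (d * (real n * E' x * exp (- real n * E x)))) (at x)"
  by (auto intro!: derivative_eq_intros E_deriv)

text \<open>The bound on \<open>w\<close> is minus the derivative of d exp (- n E); so d exp (- n E)
  + W and d exp (- n E) - W both decrease.\<close>

lemma decay_mono:
  assumes W: "\<And>x. x > a \<Longrightarrow> (W has_real_derivative w x) (at x)" and cW: "continuous_on {a..} W"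
    and b: "\<And>x. x > a \<Longrightarrow> \<bar>w x\<bar> \<le> d * (real n * E' x * exp (- real n * E x))" and a: "a \<ge> x0"
    and xy: "a \<le> x" "x \<le> y"
  shows "\<bar>W x - W y\<bar> \<le> d * exp (- real n * E x) - d * exp (- real n * E y)"
proof -
  let ?p = "\<lambda>x. d * exp (- real n * E x)"
  have dp: "(?p has_real_derivative - (d * (real n * E' t * exp (- real n * E t)))) (at t)" if "t \<ge> a" for t
    by (rule weight_deriv) (use that a in simp)
  have cp: "continuous_on {x..y} ?p"
    by (intro continuous_at_imp_continuous_on ballI DERIV_isCont[OF dp]) (use xy in auto)
  have cW': "continuous_on {x..y} W" using cW xy by (auto intro: continuous_on_subset)
  have "W y + ?p y \<le> W x + ?p x"
  proof (rule DERIV_nonpos_imp_decreasing_open[OF xy(2)])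
    fix t assume t: "x < t" "t < y"
    then have "t > a" using xy by simp
    with DERIV_add[OF W[OF this] dp[of t]] b[OF this]
    show "\<exists>D. ((\<lambda>t. W t + ?p t) has_real_derivative D) (at t) \<and> D \<le> 0"
      by (intro exI[of _ "w t + - (d * (real n * E' t * exp (- real n * E t)))"]) auto
  qed (intro continuous_on_add cp cW')
  moreover have "?p y - W y \<le> ?p x - W x"
  proof (rule DERIV_nonpos_imp_decreasing_open[OF xy(2)])
    fix t assume t: "x < t" "t < y"
    then have "t > a" using xy by simp
    with DERIV_diff[OF dp[of t] W[OF this]] b[OF this]
    show "\<exists>D. ((\<lambda>t. ?p t - W t) has_real_derivative D) (at t) \<and> D \<le> 0"
      by (intro exI[of _ "- (d * (real n * E' t * exp (- real n * E t))) - w t"]) auto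
  qed (intro continuous_on_diff cp cW')
  ultimately show ?thesis by linarith
qed

text \<open>Minus the integral of \<open>w\<close> from \<open>x\<close> to infinity, that is, the
  primitive of \<open>w\<close> that tends to 0. The limit form stays with integrals over bounded
  intervals.\<close>

definition tail_int :: "(real \<Rightarrow> real) \<Rightarrow> real \<Rightarrow> real" where
  "tail_int w x = integral {x0..x} w - Lim at_top (\<lambda>x. integral {x0..x} w)"

definition admissible :: "(real \<Rightarrow> real) \<Rightarrow> bool" where
  "admissible w \<longleftrightarrow> continuous_on {x0..} w \<and> (\<forall>x\<ge>x0. \<bar>w x\<bar> \<le> E' x * exp (- E x))"

text \<open>Cauchy's criterion at infinity: increments of the primitive are bounded by differences
  of exp (- E), which tends to 0.\<close>

lemma tail_int:
  assumes "admissible w"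
  shows "\<And>x. x > x0 \<Longrightarrow> (tail_int w has_real_derivative w x) (at x)" "continuous_on {x0..} (tail_int w)"
    "(tail_int w \<longlongrightarrow> 0) at_top"
proof -
  define W where "W x = integral {x0..x} w" for x
  have cw: "continuous_on {x0..} w" and bw: "\<And>x. x \<ge> x0 \<Longrightarrow> \<bar>w x\<bar> \<le> E' x * exp (- E x)"
    using assms unfolding admissible_def by auto
  have dW: "(W has_real_derivative w x) (at x within {x0..b})" if "x0 \<le> x" "x \<le> b" for x b
    unfolding W_def by (rule integral_has_real_derivative) (use cw that in \<open>auto intro: continuous_on_subset\<close>)
  have dW': "(W has_real_derivative w x) (at x)" if "x0 < x" for x
  proof -
    have "at x within {x0..x + 1} = at x" by (rule at_within_interior) (use that in simp)
    then show ?thesis using dW[of x "x + 1"] that by simp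
  qed
  have cW: "continuous_on {x0..} W"
  proof -
    have "continuous_on {x0..b} W" for b
      by (rule DERIV_continuous_on) (use dW in auto)
    then have "continuous (at x within {x0..}) W" if "x \<ge> x0" for x
    proof -
      have "continuous (at x within {x0..x + 1}) W"
        using \<open>\<And>b. continuous_on {x0..b} W\<close> that by (auto simp: continuous_on_eq_continuous_within)
      moreover have "at x within {x0..x + 1} = at x within {x0..}"
        by (rule at_within_nhd[of x "{..<x + 1}"]) auto
      ultimately show ?thesis by simp
    qed
    then show ?thesis by (simp add: continuous_on_eq_continuous_within)
  qed
  have "\<exists>l. (W \<longlongrightarrow> l) at_top"
  proof -
    have p: "((\<lambda>x. 1 * exp (- real 1 * E x)) \<longlongrightarrow> 0) at_top" by (rule weight_tendsto) simp
    have "cauchy_filter (filtermap W at_top)"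
      unfolding cauchy_filter_metric_filtermap
    proof (intro allI impI)
      fix e :: real assume e: "e > 0"
      have "eventually (\<lambda>x. 1 * exp (- real 1 * E x) < e) at_top" using p e by (rule order_tendstoD(2))
      then have ev: "eventually (\<lambda>x. exp (- E x) < e \<and> x \<ge> x0) at_top"
        using eventually_ge_at_top[of x0] by eventually_elim simp
      have *: "\<bar>W x - W y\<bar> < e" if "exp (- E x) < e" "x0 \<le> x" "x \<le> y" for x y
      proof -
        have "\<bar>W x - W y\<bar> \<le> 1 * exp (- real 1 * E x) - 1 * exp (- real 1 * E y)"
          by (rule decay_mono[where w = w and a = x0]) (use dW' cW bw that in auto)
        then show ?thesis using that exp_gt_zero[of "- E y"] by (simp del: exp_gt_zero)
      qed
      have "\<forall>x y. (exp (- E x) < e \<and> x \<ge> x0) \<and> (exp (- E y) < e \<and> y \<ge> x0) \<longrightarrow> dist (W x) (W y) < e"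
      proof (intro allI impI)
        fix x y assume h: "(exp (- E x) < e \<and> x \<ge> x0) \<and> (exp (- E y) < e \<and> y \<ge> x0)"
        show "dist (W x) (W y) < e"
          using *[of x y] *[of y x] h by (cases "x \<le> y") (auto simp: dist_real_def abs_minus_commute)
      qed
      then show "\<exists>P. eventually P at_top \<and> (\<forall>x y. P x \<and> P y \<longrightarrow> dist (W x) (W y) < e)"
        using ev by (intro exI[of _ "\<lambda>x. exp (- E x) < e \<and> x \<ge> x0"]) blast
    qed
    then have "convergent_filter (filtermap W at_top)" by (rule cauchy_filter_convergent)
    then show ?thesis unfolding convergent_filter_iff filterlim_def by simp
  qed
  then obtain l where l: "(W \<longlongrightarrow> l) at_top" by blast
  have Lim: "Lim at_top W = l" by (rule tendsto_Lim[OF _ l]) simp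
  have eq: "tail_int w x = W x - l" for x
    using Lim unfolding tail_int_def W_def[abs_def] by simp
  have e2: "tail_int w = (\<lambda>x. W x - l)" using eq by (rule ext)
  show "(tail_int w has_real_derivative w x) (at x)" if "x > x0" for x
    unfolding e2 using DERIV_diff[OF dW'[OF that] DERIV_const] by simp
  show "continuous_on {x0..} (tail_int w)" unfolding e2 by (intro continuous_intros cW)
  have "((\<lambda>x. W x - l) \<longlongrightarrow> l - l) at_top" by (intro tendsto_intros l)
  then show "(tail_int w \<longlongrightarrow> 0) at_top" unfolding e2 by simp
qed

text \<open>The upper endpoint tends to infinity in the estimate of increments. The power n of the
  weight is kept, so decay of every order passes through the integration.\<close>

lemma tail_int_diff_bound:
  assumes 1: "admissible w1" and 2: "admissible w2" and n: "n > 0" and a: "a \<ge> x0"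
    and b: "\<And>x. x \<ge> a \<Longrightarrow> \<bar>w1 x - w2 x\<bar> \<le> d * (E' x * exp (- real n * E x))" and d: "d \<ge> 0" and x: "x \<ge> a"
  shows "\<bar>tail_int w1 x - tail_int w2 x\<bar> \<le> d * exp (- real n * E x)"
proof -
  let ?W = "\<lambda>x. tail_int w1 x - tail_int w2 x"
  have dW: "(?W has_real_derivative w1 x - w2 x) (at x)" if "x > a" for x
    by (intro DERIV_diff tail_int 1 2) (use that a in auto)
  have cW: "continuous_on {a..} ?W"
    by (intro continuous_on_diff continuous_on_subset[OF tail_int(2)] 1 2) (use a in auto)
  have b': "\<bar>w1 x - w2 x\<bar> \<le> d * (real n * E' x * exp (- real n * E x))" if "x > a" for x
  proof -
    have "E' x * exp (- real n * E x) \<le> real n * E' x * exp (- real n * E x)"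
      using n E'_ge[of x] that a by (intro mult_right_mono) auto
    then have "d * (E' x * exp (- real n * E x)) \<le> d * (real n * E' x * exp (- real n * E x))"
      using d by (intro mult_left_mono) auto
    then show ?thesis using b[of x] that by linarith
  qed
  have yb: "\<bar>?W x - ?W y\<bar> \<le> d * exp (- real n * E x)" if y: "y \<ge> x" for y
  proof -
    have "\<bar>?W x - ?W y\<bar> \<le> d * exp (- real n * E x) - d * exp (- real n * E y)"
      by (rule decay_mono[OF dW cW b' a x y])
    moreover have "d * exp (- real n * E y) \<ge> 0" using d by simp
    ultimately show ?thesis by linarith
  qed
  have ev: "eventually (\<lambda>y. \<bar>?W x - ?W y\<bar> \<le> d * exp (- real n * E x)) at_top"
    using eventually_ge_at_top[of x] by eventually_elim (rule yb)
  have "((\<lambda>y. \<bar>?W x - ?W y\<bar>) \<longlongrightarrow> \<bar>?W x - (0 - 0)\<bar>) at_top"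
    by (intro tendsto_intros tail_int(3) 1 2)
  from tendsto_upperbound[OF this ev] show ?thesis by simp
qed

lemma admissible_zero: "admissible (\<lambda>x. 0)"
  unfolding admissible_def using E'_ge by (fastforce intro: mult_nonneg_nonneg)

lemma tail_int_zero: "tail_int (\<lambda>x. 0) x = 0"
proof -
  have "Lim at_top (\<lambda>x::real. 0::real) = 0" by (rule tendsto_Lim) auto
  then show ?thesis by (simp add: tail_int_def)
qed

text \<open>Picard iteration, integrating from infinity.\<close>

lemma perturbed_ode:
  fixes \<Phi> :: "real \<Rightarrow> (nat \<Rightarrow> real) \<Rightarrow> real" and r :: nat
  assumes lip: "\<And>x u v d. x \<ge> x0 \<Longrightarrow> (\<And>j. j \<le> r \<Longrightarrow> \<bar>u j\<bar> \<le> exp (- E x)) \<Longrightarrow> (\<And>j. j \<le> r \<Longrightarrow> \<bar>v j\<bar> \<le> exp (- E x))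
      \<Longrightarrow> (\<And>j. j \<le> r \<Longrightarrow> \<bar>u j - v j\<bar> \<le> d) \<Longrightarrow> \<bar>\<Phi> x u - \<Phi> x v\<bar> \<le> E' x / 4 * d"
    and small: "\<And>x. x \<ge> x0 \<Longrightarrow> \<bar>\<Phi> x (\<lambda>j. 0)\<bar> \<le> E' x / 4 * exp (- E x)"
    and small_ev: "\<And>n. eventually (\<lambda>x. \<bar>\<Phi> x (\<lambda>j. 0)\<bar> \<le> exp (- real n * E x)) at_top"
    and cont: "\<And>U. (\<And>j. j \<le> r \<Longrightarrow> continuous_on {x0..} (U j)) \<Longrightarrow> (\<And>j x. j \<le> r \<Longrightarrow> x \<ge> x0 \<Longrightarrow> \<bar>U j x\<bar> \<le> exp (- E x))
      \<Longrightarrow> continuous_on {x0..} (\<lambda>x. \<Phi> x (\<lambda>j. U j x))"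
  shows "\<exists>U. (\<forall>j<r. \<forall>x>x0. (U j has_real_derivative U (Suc j) x) (at x)) \<and>
     (\<forall>x>x0. (U r has_real_derivative \<Phi> x (\<lambda>j. U j x)) (at x)) \<and>
     (\<forall>j\<le>r. \<forall>x\<ge>x0. \<bar>U j x\<bar> \<le> exp (- E x)) \<and>
     (\<forall>j\<le>r. \<forall>n. eventually (\<lambda>x. \<bar>U j x\<bar> \<le> exp (- real n * E x)) at_top)"
proof -
  \<comment> \<open>Right-hand side of the companion system: component \<open>j\<close> has
    component \<open>Suc j\<close> as derivative for \<open>j < r\<close>, and only the last row
    uses \<Phi>.\<close>
  define G where "G U j x = (if j < r then U (Suc j) x else \<Phi> x (\<lambda>i. U i x))" for U :: "nat \<Rightarrow> real \<Rightarrow> real" and j :: nat and x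
  define good where "good U \<longleftrightarrow> (\<forall>j\<le>r. continuous_on {x0..} (U j) \<and> (\<forall>x\<ge>x0. \<bar>U j x\<bar> \<le> exp (- E x)))" for U :: "nat \<Rightarrow> real \<Rightarrow> real"
  have E'4: "E' x / 4 \<ge> 1" if "x \<ge> x0" for x using E'_ge[OF that] by simp
  \<comment> \<open>In the last row a quarter comes from the defect at 0 and a quarter from the
    Lipschitz bound; the total 1/2 keeps the iteration inside the ball \<bar>U j\<bar> \<le> exp (-
    E).\<close>
  have Gb: "\<bar>G U j x\<bar> \<le> (1/2) * (E' x * exp (- E x))" if U: "good U" and j: "j \<le> r" and x: "x \<ge> x0" for U j x
  proof (cases "j < r")
    case True
    have "\<bar>G U j x\<bar> \<le> 1 * exp (- E x)" using U True x by (simp add: G_def good_def)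
    also have "\<dots> \<le> E' x / 4 * exp (- E x)" using E'4[OF x] by (intro mult_right_mono) auto
    also have "\<dots> \<le> (1/2) * (E' x * exp (- E x))" using E'_ge[OF x] by simp
    finally show ?thesis .
  next
    case False
    have "\<bar>\<Phi> x (\<lambda>i. U i x) - \<Phi> x (\<lambda>j. 0)\<bar> \<le> E' x / 4 * exp (- E x)"
      by (rule lip[OF x]) (use U x in \<open>auto simp: good_def\<close>)
    then show ?thesis using small[OF x] False by (simp add: G_def, linarith)
  qed
  have Gc: "continuous_on {x0..} (G U j)" if U: "good U" and j: "j \<le> r" for U j
  proof (cases "j < r")
    case True
    then have "G U j = U (Suc j)" by (simp add: G_def fun_eq_iff)
    then show ?thesis using U True by (simp add: good_def)
  next
    case False
    then have "G U j = (\<lambda>x. \<Phi> x (\<lambda>i. U i x))" by (simp add: G_def fun_eq_iff)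
    then show ?thesis using cont[of U] U by (simp add: good_def)
  qed
  have Ga: "admissible (G U j)" if U: "good U" and j: "j \<le> r" for U j
    unfolding admissible_def
  proof (intro conjI allI impI Gc[OF U j])
    fix x assume x: "x \<ge> x0"
    have "(1/2) * (E' x * exp (- E x)) \<le> 1 * (E' x * exp (- E x))" using E'_ge[OF x] by (intro mult_right_mono) auto
    then show "\<bar>G U j x\<bar> \<le> E' x * exp (- E x)" using Gb[OF U j x] by linarith
  qed
  have Gd: "\<bar>G U j x - G V j x\<bar> \<le> (e / 4) * (E' x * w)"
    if U: "good U" "good V" and j: "j \<le> r" and x: "x \<ge> x0" and d: "\<And>j. j \<le> r \<Longrightarrow> \<bar>U j x - V j x\<bar> \<le> e * w" and ew: "e * w \<ge> 0" for U V j x e w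
  proof (cases "j < r")
    case True
    have "\<bar>G U j x - G V j x\<bar> \<le> 1 * (e * w)" using d[of "Suc j"] True by (simp add: G_def)
    also have "\<dots> \<le> E' x / 4 * (e * w)" using E'4[OF x] ew by (intro mult_right_mono) auto
    finally show ?thesis by (simp add: mult_ac)
  next
    case False
    have "\<bar>\<Phi> x (\<lambda>i. U i x) - \<Phi> x (\<lambda>i. V i x)\<bar> \<le> E' x / 4 * (e * w)"
      by (rule lip[OF x]) (use U x d in \<open>auto simp: good_def\<close>)
    then show ?thesis using False by (simp add: G_def mult_ac)
  qed
  define V where "V = rec_nat (\<lambda>j x. 0) (\<lambda>k U j. tail_int (G U j))"
  have V0: "V 0 = (\<lambda>j x. 0)" and VS: "\<And>k. V (Suc k) = (\<lambda>j. tail_int (G (V k) j))" by (simp_all add: V_def)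
  have goodTI: "good (\<lambda>j. tail_int (G U j))" if U: "good U" for U
    unfolding good_def
  proof (intro allI impI conjI)
    fix j x assume j: "j \<le> r"
    show "continuous_on {x0..} (tail_int (G U j))" by (rule tail_int(2)[OF Ga[OF U j]])
    assume x: "x \<ge> x0"
    have "\<bar>tail_int (G U j) x - tail_int (\<lambda>x. 0) x\<bar> \<le> (1/2) * exp (- real 1 * E x)"
      by (rule tail_int_diff_bound[OF Ga[OF U j] admissible_zero, where a = x0]) (use Gb[OF U j] x in auto)
    moreover have "(1/2) * exp (- real 1 * E x) \<le> exp (- E x)" by simp
    ultimately show "\<bar>tail_int (G U j) x\<bar> \<le> exp (- E x)" unfolding tail_int_zero by linarith
  qed
  have goodV: "good (V k)" for k
  proof (induction k)
    case 0 show ?case by (simp add: good_def V0)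
  next
    case (Suc k) then show ?case unfolding VS by (rule goodTI)
  qed
  \<comment> \<open>The factor E' of the Lipschitz constant is used up by the integration, so each
    step contracts at a rate that does not depend on the weight. The contraction thus holds for
    every power n, from the point \<open>a\<close> on from which the defect is that small.\<close>
  have diff: "\<bar>V (Suc k) j x - V k j x\<bar> \<le> (1/2) ^ k * exp (- real n * E x)"
    if n: "n > 0" and a: "a \<ge> x0" and sm: "\<And>x. x \<ge> a \<Longrightarrow> \<bar>\<Phi> x (\<lambda>j. 0)\<bar> \<le> E' x / 4 * exp (- real n * E x)"
      and j: "j \<le> r" and x: "x \<ge> a" for n a k j x
    using j x
  proof (induction k arbitrary: j x)
    case 0
    have "\<bar>tail_int (G (V 0) j) x - tail_int (\<lambda>x. 0) x\<bar> \<le> (1/4) * exp (- real n * E x)"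
    proof (rule tail_int_diff_bound[OF Ga[OF goodV 0(1)] admissible_zero n a])
      fix t assume t: "t \<ge> a"
      have "0 \<le> E' t / 4 * exp (- real n * E t)" using E'_ge[of t] t a by (intro mult_nonneg_nonneg) auto
      then show "\<bar>G (V 0) j t - 0\<bar> \<le> 1 / 4 * (E' t * exp (- real n * E t))"
        using sm[OF t] by (simp add: G_def V0)
    qed (use 0 in auto)
    also have "\<dots> \<le> 1 * exp (- real n * E x)" by (intro mult_right_mono) auto
    finally show ?case by (simp add: VS V0 tail_int_zero)
  next
    case (Suc k)
    have "\<bar>tail_int (G (V (Suc k)) j) x - tail_int (G (V k) j) x\<bar> \<le> ((1/2) ^ k / 4) * exp (- real n * E x)"
    proof (rule tail_int_diff_bound[OF Ga[OF goodV Suc.prems(1)] Ga[OF goodV Suc.prems(1)] n a])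
      fix t assume t: "t \<ge> a"
      show "\<bar>G (V (Suc k)) j t - G (V k) j t\<bar> \<le> (1/2) ^ k / 4 * (E' t * exp (- real n * E t))"
        by (rule Gd[OF goodV goodV Suc.prems(1)]) (use Suc.IH t a in auto)
    qed (use Suc in auto)
    also have "\<dots> \<le> (1/2) ^ Suc k * exp (- real n * E x)" by (intro mult_right_mono) auto
    finally show ?case by (simp add: VS)
  qed
  define U where "U j x = lim (\<lambda>k. V k j x)" for j x
  have lim: "(\<lambda>k. V k j x) \<longlonglongrightarrow> U j x" if j: "j \<le> r" and x: "x \<ge> x0" for j x
  proof -
    have "summable (\<lambda>k. V (Suc k) j x - V k j x)"
    proof (rule summable_comparison_test')
      show "summable (\<lambda>k. (1/2) ^ k * exp (- real 1 * E x))" by (intro summable_mult2 summable_geometric) simp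
      show "norm (V (Suc k) j x - V k j x) \<le> (1/2) ^ k * exp (- real 1 * E x)" for k
        using diff[of 1 x0, OF _ _ _ j x] small by simp
    qed
    then have "convergent (\<lambda>n. \<Sum>k<n. V (Suc k) j x - V k j x)" by (simp add: summable_iff_convergent)
    then have "convergent (\<lambda>n. V n j x - V 0 j x)" by (simp add: sum_lessThan_telescope[of "\<lambda>k. V k j x"])
    then have "convergent (\<lambda>n. V n j x)" by (simp add: V0)
    then show ?thesis unfolding U_def by (simp add: convergent_LIMSEQ_iff)
  qed
  have close: "\<bar>U j x - V k j x\<bar> \<le> 2 * (1/2) ^ k * exp (- real n * E x)"
    if n: "n > 0" and a: "a \<ge> x0" and sm: "\<And>x. x \<ge> a \<Longrightarrow> \<bar>\<Phi> x (\<lambda>j. 0)\<bar> \<le> E' x / 4 * exp (- real n * E x)"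
      and j: "j \<le> r" and x: "x \<ge> a" for n a k j x
  proof -
    have "\<bar>V (k + m) j x - V k j x\<bar> \<le> (2 * (1/2) ^ k - 2 * (1/2) ^ (k + m)) * exp (- real n * E x)" for m
    proof (induction m)
      case (Suc m)
      have "\<bar>V (Suc (k + m)) j x - V (k + m) j x\<bar> \<le> (1/2) ^ (k + m) * exp (- real n * E x)"
        by (rule diff[OF n a sm j x])
      then have "\<bar>V (k + Suc m) j x - V k j x\<bar> \<le> (2 * (1/2) ^ k - 2 * (1/2) ^ (k + m)) * exp (- real n * E x) + (1/2) ^ (k + m) * exp (- real n * E x)"
        using Suc by simp
      also have "\<dots> = (2 * (1/2) ^ k - 2 * (1/2) ^ (k + Suc m)) * exp (- real n * E x)" by (simp add: algebra_simps)
      finally show ?case .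
    qed simp
    also have "(2 * (1/2) ^ k - 2 * (1/2) ^ (k + m)) * exp (- real n * E x) \<le> 2 * (1/2) ^ k * exp (- real n * E x)" for m
      by (intro mult_right_mono) auto
    finally have b: "\<bar>V (k + m) j x - V k j x\<bar> \<le> 2 * (1/2) ^ k * exp (- real n * E x)" for m .
    have "(\<lambda>m. V (m + k) j x) \<longlonglongrightarrow> U j x" using lim[OF j] x a by (intro LIMSEQ_ignore_initial_segment) auto
    then have "(\<lambda>m. \<bar>V (m + k) j x - V k j x\<bar>) \<longlonglongrightarrow> \<bar>U j x - V k j x\<bar>" by (intro tendsto_intros)
    then show ?thesis by (rule LIMSEQ_le_const2) (use b in \<open>auto simp: add.commute\<close>)
  qed
  have close1: "\<bar>U j x - V k j x\<bar> \<le> 2 * (1/2) ^ k * exp (- E x)" if "j \<le> r" "x \<ge> x0" for j k x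
    using close[of 1 x0, OF _ _ _ that] small by simp
  have goodU: "good U"
    unfolding good_def
  proof (intro allI impI conjI)
    fix j assume j: "j \<le> r"
    have "uniform_limit {x0..} (\<lambda>k. V k j) (U j) sequentially"
    proof (rule uniform_limitI)
      fix e :: real assume e: "e > 0"
      have "(\<lambda>k. 2 * (1/2::real) ^ k) \<longlonglongrightarrow> 0" by (intro tendsto_mult_right_zero LIMSEQ_realpow_zero) auto
      then have "eventually (\<lambda>k. 2 * (1/2::real) ^ k < e) sequentially" using e by (rule order_tendstoD(2))
      then show "eventually (\<lambda>k. \<forall>x\<in>{x0..}. dist (V k j x) (U j x) < e) sequentially"
      proof eventually_elim
        case (elim k)
        show ?case
        proof
          fix x assume "x \<in> {x0..}"
          then have x: "x \<ge> x0" by simp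
          have "2 * (1/2) ^ k * exp (- E x) \<le> 2 * (1/2) ^ k * 1" using E_nonneg[OF x] by (intro mult_left_mono) auto
          then have "\<bar>U j x - V k j x\<bar> < e" using close1[OF j x, of k] elim by linarith
          then show "dist (V k j x) (U j x) < e" by (simp add: dist_real_def abs_minus_commute)
        qed
      qed
    qed
    then show "continuous_on {x0..} (U j)"
      by (rule uniform_limit_theorem[rotated]) (use goodV j in \<open>auto simp: good_def\<close>)
    fix x assume x: "x \<ge> x0"
    show "\<bar>U j x\<bar> \<le> exp (- E x)"
    proof (rule LIMSEQ_le_const2)
      show "(\<lambda>k. \<bar>V k j x\<bar>) \<longlonglongrightarrow> \<bar>U j x\<bar>" by (intro tendsto_intros lim[OF j x])
      show "\<exists>N. \<forall>k\<ge>N. \<bar>V k j x\<bar> \<le> exp (- E x)" using goodV j x by (auto simp: good_def)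
    qed
  qed
  \<comment> \<open>The integral operator is continuous for the weighted distance, so the limit of
    the iterates is a fixed point.\<close>
  have fixU: "U j x = tail_int (G U j) x" if j: "j \<le> r" and x: "x \<ge> x0" for j x
  proof -
    have b: "\<bar>tail_int (G (V k) j) x - tail_int (G U j) x\<bar> \<le> (2 * (1/2) ^ k / 4) * exp (- real 1 * E x)" for k
    proof (rule tail_int_diff_bound[OF Ga[OF goodV j] Ga[OF goodU j], where a = x0])
      fix t assume t: "t \<ge> x0"
      show "\<bar>G (V k) j t - G U j t\<bar> \<le> 2 * (1/2) ^ k / 4 * (E' t * exp (- real 1 * E t))"
        by (rule Gd[OF goodV goodU j t]) (use close1[OF _ t, of _ k] in \<open>auto simp: abs_minus_commute\<close>)
    qed (use x in auto)
    have "(\<lambda>k. (1/2::real) ^ k) \<longlonglongrightarrow> 0" by (intro LIMSEQ_realpow_zero) auto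
    then have "(\<lambda>k. (2 * (1/2) ^ k / 4) * exp (- real 1 * E x)) \<longlonglongrightarrow> (2 * 0 / 4) * exp (- real 1 * E x)" by (intro tendsto_intros) auto
    then have "(\<lambda>k. (2 * (1/2) ^ k / 4) * exp (- real 1 * E x)) \<longlonglongrightarrow> 0" by simp
    moreover have "eventually (\<lambda>k. norm (tail_int (G (V k) j) x - tail_int (G U j) x) \<le> (2 * (1/2) ^ k / 4) * exp (- real 1 * E x)) sequentially"
      using b by (intro always_eventually) simp
    ultimately have "(\<lambda>k. tail_int (G (V k) j) x - tail_int (G U j) x) \<longlonglongrightarrow> 0" by (rule Lim_null_comparison[rotated])
    then have "(\<lambda>k. V (Suc k) j x) \<longlonglongrightarrow> tail_int (G U j) x" unfolding VS by (rule LIM_zero_cancel)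
    moreover have "(\<lambda>k. V (Suc k) j x) \<longlonglongrightarrow> U j x" using lim[OF j x] by (rule LIMSEQ_Suc)
    ultimately show ?thesis using LIMSEQ_unique by blast
  qed
  have dU: "(U j has_real_derivative G U j x) (at x)" if j: "j \<le> r" and x: "x > x0" for j x
    by (rule has_field_derivative_transform_within_open[OF tail_int(1)[OF Ga[OF goodU j] x], where S = "{x0<..}"])
      (use fixU j x in auto)
  \<comment> \<open>Closeness of order n + 1 to the zeroth iterate, which is 0, is used; the
    additional power absorbs the factor 2 of the geometric series.\<close>
  have dec: "eventually (\<lambda>x. \<bar>U j x\<bar> \<le> exp (- real n * E x)) at_top" if j: "j \<le> r" for j n
  proof -
    have "eventually (\<lambda>x. \<bar>\<Phi> x (\<lambda>j. 0)\<bar> \<le> exp (- real (Suc n) * E x) \<and> x \<ge> x0) at_top"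
      using small_ev[of "Suc n"] eventually_ge_at_top[of x0] by eventually_elim simp
    then obtain a0 where a0: "\<And>x. x \<ge> a0 \<Longrightarrow> \<bar>\<Phi> x (\<lambda>j. 0)\<bar> \<le> exp (- real (Suc n) * E x)"
      by (auto simp: eventually_at_top_linorder)
    define a where "a = max a0 x0"
    have sm: "\<bar>\<Phi> x (\<lambda>j. 0)\<bar> \<le> E' x / 4 * exp (- real (Suc n) * E x)" if "x \<ge> a" for x
    proof -
      have "\<bar>\<Phi> x (\<lambda>j. 0)\<bar> \<le> 1 * exp (- real (Suc n) * E x)" using a0[of x] that by (simp add: a_def)
      also have "\<dots> \<le> E' x / 4 * exp (- real (Suc n) * E x)" using E'4[of x] that by (intro mult_right_mono) (auto simp: a_def)
      finally show ?thesis .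
    qed
    have "((\<lambda>x. 2 * exp (- real 1 * E x)) \<longlongrightarrow> 0) at_top" by (rule weight_tendsto) simp
    then have "eventually (\<lambda>x. 2 * exp (- real 1 * E x) < 1) at_top" by (rule order_tendstoD(2)) simp
    then show ?thesis using eventually_ge_at_top[of a]
    proof eventually_elim
      case (elim x)
      have "\<bar>U j x - V 0 j x\<bar> \<le> 2 * (1/2) ^ 0 * exp (- real (Suc n) * E x)"
        by (rule close[OF _ _ sm j elim(2)]) (auto simp: a_def)
      then have "\<bar>U j x\<bar> \<le> 2 * exp (- real (Suc n) * E x)" by (simp add: V0)
      also have "\<dots> = (2 * exp (- real 1 * E x)) * exp (- real n * E x)"
        by (simp add: exp_add[symmetric] algebra_simps)
      also have "\<dots> \<le> 1 * exp (- real n * E x)" using elim(1) by (intro mult_right_mono) auto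
      finally show ?case by simp
    qed
  qed
  show ?thesis
  proof (intro exI[of _ U] conjI allI impI)
    show "(U j has_real_derivative U (Suc j) x) (at x)" if "j < r" "x > x0" for j x
      using dU[of j x] that by (simp add: G_def)
    show "(U r has_real_derivative \<Phi> x (\<lambda>j. U j x)) (at x)" if "x > x0" for x
      using dU[of r x] that by (simp add: G_def)
    show "\<bar>U j x\<bar> \<le> exp (- E x)" if "j \<le> r" "x \<ge> x0" for j x
      using goodU that by (simp add: good_def)
    show "eventually (\<lambda>x. \<bar>U j x\<bar> \<le> exp (- real n * E x)) at_top" if "j \<le> r" for j n
      by (rule dec[OF that])
  qed
qed

end

section \<open>Analytic copies of Hardy fields\<close>

text \<open>One step of pseudo-division: the combination cancels the coefficient of index
  \<open>N\<close>, so that the sum on the left may stop at \<open>N - 1\<close>. Multiplication by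
  the leading coefficient \<open>c n\<close> avoids a division.\<close>

lemma polynomial_reduction_step:
  fixes a c :: "nat \<Rightarrow> 'a::comm_ring_1"
  assumes "n \<le> N" "1 \<le> n"
  shows "(\<Sum>i\<le>N - 1. (c n * a i - a N * (if N - n \<le> i then c (i - (N - n)) else 0)) * y ^ i)
     = c n * (\<Sum>i\<le>N. a i * y ^ i) - a N * y ^ (N - n) * (\<Sum>i\<le>n. c i * y ^ i)"
proof -
  let ?c = "\<lambda>i. if N - n \<le> i then c (i - (N - n)) else 0"
  have N: "{..N} = insert N {..N - 1}" using assms by auto
  have "(\<Sum>i\<le>N. (c n * a i - a N * ?c i) * y ^ i) = (\<Sum>i\<le>N - 1. (c n * a i - a N * ?c i) * y ^ i)"
    unfolding N using assms by (subst sum.insert) auto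
  moreover have "(\<Sum>i\<le>N. (c n * a i - a N * ?c i) * y ^ i) = c n * (\<Sum>i\<le>N. a i * y ^ i) - a N * (\<Sum>i\<le>N. ?c i * y ^ i)"
    by (simp add: sum_distrib_left sum_subtractf algebra_simps)
  moreover have "(\<Sum>i\<le>N. ?c i * y ^ i) = y ^ (N - n) * (\<Sum>i\<le>n. c i * y ^ i)"
  proof -
    have "(\<Sum>i\<le>N. ?c i * y ^ i) = (\<Sum>i\<in>{N - n..N}. ?c i * y ^ i)"
      by (rule sum.mono_neutral_right) auto
    also have "\<dots> = (\<Sum>i\<in>{0 + (N - n)..n + (N - n)}. ?c i * y ^ i)" using assms by simp
    also have "\<dots> = (\<Sum>i\<in>{0..n}. ?c (i + (N - n)) * y ^ (i + (N - n)))" by (rule sum.shift_bounds_cl_nat_ivl)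
    also have "\<dots> = y ^ (N - n) * (\<Sum>i\<le>n. c i * y ^ i)"
      by (simp add: sum_distrib_left power_add mult_ac atLeast0AtMost)
    finally show ?thesis .
  qed
  ultimately show ?thesis by (simp add: mult.assoc)
qed

primrec ex_sum :: "(nat \<Rightarrow> 'c ex) \<Rightarrow> nat \<Rightarrow> 'c ex" where
  "ex_sum f 0 = f 0"
| "ex_sum f (Suc n) = Ad (ex_sum f n) (f (Suc n))"

lemma ev_ex_sum: "ev k v (ex_sum f n) = (\<Sum>i\<le>n. ev k v (f i))"
  by (induction n) auto
lemma coefs_ex_sum: "coefs (ex_sum f n) = (\<Union>i\<le>n. coefs (f i))"
  by (induction n) (auto simp: atMost_Suc)
lemma vars_ex_sum: "vars (ex_sum f n) = (\<Union>i\<le>n. vars (f i))"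
  by (induction n) (auto simp: atMost_Suc)

text \<open>Terms have no numerals, so the unit is passed in as the coefficient
  \<open>w\<close>.\<close>

primrec ex_pow :: "'c ex \<Rightarrow> 'c \<Rightarrow> nat \<Rightarrow> 'c ex" where
  "ex_pow e w 0 = Cf w"
| "ex_pow e w (Suc n) = Ml (ex_pow e w n) e"

lemma ev_ex_pow: "k w = 1 \<Longrightarrow> ev k v (ex_pow e w n) = ev k v e ^ n"
  by (induction n) auto
text \<open>Quantified over all real evaluations that send \<open>z\<close> to 0 and
  \<open>w\<close> to 1, so that one decomposition by powers of variable \<open>m\<close> holds for
  the original coefficients and for the copied ones alike.\<close>

definition decomposes :: "'c set \<Rightarrow> nat \<Rightarrow> 'c \<Rightarrow> 'c \<Rightarrow> 'c ex \<Rightarrow> nat \<Rightarrow> (nat \<Rightarrow> 'c ex) \<Rightarrow> bool" where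
  "decomposes C m z w e n c \<longleftrightarrow> (\<forall>i. coefs (c i) \<subseteq> C \<and> vars (c i) \<subseteq> {..<m}) \<and>
     (\<forall>(k::'c \<Rightarrow> real) v. k z = 0 \<and> k w = 1 \<longrightarrow> (\<forall>i>n. ev k v (c i) = 0) \<and> ev k v e = (\<Sum>i\<le>n. ev k v (c i) * v m ^ i))"

lemma decomposesD:
  assumes "decomposes C m z w e n c"
  shows "coefs (c i) \<subseteq> C \<and> vars (c i) \<subseteq> {..<m}"
    "k z = 0 \<and> k w = 1 \<Longrightarrow> (\<forall>i>n. ev k v (c i) = 0) \<and> ev (k :: _ \<Rightarrow> real) v e = (\<Sum>i\<le>n. ev k v (c i) * v m ^ i)"
  using assms unfolding decomposes_def by simp_all

lemma ex_decompose:
  fixes e :: "'c ex"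
  assumes "coefs e \<subseteq> C" "vars e \<subseteq> {..<Suc m}" "z \<in> C" "w \<in> C"
  shows "\<exists>n c. decomposes C m z w e n c"
  using assms(1,2)
proof (induction e)
  case (Cf x)
  then show ?case using assms(3) unfolding decomposes_def
    by (intro exI[of _ 0] exI[of _ "\<lambda>i. if i = 0 then Cf x else Cf z"]) auto
next
  case (Vr j)
  show ?case
  proof (cases "j = m")
    case True
    then show ?thesis using assms(3,4) unfolding decomposes_def
      by (intro exI[of _ 1] exI[of _ "\<lambda>i. if i = 1 then Cf w else Cf z"]) auto
  next
    case False
    then show ?thesis using Vr assms(3) unfolding decomposes_def
      by (intro exI[of _ 0] exI[of _ "\<lambda>i. if i = 0 then Vr j else Cf z"]) auto
  qed
next
  case (Ad p q)
  from Ad.IH(1) Ad.prems obtain n1 c1 where d1: "decomposes C m z w p n1 c1" by auto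
  from Ad.IH(2) Ad.prems obtain n2 c2 where d2: "decomposes C m z w q n2 c2" by auto
  note c1 = decomposesD[OF d1] and c2 = decomposesD[OF d2]
  define n where "n = max n1 n2"
  show ?case
    unfolding decomposes_def
  proof (rule exI[of _ n], rule exI[of _ "\<lambda>i. Ad (c1 i) (c2 i)"], intro conjI allI impI)
    fix k :: "'c \<Rightarrow> real" and v assume k: "k z = 0 \<and> k w = 1"
    show "ev k v (Ad (c1 i) (c2 i)) = 0" if "n < i" for i
      using c1(2)[OF k, of v] c2(2)[OF k, of v] that by (simp add: n_def)
    have "(\<Sum>i\<le>n1. ev k v (c1 i) * v m ^ i) = (\<Sum>i\<le>n. ev k v (c1 i) * v m ^ i)"
      using c1(2)[OF k, of v] by (intro sum.mono_neutral_left) (auto simp: n_def not_le)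
    then have "ev k v p = (\<Sum>i\<le>n. ev k v (c1 i) * v m ^ i)" using c1(2)[OF k, of v] by simp
    moreover have "(\<Sum>i\<le>n2. ev k v (c2 i) * v m ^ i) = (\<Sum>i\<le>n. ev k v (c2 i) * v m ^ i)"
      using c2(2)[OF k, of v] by (intro sum.mono_neutral_left) (auto simp: n_def not_le)
    then have "ev k v q = (\<Sum>i\<le>n. ev k v (c2 i) * v m ^ i)" using c2(2)[OF k, of v] by simp
    ultimately show "ev k v (Ad p q) = (\<Sum>i\<le>n. ev k v (Ad (c1 i) (c2 i)) * v m ^ i)"
      by (simp add: sum.distrib algebra_simps)
  qed (use c1 c2 in auto)
next
  case (Ml p q)
  from Ml.IH(1) Ml.prems obtain n1 c1 where d1: "decomposes C m z w p n1 c1" by auto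
  from Ml.IH(2) Ml.prems obtain n2 c2 where d2: "decomposes C m z w q n2 c2" by auto
  note c1 = decomposesD[OF d1] and c2 = decomposesD[OF d2]
  define c where "c i = ex_sum (\<lambda>l. Ml (c1 l) (c2 (i - l))) i" for i
  have evc: "ev k v (c i) = (\<Sum>l\<le>i. ev k v (c1 l) * ev k v (c2 (i - l)))" for k :: "'c \<Rightarrow> real" and v i
    by (simp add: c_def ev_ex_sum)
  show ?case
    unfolding decomposes_def
  proof (rule exI[of _ "n1 + n2"], rule exI[of _ c], intro conjI allI impI)
    have "coefs (Ml (c1 l) (c2 (i - l))) \<subseteq> C" "vars (Ml (c1 l) (c2 (i - l))) \<subseteq> {..<m}" for i l
      using c1(1)[of l] c2(1)[of "i - l"] by auto
    then show "coefs (c i) \<subseteq> C" "vars (c i) \<subseteq> {..<m}" for i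
      unfolding c_def coefs_ex_sum vars_ex_sum by blast+
    fix k :: "'c \<Rightarrow> real" and v assume k: "k z = 0 \<and> k w = 1"
    note e1 = c1(2)[OF k, of v] and e2 = c2(2)[OF k, of v]
    show "ev k v (c i) = 0" if i: "n1 + n2 < i" for i
      unfolding evc
    proof (intro sum.neutral ballI)
      fix l assume "l \<in> {..i}"
      show "ev k v (c1 l) * ev k v (c2 (i - l)) = 0"
        using e1 e2 i by (cases "n1 < l") auto
    qed
    show "ev k v (Ml p q) = (\<Sum>i\<le>n1 + n2. ev k v (c i) * v m ^ i)"
      unfolding ev.simps evc using e1 e2
      by (simp add: polynomial_product[of n1 "\<lambda>i. ev k v (c1 i)" n2 "\<lambda>i. ev k v (c2 i)"])
  qed
qed

text \<open>For a general germ this and \<open>germ_nonzero\<close> are not complementary; that one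
  of them holds is the dichotomy available inside a Hardy field.\<close>

definition germ_zero :: "(real \<Rightarrow> real) \<Rightarrow> bool" where
  "germ_zero f \<longleftrightarrow> eventually (\<lambda>x. f x = 0) at_top"
definition germ_nonzero :: "(real \<Rightarrow> real) \<Rightarrow> bool" where
  "germ_nonzero f \<longleftrightarrow> eventually (\<lambda>x. f x \<noteq> 0) at_top"

lemma germ_zero_nonzero_False: "germ_zero f \<Longrightarrow> germ_nonzero f \<Longrightarrow> False"
proof -
  assume "germ_zero f" "germ_nonzero f"
  then have "eventually (\<lambda>x::real. False) at_top" unfolding germ_zero_def germ_nonzero_def by eventually_elim simp
  then show False by simp
qed

definition fex :: "(real \<Rightarrow> real) ex \<Rightarrow> (nat \<Rightarrow> real \<Rightarrow> real) \<Rightarrow> real \<Rightarrow> real" where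
  "fex e Y x = ev (\<lambda>c. c x) (\<lambda>j. Y j x) e"

definition Expr :: "'c set \<Rightarrow> nat \<Rightarrow> 'c ex set" where
  "Expr C m = {e. coefs e \<subseteq> C \<and> vars e \<subseteq> {..<m}}"

lemma Expr_simps: "Cf c \<in> Expr C m \<longleftrightarrow> c \<in> C" "Vr j \<in> Expr C m \<longleftrightarrow> j < m"
  "Ad p q \<in> Expr C m \<longleftrightarrow> p \<in> Expr C m \<and> q \<in> Expr C m" "Ml p q \<in> Expr C m \<longleftrightarrow> p \<in> Expr C m \<and> q \<in> Expr C m"
  by (auto simp: Expr_def)

lemma Expr_mono: "m \<le> n \<Longrightarrow> C \<subseteq> D \<Longrightarrow> e \<in> Expr C m \<Longrightarrow> e \<in> Expr D n"
  by (auto simp: Expr_def)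

type_synonym rpair = "(real \<Rightarrow> real) \<times> (real \<Rightarrow> real)"

text \<open>An expression whose coefficients are pairs \<open>(a, a*)\<close> encodes a differential polynomial together with
its analytic copy: \<open>ev1\<close> reads off the original, \<open>ev2\<close> the copy.\<close>

definition ev1 :: "(nat \<Rightarrow> real \<Rightarrow> real) \<Rightarrow> rpair ex \<Rightarrow> real \<Rightarrow> real" where
  "ev1 Y e x = ev (\<lambda>c. fst c x) (\<lambda>j. Y j x) e"
definition ev2 :: "(nat \<Rightarrow> real \<Rightarrow> real) \<Rightarrow> rpair ex \<Rightarrow> real \<Rightarrow> real" where
  "ev2 Z e x = ev (\<lambda>c. snd c x) (\<lambda>j. Z j x) e"

text \<open>\<open>Y j\<close> is transcendental over the ring generated by the first components of \<open>\<rho>\<close> and \<open>Y 0, ..., Y (j - 1)\<close>.\<close>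

definition transc :: "rpair set \<Rightarrow> (nat \<Rightarrow> real \<Rightarrow> real) \<Rightarrow> nat \<Rightarrow> bool" where
  "transc \<rho> Y j \<longleftrightarrow> (\<forall>n c. (\<forall>i\<le>n. c i \<in> Expr \<rho> j) \<and> germ_zero (\<lambda>x. \<Sum>i\<le>n. ev1 Y (c i) x * Y j x ^ i) \<longrightarrow> (\<forall>i\<le>n. germ_zero (ev1 Y (c i))))"

text \<open>This inclusion of kernels makes the assignment of \<open>Z j\<close> to
  \<open>Y j\<close>, on top of the given pairs of coefficients, a well-defined ring homomorphism on
  polynomials in the first \<open>m\<close> variables.\<close>

definition zero_pres :: "rpair set \<Rightarrow> (nat \<Rightarrow> real \<Rightarrow> real) \<Rightarrow> (nat \<Rightarrow> real \<Rightarrow> real) \<Rightarrow> nat \<Rightarrow> bool" where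
  "zero_pres \<rho> Y Z m \<longleftrightarrow> (\<forall>e\<in>Expr \<rho> m. germ_zero (ev1 Y e) \<longrightarrow> germ_zero (ev2 Z e))"

lemma germ_zero_sum:
  assumes "finite A" "\<And>i. i \<in> A \<Longrightarrow> germ_zero (f i)"
  shows "germ_zero (\<lambda>x. \<Sum>i\<in>A. f i x * g i x)"
proof -
  have "eventually (\<lambda>x. \<forall>i\<in>A. f i x = 0) at_top"
    using assms unfolding germ_zero_def by (intro eventually_ball_finite) auto
  then show ?thesis unfolding germ_zero_def by eventually_elim (simp)
qed

lemma germ_zero_cong: "germ_zero f \<Longrightarrow> eventually (\<lambda>x. f x = g x) at_top \<Longrightarrow> germ_zero g"
  unfolding germ_zero_def by (erule (1) eventually_elim2) simp

abbreviation "zero_pair \<equiv> ((\<lambda>x. 0, \<lambda>x. 0) :: rpair)"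
abbreviation "one_pair \<equiv> ((\<lambda>x. 1, \<lambda>x. 1) :: rpair)"

lemma Expr_pair_decompose:
  assumes e: "e \<in> Expr \<rho> (Suc m)" and z: "zero_pair \<in> \<rho>" "one_pair \<in> \<rho>"
  obtains n c where "\<And>i. c i \<in> Expr \<rho> m" "\<And>Y x. ev1 Y e x = (\<Sum>i\<le>n. ev1 Y (c i) x * Y m x ^ i)"
    "\<And>Y x. ev2 Y e x = (\<Sum>i\<le>n. ev2 Y (c i) x * Y m x ^ i)"
proof -
  have "coefs e \<subseteq> \<rho>" "vars e \<subseteq> {..<Suc m}" using e by (auto simp: Expr_def)
  from ex_decompose[OF this z] obtain n c where "decomposes \<rho> m zero_pair one_pair e n c" by auto
  note c = decomposesD[OF this]
  show ?thesis
  proof (rule that)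
    show "c i \<in> Expr \<rho> m" for i using c(1) by (simp add: Expr_def)
    show "ev1 Y e x = (\<Sum>i\<le>n. ev1 Y (c i) x * Y m x ^ i)" for Y x unfolding ev1_def by (rule conjunct2[OF c(2)]) simp
    show "ev2 Y e x = (\<Sum>i\<le>n. ev2 Y (c i) x * Y m x ^ i)" for Y x unfolding ev2_def by (rule conjunct2[OF c(2)]) simp
  qed
qed

text \<open>A transcendental \<open>Y m\<close> satisfies only trivial relations over the ring
  below, so \<open>Z m\<close> is unrestricted.\<close>

lemma zero_pres_transc:
  assumes zp: "zero_pres \<rho> Y Z m" and t: "transc \<rho> Y m" and z: "zero_pair \<in> \<rho>" "one_pair \<in> \<rho>"
  shows "zero_pres \<rho> Y Z (Suc m)"
  unfolding zero_pres_def
proof (intro ballI impI)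
  fix e assume e: "e \<in> Expr \<rho> (Suc m)" and 0: "germ_zero (ev1 Y e)"
  obtain n c where c: "\<And>i. c i \<in> Expr \<rho> m" "\<And>Y x. ev1 Y e x = (\<Sum>i\<le>n. ev1 Y (c i) x * Y m x ^ i)"
    "\<And>Y x. ev2 Y e x = (\<Sum>i\<le>n. ev2 Y (c i) x * Y m x ^ i)" by (rule Expr_pair_decompose[OF e z]) (rule that)
  have "germ_zero (\<lambda>x. \<Sum>i\<le>n. ev1 Y (c i) x * Y m x ^ i)" using 0 c(2) by (simp add: germ_zero_def)
  then have "\<forall>i\<le>n. germ_zero (ev1 Y (c i))" using t c(1) unfolding transc_def by blast
  then have "\<forall>i\<le>n. germ_zero (ev2 Z (c i))" using zp c(1) unfolding zero_pres_def by blast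
  then have "germ_zero (\<lambda>x. \<Sum>i\<le>n. ev2 Z (c i) x * Z m x ^ i)" by (intro germ_zero_sum) auto
  then show "germ_zero (ev2 Z e)" using c(3) by (simp add: germ_zero_def)
qed

lemma ev12_simps: "ev1 Y (Ad p q) x = ev1 Y p x + ev1 Y q x" "ev2 Y (Ad p q) x = ev2 Y p x + ev2 Y q x"
  "ev1 Y (Ml p q) x = ev1 Y p x * ev1 Y q x" "ev2 Y (Ml p q) x = ev2 Y p x * ev2 Y q x"
  "ev1 Y (Cf c) x = fst c x" "ev2 Y (Cf c) x = snd c x" "ev1 Y (Vr j) x = Y j x" "ev2 Y (Vr j) x = Y j x"
  by (simp_all add: ev1_def ev2_def)

text \<open>\<open>c\<close> is a relation of minimal degree for \<open>Y m\<close>, and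
  \<open>Z m\<close> satisfies its copy. Any other relation is lowered in degree by pseudo-division
  through \<open>c\<close> until minimality forces its coefficients to vanish. The same steps on the
  copies, followed by cancelling the nonzero leading coefficient of the copied \<open>c\<close>,
  give the copied relation.\<close>

lemma zero_pres_algebraic:
  assumes zp: "zero_pres \<rho> Y Z m" and z: "zero_pair \<in> \<rho>" "one_pair \<in> \<rho>" "(\<lambda>x. -1, \<lambda>x. -1) \<in> \<rho>"
    and c: "\<And>i. i \<le> n \<Longrightarrow> c i \<in> Expr \<rho> m" and n: "n \<ge> 1"
    and c1: "germ_zero (\<lambda>x. \<Sum>i\<le>n. ev1 Y (c i) x * Y m x ^ i)"
    and c2: "germ_zero (\<lambda>x. \<Sum>i\<le>n. ev2 Z (c i) x * Z m x ^ i)"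
    and top: "germ_nonzero (ev2 Z (c n))"
    and min: "\<And>N d. N < n \<Longrightarrow> (\<And>i. i \<le> N \<Longrightarrow> d i \<in> Expr \<rho> m) \<Longrightarrow> germ_zero (\<lambda>x. \<Sum>i\<le>N. ev1 Y (d i) x * Y m x ^ i) \<Longrightarrow> (\<And>i. i \<le> N \<Longrightarrow> germ_zero (ev1 Y (d i)))"
  shows "zero_pres \<rho> Y Z (Suc m)"
proof -
  have main: "germ_zero (\<lambda>x. \<Sum>i\<le>N. ev2 Z (d i) x * Z m x ^ i)"
    if "\<And>i. i \<le> N \<Longrightarrow> d i \<in> Expr \<rho> m" "germ_zero (\<lambda>x. \<Sum>i\<le>N. ev1 Y (d i) x * Y m x ^ i)" for N d
    using that
  proof (induction N arbitrary: d rule: less_induct)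
    case (less N)
    show ?case
    proof (cases "N < n")
      case True
      have "germ_zero (ev1 Y (d i))" if "i \<le> N" for i by (rule min[OF True less.prems that])
      then have "germ_zero (ev2 Z (d i))" if "i \<le> N" for i using zp less.prems(1) that unfolding zero_pres_def by blast
      then show ?thesis by (intro germ_zero_sum) auto
    next
      case False
      then have nN: "n \<le> N" by simp
      \<comment> \<open>Coefficients of \<open>c\<close> multiplied by the power N - n of the
        variable.\<close>
      define s where "s i = (if N - n \<le> i then c (i - (N - n)) else Cf zero_pair)" for i
      define d' where "d' i = Ad (Ml (c n) (d i)) (Ml (Cf (\<lambda>x. -1, \<lambda>x. -1)) (Ml (d N) (s i)))" for i
      have e1: "ev1 Y (d' i) x = ev1 Y (c n) x * ev1 Y (d i) x - ev1 Y (d N) x * (if N - n \<le> i then ev1 Y (c (i - (N - n))) x else 0)" for i x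
        by (simp add: d'_def s_def ev12_simps)
      have e2: "ev2 Z (d' i) x = ev2 Z (c n) x * ev2 Z (d i) x - ev2 Z (d N) x * (if N - n \<le> i then ev2 Z (c (i - (N - n))) x else 0)" for i x
        by (simp add: d'_def s_def ev12_simps)
      note r1 = polynomial_reduction_step[OF nN n, of "\<lambda>i. ev1 Y (c i) x" "\<lambda>i. ev1 Y (d i) x" "Y m x" for x]
      note r2 = polynomial_reduction_step[OF nN n, of "\<lambda>i. ev2 Z (c i) x" "\<lambda>i. ev2 Z (d i) x" "Z m x" for x]
      have "germ_zero (\<lambda>x. \<Sum>i\<le>N - 1. ev2 Z (d' i) x * Z m x ^ i)"
      proof (rule less.IH)
        show "N - 1 < N" using n nN by simp
        show "d' i \<in> Expr \<rho> m" if "i \<le> N - 1" for i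
          using c less.prems(1) that nN z by (auto simp: d'_def s_def Expr_simps)
        show "germ_zero (\<lambda>x. \<Sum>i\<le>N - 1. ev1 Y (d' i) x * Y m x ^ i)"
          using c1 less.prems(2) unfolding e1 r1 germ_zero_def by eventually_elim simp
      qed
      then have "germ_zero (\<lambda>x. ev2 Z (c n) x * (\<Sum>i\<le>N. ev2 Z (d i) x * Z m x ^ i) - ev2 Z (d N) x * Z m x ^ (N - n) * (\<Sum>i\<le>n. ev2 Z (c i) x * Z m x ^ i))"
        unfolding e2 r2 .
      then show ?thesis using c2 top unfolding germ_zero_def germ_nonzero_def by eventually_elim auto
    qed
  qed
  show ?thesis unfolding zero_pres_def
  proof (intro ballI impI)
    fix e assume e: "e \<in> Expr \<rho> (Suc m)" and 0: "germ_zero (ev1 Y e)"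
    obtain N d where d: "\<And>i. d i \<in> Expr \<rho> m" "\<And>Y x. ev1 Y e x = (\<Sum>i\<le>N. ev1 Y (d i) x * Y m x ^ i)"
      "\<And>Y x. ev2 Y e x = (\<Sum>i\<le>N. ev2 Y (d i) x * Y m x ^ i)" by (rule Expr_pair_decompose[OF e z(1,2)]) (rule that)
    have "germ_zero (\<lambda>x. \<Sum>i\<le>N. ev1 Y (d i) x * Y m x ^ i)" using 0 d(2) by (simp add: germ_zero_def)
    from main[OF d(1) this] show "germ_zero (ev2 Z e)" using d(3) by (simp add: germ_zero_def)
  qed
qed

section \<open>Negligible errors and copies of a dominated field\<close>

text \<open>The bound by \<open>E\<close> lets negligible errors absorb factors from
  \<open>K\<close>; the bound by \<open>E'\<close> lets \<open>E'\<close> serve as Lipschitz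
  constant in the perturbed equations. Monotonicity carries lower bounds prescribed at integers to
  all later arguments.\<close>

locale gauged =
  fixes K :: "(real \<Rightarrow> real) set" and E E' :: "real \<Rightarrow> real"
  assumes K: "hardy_field K"
    and E_deriv: "\<And>x. (E has_real_derivative E' x) (at x)"
    and E_lim: "filterlim E at_top at_top"
    and E_mono: "mono E"
    and dom: "\<And>f. f \<in> K \<Longrightarrow> eventually (\<lambda>x. \<bar>f x\<bar> \<le> E x \<and> \<bar>f x\<bar> \<le> E' x) at_top"
begin

definition negl :: "(real \<Rightarrow> real) \<Rightarrow> bool" where
  "negl d \<longleftrightarrow> (\<forall>n::nat. eventually (\<lambda>x. \<bar>d x\<bar> \<le> exp (- real n * E x)) at_top)"

lemma E_ge: "eventually (\<lambda>x. E x \<ge> c) at_top"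
  using E_lim unfolding filterlim_at_top by blast

text \<open>As \<open>E\<close> and 2 are eventually at most exp E, a factor \<open>E\<close> or 2
  costs one power of exp (- E), and a negligible function has all powers to spare.\<close>

lemma exp_weight_absorb: "eventually (\<lambda>x. \<forall>n::nat. E x * exp (- real (Suc n) * E x) \<le> exp (- real n * E x) \<and> 2 * exp (- real (Suc n) * E x) \<le> exp (- real n * E x)) at_top"
  using E_ge[of 1]
proof eventually_elim
  case (elim x)
  show ?case
  proof
    fix n :: nat
    have e: "exp (- real n * E x) = exp (E x) * exp (- real (Suc n) * E x)"
      by (simp add: exp_add[symmetric] algebra_simps)
    have "E x \<le> exp (E x)" using exp_ge_add_one_self[of "E x"] by linarith
    moreover have "2 \<le> exp (E x)" using exp_ge_add_one_self[of "E x"] elim by linarith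
    ultimately show "E x * exp (- real (Suc n) * E x) \<le> exp (- real n * E x) \<and> 2 * exp (- real (Suc n) * E x) \<le> exp (- real n * E x)"
      unfolding e by (intro conjI mult_right_mono) auto
  qed
qed

lemma neglI: "(\<And>n::nat. eventually (\<lambda>x. \<bar>d x\<bar> \<le> exp (- real n * E x)) at_top) \<Longrightarrow> negl d"
  unfolding negl_def by blast

lemma neglD: "negl d \<Longrightarrow> eventually (\<lambda>x. \<bar>d x\<bar> \<le> exp (- real n * E x)) at_top"
  unfolding negl_def by blast

lemma negl_le: assumes "negl d" "eventually (\<lambda>x. \<bar>d' x\<bar> \<le> \<bar>d x\<bar>) at_top" shows "negl d'"
proof (rule neglI)
  fix n :: nat
  show "eventually (\<lambda>x. \<bar>d' x\<bar> \<le> exp (- real n * E x)) at_top"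
    using neglD[OF assms(1), of n] assms(2) by eventually_elim linarith
qed

lemma negl_cong: "negl d \<Longrightarrow> eventually (\<lambda>x. d x = d' x) at_top \<Longrightarrow> negl d'"
  by (erule negl_le) (auto elim: eventually_mono)

lemma negl_zero: "negl (\<lambda>x. 0)" by (rule neglI) simp

lemma negl_add: assumes "negl d" "negl d'" shows "negl (\<lambda>x. d x + d' x)"
proof (rule neglI)
  fix n :: nat
  show "eventually (\<lambda>x. \<bar>d x + d' x\<bar> \<le> exp (- real n * E x)) at_top"
    using neglD[OF assms(1), of "Suc n"] neglD[OF assms(2), of "Suc n"] exp_weight_absorb
  proof eventually_elim
    case (elim x)
    have "2 * exp (- real (Suc n) * E x) \<le> exp (- real n * E x)" using elim(3) by blast
    then show ?case using elim(1,2) by linarith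
  qed
qed

lemma negl_minus: "negl d \<Longrightarrow> negl (\<lambda>x. - d x)"
  by (erule negl_le) auto

lemma negl_mult:
  assumes "negl d" "eventually (\<lambda>x. \<bar>f x\<bar> \<le> E x) at_top"
  shows "negl (\<lambda>x. f x * d x)"
proof (rule neglI)
  fix n :: nat
  show "eventually (\<lambda>x. \<bar>f x * d x\<bar> \<le> exp (- real n * E x)) at_top"
    using neglD[OF assms(1), of "Suc n"] assms(2) exp_weight_absorb
  proof eventually_elim
    case (elim x)
    have "\<bar>f x * d x\<bar> \<le> E x * exp (- real (Suc n) * E x)"
      unfolding abs_mult using elim by (intro mult_mono) auto
    also have "\<dots> \<le> exp (- real n * E x)" using elim(3) by blast
    finally show ?case .
  qed
qed

lemma dom1: "f \<in> K \<Longrightarrow> eventually (\<lambda>x. \<bar>f x\<bar> \<le> E x) at_top"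
  using dom by (blast intro: eventually_mono)

lemma negl_mult_K: "negl d \<Longrightarrow> f \<in> K \<Longrightarrow> negl (\<lambda>x. f x * d x)"
  by (rule negl_mult[OF _ dom1])

lemma negl_mult_negl: assumes "negl d" "negl d'" shows "negl (\<lambda>x. d x * d' x)"
proof (rule negl_mult[OF assms(2)])
  show "eventually (\<lambda>x. \<bar>d x\<bar> \<le> E x) at_top"
    using neglD[OF assms(1), of 0] E_ge[of 1] by eventually_elim simp
qed

lemmas Kcong = hardy_fieldD(1)[OF K] and KC = hardy_fieldD(2)[OF K] and K0 = hardy_fieldD(3)[OF K] and K1 = hardy_fieldD(4)[OF K]
  and Kadd = hardy_fieldD(5)[OF K] and Kmult = hardy_fieldD(6)[OF K] and Kminus = hardy_fieldD(7)[OF K] and Kderiv = hardy_fieldD(8)[OF K]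
  and Kinv = hardy_field_inverse[OF K]

lemma K_zn: "f \<in> K \<Longrightarrow> germ_zero f \<or> germ_nonzero f"
  using hardy_field_zero_or_nonzero[OF K] unfolding germ_zero_def germ_nonzero_def by blast

lemma K_derivs: "f \<in> K \<Longrightarrow> (deriv ^^ n) f \<in> K"
  by (induction n) (auto intro: Kderiv)

text \<open>The inverse of \<open>f\<close> lies in \<open>K\<close> as well and is therefore at
  most \<open>E\<close>. The factor 2 leaves half of \<bar>f\<bar> after an error of size exp (- 2
  E).\<close>

lemma K_nonzero_lower:
  assumes "f \<in> K" "germ_nonzero f"
  shows "eventually (\<lambda>x. \<bar>f x\<bar> \<ge> 2 * exp (- 2 * E x)) at_top"
proof -
  have "eventually (\<lambda>x. \<bar>inverse (f x)\<bar> \<le> E x) at_top" by (rule dom1[OF Kinv[OF assms(1)]])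
  then show ?thesis using assms(2) exp_weight_absorb unfolding germ_nonzero_def
  proof eventually_elim
    case (elim x)
    have a: "E x * exp (- real (Suc 0) * E x) \<le> 1" "2 * exp (- real (Suc 1) * E x) \<le> exp (- real 1 * E x)"
      using elim(3)[rule_format, of 0] elim(3)[rule_format, of 1] by auto
    have "1 = \<bar>f x\<bar> * \<bar>inverse (f x)\<bar>" using elim by (simp add: abs_mult[symmetric])
    also have "\<dots> \<le> \<bar>f x\<bar> * E x" using elim by (intro mult_left_mono) auto
    finally have "1 * exp (- E x) \<le> \<bar>f x\<bar> * E x * exp (- E x)" by (intro mult_right_mono) auto
    also have "\<dots> \<le> \<bar>f x\<bar> * 1" unfolding mult.assoc using a(1) by (intro mult_left_mono) auto
    finally show ?case using a(2) by simp
  qed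
qed

lemma near_nonzero:
  assumes "f \<in> K" "germ_nonzero f" "negl (\<lambda>x. g x - f x)"
  shows "germ_nonzero g" "eventually (\<lambda>x. \<bar>inverse (g x)\<bar> \<le> 2 * \<bar>inverse (f x)\<bar>) at_top"
proof -
  have "eventually (\<lambda>x. \<bar>g x\<bar> \<ge> \<bar>f x\<bar> / 2 \<and> f x \<noteq> 0) at_top"
    using K_nonzero_lower[OF assms(1,2)] neglD[OF assms(3), of 2] assms(2) unfolding germ_nonzero_def
    by eventually_elim auto
  note ev = this
  show "germ_nonzero g" using ev unfolding germ_nonzero_def by eventually_elim auto
  show "eventually (\<lambda>x. \<bar>inverse (g x)\<bar> \<le> 2 * \<bar>inverse (f x)\<bar>) at_top"
    using ev
  proof eventually_elim
    case (elim x)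
    then have "inverse \<bar>g x\<bar> \<le> inverse (\<bar>f x\<bar> / 2)" by (intro le_imp_inverse_le) auto
    then show ?case by (simp add: field_simps)
  qed
qed

text \<open>The graph of a ring isomorphism onto analytic germs that moves every germ by a negligible amount.\<close>

definition copy_ring :: "rpair set \<Rightarrow> bool" where
  "copy_ring \<rho> \<longleftrightarrow>
    (\<forall>a b a' b'. (a, b) \<in> \<rho> \<and> eventually (\<lambda>x. a x = a' x) at_top \<and> eventually (\<lambda>x. b x = b' x) at_top \<longrightarrow> (a', b') \<in> \<rho>) \<and>
    (\<lambda>x. 1, \<lambda>x. 1) \<in> \<rho> \<and>
    (\<forall>a b c d. (a, b) \<in> \<rho> \<and> (c, d) \<in> \<rho> \<longrightarrow> (\<lambda>x. a x + c x, \<lambda>x. b x + d x) \<in> \<rho> \<and> (\<lambda>x. a x * c x, \<lambda>x. b x * d x) \<in> \<rho>) \<and>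
    (\<forall>a b. (a, b) \<in> \<rho> \<longrightarrow> (\<lambda>x. - a x, \<lambda>x. - b x) \<in> \<rho>) \<and>
    (\<forall>a b. (a, b) \<in> \<rho> \<longrightarrow> a \<in> K \<and> b \<in> germ_C_omega \<and> negl (\<lambda>x. b x - a x) \<and> (germ_zero a \<longrightarrow> germ_zero b))"

lemma copy_ringD:
  assumes "copy_ring \<rho>"
  shows "\<And>a b a' b'. (a, b) \<in> \<rho> \<Longrightarrow> eventually (\<lambda>x. a x = a' x) at_top \<Longrightarrow> eventually (\<lambda>x. b x = b' x) at_top \<Longrightarrow> (a', b') \<in> \<rho>"
    "(\<lambda>x. 1, \<lambda>x. 1) \<in> \<rho>"
    "\<And>a b c d. (a, b) \<in> \<rho> \<Longrightarrow> (c, d) \<in> \<rho> \<Longrightarrow> (\<lambda>x. a x + c x, \<lambda>x. b x + d x) \<in> \<rho>"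
    "\<And>a b c d. (a, b) \<in> \<rho> \<Longrightarrow> (c, d) \<in> \<rho> \<Longrightarrow> (\<lambda>x. a x * c x, \<lambda>x. b x * d x) \<in> \<rho>"
    "\<And>a b. (a, b) \<in> \<rho> \<Longrightarrow> (\<lambda>x. - a x, \<lambda>x. - b x) \<in> \<rho>"
    "\<And>a b. (a, b) \<in> \<rho> \<Longrightarrow> a \<in> K" "\<And>a b. (a, b) \<in> \<rho> \<Longrightarrow> b \<in> germ_C_omega"
    "\<And>a b. (a, b) \<in> \<rho> \<Longrightarrow> negl (\<lambda>x. b x - a x)" "\<And>a b. (a, b) \<in> \<rho> \<Longrightarrow> germ_zero a \<Longrightarrow> germ_zero b"
  using assms unfolding copy_ring_def by simp_all

lemma copy_ringI:
  assumes "\<And>a b a' b'. (a, b) \<in> \<rho> \<Longrightarrow> eventually (\<lambda>x. a x = a' x) at_top \<Longrightarrow> eventually (\<lambda>x. b x = b' x) at_top \<Longrightarrow> (a', b') \<in> \<rho>"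
    "(\<lambda>x. 1, \<lambda>x. 1) \<in> \<rho>"
    "\<And>a b c d. (a, b) \<in> \<rho> \<Longrightarrow> (c, d) \<in> \<rho> \<Longrightarrow> (\<lambda>x. a x + c x, \<lambda>x. b x + d x) \<in> \<rho>"
    "\<And>a b c d. (a, b) \<in> \<rho> \<Longrightarrow> (c, d) \<in> \<rho> \<Longrightarrow> (\<lambda>x. a x * c x, \<lambda>x. b x * d x) \<in> \<rho>"
    "\<And>a b. (a, b) \<in> \<rho> \<Longrightarrow> (\<lambda>x. - a x, \<lambda>x. - b x) \<in> \<rho>"
    "\<And>a b. (a, b) \<in> \<rho> \<Longrightarrow> a \<in> K" "\<And>a b. (a, b) \<in> \<rho> \<Longrightarrow> b \<in> germ_C_omega"
    "\<And>a b. (a, b) \<in> \<rho> \<Longrightarrow> negl (\<lambda>x. b x - a x)" "\<And>a b. (a, b) \<in> \<rho> \<Longrightarrow> germ_zero a \<Longrightarrow> germ_zero b"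
  shows "copy_ring \<rho>"
  unfolding copy_ring_def
  apply (intro conjI allI impI; (elim conjE)?)
         apply (erule (2) assms(1))
        apply (rule assms(2))
       apply (erule (1) assms(3))
      apply (erule (1) assms(4))
     apply (erule assms(5))
    apply (erule assms(6))
   apply (erule assms(7))
  apply (erule assms(8))
  apply (erule (1) assms(9))
  done

text \<open>Closeness alone rules out a zero copy of a nonzero germ; this is injectivity of the
  copying homomorphism.\<close>

lemma copy_ring_nonzero:
  assumes "copy_ring \<rho>" "(a, b) \<in> \<rho>" "germ_nonzero a" shows "germ_nonzero b"
  by (rule near_nonzero(1)[OF copy_ringD(6)[OF assms(1,2)] assms(3) copy_ringD(8)[OF assms(1,2)]])

lemma copy_ring_consts:
  assumes "copy_ring \<rho>" shows "zero_pair \<in> \<rho>" "(\<lambda>x. -1, \<lambda>x. -1) \<in> \<rho>"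
proof -
  show m: "(\<lambda>x. -1, \<lambda>x. -1) \<in> \<rho>" by (rule copy_ringD(5)[OF assms copy_ringD(2)[OF assms]])
  show "zero_pair \<in> \<rho>" using copy_ringD(3)[OF assms copy_ringD(2)[OF assms] m] by simp
qed

definition fracp :: "rpair set \<Rightarrow> rpair set" where
  "fracp \<rho> = {(a, b). \<exists>p p' q q'. (p, p') \<in> \<rho> \<and> (q, q') \<in> \<rho> \<and> germ_nonzero q \<and>
     eventually (\<lambda>x. a x = p x * inverse (q x)) at_top \<and> eventually (\<lambda>x. b x = p' x * inverse (q' x)) at_top}"

lemma fracpI:
  assumes "(p, p') \<in> \<rho>" "(q, q') \<in> \<rho>" "germ_nonzero q"
     "eventually (\<lambda>x. a x = p x * inverse (q x)) at_top" "eventually (\<lambda>x. b x = p' x * inverse (q' x)) at_top"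
  shows "(a, b) \<in> fracp \<rho>"
  unfolding fracp_def using assms by auto

lemma fracpE:
  assumes "(a, b) \<in> fracp \<rho>"
  obtains p p' q q' where "(p, p') \<in> \<rho>" "(q, q') \<in> \<rho>" "germ_nonzero q"
     "eventually (\<lambda>x. a x = p x * inverse (q x)) at_top" "eventually (\<lambda>x. b x = p' x * inverse (q' x)) at_top"
  using assms unfolding fracp_def by auto

lemma subset_fracp: assumes "copy_ring \<rho>" shows "\<rho> \<subseteq> fracp \<rho>"
proof (rule subrelI)
  fix a b assume "(a, b) \<in> \<rho>"
  then show "(a, b) \<in> fracp \<rho>"
    by (rule fracpI[OF _ copy_ringD(2)[OF assms]]) (auto simp: germ_nonzero_def)
qed

lemma germ_nonzero_mult: "germ_nonzero p \<Longrightarrow> germ_nonzero q \<Longrightarrow> germ_nonzero (\<lambda>x. p x * q x)"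
  unfolding germ_nonzero_def by (erule (1) eventually_elim2) simp

text \<open>The difference is (q (p' - p) - p (q' - q)) / (q q'), primes denoting copies, and 1 / q'
  is at most twice 1 / q in absolute value. What remains is a negligible function times factors from
  \<open>K\<close>.\<close>

lemma fracp_near:
  assumes r: "copy_ring \<rho>" and p: "(p, p') \<in> \<rho>" and q: "(q, q') \<in> \<rho>" "germ_nonzero q"
  shows "negl (\<lambda>x. p' x * inverse (q' x) - p x * inverse (q x))"
proof -
  note q'0 = copy_ring_nonzero[OF r q]
  note K' = copy_ringD(6)[OF r p] copy_ringD(6)[OF r q(1)]
  have 1: "negl (\<lambda>x. q x * (p' x - p x) + - (p x * (q' x - q x)))"
    by (intro negl_add negl_minus negl_mult_K copy_ringD(8)[OF r] p q K')
  have 2: "negl (\<lambda>x. (2 * inverse (q x) * inverse (q x)) * (q x * (p' x - p x) + - (p x * (q' x - q x))))"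
    using Kmult[OF Kmult[OF Kadd[OF K1 K1] Kinv[OF K'(2)]] Kinv[OF K'(2)]] by (intro negl_mult_K[OF 1]) simp
  show ?thesis
  proof (rule negl_le[OF 2])
    show "eventually (\<lambda>x. \<bar>p' x * inverse (q' x) - p x * inverse (q x)\<bar> \<le> \<bar>(2 * inverse (q x) * inverse (q x)) * (q x * (p' x - p x) + - (p x * (q' x - q x)))\<bar>) at_top"
      using near_nonzero(2)[OF K'(2) q(2) copy_ringD(8)[OF r q(1)]] q'0 q(2) unfolding germ_nonzero_def
    proof eventually_elim
      case (elim x)
      have "p' x * inverse (q' x) - p x * inverse (q x) = (inverse (q' x) * inverse (q x)) * (q x * (p' x - p x) + - (p x * (q' x - q x)))"
        using elim by (simp add: field_simps)
      also have "\<bar>\<dots>\<bar> = (\<bar>inverse (q' x)\<bar> * \<bar>inverse (q x)\<bar>) * \<bar>q x * (p' x - p x) + - (p x * (q' x - q x))\<bar>" by (simp only: abs_mult)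
      also have "\<dots> \<le> ((2 * \<bar>inverse (q x)\<bar>) * \<bar>inverse (q x)\<bar>) * \<bar>q x * (p' x - p x) + - (p x * (q' x - q x))\<bar>"
        using elim by (intro mult_right_mono) auto
      also have "\<dots> = \<bar>(2 * inverse (q x) * inverse (q x)) * (q x * (p' x - p x) + - (p x * (q' x - q x)))\<bar>" by (simp add: abs_mult)
      finally show ?case .
    qed
  qed
qed

lemma copy_ring_fracp:
  assumes r: "copy_ring \<rho>" shows "copy_ring (fracp \<rho>)"
proof (rule copy_ringI)
  show "one_pair \<in> fracp \<rho>" using subset_fracp[OF r] copy_ringD(2)[OF r] by (rule subsetD)
next
  fix a b a' b' assume ab: "(a, b) \<in> fracp \<rho>" and e: "eventually (\<lambda>x. a x = a' x) at_top" "eventually (\<lambda>x. b x = b' x) at_top"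
  from ab obtain p p' q q' where pq: "(p, p') \<in> \<rho>" "(q, q') \<in> \<rho>" "germ_nonzero q"
     "eventually (\<lambda>x. a x = p x * inverse (q x)) at_top" "eventually (\<lambda>x. b x = p' x * inverse (q' x)) at_top" by (rule fracpE)
  show "(a', b') \<in> fracp \<rho>"
    by (rule fracpI[OF pq(1-3)]) (use pq(4) e(1) in \<open>eventually_elim, simp\<close>, use pq(5) e(2) in \<open>eventually_elim, simp\<close>)
next
  fix a b assume ab: "(a, b) \<in> fracp \<rho>"
  from ab obtain p p' q q' where pq: "(p, p') \<in> \<rho>" "(q, q') \<in> \<rho>" "germ_nonzero q"
     "eventually (\<lambda>x. a x = p x * inverse (q x)) at_top" "eventually (\<lambda>x. b x = p' x * inverse (q' x)) at_top" by (rule fracpE)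
  note K' = copy_ringD(6)[OF r pq(1)] copy_ringD(6)[OF r pq(2)] and W = copy_ringD(7)[OF r pq(1)] copy_ringD(7)[OF r pq(2)]
  note q'0 = copy_ring_nonzero[OF r pq(2,3)]
  have sym: "eventually (\<lambda>x. p x * inverse (q x) = a x) at_top" "eventually (\<lambda>x. p' x * inverse (q' x) = b x) at_top"
    using pq(4,5) by (auto elim: eventually_mono)
  show "a \<in> K" by (rule Kcong[OF Kmult[OF K'(1) Kinv[OF K'(2)]] sym(1)])
  show "b \<in> germ_C_omega"
    by (rule germ_C_omega_cong[OF germ_C_omega_mult[OF W(1) germ_C_omega_inverse[OF W(2)]] sym(2)]) (use q'0 in \<open>simp add: germ_nonzero_def\<close>)
  show "negl (\<lambda>x. b x - a x)"
    by (rule negl_cong[OF fracp_near[OF r pq(1-3)]]) (use pq(4,5) in \<open>eventually_elim, simp\<close>)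
  show "(\<lambda>x. - a x, \<lambda>x. - b x) \<in> fracp \<rho>"
    by (rule fracpI[OF copy_ringD(5)[OF r pq(1)] pq(2,3)]) (use pq(4) in \<open>eventually_elim, simp\<close>, use pq(5) in \<open>eventually_elim, simp\<close>)
  show "germ_zero b" if a0: "germ_zero a"
  proof -
    have "germ_zero p" using a0 pq(3,4) unfolding germ_zero_def germ_nonzero_def by eventually_elim auto
    then have "germ_zero p'" by (rule copy_ringD(9)[OF r pq(1)])
    then show ?thesis using pq(5) unfolding germ_zero_def by eventually_elim simp
  qed
next
  fix a b c d assume ab: "(a, b) \<in> fracp \<rho>" and cd: "(c, d) \<in> fracp \<rho>"
  from ab obtain p p' q q' where pq: "(p, p') \<in> \<rho>" "(q, q') \<in> \<rho>" "germ_nonzero q"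
     "eventually (\<lambda>x. a x = p x * inverse (q x)) at_top" "eventually (\<lambda>x. b x = p' x * inverse (q' x)) at_top" by (rule fracpE)
  from cd obtain u u' v v' where uv: "(u, u') \<in> \<rho>" "(v, v') \<in> \<rho>" "germ_nonzero v"
     "eventually (\<lambda>x. c x = u x * inverse (v x)) at_top" "eventually (\<lambda>x. d x = u' x * inverse (v' x)) at_top" by (rule fracpE)
  note q'0 = copy_ring_nonzero[OF r pq(2,3)] and v'0 = copy_ring_nonzero[OF r uv(2,3)]
  show "(\<lambda>x. a x * c x, \<lambda>x. b x * d x) \<in> fracp \<rho>"
    by (rule fracpI[OF copy_ringD(4)[OF r pq(1) uv(1)] copy_ringD(4)[OF r pq(2) uv(2)] germ_nonzero_mult[OF pq(3) uv(3)]])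
      (use pq(4) uv(4) in \<open>eventually_elim, simp\<close>, use pq(5) uv(5) in \<open>eventually_elim, simp\<close>)
  show "(\<lambda>x. a x + c x, \<lambda>x. b x + d x) \<in> fracp \<rho>"
  proof (rule fracpI[OF copy_ringD(3)[OF r copy_ringD(4)[OF r pq(1) uv(2)] copy_ringD(4)[OF r uv(1) pq(2)]] copy_ringD(4)[OF r pq(2) uv(2)] germ_nonzero_mult[OF pq(3) uv(3)]])
    show "eventually (\<lambda>x. a x + c x = (p x * v x + u x * q x) * inverse (q x * v x)) at_top"
      using pq(3,4) uv(3,4) unfolding germ_nonzero_def by eventually_elim (simp add: field_simps)
    show "eventually (\<lambda>x. b x + d x = (p' x * v' x + u' x * q' x) * inverse (q' x * v' x)) at_top"
      using q'0 v'0 pq(5) uv(5) unfolding germ_nonzero_def by eventually_elim (simp add: field_simps)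
  qed
qed

definition inv_closed :: "rpair set \<Rightarrow> bool" where
  "inv_closed \<rho> \<longleftrightarrow> (\<forall>a b. (a, b) \<in> \<rho> \<and> germ_nonzero a \<longrightarrow> (\<lambda>x. inverse (a x), \<lambda>x. inverse (b x)) \<in> \<rho>)"

definition copy_field :: "rpair set \<Rightarrow> bool" where
  "copy_field \<rho> \<longleftrightarrow> copy_ring \<rho> \<and> inv_closed \<rho> \<and> (\<forall>a b. (a, b) \<in> \<rho> \<longrightarrow> (deriv a, deriv b) \<in> \<rho>)"

lemma inv_closed_fracp: assumes r: "copy_ring \<rho>" shows "inv_closed (fracp \<rho>)"
  unfolding inv_closed_def
proof (intro allI impI, elim conjE)
  fix a b assume ab: "(a, b) \<in> fracp \<rho>" and nz: "germ_nonzero a"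
  from ab obtain p p' q q' where pq: "(p, p') \<in> \<rho>" "(q, q') \<in> \<rho>" "germ_nonzero q"
     "eventually (\<lambda>x. a x = p x * inverse (q x)) at_top" "eventually (\<lambda>x. b x = p' x * inverse (q' x)) at_top" by (rule fracpE)
  have "germ_nonzero p" using nz pq(4) unfolding germ_nonzero_def by eventually_elim auto
  then show "(\<lambda>x. inverse (a x), \<lambda>x. inverse (b x)) \<in> fracp \<rho>"
    by (rule fracpI[OF pq(2,1)]) (use pq(4) in \<open>eventually_elim, simp\<close>, use pq(5) in \<open>eventually_elim, simp\<close>)
qed

lemma copy_ring_ev_deriv:
  assumes "copy_ring \<rho>" "(a, b) \<in> \<rho>" shows "ev_deriv a (deriv a)" "ev_deriv b (deriv b)"
  using germ_C_lt_inf_ev_deriv KC[OF copy_ringD(6)[OF assms]] copy_ringD(7)[OF assms] germ_C_omega_subset by auto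

text \<open>Derivatives of ring elements may fall into the fraction field. This is needed for an
  algebraic germ, whose highest derivative is expressed by a division by the separant.\<close>

lemma copy_field_fracp:
  assumes r: "copy_ring \<rho>" and d: "\<And>a b. (a, b) \<in> \<rho> \<Longrightarrow> (deriv a, deriv b) \<in> fracp \<rho>"
  shows "copy_field (fracp \<rho>)"
  unfolding copy_field_def
proof (intro conjI allI impI copy_ring_fracp[OF r] inv_closed_fracp[OF r])
  note F = copy_ring_fracp[OF r]
  fix a b assume ab: "(a, b) \<in> fracp \<rho>"
  from ab obtain p p' q q' where pq: "(p, p') \<in> \<rho>" "(q, q') \<in> \<rho>" "germ_nonzero q"
     "eventually (\<lambda>x. a x = p x * inverse (q x)) at_top" "eventually (\<lambda>x. b x = p' x * inverse (q' x)) at_top" by (rule fracpE)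
  note q'0 = copy_ring_nonzero[OF r pq(2,3)]
  have pF: "(p, p') \<in> fracp \<rho>" and qF: "(q, q') \<in> fracp \<rho>" using subset_fracp[OF r] pq by auto
  have iF: "(\<lambda>x. inverse (q x), \<lambda>x. inverse (q' x)) \<in> fracp \<rho>"
    using inv_closed_fracp[OF r] qF pq(3) unfolding inv_closed_def by simp
  have D: "ev_deriv (\<lambda>x. f x * inverse (g x)) (\<lambda>x. deriv f x * inverse (g x) + (-1 * deriv g x * (inverse (g x) * inverse (g x))) * f x)"
    if "ev_deriv f (deriv f)" "ev_deriv g (deriv g)" "germ_nonzero g" for f g :: "real \<Rightarrow> real"
    by (rule ev_deriv_mult[OF that(1) ev_deriv_inverse[OF that(2)]]) (use that(3) in \<open>simp add: germ_nonzero_def\<close>)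
  note ep = copy_ring_ev_deriv[OF r pq(1)] and eq = copy_ring_ev_deriv[OF r pq(2)]
  have 1: "eventually (\<lambda>x. deriv a x = deriv p x * inverse (q x) + (-1 * deriv q x * (inverse (q x) * inverse (q x))) * p x) at_top"
    by (rule ev_deriv_imp_deriv[OF ev_deriv_cong1[OF pq(4) D[OF ep(1) eq(1) pq(3)]]])
  have 2: "eventually (\<lambda>x. deriv b x = deriv p' x * inverse (q' x) + (-1 * deriv q' x * (inverse (q' x) * inverse (q' x))) * p' x) at_top"
    by (rule ev_deriv_imp_deriv[OF ev_deriv_cong1[OF pq(5) D[OF ep(2) eq(2) q'0]]])
  have "(\<lambda>x. deriv p x * inverse (q x) + (-1 * deriv q x * (inverse (q x) * inverse (q x))) * p x,
         \<lambda>x. deriv p' x * inverse (q' x) + (-1 * deriv q' x * (inverse (q' x) * inverse (q' x))) * p' x) \<in> fracp \<rho>"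
    by (rule copy_ringD(3)[OF F copy_ringD(4)[OF F d[OF pq(1)] iF] copy_ringD(4)[OF F copy_ringD(4)[OF F copy_ringD(4)[OF F copy_ring_consts(2)[OF F] d[OF pq(2)]] copy_ringD(4)[OF F iF iF]] pF]])
  then show "(deriv a, deriv b) \<in> fracp \<rho>"
    by (rule copy_ringD(1)[OF F]) (use 1 in \<open>eventually_elim, simp\<close>, use 2 in \<open>eventually_elim, simp\<close>)
qed

definition adjoin :: "rpair set \<Rightarrow> (nat \<Rightarrow> real \<Rightarrow> real) \<Rightarrow> (nat \<Rightarrow> real \<Rightarrow> real) \<Rightarrow> nat \<Rightarrow> rpair set" where
  "adjoin \<rho> Y Z m = {(a, b). \<exists>e\<in>Expr \<rho> m. eventually (\<lambda>x. a x = ev1 Y e x) at_top \<and> eventually (\<lambda>x. b x = ev2 Z e x) at_top}"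

lemma adjoinI: "e \<in> Expr \<rho> m \<Longrightarrow> eventually (\<lambda>x. a x = ev1 Y e x) at_top \<Longrightarrow> eventually (\<lambda>x. b x = ev2 Z e x) at_top \<Longrightarrow> (a, b) \<in> adjoin \<rho> Y Z m"
  unfolding adjoin_def by auto

lemma adjoinE:
  assumes "(a, b) \<in> adjoin \<rho> Y Z m"
  obtains e where "e \<in> Expr \<rho> m" "eventually (\<lambda>x. a x = ev1 Y e x) at_top" "eventually (\<lambda>x. b x = ev2 Z e x) at_top"
  using assms unfolding adjoin_def by auto

lemma ev1_in_K:
  assumes r: "copy_ring \<rho>" and Y: "\<And>j. j < m \<Longrightarrow> Y j \<in> K" and e: "e \<in> Expr \<rho> m"
  shows "ev1 Y e \<in> K"
  using e
proof (induction e)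
  case (Cf c)
  have "(fst c, snd c) \<in> \<rho>" using Cf by (simp add: Expr_simps)
  from copy_ringD(6)[OF r this] show ?case by (simp add: ev12_simps[abs_def])
next
  case (Vr j) then show ?case using Y by (simp add: Expr_simps ev12_simps[abs_def])
next
  case (Ad p q) then show ?case using Kadd by (simp add: Expr_simps ev12_simps[abs_def])
next
  case (Ml p q) then show ?case using Kmult by (simp add: Expr_simps ev12_simps[abs_def])
qed

text \<open>For a product of p and q with errors dp and dq the error is dp dq + q dp + p dq, in
  which only negligible functions and factors from \<open>K\<close> occur.\<close>

lemma ev2_near:
  assumes r: "copy_ring \<rho>" and Y: "\<And>j. j < m \<Longrightarrow> Y j \<in> K" and Z: "\<And>j. j < m \<Longrightarrow> Z j \<in> germ_C_omega"
    and n: "\<And>j. j < m \<Longrightarrow> negl (\<lambda>x. Z j x - Y j x)" and e: "e \<in> Expr \<rho> m"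
  shows "ev2 Z e \<in> germ_C_omega" "negl (\<lambda>x. ev2 Z e x - ev1 Y e x)"
proof -
  have "ev2 Z e \<in> germ_C_omega \<and> negl (\<lambda>x. ev2 Z e x - ev1 Y e x)" using e
  proof (induction e)
    case (Cf c)
    have "(fst c, snd c) \<in> \<rho>" using Cf by (simp add: Expr_simps)
    from copy_ringD(7)[OF r this] copy_ringD(8)[OF r this] show ?case by (simp add: ev12_simps[abs_def])
  next
    case (Vr j) then show ?case using Z n by (simp add: Expr_simps ev12_simps[abs_def])
  next
    case (Ad p q)
    then have "negl (\<lambda>x. (ev2 Z p x - ev1 Y p x) + (ev2 Z q x - ev1 Y q x))" by (intro negl_add) (auto simp: Expr_simps)
    then have "negl (\<lambda>x. (ev2 Z p x + ev2 Z q x) - (ev1 Y p x + ev1 Y q x))" by (simp add: algebra_simps)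
    then show ?case using Ad germ_C_omega_add by (simp add: Expr_simps ev12_simps[abs_def])
  next
    case (Ml p q)
    have e: "p \<in> Expr \<rho> m" "q \<in> Expr \<rho> m" using Ml.prems by (auto simp: Expr_simps)
    have Kp: "ev1 Y p \<in> K" and Kq: "ev1 Y q \<in> K" by (rule ev1_in_K[OF r Y e(1)], assumption, rule ev1_in_K[OF r Y e(2)], assumption)
    have np: "negl (\<lambda>x. ev2 Z p x - ev1 Y p x)" and nq: "negl (\<lambda>x. ev2 Z q x - ev1 Y q x)" using Ml e by auto
    have "negl (\<lambda>x. ((ev2 Z p x - ev1 Y p x) * (ev2 Z q x - ev1 Y q x) + ev1 Y q x * (ev2 Z p x - ev1 Y p x)) + ev1 Y p x * (ev2 Z q x - ev1 Y q x))"
      by (rule negl_add[OF negl_add[OF negl_mult_negl[OF np nq] negl_mult_K[OF np Kq]] negl_mult_K[OF nq Kp]])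
    then have "negl (\<lambda>x. ev2 Z p x * ev2 Z q x - ev1 Y p x * ev1 Y q x)" by (simp add: algebra_simps)
    then show ?case using Ml e germ_C_omega_mult by (simp add: ev12_simps[abs_def])
  qed
  then show "ev2 Z e \<in> germ_C_omega" "negl (\<lambda>x. ev2 Z e x - ev1 Y e x)" by auto
qed

text \<open>A germ may be the value of several terms; \<open>zero_pres\<close> makes the copies read
  off from them agree.\<close>

lemma copy_ring_adjoin:
  assumes r: "copy_ring \<rho>" and Y: "\<And>j. j < m \<Longrightarrow> Y j \<in> K" and Z: "\<And>j. j < m \<Longrightarrow> Z j \<in> germ_C_omega"
    and n: "\<And>j. j < m \<Longrightarrow> negl (\<lambda>x. Z j x - Y j x)" and zp: "zero_pres \<rho> Y Z m"
  shows "copy_ring (adjoin \<rho> Y Z m)"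
proof (rule copy_ringI)
  show "one_pair \<in> adjoin \<rho> Y Z m"
    by (rule adjoinI[of "Cf one_pair"]) (auto simp: Expr_simps ev12_simps copy_ringD(2)[OF r])
next
  fix a b a' b' assume ab: "(a, b) \<in> adjoin \<rho> Y Z m" and 1: "eventually (\<lambda>x. a x = a' x) at_top" "eventually (\<lambda>x. b x = b' x) at_top"
  from ab obtain e where e: "e \<in> Expr \<rho> m" "eventually (\<lambda>x. a x = ev1 Y e x) at_top" "eventually (\<lambda>x. b x = ev2 Z e x) at_top" by (rule adjoinE)
  show "(a', b') \<in> adjoin \<rho> Y Z m"
    by (rule adjoinI[OF e(1)]) (use e(2) 1(1) in \<open>eventually_elim, simp\<close>, use e(3) 1(2) in \<open>eventually_elim, simp\<close>)
next
  fix a b assume ab: "(a, b) \<in> adjoin \<rho> Y Z m"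
  from ab obtain e where e: "e \<in> Expr \<rho> m" "eventually (\<lambda>x. a x = ev1 Y e x) at_top" "eventually (\<lambda>x. b x = ev2 Z e x) at_top" by (rule adjoinE)
  have sym: "eventually (\<lambda>x. ev1 Y e x = a x) at_top" "eventually (\<lambda>x. ev2 Z e x = b x) at_top"
    using e by (auto elim: eventually_mono)
  show "a \<in> K" by (rule Kcong[OF ev1_in_K[OF r Y e(1)] sym(1)])
  show "b \<in> germ_C_omega" by (rule germ_C_omega_cong[OF ev2_near(1)[OF r Y Z n e(1)] sym(2)])
  have "negl (\<lambda>x. ev2 Z e x - ev1 Y e x)" by (rule ev2_near(2)[OF r Y Z n e(1)])
  then show "negl (\<lambda>x. b x - a x)"
    by (rule negl_cong) (use sym in \<open>eventually_elim, simp\<close>)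
  show "(\<lambda>x. - a x, \<lambda>x. - b x) \<in> adjoin \<rho> Y Z m"
    by (rule adjoinI[of "Ml (Cf (\<lambda>x. -1, \<lambda>x. -1)) e"])
      (use e copy_ring_consts(2)[OF r] in \<open>auto simp: Expr_simps ev12_simps elim: eventually_mono\<close>)
  show "germ_zero b" if "germ_zero a"
  proof -
    have "germ_zero (ev1 Y e)" by (rule germ_zero_cong[OF that e(2)])
    then have "germ_zero (ev2 Z e)" using zp e(1) unfolding zero_pres_def by simp
    then show ?thesis by (rule germ_zero_cong[OF _ sym(2)])
  qed
next
  fix a b c d assume ab: "(a, b) \<in> adjoin \<rho> Y Z m" and cd: "(c, d) \<in> adjoin \<rho> Y Z m"
  from ab obtain e where e: "e \<in> Expr \<rho> m" "eventually (\<lambda>x. a x = ev1 Y e x) at_top" "eventually (\<lambda>x. b x = ev2 Z e x) at_top" by (rule adjoinE)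
  from cd obtain f where f: "f \<in> Expr \<rho> m" "eventually (\<lambda>x. c x = ev1 Y f x) at_top" "eventually (\<lambda>x. d x = ev2 Z f x) at_top" by (rule adjoinE)
  show "(\<lambda>x. a x + c x, \<lambda>x. b x + d x) \<in> adjoin \<rho> Y Z m"
    by (rule adjoinI[of "Ad e f"])
      (use e(1) f(1) in \<open>simp add: Expr_simps\<close>, use e(2) f(2) in \<open>eventually_elim, simp add: ev12_simps\<close>, use e(3) f(3) in \<open>eventually_elim, simp add: ev12_simps\<close>)
  show "(\<lambda>x. a x * c x, \<lambda>x. b x * d x) \<in> adjoin \<rho> Y Z m"
    by (rule adjoinI[of "Ml e f"])
      (use e(1) f(1) in \<open>simp add: Expr_simps\<close>, use e(2) f(2) in \<open>eventually_elim, simp add: ev12_simps\<close>, use e(3) f(3) in \<open>eventually_elim, simp add: ev12_simps\<close>)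
qed

lemma adjoin_base: "c \<in> \<rho> \<Longrightarrow> c \<in> adjoin \<rho> Y Z m"
  using adjoinI[of "Cf c" \<rho> m "fst c" Y "snd c" Z] by (auto simp: Expr_simps ev12_simps)

lemma adjoin_var: "j < m \<Longrightarrow> (Y j, Z j) \<in> adjoin \<rho> Y Z m"
  by (rule adjoinI[of "Vr j"]) (auto simp: Expr_simps ev12_simps)

lemma adjoin_mono: "m \<le> n \<Longrightarrow> adjoin \<rho> Y Z m \<subseteq> adjoin \<rho> Y Z n"
  unfolding adjoin_def using Expr_mono[of m n \<rho> \<rho>] by auto

text \<open>\<open>F\<close> is a larger ring that contains the derivatives of the variables: the
  ring with one more variable in the transcendental case, the fraction field in the algebraic
  case.\<close>

lemma adjoin_deriv:
  assumes r: "copy_ring \<rho>" and rd: "\<And>a b. (a, b) \<in> \<rho> \<Longrightarrow> (deriv a, deriv b) \<in> \<rho>"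
    and A: "copy_ring (adjoin \<rho> Y Z m)" and F: "copy_ring F" "adjoin \<rho> Y Z m \<subseteq> F"
    and v: "\<And>j. j < m \<Longrightarrow> (deriv (Y j), deriv (Z j)) \<in> F"
    and ab: "(a, b) \<in> adjoin \<rho> Y Z m"
  shows "(deriv a, deriv b) \<in> F"
proof -
  have inA: "(ev1 Y e, ev2 Z e) \<in> adjoin \<rho> Y Z m" if "e \<in> Expr \<rho> m" for e by (rule adjoinI[OF that]) auto
  have *: "(deriv (ev1 Y e), deriv (ev2 Z e)) \<in> F" if "e \<in> Expr \<rho> m" for e
    using that
  proof (induction e)
    case (Cf c)
    have "(deriv (fst c), deriv (snd c)) \<in> \<rho>" using Cf rd by (simp add: Expr_simps)
    then show ?case using F(2) adjoin_base by (auto simp: ev12_simps[abs_def])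
  next
    case (Vr j) then show ?case using v by (simp add: Expr_simps ev12_simps[abs_def])
  next
    case (Ad p q)
    then have e: "p \<in> Expr \<rho> m" "q \<in> Expr \<rho> m" by (auto simp: Expr_simps)
    note dp = copy_ring_ev_deriv[OF A inA[OF e(1)]] and dq = copy_ring_ev_deriv[OF A inA[OF e(2)]]
    have "(\<lambda>x. deriv (ev1 Y p) x + deriv (ev1 Y q) x, \<lambda>x. deriv (ev2 Z p) x + deriv (ev2 Z q) x) \<in> F"
      by (rule copy_ringD(3)[OF F(1)]) (use Ad e in auto)
    then show ?case
    proof (rule copy_ringD(1)[OF F(1)])
      show "eventually (\<lambda>x. deriv (ev1 Y p) x + deriv (ev1 Y q) x = deriv (ev1 Y (Ad p q)) x) at_top"
        using ev_deriv_imp_deriv[OF ev_deriv_add[OF dp(1) dq(1)]] unfolding ev12_simps[abs_def] by eventually_elim simp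
      show "eventually (\<lambda>x. deriv (ev2 Z p) x + deriv (ev2 Z q) x = deriv (ev2 Z (Ad p q)) x) at_top"
        using ev_deriv_imp_deriv[OF ev_deriv_add[OF dp(2) dq(2)]] unfolding ev12_simps[abs_def] by eventually_elim simp
    qed
  next
    case (Ml p q)
    then have e: "p \<in> Expr \<rho> m" "q \<in> Expr \<rho> m" by (auto simp: Expr_simps)
    have pF: "(ev1 Y p, ev2 Z p) \<in> F" and qF: "(ev1 Y q, ev2 Z q) \<in> F" using inA e F(2) by auto
    note dp = copy_ring_ev_deriv[OF A inA[OF e(1)]] and dq = copy_ring_ev_deriv[OF A inA[OF e(2)]]
    have "(\<lambda>x. deriv (ev1 Y p) x * ev1 Y q x + deriv (ev1 Y q) x * ev1 Y p x, \<lambda>x. deriv (ev2 Z p) x * ev2 Z q x + deriv (ev2 Z q) x * ev2 Z p x) \<in> F"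
      by (rule copy_ringD(3)[OF F(1) copy_ringD(4)[OF F(1) _ qF] copy_ringD(4)[OF F(1) _ pF]]) (use Ml e in auto)
    then show ?case
    proof (rule copy_ringD(1)[OF F(1)])
      show "eventually (\<lambda>x. deriv (ev1 Y p) x * ev1 Y q x + deriv (ev1 Y q) x * ev1 Y p x = deriv (ev1 Y (Ml p q)) x) at_top"
        using ev_deriv_imp_deriv[OF ev_deriv_mult[OF dp(1) dq(1)]] unfolding ev12_simps[abs_def] by eventually_elim simp
      show "eventually (\<lambda>x. deriv (ev2 Z p) x * ev2 Z q x + deriv (ev2 Z q) x * ev2 Z p x = deriv (ev2 Z (Ml p q)) x) at_top"
        using ev_deriv_imp_deriv[OF ev_deriv_mult[OF dp(2) dq(2)]] unfolding ev12_simps[abs_def] by eventually_elim simp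
    qed
  qed
  from ab obtain e where e: "e \<in> Expr \<rho> m" "eventually (\<lambda>x. a x = ev1 Y e x) at_top" "eventually (\<lambda>x. b x = ev2 Z e x) at_top" by (rule adjoinE)
  show ?thesis
    by (rule copy_ringD(1)[OF F(1) *[OF e(1)]])
      (use deriv_ev_cong[OF e(2)] in \<open>eventually_elim, simp\<close>, use deriv_ev_cong[OF e(3)] in \<open>eventually_elim, simp\<close>)
qed

end

section \<open>Lipschitz estimates for terms and quotients\<close>

definition bounded_close :: "real \<Rightarrow> real \<Rightarrow> real \<Rightarrow> real \<Rightarrow> bool" where
  "bounded_close B \<delta> a b \<longleftrightarrow> \<bar>a\<bar> \<le> B \<and> \<bar>b\<bar> \<le> B \<and> \<bar>a - b\<bar> \<le> \<delta>"

lemma bounded_close_mono: "bounded_close B \<delta> a b \<Longrightarrow> B \<le> B' \<Longrightarrow> \<delta> \<le> \<delta>' \<Longrightarrow> bounded_close B' \<delta>' a b"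
  unfolding bounded_close_def by auto

lemma bounded_close_add: "bounded_close B \<delta> a b \<Longrightarrow> bounded_close C \<epsilon> c d \<Longrightarrow> bounded_close (B + C) (\<delta> + \<epsilon>) (a + c) (b + d)"
  unfolding bounded_close_def abs_le_iff by (elim conjE, intro conjI; linarith)

lemma bounded_close_mult:
  assumes "bounded_close B \<delta> a b" "bounded_close C \<epsilon> c d"
  shows "bounded_close (B * C) (B * \<epsilon> + \<delta> * C) (a * c) (b * d)"
proof -
  have h: "\<bar>a\<bar> \<le> B" "\<bar>b\<bar> \<le> B" "\<bar>a - b\<bar> \<le> \<delta>" "\<bar>c\<bar> \<le> C" "\<bar>d\<bar> \<le> C" "\<bar>c - d\<bar> \<le> \<epsilon>" using assms unfolding bounded_close_def by auto
  have 0: "0 \<le> B" "0 \<le> \<delta>" "0 \<le> C" using order_trans[OF abs_ge_zero] h by blast+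
  have "\<bar>a * (c - d)\<bar> \<le> B * \<epsilon>" "\<bar>(a - b) * d\<bar> \<le> \<delta> * C" "\<bar>a * c\<bar> \<le> B * C" "\<bar>b * d\<bar> \<le> B * C"
    unfolding abs_mult by (intro mult_mono h 0 abs_ge_zero)+
  moreover have "a * c - b * d = a * (c - d) + (a - b) * d" by (simp add: algebra_simps)
  ultimately show ?thesis unfolding bounded_close_def using abs_triangle_ineq[of "a * (c - d)" "(a - b) * d"] by simp
qed

text \<open>One power B^N serves as bound and as Lipschitz constant. With B at least 2, the factor 2
  arising from a sum or a product is absorbed by raising N by 1, so N depends on the term
  only.\<close>

definition lip_exp :: "nat \<Rightarrow> 'c ex \<Rightarrow> bool" where
  "lip_exp N e \<longleftrightarrow> (\<forall>B k k' v v' \<delta>. B \<ge> 2 \<and> \<delta> \<ge> 0 \<and> (\<forall>c\<in>coefs e. bounded_close B \<delta> (k c) (k' c)) \<and>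
    (\<forall>j\<in>vars e. bounded_close B \<delta> (v j) (v' j)) \<longrightarrow> bounded_close (B ^ N) (B ^ N * \<delta>) (ev k v e) (ev k' v' e))"

lemma lip_expI:
  assumes "\<And>B k k' v v' \<delta>. B \<ge> 2 \<Longrightarrow> \<delta> \<ge> 0 \<Longrightarrow> \<forall>c\<in>coefs e. bounded_close B \<delta> (k c) (k' c) \<Longrightarrow>
    \<forall>j\<in>vars e. bounded_close B \<delta> (v j) (v' j) \<Longrightarrow> bounded_close (B ^ N) (B ^ N * \<delta>) (ev k v e) (ev k' v' e)"
  shows "lip_exp N e"
  using assms unfolding lip_exp_def by blast

lemma lip_exp_close:
  assumes "lip_exp N e" "B \<ge> 2" "\<delta> \<ge> 0" "\<forall>c\<in>coefs e. bounded_close B \<delta> (k c) (k' c)" "\<forall>j\<in>vars e. bounded_close B \<delta> (v j) (v' j)"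
  shows "bounded_close (B ^ N) (B ^ N * \<delta>) (ev k v e) (ev k' v' e)"
  using assms unfolding lip_exp_def by blast

lemma lip_expD:
  assumes "lip_exp N e" "B \<ge> (2::real)" "\<delta> \<ge> 0"
    "\<And>c. c \<in> coefs e \<Longrightarrow> \<bar>k c\<bar> \<le> B \<and> \<bar>k' c\<bar> \<le> B \<and> \<bar>k c - k' c\<bar> \<le> \<delta>" "\<And>j. j \<in> vars e \<Longrightarrow> \<bar>v j\<bar> \<le> B \<and> \<bar>v' j\<bar> \<le> B \<and> \<bar>v j - v' j\<bar> \<le> \<delta>"
  shows "\<bar>ev k v e\<bar> \<le> B ^ N" "\<bar>ev k' v' e\<bar> \<le> B ^ N" "\<bar>ev k v e - ev k' v' e\<bar> \<le> B ^ N * \<delta>"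
  using lip_exp_close[OF assms(1-3), of k k' v v'] assms(4,5) unfolding bounded_close_def by simp_all

lemma lip_exp_mono: assumes "lip_exp N e" "N \<le> M" shows "lip_exp M e"
proof (rule lip_expI)
  fix B k k' v v' \<delta>
  assume B: "B \<ge> 2" and \<delta>: "\<delta> \<ge> 0" and h: "\<forall>c\<in>coefs e. bounded_close B \<delta> (k c) (k' c)" "\<forall>j\<in>vars e. bounded_close B \<delta> (v j) (v' j)"
  have "B ^ N \<le> B ^ M" using assms(2) B by (intro power_increasing) auto
  then show "bounded_close (B ^ M) (B ^ M * \<delta>) (ev k v e) (ev k' v' e)"
    using \<delta> by (intro bounded_close_mono[OF lip_exp_close[OF assms(1) B \<delta> h]] mult_right_mono)
qed

lemma lip_exp_exists: "\<exists>N. lip_exp N e"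
proof (induction e)
  case (Cf c)
  have "lip_exp 1 (Cf c)"
    by (rule lip_expI) (auto elim!: bounded_close_mono simp: mult_le_cancel_right1)
  then show ?case ..
next
  case (Vr j)
  have "lip_exp 1 (Vr j :: 'a ex)"
    by (rule lip_expI) (auto elim!: bounded_close_mono simp: mult_le_cancel_right1)
  then show ?case ..
next
  case (Ad p q)
  then obtain N1 N2 where "lip_exp N1 p" "lip_exp N2 q" by blast
  then have N: "lip_exp (N1 + N2) p" "lip_exp (N1 + N2) q" by (auto elim: lip_exp_mono)
  have "lip_exp (Suc (N1 + N2)) (Ad p q)"
  proof (rule lip_expI)
    fix B k k' v v' \<delta>
    assume B: "B \<ge> 2" and \<delta>: "\<delta> \<ge> 0" and h: "\<forall>c\<in>coefs (Ad p q). bounded_close B \<delta> (k c) (k' c)" "\<forall>j\<in>vars (Ad p q). bounded_close B \<delta> (v j) (v' j)"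
    have 2: "2 * B ^ (N1 + N2) \<le> B ^ Suc (N1 + N2)" using B by simp
    have "bounded_close (B ^ (N1 + N2)) (B ^ (N1 + N2) * \<delta>) (ev k v p) (ev k' v' p)" "bounded_close (B ^ (N1 + N2)) (B ^ (N1 + N2) * \<delta>) (ev k v q) (ev k' v' q)"
      by (rule lip_exp_close[OF _ B \<delta>]; use N h in simp)+
    from bounded_close_add[OF this]
    show "bounded_close (B ^ Suc (N1 + N2)) (B ^ Suc (N1 + N2) * \<delta>) (ev k v (Ad p q)) (ev k' v' (Ad p q))"
      unfolding ev.simps by (rule bounded_close_mono) (use 2 mult_right_mono[OF 2 \<delta>] in \<open>simp_all add: mult_ac\<close>)
  qed
  then show ?case ..
next
  case (Ml p q)
  then obtain N1 N2 where N: "lip_exp N1 p" "lip_exp N2 q" by blast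
  have "lip_exp (Suc (N1 + N2)) (Ml p q)"
  proof (rule lip_expI)
    fix B k k' v v' \<delta>
    assume B: "B \<ge> 2" and \<delta>: "\<delta> \<ge> 0" and h: "\<forall>c\<in>coefs (Ml p q). bounded_close B \<delta> (k c) (k' c)" "\<forall>j\<in>vars (Ml p q). bounded_close B \<delta> (v j) (v' j)"
    have 1: "B ^ (N1 + N2) \<le> B ^ Suc (N1 + N2)" and 2: "2 * B ^ (N1 + N2) \<le> B ^ Suc (N1 + N2)"
      using B by (simp_all add: power_increasing mult_le_cancel_right1)
    have "bounded_close (B ^ N1) (B ^ N1 * \<delta>) (ev k v p) (ev k' v' p)" "bounded_close (B ^ N2) (B ^ N2 * \<delta>) (ev k v q) (ev k' v' q)"
      by (rule lip_exp_close[OF _ B \<delta>]; use N h in simp)+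
    from bounded_close_mult[OF this]
    show "bounded_close (B ^ Suc (N1 + N2)) (B ^ Suc (N1 + N2) * \<delta>) (ev k v (Ml p q)) (ev k' v' (Ml p q))"
      unfolding ev.simps
    proof (rule bounded_close_mono)
      show "B ^ N1 * B ^ N2 \<le> B ^ Suc (N1 + N2)" using 1 by (simp only: power_add[symmetric])
      have "B ^ N1 * (B ^ N2 * \<delta>) + B ^ N1 * \<delta> * B ^ N2 = 2 * B ^ (N1 + N2) * \<delta>" by (simp add: power_add)
      then show "B ^ N1 * (B ^ N2 * \<delta>) + B ^ N1 * \<delta> * B ^ N2 \<le> B ^ Suc (N1 + N2) * \<delta>" using mult_right_mono[OF 2 \<delta>] by (simp only:)
    qed
  qed
  then show ?case ..
qed

text \<open>Over the common denominator the numerator is at most 2 B^(2N) \<delta> and the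
  denominator at least 1 / (4 B^2). The resulting factor 8 is bounded by B^3, whence the exponent 2N
  + 5.\<close>

lemma quotient_lipschitz:
  fixes B :: real
  assumes B: "B \<ge> 2" and a: "\<bar>a\<bar> \<le> B ^ N" and s': "\<bar>s'\<bar> \<ge> 1 / (2 * B)" and s: "\<bar>s\<bar> \<ge> 1 / (2 * B)" "\<bar>s\<bar> \<le> B ^ N"
    and da: "\<bar>a - a'\<bar> \<le> B ^ N * \<delta>" and ds: "\<bar>s - s'\<bar> \<le> B ^ N * \<delta>" and \<delta>: "\<delta> \<ge> 0"
  shows "\<bar>- a / s - (- a' / s')\<bar> \<le> B ^ (2 * N + 5) * \<delta>"
proof -
  have pos: "1 / (2 * B) > 0" using B by simp
  have nz: "s \<noteq> 0" "s' \<noteq> 0" using s(1) s' pos by auto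
  have e: "- a / s - (- a' / s') = (a * (s - s') - (a - a') * s) / (s * s')"
    using nz by (simp add: field_simps)
  have "\<bar>- a / s - (- a' / s')\<bar> = \<bar>a * (s - s') - (a - a') * s\<bar> / (\<bar>s\<bar> * \<bar>s'\<bar>)" unfolding e by (simp add: abs_mult)
  also have "\<dots> \<le> (2 * (B ^ (2 * N) * \<delta>)) / ((1 / (2 * B)) * (1 / (2 * B)))"
  proof (rule frac_le)
    have "\<bar>a * (s - s') - (a - a') * s\<bar> \<le> \<bar>a\<bar> * \<bar>s - s'\<bar> + \<bar>a - a'\<bar> * \<bar>s\<bar>"
      by (rule order_trans[OF abs_triangle_ineq4]) (simp only: abs_mult order_refl)
    also have "\<dots> \<le> B ^ N * (B ^ N * \<delta>) + (B ^ N * \<delta>) * B ^ N"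
    proof (rule add_mono)
      have B0: "0 \<le> B ^ M" for M using B by simp
      show "\<bar>a\<bar> * \<bar>s - s'\<bar> \<le> B ^ N * (B ^ N * \<delta>)" by (rule mult_mono[OF a ds]) (use B0 in simp_all)
      show "\<bar>a - a'\<bar> * \<bar>s\<bar> \<le> (B ^ N * \<delta>) * B ^ N" by (rule mult_mono[OF da s(2)]) (use B0 \<delta> in simp_all)
    qed
    also have "\<dots> = 2 * (B ^ (2 * N) * \<delta>)"
      unfolding mult_2[of N] power_add by (simp only: mult_2) (simp only: mult_ac)
    finally show "\<bar>a * (s - s') - (a - a') * s\<bar> \<le> 2 * (B ^ (2 * N) * \<delta>)" .
    show "0 < (1 / (2 * B)) * (1 / (2 * B))" using B by simp
    show "(1 / (2 * B)) * (1 / (2 * B)) \<le> \<bar>s\<bar> * \<bar>s'\<bar>" using s s' pos by (intro mult_mono) auto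
    show "0 \<le> 2 * (B ^ (2 * N) * \<delta>)" using \<delta> B by simp
  qed
  also have "\<dots> = 2 ^ 3 * (B ^ 2 * (B ^ (2 * N) * \<delta>))" using B by (simp add: field_simps power2_eq_square)
  also have "\<dots> \<le> B ^ 3 * (B ^ 2 * (B ^ (2 * N) * \<delta>))"
    using B \<delta> by (intro mult_right_mono power_mono) auto
  also have "\<dots> = B ^ (2 * N + 5) * \<delta>" by (simp add: power_add numeral_eq_Suc mult_ac)
  finally show ?thesis .
qed

text \<open>The derivative \<open>D\<close> of \<open>Y r\<close> is kept apart from
  \<open>Y (Suc r)\<close>, because for the solution of the copied equation it is a quotient of
  terms and not the next variable.\<close>

lemma deriv_of_relation:
  fixes k :: "'c \<Rightarrow> real \<Rightarrow> real" and Y :: "nat \<Rightarrow> real \<Rightarrow> real"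
  assumes c: "\<And>i. i \<le> Suc n \<Longrightarrow> vars (c i) \<subseteq> {..<r}"
    and k: "\<And>i a. i \<le> Suc n \<Longrightarrow> a \<in> coefs (c i) \<Longrightarrow> (k a has_real_derivative k (d a) x) (at x)"
    and Y: "\<And>j. j < r \<Longrightarrow> (Y j has_real_derivative Y (Suc j) x) (at x)" and Yr: "(Y r has_real_derivative D) (at x)"
  shows "((\<lambda>x. \<Sum>i\<le>Suc n. ev (\<lambda>c. k c x) (\<lambda>j. Y j x) (c i) * Y r x ^ i) has_real_derivative
     (\<Sum>i\<le>Suc n. ev (\<lambda>c. k c x) (\<lambda>j. Y j x) (Dx d (\<lambda>j. Vr (Suc j)) (c i)) * Y r x ^ i)
     + (\<Sum>i\<le>n. (real (Suc i) * ev (\<lambda>c. k c x) (\<lambda>j. Y j x) (c (Suc i))) * Y r x ^ i) * D) (at x)"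
proof -
  let ?e = "\<lambda>x p. ev (\<lambda>c. k c x) (\<lambda>j. Y j x) p"
  have ci: "((\<lambda>x. ?e x (c i)) has_real_derivative ?e x (Dx d (\<lambda>j. Vr (Suc j)) (c i))) (at x)" if "i \<le> Suc n" for i
    by (rule ev_has_real_derivative) (use c[OF that] k[OF that] Y in auto)
  have "((\<lambda>x. \<Sum>i\<le>Suc n. ?e x (c i) * Y r x ^ i) has_real_derivative
     (\<Sum>i\<le>Suc n. ?e x (Dx d (\<lambda>j. Vr (Suc j)) (c i)) * Y r x ^ i + (real i * (Y r x ^ (i - Suc 0) * D)) * ?e x (c i))) (at x)"
  proof (rule DERIV_sum)
    fix i assume "i \<in> {..Suc n}"
    then have i: "i \<le> Suc n" by simp
    have "((\<lambda>x. Y r x ^ i) has_real_derivative real i * (Y r x ^ (i - Suc 0) * D)) (at x)"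
      using DERIV_power[OF Yr, of i] by (simp add: mult_ac)
    from DERIV_mult[OF ci[OF i] this]
    show "((\<lambda>x. ?e x (c i) * Y r x ^ i) has_real_derivative ?e x (Dx d (\<lambda>j. Vr (Suc j)) (c i)) * Y r x ^ i + (real i * (Y r x ^ (i - Suc 0) * D)) * ?e x (c i)) (at x)" .
  qed
  also have "(\<Sum>i\<le>Suc n. ?e x (Dx d (\<lambda>j. Vr (Suc j)) (c i)) * Y r x ^ i + (real i * (Y r x ^ (i - Suc 0) * D)) * ?e x (c i))
    = (\<Sum>i\<le>Suc n. ?e x (Dx d (\<lambda>j. Vr (Suc j)) (c i)) * Y r x ^ i) + (\<Sum>i\<le>Suc n. (real i * (Y r x ^ (i - Suc 0) * D)) * ?e x (c i))"
    by (rule sum.distrib)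
  also have "(\<Sum>i\<le>Suc n. (real i * (Y r x ^ (i - Suc 0) * D)) * ?e x (c i)) = (\<Sum>i\<le>n. (real (Suc i) * ?e x (c (Suc i))) * Y r x ^ i) * D"
    by (subst sum.atMost_Suc_shift) (simp add: sum_distrib_right sum_distrib_left mult_ac del: of_nat_Suc)
  finally show ?thesis .
qed

text \<open>The three estimates needed to solve the copied equation with an unknown deviation
  \<open>u\<close>: the copied denominator stays away from 0, the quotient is Lipschitz in the
  deviation, and without deviation it differs from the original quotient by a multiple of the
  coefficient error. The condition \<open>B ^ N * \<eta> \<le> 1 / (2 * B)\<close> preserves half of
  the lower bound 1 / B of the denominator.\<close>

lemma quotient_estimates:
  fixes kf ks :: "'c \<Rightarrow> real" and y :: "nat \<Rightarrow> real"
  assumes N: "lip_exp N A" "lip_exp N S" and B: "B \<ge> 2"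
    and k: "\<And>c. c \<in> coefs A \<union> coefs S \<Longrightarrow> \<bar>kf c\<bar> \<le> B \<and> \<bar>ks c\<bar> \<le> B \<and> \<bar>ks c - kf c\<bar> \<le> \<delta>"
    and y: "\<And>j. j \<in> vars A \<union> vars S \<Longrightarrow> \<bar>y j\<bar> \<le> B - 1"
    and S: "\<bar>ev kf y S\<bar> \<ge> 1 / B" and \<delta>: "0 \<le> \<delta>" "\<delta> \<le> \<eta>" and \<eta>: "\<eta> \<le> 1" "B ^ N * \<eta> \<le> 1 / (2 * B)"
    and u: "\<And>j. j \<in> vars A \<union> vars S \<Longrightarrow> \<bar>u j\<bar> \<le> \<eta>"
  shows "\<bar>ev ks (\<lambda>j. y j + u j) S\<bar> \<ge> 1 / (2 * B)"
    "\<And>u' d. (\<And>j. j \<in> vars A \<union> vars S \<Longrightarrow> \<bar>u' j\<bar> \<le> \<eta>) \<Longrightarrow> (\<And>j. j \<in> vars A \<union> vars S \<Longrightarrow> \<bar>u j - u' j\<bar> \<le> d) \<Longrightarrow> 0 \<le> d \<Longrightarrow>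
       \<bar>- ev ks (\<lambda>j. y j + u j) A / ev ks (\<lambda>j. y j + u j) S - (- ev ks (\<lambda>j. y j + u' j) A / ev ks (\<lambda>j. y j + u' j) S)\<bar> \<le> B ^ (2 * N + 5) * d"
    "\<bar>- ev ks (\<lambda>j. y j) A / ev ks (\<lambda>j. y j) S - (- ev kf y A / ev kf y S)\<bar> \<le> B ^ (2 * N + 5) * \<delta>"
proof -
  have \<eta>0: "0 \<le> \<eta>" using \<delta> by linarith
  have yu: "\<bar>y j + u j\<bar> \<le> B" if "j \<in> vars A \<union> vars S" "\<And>j. j \<in> vars A \<union> vars S \<Longrightarrow> \<bar>u j\<bar> \<le> \<eta>" for u j
    using y[OF that(1)] that(2)[OF that(1)] \<eta>(1) by linarith
  have low: "\<bar>ev ks (\<lambda>j. y j + u j) S\<bar> \<ge> 1 / (2 * B)" if u: "\<And>j. j \<in> vars A \<union> vars S \<Longrightarrow> \<bar>u j\<bar> \<le> \<eta>" for u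
  proof -
    have "\<bar>ev ks (\<lambda>j. y j + u j) S - ev kf y S\<bar> \<le> B ^ N * \<eta>"
    proof (rule lip_expD(3)[OF N(2) B \<eta>0])
      fix c assume "c \<in> coefs S"
      then show "\<bar>ks c\<bar> \<le> B \<and> \<bar>kf c\<bar> \<le> B \<and> \<bar>ks c - kf c\<bar> \<le> \<eta>" using k[of c] \<delta>(2) by auto
    next
      fix j assume "j \<in> vars S"
      then have j: "j \<in> vars A \<union> vars S" by simp
      show "\<bar>y j + u j\<bar> \<le> B \<and> \<bar>y j\<bar> \<le> B \<and> \<bar>y j + u j - y j\<bar> \<le> \<eta>" using yu[OF j u] u[OF j] y[OF j] by auto
    qed
    then have "\<bar>ev ks (\<lambda>j. y j + u j) S - ev kf y S\<bar> \<le> 1 / (2 * B)" using \<eta>(2) by linarith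
    moreover have "1 / B = 1 / (2 * B) + 1 / (2 * B)" using B by (simp add: field_simps)
    ultimately show ?thesis using S by linarith
  qed
  show "\<bar>ev ks (\<lambda>j. y j + u j) S\<bar> \<ge> 1 / (2 * B)" by (rule low[OF u])
  show "\<bar>- ev ks (\<lambda>j. y j + u j) A / ev ks (\<lambda>j. y j + u j) S - (- ev ks (\<lambda>j. y j + u' j) A / ev ks (\<lambda>j. y j + u' j) S)\<bar> \<le> B ^ (2 * N + 5) * d"
    if u': "\<And>j. j \<in> vars A \<union> vars S \<Longrightarrow> \<bar>u' j\<bar> \<le> \<eta>" and d: "\<And>j. j \<in> vars A \<union> vars S \<Longrightarrow> \<bar>u j - u' j\<bar> \<le> d" and d0: "0 \<le> d" for u' d
  proof (rule quotient_lipschitz[OF B])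
    have kc: "\<bar>ks c\<bar> \<le> B \<and> \<bar>ks c\<bar> \<le> B \<and> \<bar>ks c - ks c\<bar> \<le> d" if "c \<in> coefs A \<union> coefs S" for c using k[OF that] d0 by auto
    have vj: "\<bar>y j + u j\<bar> \<le> B \<and> \<bar>y j + u' j\<bar> \<le> B \<and> \<bar>y j + u j - (y j + u' j)\<bar> \<le> d" if "j \<in> vars A \<union> vars S" for j
      using yu[OF that u] yu[OF that u'] d[OF that] by auto
    show "\<bar>ev ks (\<lambda>j. y j + u j) A\<bar> \<le> B ^ N" by (rule lip_expD(1)[OF N(1) B d0, of ks ks _ "\<lambda>j. y j + u' j"]) (use kc vj in auto)
    show "1 / (2 * B) \<le> \<bar>ev ks (\<lambda>j. y j + u' j) S\<bar>" by (rule low[OF u'])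
    show "1 / (2 * B) \<le> \<bar>ev ks (\<lambda>j. y j + u j) S\<bar>" by (rule low[OF u])
    show "\<bar>ev ks (\<lambda>j. y j + u j) S\<bar> \<le> B ^ N" by (rule lip_expD(1)[OF N(2) B d0, of ks ks _ "\<lambda>j. y j + u' j"]) (use kc vj in auto)
    show "\<bar>ev ks (\<lambda>j. y j + u j) A - ev ks (\<lambda>j. y j + u' j) A\<bar> \<le> B ^ N * d" by (rule lip_expD(3)[OF N(1) B d0]) (use kc vj in auto)
    show "\<bar>ev ks (\<lambda>j. y j + u j) S - ev ks (\<lambda>j. y j + u' j) S\<bar> \<le> B ^ N * d" by (rule lip_expD(3)[OF N(2) B d0]) (use kc vj in auto)
  qed (rule d0)
  show "\<bar>- ev ks (\<lambda>j. y j) A / ev ks (\<lambda>j. y j) S - (- ev kf y A / ev kf y S)\<bar> \<le> B ^ (2 * N + 5) * \<delta>"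
  proof (rule quotient_lipschitz[OF B])
    have kc: "\<bar>ks c\<bar> \<le> B \<and> \<bar>kf c\<bar> \<le> B \<and> \<bar>ks c - kf c\<bar> \<le> \<delta>" if "c \<in> coefs A \<union> coefs S" for c using k[OF that] by auto
    have vj: "\<bar>y j\<bar> \<le> B \<and> \<bar>y j\<bar> \<le> B \<and> \<bar>y j - y j\<bar> \<le> \<delta>" if "j \<in> vars A \<union> vars S" for j
      using y[OF that] \<delta> by auto
    show "\<bar>ev ks (\<lambda>j. y j) A\<bar> \<le> B ^ N" by (rule lip_expD(1)[OF N(1) B \<delta>(1), of ks kf _ y]) (use kc vj in auto)
    show "1 / (2 * B) \<le> \<bar>ev ks (\<lambda>j. y j) S\<bar>" using low[of "\<lambda>j. 0"] \<eta>0 by simp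
    have "1 / (2 * B) \<le> 1 / B" using B by (simp add: field_simps)
    then show "1 / (2 * B) \<le> \<bar>ev kf y S\<bar>" using S by linarith
    show "\<bar>ev ks (\<lambda>j. y j) S\<bar> \<le> B ^ N" by (rule lip_expD(1)[OF N(2) B \<delta>(1), of ks kf _ y]) (use kc vj in auto)
    show "\<bar>ev ks (\<lambda>j. y j) A - ev kf y A\<bar> \<le> B ^ N * \<delta>" by (rule lip_expD(3)[OF N(1) B \<delta>(1)]) (use kc vj in auto)
    show "\<bar>ev ks (\<lambda>j. y j) S - ev kf y S\<bar> \<le> B ^ N * \<delta>" by (rule lip_expD(3)[OF N(2) B \<delta>(1)]) (use kc vj in auto)
  qed (rule \<delta>(1))
qed

lemma continuous_on_ev:
  fixes k :: "'c \<Rightarrow> real \<Rightarrow> real"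
  assumes "\<And>c. c \<in> coefs e \<Longrightarrow> continuous_on X (k c)" "\<And>j. j \<in> vars e \<Longrightarrow> continuous_on X (v j)"
  shows "continuous_on X (\<lambda>x. ev (\<lambda>c. k c x) (\<lambda>j. v j x) e)"
  using assms by (induction e) (auto intro!: continuous_intros)

definition dpair :: "rpair \<Rightarrow> rpair" where
  "dpair c = (deriv (fst c), deriv (snd c))"

text \<open>For the differential polynomial \<open>P = (\<Sum>i\<le>Suc n. c i * Y r ^ i)\<close>, where \<open>c i\<close> only involves \<open>Y 0, ..., Y (r - 1)\<close>, the derivative
is \<open>P' = A + S * Y (Suc r)\<close> with \<open>A = relA c n r\<close> and the separant \<open>S = relS c n r\<close>.\<close>

definition relA :: "(nat \<Rightarrow> rpair ex) \<Rightarrow> nat \<Rightarrow> nat \<Rightarrow> rpair ex" where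
  "relA c n r = ex_sum (\<lambda>i. Ml (Dx dpair (\<lambda>j. Vr (Suc j)) (c i)) (ex_pow (Vr r) one_pair i)) (Suc n)"
definition relS :: "(nat \<Rightarrow> rpair ex) \<Rightarrow> nat \<Rightarrow> nat \<Rightarrow> rpair ex" where
  "relS c n r = ex_sum (\<lambda>i. Ml (Ml (Cf (\<lambda>x. real (Suc i), \<lambda>x. real (Suc i))) (c (Suc i))) (ex_pow (Vr r) one_pair i)) n"

lemma ev_relA:
  assumes "k one_pair = 1"
  shows "ev k v (relA c n r) = (\<Sum>i\<le>Suc n. ev k v (Dx dpair (\<lambda>j. Vr (Suc j)) (c i)) * v r ^ i)"
  unfolding relA_def by (simp add: ev_ex_sum ev_ex_pow[where k = k and w = one_pair, OF assms])
lemma ev_relS: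
  assumes "k one_pair = 1" "\<And>i. k (\<lambda>x. real (Suc i), \<lambda>x. real (Suc i)) = real (Suc i)"
  shows "ev k v (relS c n r) = (\<Sum>i\<le>n. (real (Suc i) * ev k v (c (Suc i))) * v r ^ i)"
  unfolding relS_def by (simp add: ev_ex_sum ev_ex_pow[where k = k and w = one_pair, OF assms(1)] assms(2) del: of_nat_Suc)

lemma Expr_ex_sum: "(\<And>i. i \<le> n \<Longrightarrow> f i \<in> Expr C m) \<Longrightarrow> ex_sum f n \<in> Expr C m"
  by (induction n) (auto simp: Expr_simps)
lemma Expr_ex_pow: "e \<in> Expr C m \<Longrightarrow> w \<in> C \<Longrightarrow> ex_pow e w n \<in> Expr C m"
  by (induction n) (auto simp: Expr_simps)
lemma Expr_Dx_shift: "(\<And>c. c \<in> C \<Longrightarrow> d c \<in> C) \<Longrightarrow> e \<in> Expr C m \<Longrightarrow> Dx d (\<lambda>j. Vr (Suc j)) e \<in> Expr C (Suc m)"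
proof (induction e)
  case (Ml p q)
  then show ?case using Expr_mono[of m "Suc m" C C] by (auto simp: Expr_simps)
qed (auto simp: Expr_simps)

context gauged begin

text \<open>exp (- x E x) is eventually below every power of exp (- E). The maxima with 0 make the
  exponent monotone on the whole line, as the approximation theorem asks for an antitone error
  function.\<close>

lemma approx_negl:
  assumes "y \<in> germ_C_lt_inf"
  shows "\<exists>g\<in>germ_C_omega. \<forall>j. negl (\<lambda>x. (deriv ^^ j) g x - (deriv ^^ j) y x)"
proof -
  define \<theta> where "\<theta> t = exp (- (max 0 t * max 0 (E t)))" for t
  have "\<theta> t \<le> \<theta> s" if "s \<le> t" for s t
    unfolding \<theta>_def using that E_mono by (auto intro!: mult_mono max.mono simp: monoD)
  then obtain g where g: "g \<in> germ_C_omega" "\<And>j. eventually (\<lambda>x. \<bar>(deriv ^^ j) g x - (deriv ^^ j) y x\<bar> \<le> \<theta> x) at_top"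
    using analytic_approximation[OF assms, of \<theta>] by (metis \<theta>_def exp_gt_zero)
  have "negl (\<lambda>x. (deriv ^^ j) g x - (deriv ^^ j) y x)" for j
  proof (rule neglI)
    fix n :: nat
    show "eventually (\<lambda>x. \<bar>(deriv ^^ j) g x - (deriv ^^ j) y x\<bar> \<le> exp (- real n * E x)) at_top"
      using g(2)[of j] E_ge[of 0] eventually_ge_at_top[of "real n"]
    proof eventually_elim
      case (elim x)
      have "real n * E x \<le> max 0 x * max 0 (E x)" using elim by (intro mult_mono) auto
      then have "\<theta> x \<le> exp (- real n * E x)" by (simp add: \<theta>_def)
      then show ?case using elim(1) by linarith
    qed
  qed
  then show ?thesis using g(1) by blast
qed

lemma copy_field_copy_ring: "copy_field \<rho> \<Longrightarrow> copy_ring \<rho>" unfolding copy_field_def by simp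
lemma copy_field_deriv: "copy_field \<rho> \<Longrightarrow> (a, b) \<in> \<rho> \<Longrightarrow> (deriv a, deriv b) \<in> \<rho>" unfolding copy_field_def by simp
lemma copy_field_dpair: "copy_field \<rho> \<Longrightarrow> c \<in> \<rho> \<Longrightarrow> dpair c \<in> \<rho>"
  unfolding dpair_def using copy_field_deriv[of \<rho> "fst c" "snd c"] by simp

text \<open>A term without variables evaluates to a pair of the copy itself.\<close>

lemma zero_pres_0:
  assumes r: "copy_ring \<rho>" shows "zero_pres \<rho> Y Z 0"
proof -
  have *: "(ev1 Y e, ev2 Z e) \<in> \<rho>" if "e \<in> Expr \<rho> 0" for e
    using that
  proof (induction e)
    case (Cf c) then show ?case by (simp add: Expr_simps ev12_simps[abs_def])
  next
    case (Vr j) then show ?case by (simp add: Expr_simps)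
  next
    case (Ad p q) then show ?case using copy_ringD(3)[OF r] by (simp add: Expr_simps ev12_simps[abs_def])
  next
    case (Ml p q) then show ?case using copy_ringD(4)[OF r] by (simp add: Expr_simps ev12_simps[abs_def])
  qed
  show ?thesis unfolding zero_pres_def
  proof (intro ballI impI)
    fix e assume "e \<in> Expr \<rho> 0" "germ_zero (ev1 Y e)"
    then show "germ_zero (ev2 Z e)" using copy_ringD(9)[OF r *] by blast
  qed
qed

lemma zero_pres_all_transc:
  assumes r: "copy_ring \<rho>" and t: "\<And>j. j < m \<Longrightarrow> transc \<rho> Y j"
  shows "zero_pres \<rho> Y Z m"
  using t by (induction m) (auto intro: zero_pres_0[OF r] zero_pres_transc copy_ring_consts[OF r] copy_ringD(2)[OF r])

lemma copy_ring_const_nat: "copy_ring \<rho> \<Longrightarrow> (\<lambda>x. real k, \<lambda>x. real k) \<in> \<rho>"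
proof (induction k)
  case 0 then show ?case using copy_ring_consts(1) by simp
next
  case (Suc k)
  then show ?case using copy_ringD(3)[OF Suc.prems Suc.IH[OF Suc.prems] copy_ringD(2)[OF Suc.prems]] by (simp add: add.commute)
qed

lemma copy_ring_Union:
  assumes ne: "C \<noteq> {}" and ch: "\<And>A B. A \<in> C \<Longrightarrow> B \<in> C \<Longrightarrow> A \<subseteq> B \<or> B \<subseteq> A" and ar: "\<And>A. A \<in> C \<Longrightarrow> copy_ring A"
  shows "copy_ring (\<Union>C)"
proof -
  obtain A0 where A0: "A0 \<in> C" using ne by blast
  have two: "\<exists>A\<in>C. s \<in> A \<and> t \<in> A" if "s \<in> \<Union>C" "t \<in> \<Union>C" for s t
  proof -
    from that(1) obtain A where A: "s \<in> A" "A \<in> C" by (rule UnionE)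
    from that(2) obtain B where B: "t \<in> B" "B \<in> C" by (rule UnionE)
    from A B ch[OF A(2) B(2)] show ?thesis by (elim disjE) (auto intro: bexI[of _ A] bexI[of _ B])
  qed
  show ?thesis
  proof (rule copy_ringI)
    show "one_pair \<in> \<Union>C" by (rule UnionI[OF A0 copy_ringD(2)[OF ar[OF A0]]])
  next
    fix a b assume "(a, b) \<in> \<Union>C"
    then obtain A where A: "(a, b) \<in> A" "A \<in> C" by (rule UnionE)
    note r = ar[OF A(2)]
    show "(\<lambda>x. - a x, \<lambda>x. - b x) \<in> \<Union>C" by (rule UnionI[OF A(2) copy_ringD(5)[OF r A(1)]])
    show "a \<in> K" by (rule copy_ringD(6)[OF r A(1)])
    show "b \<in> germ_C_omega" by (rule copy_ringD(7)[OF r A(1)])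
    show "negl (\<lambda>x. b x - a x)" by (rule copy_ringD(8)[OF r A(1)])
    show "germ_zero b" if "germ_zero a" by (rule copy_ringD(9)[OF r A(1) that])
    show "(a', b') \<in> \<Union>C" if "eventually (\<lambda>x. a x = a' x) at_top" "eventually (\<lambda>x. b x = b' x) at_top" for a' b'
      by (rule UnionI[OF A(2) copy_ringD(1)[OF r A(1) that]])
  next
    fix a b c d assume "(a, b) \<in> \<Union>C" "(c, d) \<in> \<Union>C"
    then have "\<exists>A\<in>C. (a, b) \<in> A \<and> (c, d) \<in> A" by (rule two)
    then obtain A where A: "A \<in> C" "(a, b) \<in> A \<and> (c, d) \<in> A" by (rule bexE)
    note r = ar[OF A(1)]
    show "(\<lambda>x. a x + c x, \<lambda>x. b x + d x) \<in> \<Union>C" by (rule UnionI[OF A(1) copy_ringD(3)[OF r conjunct1[OF A(2)] conjunct2[OF A(2)]]])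
    show "(\<lambda>x. a x * c x, \<lambda>x. b x * d x) \<in> \<Union>C" by (rule UnionI[OF A(1) copy_ringD(4)[OF r conjunct1[OF A(2)] conjunct2[OF A(2)]]])
  qed
qed

section \<open>Extending a copy by one germ\<close>

text \<open>No nontrivial relation among \<open>y\<close> and its derivatives has to be respected,
  so every analytic \<open>g\<close> that is close to \<open>y\<close> together with all derivatives
  is acceptable as its copy. Differentiation leads from the ring in the first m derivatives into the
  next one; the union of these rings is closed under it.\<close>

lemma extend_transcendental:
  assumes f: "copy_field \<rho>" and y: "y \<in> K" and t: "\<And>j. transc \<rho> (\<lambda>j. (deriv ^^ j) y) j"
    and g: "g \<in> germ_C_omega" and n: "\<And>j. negl (\<lambda>x. (deriv ^^ j) g x - (deriv ^^ j) y x)"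
  shows "\<exists>\<rho>'. copy_field \<rho>' \<and> \<rho> \<subseteq> \<rho>' \<and> (y, g) \<in> \<rho>'"
proof -
  define Y Z where "Y = (\<lambda>j. (deriv ^^ j) y)" and "Z = (\<lambda>j. (deriv ^^ j) g)"
  note r = copy_field_copy_ring[OF f]
  have Y: "Y j \<in> K" for j unfolding Y_def by (rule K_derivs[OF y])
  have Z: "Z j \<in> germ_C_omega" for j unfolding Z_def by (induction j) (auto intro: g germ_C_omega_deriv)
  have YZ: "negl (\<lambda>x. Z j x - Y j x)" for j unfolding Y_def Z_def by (rule n)
  have A: "copy_ring (adjoin \<rho> Y Z m)" for m
    by (rule copy_ring_adjoin[OF r Y Z YZ]) (rule zero_pres_all_transc[OF r], use t in \<open>simp add: Y_def\<close>)
  define R where "R = \<Union>(range (adjoin \<rho> Y Z))"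
  have R: "copy_ring R" unfolding R_def
  proof (rule copy_ring_Union)
    fix P Q assume "P \<in> range (adjoin \<rho> Y Z)" "Q \<in> range (adjoin \<rho> Y Z)"
    then obtain i j where "P = adjoin \<rho> Y Z i" "Q = adjoin \<rho> Y Z j" by auto
    then show "P \<subseteq> Q \<or> Q \<subseteq> P" using adjoin_mono[of i j] adjoin_mono[of j i] by (cases "i \<le> j") auto
  qed (use A in auto)
  have sub: "adjoin \<rho> Y Z m \<subseteq> R" for m unfolding R_def by auto
  have "(deriv a, deriv b) \<in> fracp R" if "(a, b) \<in> R" for a b
  proof -
    from that obtain m where m: "(a, b) \<in> adjoin \<rho> Y Z m" unfolding R_def by auto
    have "(deriv a, deriv b) \<in> adjoin \<rho> Y Z (Suc m)"
    proof (rule adjoin_deriv[OF r copy_field_deriv[OF f] A A adjoin_mono _ m])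
      fix j assume "j < m"
      then have "(Y (Suc j), Z (Suc j)) \<in> adjoin \<rho> Y Z (Suc m)" by (intro adjoin_var) simp
      then show "(deriv (Y j), deriv (Z j)) \<in> adjoin \<rho> Y Z (Suc m)" by (simp add: Y_def Z_def)
    qed simp_all
    then show ?thesis using sub subset_fracp[OF R] by blast
  qed
  then have "copy_field (fracp R)" by (rule copy_field_fracp[OF R])
  moreover have "\<rho> \<subseteq> fracp R" using adjoin_base[of _ \<rho> Y Z 0] sub[of 0] subset_fracp[OF R] by blast
  moreover have "(Y 0, Z 0) \<in> fracp R" using adjoin_var[of 0 "Suc 0" Y Z \<rho>] sub[of "Suc 0"] subset_fracp[OF R] by blast
  ultimately show ?thesis unfolding Y_def Z_def by (intro exI[of _ "fracp R"]) simp
qed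

text \<open>The index \<open>r\<close> is minimised before the degree, so that the lower variables
  are free and the relation cannot be shortened. A vanishing leading coefficient could be dropped,
  so the leading coefficient is nonzero.\<close>

lemma minimal_relation:
  assumes r: "copy_ring \<rho>" and Y: "\<And>j. Y j \<in> K" and nt: "\<not> (\<forall>j. transc \<rho> Y j)"
  obtains r n c where "\<And>j. j < r \<Longrightarrow> transc \<rho> Y j" "\<And>i. i \<le> Suc n \<Longrightarrow> c i \<in> Expr \<rho> r"
    "germ_zero (\<lambda>x. \<Sum>i\<le>Suc n. ev1 Y (c i) x * Y r x ^ i)" "germ_nonzero (ev1 Y (c (Suc n)))"
    "\<And>N d. N < Suc n \<Longrightarrow> (\<And>i. i \<le> N \<Longrightarrow> d i \<in> Expr \<rho> r) \<Longrightarrow> germ_zero (\<lambda>x. \<Sum>i\<le>N. ev1 Y (d i) x * Y r x ^ i) \<Longrightarrow> (\<And>i. i \<le> N \<Longrightarrow> germ_zero (ev1 Y (d i)))"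
proof -
  define r where "r = (LEAST j. \<not> transc \<rho> Y j)"
  have rn: "\<not> transc \<rho> Y r" unfolding r_def using nt by (metis (mono_tags) LeastI)
  have rl: "transc \<rho> Y j" if "j < r" for j using that not_less_Least unfolding r_def by blast
  define Q where "Q n \<longleftrightarrow> (\<exists>c. (\<forall>i\<le>n. c i \<in> Expr \<rho> r) \<and> germ_zero (\<lambda>x. \<Sum>i\<le>n. ev1 Y (c i) x * Y r x ^ i) \<and> \<not> (\<forall>i\<le>n. germ_zero (ev1 Y (c i))))" for n
  have "\<exists>n. Q n" using rn unfolding transc_def Q_def by blast
  define n where "n = (LEAST n. Q n)"
  have Qn: "Q n" unfolding n_def using \<open>\<exists>n. Q n\<close> by (rule LeastI_ex)
  have Ql: "\<not> Q N" if "N < n" for N using that not_less_Least unfolding n_def by blast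
  from Qn obtain c where c: "\<forall>i\<le>n. c i \<in> Expr \<rho> r" "germ_zero (\<lambda>x. \<Sum>i\<le>n. ev1 Y (c i) x * Y r x ^ i)" "\<not> (\<forall>i\<le>n. germ_zero (ev1 Y (c i)))"
    unfolding Q_def by blast
  have n0: "n \<noteq> 0"
  proof
    assume n: "n = 0"
    then have "germ_zero (ev1 Y (c 0))" using c(2) by (simp add: germ_zero_def)
    then show False using c(3) n by simp
  qed
  then obtain n' where n': "n = Suc n'" by (cases n) auto
  have "\<not> germ_zero (ev1 Y (c n))"
  proof
    assume top: "germ_zero (ev1 Y (c n))"
    have "germ_zero (\<lambda>x. \<Sum>i\<le>n'. ev1 Y (c i) x * Y r x ^ i)"
      using c(2) top unfolding germ_zero_def n' by eventually_elim simp
    moreover have "\<forall>i\<le>n'. c i \<in> Expr \<rho> r" using c(1) n' by simp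
    moreover have "\<not> (\<forall>i\<le>n'. germ_zero (ev1 Y (c i)))" using c(3) top n' by (auto simp: le_Suc_eq)
    ultimately have "Q n'" unfolding Q_def by blast
    then show False using Ql[of n'] n' by simp
  qed
  moreover have "c n \<in> Expr \<rho> r" using c(1) by simp
  then have "ev1 Y (c n) \<in> K" by (rule ev1_in_K[OF r Y])
  ultimately have top: "germ_nonzero (ev1 Y (c n))" using K_zn[of "ev1 Y (c n)"] by simp
  have min: "germ_zero (ev1 Y (d i))" if "N < n" "\<And>i. i \<le> N \<Longrightarrow> d i \<in> Expr \<rho> r" "germ_zero (\<lambda>x. \<Sum>i\<le>N. ev1 Y (d i) x * Y r x ^ i)" "i \<le> N" for N d i
    using Ql[OF that(1)] that(2-) unfolding Q_def by blast
  show ?thesis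
    by (rule that[of r n' c]) (use rl c top min n' in auto)
qed

text \<open>The separant has degree n in variable \<open>r\<close>, one less than the minimal
  relation, and its leading coefficient is n + 1 times that of the relation; minimality forbids it
  to vanish.\<close>

lemma separant_nonzero:
  assumes r: "copy_ring \<rho>" and Y: "\<And>j. Y j \<in> K" and c: "\<And>i. i \<le> Suc n \<Longrightarrow> c i \<in> Expr \<rho> r"
    and top: "germ_nonzero (ev1 Y (c (Suc n)))"
    and min: "\<And>N d. N < Suc n \<Longrightarrow> (\<And>i. i \<le> N \<Longrightarrow> d i \<in> Expr \<rho> r) \<Longrightarrow> germ_zero (\<lambda>x. \<Sum>i\<le>N. ev1 Y (d i) x * Y r x ^ i) \<Longrightarrow> (\<And>i. i \<le> N \<Longrightarrow> germ_zero (ev1 Y (d i)))"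
  shows "germ_nonzero (ev1 Y (relS c n r))"
proof -
  define d where "d i = Ml (Cf (\<lambda>x. real (Suc i), \<lambda>x. real (Suc i))) (c (Suc i))" for i
  have d: "d i \<in> Expr \<rho> r" if "i \<le> n" for i
    using that c[of "Suc i"] copy_ring_const_nat[OF r, of "Suc i"] by (simp add: d_def Expr_simps del: of_nat_Suc)
  have ed: "ev1 Y (relS c n r) x = (\<Sum>i\<le>n. ev1 Y (d i) x * Y r x ^ i)" for x
    unfolding ev1_def d_def by (subst ev_relS) simp_all
  have "d i \<in> Expr \<rho> (Suc r)" if "i \<le> n" for i using Expr_mono[of r "Suc r" \<rho> \<rho>] d[OF that] by simp
  then have "relS c n r \<in> Expr \<rho> (Suc r)"
    unfolding relS_def d_def[symmetric]
    by (intro Expr_ex_sum) (auto simp: Expr_simps intro!: Expr_ex_pow copy_ringD(2)[OF r])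
  then have "ev1 Y (relS c n r) \<in> K" by (rule ev1_in_K[OF r Y])
  then have "germ_zero (ev1 Y (relS c n r)) \<or> germ_nonzero (ev1 Y (relS c n r))" by (rule K_zn)
  moreover have "\<not> germ_zero (ev1 Y (relS c n r))"
  proof
    assume "germ_zero (ev1 Y (relS c n r))"
    then have "germ_zero (\<lambda>x. \<Sum>i\<le>n. ev1 Y (d i) x * Y r x ^ i)" unfolding ed[abs_def] .
    then have "germ_zero (ev1 Y (d n))" by (intro min[of n d n]) (use d in auto)
    then have "germ_zero (ev1 Y (c (Suc n)))" unfolding germ_zero_def d_def by eventually_elim (simp add: ev12_simps del: of_nat_Suc)
    then show False using top germ_zero_nonzero_False by blast
  qed
  ultimately show ?thesis by blast
qed

lemma K_const_nat: "(\<lambda>x. real k) \<in> K"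
proof (induction k)
  case 0 then show ?case using K0 by simp
next
  case (Suc k) then show ?case using Kadd[OF Suc.IH K1] by (simp add: add.commute)
qed

lemma K_sum: "finite A \<Longrightarrow> (\<And>i. i \<in> A \<Longrightarrow> f i \<in> K) \<Longrightarrow> (\<lambda>x. \<Sum>i\<in>A. f i x) \<in> K"
  by (induction A rule: finite_induct) (auto intro: K0 Kadd)

lemma K_power: "f \<in> K \<Longrightarrow> (\<lambda>x. f x ^ n) \<in> K"
  by (induction n) (auto intro: K1 Kmult)

lemma negl_sum: "finite A \<Longrightarrow> (\<And>i. i \<in> A \<Longrightarrow> negl (f i)) \<Longrightarrow> negl (\<lambda>x. \<Sum>i\<in>A. f i x)"
  by (induction A rule: finite_induct) (auto intro: negl_zero negl_add)

lemma negl_abs: "negl d \<Longrightarrow> negl (\<lambda>x. \<bar>d x\<bar>)"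
  by (erule negl_le) auto

text \<open>3 plus the sum of squares lies in \<open>K\<close>, so that its powers are dominated by
  \<open>E\<close> and \<open>E'\<close> again; it bounds each f since \<bar>t\<bar> \<le> 1 + t^2.
  The margin 1 leaves room for deviations.\<close>

lemma K_common_bound:
  assumes "finite A" "A \<subseteq> K"
  obtains B where "B \<in> K" "\<And>x. B x \<ge> 3" "\<And>f x. f \<in> A \<Longrightarrow> \<bar>f x\<bar> \<le> B x - 1"
proof -
  define B where "B x = real 3 + (\<Sum>f\<in>A. f x ^ 2)" for x
  have "(\<lambda>x. f x ^ 2) \<in> K" if "f \<in> A" for f by (rule K_power) (use assms(2) that in auto)
  then have "B \<in> K" unfolding B_def[abs_def] by (rule Kadd[OF K_const_nat K_sum[OF assms(1)]])
  moreover have "B x \<ge> 3" for x by (simp add: B_def sum_nonneg)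
  moreover have "\<bar>f x\<bar> \<le> B x - 1" if "f \<in> A" for f x
  proof -
    have "f x ^ 2 \<le> (\<Sum>f\<in>A. f x ^ 2)" by (rule member_le_sum) (use that assms(1) in auto)
    moreover have "\<bar>f x\<bar> \<le> 1 + f x ^ 2"
    proof -
      have "0 \<le> (\<bar>f x\<bar> - 1)\<^sup>2" by simp
      also have "\<dots> = f x ^ 2 - 2 * \<bar>f x\<bar> + 1" by (simp add: power2_diff)
      finally show ?thesis by (smt (verit) zero_le_power2)
    qed
    ultimately show ?thesis by (simp add: B_def)
  qed
  ultimately show ?thesis by (rule that)
qed

text \<open>With Z = Y + U the copied equation becomes an equation for \<open>U\<close> whose
  right-hand side is Lipschitz with a constant from \<open>K\<close> and negligible at U = 0. Since
  \<open>E'\<close> dominates that constant, it can be solved from infinity with negligible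
  \<open>U\<close>. Analyticity of \<open>Z\<close> comes from the copied equation, as
  \<open>Y\<close> need not be analytic.\<close>

lemma solve_perturbed:
  fixes A S :: "rpair ex" and Y :: "nat \<Rightarrow> real \<Rightarrow> real"
  assumes r: "copy_ring \<rho>" and A: "A \<in> Expr \<rho> (Suc r)" and S: "S \<in> Expr \<rho> (Suc r)" and Y: "\<And>j. Y j \<in> K"
    and Yd: "\<And>j. ev_deriv (Y j) (Y (Suc j))" and S0: "germ_nonzero (ev1 Y S)"
    and eq: "eventually (\<lambda>x. Y (Suc r) x = - ev1 Y A x / ev1 Y S x) at_top"
  obtains Z x0 where "\<And>j x. j < r \<Longrightarrow> x > x0 \<Longrightarrow> (Z j has_real_derivative Z (Suc j) x) (at x)"
    "\<And>x. x > x0 \<Longrightarrow> (Z r has_real_derivative - ev2 Z A x / ev2 Z S x) (at x)"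
    "\<And>x. x > x0 \<Longrightarrow> ev2 Z S x \<noteq> 0" "\<And>j. j \<le> r \<Longrightarrow> Z j \<in> germ_C_omega" "\<And>j. j \<le> r \<Longrightarrow> negl (\<lambda>x. Z j x - Y j x)"
proof -
  define C where "C = coefs A \<union> coefs S"
  have C: "finite C" "C \<subseteq> \<rho>" using A S by (auto simp: C_def Expr_def finite_coefs)
  have vs: "vars A \<union> vars S \<subseteq> {..r}" using A S by (auto simp: Expr_def)
  have CK: "fst c \<in> K" "snd c \<in> germ_C_omega" "negl (\<lambda>x. snd c x - fst c x)" if "c \<in> C" for c
  proof -
    have "(fst c, snd c) \<in> \<rho>" using that C by auto
    from copy_ringD(6)[OF r this] copy_ringD(7)[OF r this] copy_ringD(8)[OF r this]
    show "fst c \<in> K" "snd c \<in> germ_C_omega" "negl (\<lambda>x. snd c x - fst c x)" by auto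
  qed
  \<comment> \<open>The inverse of the denominator is among the functions bounded by
    \<open>B\<close>; this yields the lower bound 1 / B for the denominator.\<close>
  define iS where "iS x = inverse (ev1 Y S x)" for x
  have isK: "iS \<in> K" unfolding iS_def[abs_def] by (rule Kinv[OF ev1_in_K[OF r Y S]])
  obtain B where B: "B \<in> K" "\<And>x. B x \<ge> 3" "\<And>f x. f \<in> fst ` C \<union> Y ` {..r} \<union> {iS} \<Longrightarrow> \<bar>f x\<bar> \<le> B x - 1"
    by (rule K_common_bound[of "fst ` C \<union> Y ` {..r} \<union> {iS}"]) (use C CK Y isK in auto)
  obtain N1 where "lip_exp N1 A" using lip_exp_exists by blast
  obtain N2 where "lip_exp N2 S" using lip_exp_exists by blast
  define N where "N = max N1 N2"
  have N: "lip_exp N A" "lip_exp N S"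
    using lip_exp_mono[OF \<open>lip_exp N1 A\<close>, of N] lip_exp_mono[OF \<open>lip_exp N2 S\<close>, of N] by (auto simp: N_def)
  define M where "M = 2 * N + 5"
  define \<delta> where "\<delta> x = (\<Sum>c\<in>C. \<bar>snd c x - fst c x\<bar>)" for x
  have \<delta>n: "negl \<delta>" unfolding \<delta>_def[abs_def] by (rule negl_sum[OF C(1)]) (use CK in \<open>auto intro: negl_abs\<close>)
  have \<delta>0: "\<delta> x \<ge> 0" for x unfolding \<delta>_def by (intro sum_nonneg) auto
  have \<delta>c: "\<bar>snd c x - fst c x\<bar> \<le> \<delta> x" if "c \<in> C" for c x
    unfolding \<delta>_def by (rule member_le_sum) (use that C in auto)
  have BMn: "negl (\<lambda>x. B x ^ M * \<delta> x)" by (rule negl_mult_K[OF \<delta>n K_power[OF B(1)]])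
  have K1': "(\<lambda>x. real 2 * B x ^ (N + 1)) \<in> K" "(\<lambda>x. real 4 * B x ^ M) \<in> K" "(\<lambda>x. real 4) \<in> K"
    by (intro Kmult K_const_nat K_power B(1))+
  have anC: "eventually (\<lambda>a. \<forall>c\<in>C. real_analytic_on {a<..} (snd c)) at_top"
  proof (rule eventually_ball_finite[OF C(1)], rule ballI)
    fix c assume "c \<in> C"
    then obtain a0 where "real_analytic_on {a0<..} (snd c)" using CK(2) unfolding germ_C_omega_def by blast
    note a0 = this
    show "eventually (\<lambda>a. real_analytic_on {a<..} (snd c)) at_top"
      using eventually_ge_at_top[of a0] by eventually_elim (rule real_analytic_on_subset[OF a0], simp)
  qed
  have evY: "eventually (\<lambda>x. \<forall>j\<in>{..r}. (Y j has_real_derivative Y (Suc j) x) (at x)) at_top"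
    using Yd unfolding ev_deriv_def by (intro eventually_ball_finite) auto
  have contYr: "eventually (\<lambda>x. isCont (Y (Suc r)) x) at_top"
    by (rule germ_C_lt_inf_isCont[OF KC[OF Y]])
  have "eventually (\<lambda>x. (\<forall>j\<in>{..r}. (Y j has_real_derivative Y (Suc j) x) (at x)) \<and> isCont (Y (Suc r)) x \<and>
     Y (Suc r) x = - ev1 Y A x / ev1 Y S x \<and> ev1 Y S x \<noteq> 0 \<and> real 2 * B x ^ (N + 1) \<le> E x \<and> real 4 * B x ^ M \<le> E' x \<and> E' x \<ge> 4 \<and> E x \<ge> 1
     \<and> \<delta> x \<le> exp (- E x) \<and> B x ^ M * \<delta> x \<le> exp (- E x)) at_top"
    using evY contYr eq S0 dom[OF K1'(1)] dom[OF K1'(2)] dom[OF K1'(3)] E_ge[of 1] neglD[OF \<delta>n, of 1] neglD[OF BMn, of 1]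
    unfolding germ_nonzero_def by eventually_elim (simp, linarith)
  \<comment> \<open>Analyticity beyond x - 1 puts \<open>x0\<close> itself into an open domain,
    which gives continuity on the closed half-line.\<close>
  moreover have "eventually (\<lambda>x. \<forall>c\<in>C. real_analytic_on {x - 1<..} (snd c)) at_top"
  proof -
    have "filterlim (\<lambda>x::real. x - 1) at_top at_top"
      using filterlim_tendsto_add_at_top[OF tendsto_const[of "-1::real"] filterlim_ident[of at_top]] by (simp add: add.commute)
    from eventually_compose_filterlim[OF anC this] show ?thesis .
  qed
  ultimately have "eventually (\<lambda>x. ((\<forall>j\<in>{..r}. (Y j has_real_derivative Y (Suc j) x) (at x)) \<and> isCont (Y (Suc r)) x \<and>
     Y (Suc r) x = - ev1 Y A x / ev1 Y S x \<and> ev1 Y S x \<noteq> 0 \<and> real 2 * B x ^ (N + 1) \<le> E x \<and> real 4 * B x ^ M \<le> E' x \<and> E' x \<ge> 4 \<and> E x \<ge> 1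
     \<and> \<delta> x \<le> exp (- E x) \<and> B x ^ M * \<delta> x \<le> exp (- E x)) \<and> (\<forall>c\<in>C. real_analytic_on {x - 1<..} (snd c))) at_top"
    by (rule eventually_conj)
  then obtain x0 where x0: "\<forall>x\<ge>x0. ((\<forall>j\<in>{..r}. (Y j has_real_derivative Y (Suc j) x) (at x)) \<and> isCont (Y (Suc r)) x \<and>
     Y (Suc r) x = - ev1 Y A x / ev1 Y S x \<and> ev1 Y S x \<noteq> 0 \<and> real 2 * B x ^ (N + 1) \<le> E x \<and> real 4 * B x ^ M \<le> E' x \<and> E' x \<ge> 4 \<and> E x \<ge> 1
     \<and> \<delta> x \<le> exp (- E x) \<and> B x ^ M * \<delta> x \<le> exp (- E x)) \<and> (\<forall>c\<in>C. real_analytic_on {x - 1<..} (snd c))"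
    unfolding eventually_at_top_linorder by (rule exE)
  have Yd: "(Y j has_real_derivative Y (Suc j) x) (at x)" if "j \<le> r" "x \<ge> x0" for j x using x0 that by simp
  have Yc: "isCont (Y (Suc r)) x" if "x \<ge> x0" for x using x0 that by simp
  have Yeq: "Y (Suc r) x = - ev1 Y A x / ev1 Y S x" and S0: "ev1 Y S x \<noteq> 0" if "x \<ge> x0" for x using x0 that by auto
  have EB: "real 2 * B x ^ (N + 1) \<le> E x" and EB': "real 4 * B x ^ M \<le> E' x" and E'4: "E' x \<ge> 4" and E1: "E x \<ge> 1"
    and \<delta>E: "\<delta> x \<le> exp (- E x)" and \<delta>E': "B x ^ M * \<delta> x \<le> exp (- E x)" if "x \<ge> x0" for x using x0 that by auto
  have anC: "real_analytic_on {x0 - 1<..} (snd c)" if "c \<in> C" for c using x0 that by auto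
  interpret decay_weight E E' x0
    by unfold_locales (use E_deriv E'4 E1 E_lim in \<open>auto intro: order_trans[of 0 1]\<close>)
  \<comment> \<open>Right-hand side of the last equation for the deviation: the copied quotient at Y
    + u minus the derivative of \<open>Y r\<close>, which is the original quotient.\<close>
  define \<Phi> where "\<Phi> x u = - ev (\<lambda>c. snd c x) (\<lambda>j. Y j x + u j) A / ev (\<lambda>c. snd c x) (\<lambda>j. Y j x + u j) S - Y (Suc r) x" for x u
  have kk: "\<bar>fst c x\<bar> \<le> B x \<and> \<bar>snd c x\<bar> \<le> B x \<and> \<bar>snd c x - fst c x\<bar> \<le> \<delta> x" if c: "c \<in> coefs A \<union> coefs S" and x: "x \<ge> x0" for c x
  proof -
    have cC: "c \<in> C" using c by (simp add: C_def)
    have 1: "\<bar>fst c x\<bar> \<le> B x - 1" using B(3)[of "fst c" x] cC by auto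
    have "exp (- E x) \<le> 1" using E1[OF x] by simp
    then have "\<bar>snd c x - fst c x\<bar> \<le> 1" using \<delta>c[OF cC, of x] \<delta>E[OF x] by linarith
    then have "\<bar>snd c x\<bar> \<le> B x" using 1 by linarith
    then show ?thesis using 1 \<delta>c[OF cC, of x] by linarith
  qed
  have yy: "\<bar>Y j x\<bar> \<le> B x - 1" if "j \<in> vars A \<union> vars S" for j x
    using B(3)[of "Y j" x] vs that by auto
  have SS: "1 / B x \<le> \<bar>ev1 Y S x\<bar>" if x: "x \<ge> x0" for x
  proof -
    have "\<bar>iS x\<bar> \<le> B x" using B(3)[of iS x] by simp
    then have "\<bar>ev1 Y S x\<bar> * \<bar>iS x\<bar> \<le> \<bar>ev1 Y S x\<bar> * B x" by (intro mult_left_mono) auto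
    moreover have "\<bar>ev1 Y S x\<bar> * \<bar>iS x\<bar> = 1" using S0[OF x] by (simp add: iS_def abs_mult[symmetric])
    ultimately show ?thesis using B(2)[of x] by (simp add: field_simps)
  qed
  have small: "B x ^ N * exp (- E x) \<le> 1 / (2 * B x)" if x: "x \<ge> x0" for x
  proof -
    have "E x \<le> exp (E x)" using exp_ge_add_one_self[of "E x"] by linarith
    then have "real 2 * B x ^ (N + 1) \<le> exp (E x)" using EB[OF x] by linarith
    then have "(2 * B x * B x ^ N) * exp (- E x) \<le> exp (E x) * exp (- E x)" by (intro mult_right_mono) (auto simp: mult_ac)
    then have "2 * B x * (B x ^ N * exp (- E x)) \<le> 1" by (simp add: exp_add[symmetric] mult_ac)
    then show ?thesis using B(2)[of x] by (simp add: field_simps)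
  qed
  have e1: "exp (- E x) \<le> 1" if "x \<ge> x0" for x using E1[OF that] by simp
  have uv: "\<bar>u j\<bar> \<le> e" if "\<And>j. j \<le> r \<Longrightarrow> \<bar>u j\<bar> \<le> e" "j \<in> vars A \<union> vars S" for u :: "nat \<Rightarrow> real" and e j
    using that vs by auto
  have B2: "B x \<ge> 2" for x using B(2)[of x] by linarith
  have lowS: "\<bar>ev (\<lambda>c. snd c x) (\<lambda>j. Y j x + u j) S\<bar> \<ge> 1 / (2 * B x)"
    if x: "x \<ge> x0" and u: "\<And>j. j \<le> r \<Longrightarrow> \<bar>u j\<bar> \<le> exp (- E x)" for x u
    by (rule quotient_estimates(1)[OF N B2 kk[OF _ x] yy _ \<delta>0 \<delta>E[OF x] e1[OF x] small[OF x] uv[OF u]])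
      (use SS[OF x] in \<open>auto simp: ev1_def\<close>)
  have lip: "\<bar>\<Phi> x u - \<Phi> x v\<bar> \<le> E' x / 4 * d"
    if x: "x \<ge> x0" and u: "\<And>j. j \<le> r \<Longrightarrow> \<bar>u j\<bar> \<le> exp (- E x)" and v: "\<And>j. j \<le> r \<Longrightarrow> \<bar>v j\<bar> \<le> exp (- E x)"
      and d: "\<And>j. j \<le> r \<Longrightarrow> \<bar>u j - v j\<bar> \<le> d" for x u v d
  proof -
    have d0: "d \<ge> 0" using d[of 0] by linarith
    have dd: "\<bar>u j - v j\<bar> \<le> d" if "j \<in> vars A \<union> vars S" for j using d vs that by auto
    have "\<bar>- ev (\<lambda>c. snd c x) (\<lambda>j. Y j x + u j) A / ev (\<lambda>c. snd c x) (\<lambda>j. Y j x + u j) S - (- ev (\<lambda>c. snd c x) (\<lambda>j. Y j x + v j) A / ev (\<lambda>c. snd c x) (\<lambda>j. Y j x + v j) S)\<bar> \<le> B x ^ (2 * N + 5) * d"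
      by (rule quotient_estimates(2)[OF N B2 kk[OF _ x] yy _ \<delta>0 \<delta>E[OF x] e1[OF x] small[OF x] uv[OF u] uv[OF v] dd d0])
        (use SS[OF x] in \<open>auto simp: ev1_def\<close>)
    then have "\<bar>\<Phi> x u - \<Phi> x v\<bar> \<le> B x ^ M * d" unfolding \<Phi>_def M_def by simp
    also have "\<dots> \<le> E' x / 4 * d" using EB'[OF x] d0 by (intro mult_right_mono) auto
    finally show ?thesis .
  qed
  have \<Phi>0: "\<bar>\<Phi> x (\<lambda>j. 0)\<bar> \<le> B x ^ M * \<delta> x" if x: "x \<ge> x0" for x
  proof -
    have "\<bar>- ev (\<lambda>c. snd c x) (\<lambda>j. Y j x) A / ev (\<lambda>c. snd c x) (\<lambda>j. Y j x) S - (- ev (\<lambda>c. fst c x) (\<lambda>j. Y j x) A / ev (\<lambda>c. fst c x) (\<lambda>j. Y j x) S)\<bar> \<le> B x ^ (2 * N + 5) * \<delta> x"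
      by (rule quotient_estimates(3)[OF N B2 kk[OF _ x] yy _ \<delta>0 \<delta>E[OF x] e1[OF x] small[OF x], where u = "\<lambda>j. 0"])
        (use SS[OF x] in \<open>auto simp: ev1_def\<close>)
    then show ?thesis unfolding \<Phi>_def M_def Yeq[OF x] ev1_def by simp
  qed
  have contS: "continuous_on {x0..} (\<lambda>x. ev (\<lambda>c. snd c x) (\<lambda>j. Y j x + U j x) e)"
    if e: "e \<in> {A, S}" and U: "\<And>j. j \<le> r \<Longrightarrow> continuous_on {x0..} (U j)" for e U
  proof (rule continuous_on_ev)
    fix c assume "c \<in> coefs e"
    then have "c \<in> C" using e by (auto simp: C_def)
    then show "continuous_on {x0..} (snd c)"
      by (intro continuous_at_imp_continuous_on ballI DERIV_isCont[OF real_analytic_on_has_derivative[OF anC]]) auto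
  next
    fix j assume "j \<in> vars e"
    then have j: "j \<le> r" using e vs by auto
    show "continuous_on {x0..} (\<lambda>x. Y j x + U j x)"
      by (intro continuous_on_add U[OF j] continuous_at_imp_continuous_on ballI DERIV_isCont[OF Yd[OF j]]) auto
  qed
  have "\<exists>U. (\<forall>j<r. \<forall>x>x0. (U j has_real_derivative U (Suc j) x) (at x)) \<and>
     (\<forall>x>x0. (U r has_real_derivative \<Phi> x (\<lambda>j. U j x)) (at x)) \<and>
     (\<forall>j\<le>r. \<forall>x\<ge>x0. \<bar>U j x\<bar> \<le> exp (- E x)) \<and>
     (\<forall>j\<le>r. \<forall>n. eventually (\<lambda>x. \<bar>U j x\<bar> \<le> exp (- real n * E x)) at_top)"
  proof (rule perturbed_ode)
    fix x u v d assume "x \<ge> x0" "\<And>j. j \<le> r \<Longrightarrow> \<bar>u j\<bar> \<le> exp (- E x)" "\<And>j. j \<le> r \<Longrightarrow> \<bar>v j\<bar> \<le> exp (- E x)" "\<And>j. j \<le> r \<Longrightarrow> \<bar>u j - v j\<bar> \<le> d"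
    then show "\<bar>\<Phi> x u - \<Phi> x v\<bar> \<le> E' x / 4 * d" by (rule lip)
  next
    fix x assume x: "x \<ge> x0"
    have "1 * exp (- E x) \<le> E' x / 4 * exp (- E x)" using E'4[OF x] by (intro mult_right_mono) auto
    then show "\<bar>\<Phi> x (\<lambda>j. 0)\<bar> \<le> E' x / 4 * exp (- E x)" using \<Phi>0[OF x] \<delta>E'[OF x] by linarith
  next
    fix n :: nat
    show "eventually (\<lambda>x. \<bar>\<Phi> x (\<lambda>j. 0)\<bar> \<le> exp (- real n * E x)) at_top"
      using neglD[OF BMn, of n] eventually_ge_at_top[of x0]
    proof eventually_elim
      case (elim x) then show ?case using \<Phi>0[OF elim(2)] by linarith
    qed
  next
    fix U assume U: "\<And>j. j \<le> r \<Longrightarrow> continuous_on {x0..} (U j)" "\<And>j x. j \<le> r \<Longrightarrow> x \<ge> x0 \<Longrightarrow> \<bar>U j x\<bar> \<le> exp (- E x)"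
    have nz: "ev (\<lambda>c. snd c x) (\<lambda>j. Y j x + U j x) S \<noteq> 0" if "x \<in> {x0..}" for x
    proof -
      have "1 / (2 * B x) > 0" using B2[of x] by simp
      moreover have "1 / (2 * B x) \<le> \<bar>ev (\<lambda>c. snd c x) (\<lambda>j. Y j x + U j x) S\<bar>"
        by (rule lowS) (use that U(2) in auto)
      ultimately show ?thesis by auto
    qed
    show "continuous_on {x0..} (\<lambda>x. \<Phi> x (\<lambda>j. U j x))"
      unfolding \<Phi>_def
      by (intro continuous_on_diff continuous_on_divide continuous_on_minus contS U(1) ballI nz continuous_at_imp_continuous_on Yc) auto
  qed
  then obtain U where U: "(\<forall>j<r. \<forall>x>x0. (U j has_real_derivative U (Suc j) x) (at x)) \<and>
     (\<forall>x>x0. (U r has_real_derivative \<Phi> x (\<lambda>j. U j x)) (at x)) \<and>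
     (\<forall>j\<le>r. \<forall>x\<ge>x0. \<bar>U j x\<bar> \<le> exp (- E x)) \<and>
     (\<forall>j\<le>r. \<forall>n. eventually (\<lambda>x. \<bar>U j x\<bar> \<le> exp (- real n * E x)) at_top)" by (rule exE)
  define Z where "Z j x = Y j x + U j x" for j x
  have Zd: "(Z j has_real_derivative Z (Suc j) x) (at x)" if "j < r" "x > x0" for j x
    unfolding Z_def[abs_def] by (intro DERIV_add Yd) (use U that in auto)
  have Zr: "(Z r has_real_derivative - ev2 Z A x / ev2 Z S x) (at x)" if x: "x > x0" for x
  proof -
    have "((\<lambda>x. Y r x + U r x) has_real_derivative Y (Suc r) x + \<Phi> x (\<lambda>j. U j x)) (at x)"
      by (intro DERIV_add Yd) (use U x in auto)
    moreover have "Y (Suc r) x + \<Phi> x (\<lambda>j. U j x) = - ev2 Z A x / ev2 Z S x" by (simp add: \<Phi>_def ev2_def Z_def)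
    ultimately show ?thesis unfolding Z_def[abs_def] by simp
  qed
  have ZS: "ev2 Z S x \<noteq> 0" if x: "x > x0" for x
  proof -
    have "1 / (2 * B x) > 0" using B2[of x] by simp
    moreover have "1 / (2 * B x) \<le> \<bar>ev (\<lambda>c. snd c x) (\<lambda>j. Y j x + U j x) S\<bar>"
      by (rule lowS) (use x U in auto)
    ultimately show ?thesis unfolding ev2_def Z_def by auto
  qed
  have Zw: "Z j \<in> germ_C_omega" if j: "j \<le> r" for j
  proof -
    have e: "ev2 Z e x = ev (\<lambda>c. c x) (\<lambda>j. Z j x) (map_ex snd e)" for e :: "rpair ex" and x by (simp add: ev2_def ev_map)
    have "real_analytic_on {x0<..} (Z j)"
    proof (rule rational_ode_analytic[of r x0 Z "map_ex snd A" "map_ex snd S"])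
      show "(Z r has_real_derivative - ev (\<lambda>c. c x) (\<lambda>j. Z j x) (map_ex snd A) / ev (\<lambda>c. c x) (\<lambda>j. Z j x) (map_ex snd S)) (at x)" if "x > x0" for x
        using Zr[OF that] unfolding e .
      show "ev (\<lambda>c. c x) (\<lambda>j. Z j x) (map_ex snd S) \<noteq> 0" if "x > x0" for x using ZS[OF that] unfolding e .
      show "real_analytic_on {x0<..} c" if "c \<in> coefs (map_ex snd A) \<union> coefs (map_ex snd S)" for c
      proof -
        have "c \<in> snd ` C" using that by (simp add: C_def ex.set_map image_Un)
        then obtain d where "c = snd d" "d \<in> C" by (rule imageE)
        then show ?thesis using real_analytic_on_subset[OF anC] by auto
      qed
    qed (use Zd vs j in \<open>auto simp: vars_map\<close>)
    then show ?thesis unfolding germ_C_omega_def by blast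
  qed
  have Zn: "negl (\<lambda>x. Z j x - Y j x)" if j: "j \<le> r" for j
    unfolding Z_def using U j by (simp add: negl_def)
  show ?thesis by (rule that[OF Zd Zr ZS Zw Zn])
qed

lemma ev1_relS: "ev1 Y (relS c n r) x = (\<Sum>i\<le>n. (real (Suc i) * ev1 Y (c (Suc i)) x) * Y r x ^ i)"
  unfolding ev1_def by (subst ev_relS) simp_all
lemma ev2_relS: "ev2 Y (relS c n r) x = (\<Sum>i\<le>n. (real (Suc i) * ev2 Y (c (Suc i)) x) * Y r x ^ i)"
  unfolding ev2_def by (subst ev_relS) simp_all
lemma ev1_relA: "ev1 Y (relA c n r) x = (\<Sum>i\<le>Suc n. ev1 Y (Dx dpair (\<lambda>j. Vr (Suc j)) (c i)) x * Y r x ^ i)"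
  unfolding ev1_def by (subst ev_relA) simp_all
lemma ev2_relA: "ev2 Y (relA c n r) x = (\<Sum>i\<le>Suc n. ev2 Y (Dx dpair (\<lambda>j. Vr (Suc j)) (c i)) x * Y r x ^ i)"
  unfolding ev2_def by (subst ev_relA) simp_all

text \<open>Stated at a point and for all families \<open>Y\<close>, so that the arguments to be
  excluded depend on the coefficients only. It is applied to the original jet and to the solution of
  the copied equation.\<close>

definition rel_deriv :: "(nat \<Rightarrow> rpair ex) \<Rightarrow> nat \<Rightarrow> nat \<Rightarrow> real \<Rightarrow> bool" where
  "rel_deriv c n r x \<longleftrightarrow> (\<forall>Y D. (\<forall>j<r. (Y j has_real_derivative Y (Suc j) x) (at x)) \<and> (Y r has_real_derivative D) (at x) \<longrightarrow>
      ((\<lambda>x. \<Sum>i\<le>Suc n. ev1 Y (c i) x * Y r x ^ i) has_real_derivative ev1 Y (relA c n r) x + ev1 Y (relS c n r) x * D) (at x) \<and>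
      ((\<lambda>x. \<Sum>i\<le>Suc n. ev2 Y (c i) x * Y r x ^ i) has_real_derivative ev2 Y (relA c n r) x + ev2 Y (relS c n r) x * D) (at x))"

lemma rel_derivD:
  assumes "rel_deriv c n r x" "\<forall>j<r. (Y j has_real_derivative Y (Suc j) x) (at x)" "(Y r has_real_derivative D) (at x)"
  shows "((\<lambda>x. \<Sum>i\<le>Suc n. ev1 Y (c i) x * Y r x ^ i) has_real_derivative ev1 Y (relA c n r) x + ev1 Y (relS c n r) x * D) (at x)"
    "((\<lambda>x. \<Sum>i\<le>Suc n. ev2 Y (c i) x * Y r x ^ i) has_real_derivative ev2 Y (relA c n r) x + ev2 Y (relS c n r) x * D) (at x)"
proof -
  note * = assms(1)[unfolded rel_deriv_def, THEN spec, THEN spec, THEN mp, OF conjI[OF assms(2,3)]]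
  show "((\<lambda>x. \<Sum>i\<le>Suc n. ev1 Y (c i) x * Y r x ^ i) has_real_derivative ev1 Y (relA c n r) x + ev1 Y (relS c n r) x * D) (at x)"
    by (rule *[THEN conjunct1])
  show "((\<lambda>x. \<Sum>i\<le>Suc n. ev2 Y (c i) x * Y r x ^ i) has_real_derivative ev2 Y (relA c n r) x + ev2 Y (relS c n r) x * D) (at x)"
    by (rule *[THEN conjunct2])
qed

lemma relation_derivative:
  assumes f: "copy_field \<rho>" and c: "\<And>i. i \<le> Suc n \<Longrightarrow> c i \<in> Expr \<rho> r"
  shows "eventually (rel_deriv c n r) at_top"
proof -
  define C where "C = (\<Union>i\<le>Suc n. coefs (c i))"
  have C: "finite C" "C \<subseteq> \<rho>" using c by (auto simp: C_def Expr_def finite_coefs)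
  have "eventually (\<lambda>x. \<forall>a\<in>C. (fst a has_real_derivative deriv (fst a) x) (at x) \<and> (snd a has_real_derivative deriv (snd a) x) (at x)) at_top"
  proof (rule eventually_ball_finite[OF C(1)], rule ballI)
    fix a assume "a \<in> C"
    then have "(fst a, snd a) \<in> \<rho>" using C by auto
    from copy_ring_ev_deriv[OF copy_field_copy_ring[OF f] this]
    show "eventually (\<lambda>x. (fst a has_real_derivative deriv (fst a) x) (at x) \<and> (snd a has_real_derivative deriv (snd a) x) (at x)) at_top"
      unfolding ev_deriv_def by eventually_elim simp
  qed
  then show ?thesis
  proof eventually_elim
    case (elim x)
    show ?case unfolding rel_deriv_def
    proof (intro allI impI, elim conjE)
      fix Y :: "nat \<Rightarrow> real \<Rightarrow> real" and D
      assume Y: "\<forall>j<r. (Y j has_real_derivative Y (Suc j) x) (at x)" "(Y r has_real_derivative D) (at x)"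
      have 1: "((\<lambda>x. \<Sum>i\<le>Suc n. ev (\<lambda>c. fst c x) (\<lambda>j. Y j x) (c i) * Y r x ^ i) has_real_derivative
     (\<Sum>i\<le>Suc n. ev (\<lambda>c. fst c x) (\<lambda>j. Y j x) (Dx dpair (\<lambda>j. Vr (Suc j)) (c i)) * Y r x ^ i)
     + (\<Sum>i\<le>n. (real (Suc i) * ev (\<lambda>c. fst c x) (\<lambda>j. Y j x) (c (Suc i))) * Y r x ^ i) * D) (at x)"
        by (rule deriv_of_relation[where k = "\<lambda>c. fst c"])
          (use c elim Y in \<open>auto simp: Expr_def C_def dpair_def\<close>)
      have 2: "((\<lambda>x. \<Sum>i\<le>Suc n. ev (\<lambda>c. snd c x) (\<lambda>j. Y j x) (c i) * Y r x ^ i) has_real_derivative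
     (\<Sum>i\<le>Suc n. ev (\<lambda>c. snd c x) (\<lambda>j. Y j x) (Dx dpair (\<lambda>j. Vr (Suc j)) (c i)) * Y r x ^ i)
     + (\<Sum>i\<le>n. (real (Suc i) * ev (\<lambda>c. snd c x) (\<lambda>j. Y j x) (c (Suc i))) * Y r x ^ i) * D) (at x)"
        by (rule deriv_of_relation[where k = "\<lambda>c. snd c"])
          (use c elim Y in \<open>auto simp: Expr_def C_def dpair_def\<close>)
      show "((\<lambda>x. \<Sum>i\<le>Suc n. ev1 Y (c i) x * Y r x ^ i) has_real_derivative ev1 Y (relA c n r) x + ev1 Y (relS c n r) x * D) (at x) \<and>
      ((\<lambda>x. \<Sum>i\<le>Suc n. ev2 Y (c i) x * Y r x ^ i) has_real_derivative ev2 Y (relA c n r) x + ev2 Y (relS c n r) x * D) (at x)"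
        unfolding ev1_relA ev2_relA ev1_relS ev2_relS unfolding ev1_def ev2_def using 1 2 by (rule conjI)
    qed
  qed
qed

lemma relA_relS_Ex:
  assumes f: "copy_field \<rho>" and c: "\<And>i. i \<le> Suc n \<Longrightarrow> c i \<in> Expr \<rho> r"
  shows "relA c n r \<in> Expr \<rho> (Suc r)" "relS c n r \<in> Expr \<rho> (Suc r)"
proof -
  note r = copy_field_copy_ring[OF f]
  have p: "ex_pow (Vr r) one_pair i \<in> Expr \<rho> (Suc r)" for i
    by (rule Expr_ex_pow) (use copy_ringD(2)[OF r] in \<open>auto simp: Expr_simps\<close>)
  have d: "Dx dpair (\<lambda>j. Vr (Suc j)) (c i) \<in> Expr \<rho> (Suc r)" if "i \<le> Suc n" for i
    by (rule Expr_Dx_shift[OF copy_field_dpair[OF f] c[OF that]])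
  show "relA c n r \<in> Expr \<rho> (Suc r)" unfolding relA_def by (rule Expr_ex_sum) (use p d in \<open>simp add: Expr_simps\<close>)
  have c': "c i \<in> Expr \<rho> (Suc r)" if "i \<le> Suc n" for i using Expr_mono[of r "Suc r" \<rho> \<rho>] c[OF that] by simp
  show "relS c n r \<in> Expr \<rho> (Suc r)" unfolding relS_def
    by (rule Expr_ex_sum) (use p c' copy_ring_const_nat[OF r] in \<open>simp add: Expr_simps del: of_nat_Suc\<close>)
qed

lemma relation_quotient:
  assumes f: "copy_field \<rho>" and c: "\<And>i. i \<le> Suc n \<Longrightarrow> c i \<in> Expr \<rho> r"
    and Yd: "\<And>j. ev_deriv (Y j) (Y (Suc j))"
    and rel: "germ_zero (\<lambda>x. \<Sum>i\<le>Suc n. ev1 Y (c i) x * Y r x ^ i)" and S: "germ_nonzero (ev1 Y (relS c n r))"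
  shows "eventually (\<lambda>x. Y (Suc r) x = - ev1 Y (relA c n r) x / ev1 Y (relS c n r) x) at_top"
proof -
  have evY: "eventually (\<lambda>x. \<forall>j\<in>{..r}. (Y j has_real_derivative Y (Suc j) x) (at x)) at_top"
    using Yd unfolding ev_deriv_def by (intro eventually_ball_finite) auto
  have rd: "eventually (rel_deriv c n r) at_top" by (rule relation_derivative[OF f]) (rule c)
  have "ev_deriv (\<lambda>x. \<Sum>i\<le>Suc n. ev1 Y (c i) x * Y r x ^ i) (\<lambda>x. ev1 Y (relA c n r) x + ev1 Y (relS c n r) x * Y (Suc r) x)"
    using rd evY unfolding ev_deriv_def
  proof eventually_elim
    case (elim x)
    show ?case by (rule rel_derivD(1)[OF elim(1)]) (use elim(2) in auto)
  qed
  then have "eventually (\<lambda>x. deriv (\<lambda>x. \<Sum>i\<le>Suc n. ev1 Y (c i) x * Y r x ^ i) x = ev1 Y (relA c n r) x + ev1 Y (relS c n r) x * Y (Suc r) x) at_top"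
    by (rule ev_deriv_imp_deriv)
  moreover have "eventually (\<lambda>x. deriv (\<lambda>x. \<Sum>i\<le>Suc n. ev1 Y (c i) x * Y r x ^ i) x = deriv (\<lambda>x. 0) x) at_top"
    by (rule deriv_ev_cong) (use rel in \<open>simp add: germ_zero_def\<close>)
  ultimately show ?thesis using S unfolding germ_nonzero_def
    by eventually_elim (simp add: field_simps add_eq_0_iff)
qed

text \<open>Solving the differentiated relation gives a \<open>Z\<close> for which the copied
  relation has derivative 0 and is eventually constant. Being close to the original relation, which
  is 0, it is 0; so \<open>Z\<close> satisfies the copied minimal relation itself, and all other
  relations follow from it.\<close>

lemma extend_algebraic:
  assumes f: "copy_field \<rho>" and y: "y \<in> K" and nt: "\<not> (\<forall>j. transc \<rho> (\<lambda>j. (deriv ^^ j) y) j)"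
  shows "\<exists>\<rho>' g. copy_field \<rho>' \<and> \<rho> \<subseteq> \<rho>' \<and> (y, g) \<in> \<rho>'"
proof -
  define Y where "Y = (\<lambda>j. (deriv ^^ j) y)"
  note ar = copy_field_copy_ring[OF f]
  have YK: "Y j \<in> K" for j unfolding Y_def by (rule K_derivs[OF y])
  have Yd: "ev_deriv (Y j) (Y (Suc j))" for j
    unfolding Y_def using germ_C_lt_inf_ev_deriv[OF KC[OF K_derivs[OF y]]] by simp
  show ?thesis
  proof (rule minimal_relation[OF ar YK nt[folded Y_def]])
  fix r n c assume t: "\<And>j. j < r \<Longrightarrow> transc \<rho> Y j" and c: "\<And>i. i \<le> Suc n \<Longrightarrow> c i \<in> Expr \<rho> r"
    and rel: "germ_zero (\<lambda>x. \<Sum>i\<le>Suc n. ev1 Y (c i) x * Y r x ^ i)" and top: "germ_nonzero (ev1 Y (c (Suc n)))"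
    and min: "\<And>N d. N < Suc n \<Longrightarrow> (\<And>i. i \<le> N \<Longrightarrow> d i \<in> Expr \<rho> r) \<Longrightarrow> germ_zero (\<lambda>x. \<Sum>i\<le>N. ev1 Y (d i) x * Y r x ^ i) \<Longrightarrow> (\<And>i. i \<le> N \<Longrightarrow> germ_zero (ev1 Y (d i)))"
  define A S where "A = relA c n r" and "S = relS c n r"
  have A: "A \<in> Expr \<rho> (Suc r)" and S: "S \<in> Expr \<rho> (Suc r)" unfolding A_def S_def by (rule relA_relS_Ex[OF f c], assumption)+
  have S0: "germ_nonzero (ev1 Y S)" unfolding S_def
  proof (rule separant_nonzero[where Y = Y and c = c and n = n and r = r, OF ar YK c top])
    fix N d i assume m: "N < Suc n" "\<And>i. i \<le> N \<Longrightarrow> d i \<in> Expr \<rho> r" "germ_zero (\<lambda>x. \<Sum>i\<le>N. ev1 Y (d i) x * Y r x ^ i)" "i \<le> N"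
    show "germ_zero (ev1 Y (d i))" by (rule min[OF m])
  qed
  have eq: "eventually (\<lambda>x. Y (Suc r) x = - ev1 Y A x / ev1 Y S x) at_top"
    unfolding A_def S_def by (rule relation_quotient[OF f c Yd rel S0[unfolded S_def]])
  obtain Z x0 where Zd: "\<And>j x. j < r \<Longrightarrow> x > x0 \<Longrightarrow> (Z j has_real_derivative Z (Suc j) x) (at x)"
    and Zr: "\<And>x. x > x0 \<Longrightarrow> (Z r has_real_derivative - ev2 Z A x / ev2 Z S x) (at x)"
    and ZS: "\<And>x. x > x0 \<Longrightarrow> ev2 Z S x \<noteq> 0" and Zw: "\<And>j. j \<le> r \<Longrightarrow> Z j \<in> germ_C_omega" and Zn: "\<And>j. j \<le> r \<Longrightarrow> negl (\<lambda>x. Z j x - Y j x)"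
    by (rule solve_perturbed[OF ar A S YK Yd S0 eq]) (rule that)
  have Zw': "Z j \<in> germ_C_omega" and Zn': "negl (\<lambda>x. Z j x - Y j x)" if "j < Suc r" for j using Zw Zn that by auto
  define P2 where "P2 x = (\<Sum>i\<le>Suc n. ev2 Z (c i) x * Z r x ^ i)" for x
  have P20: "germ_zero P2"
  proof -
    have rd: "eventually (rel_deriv c n r) at_top" by (rule relation_derivative[OF f]) (rule c)
    have "eventually (\<lambda>x. (P2 has_real_derivative 0) (at x)) at_top"
      using rd eventually_gt_at_top[of x0]
    proof eventually_elim
      case (elim x)
      have "(P2 has_real_derivative ev2 Z A x + ev2 Z S x * (- ev2 Z A x / ev2 Z S x)) (at x)"
        unfolding P2_def[abs_def] A_def S_def
        by (rule rel_derivD(2)[OF elim(1)]) (use Zd[OF _ elim(2)] Zr[OF elim(2)] in \<open>simp_all add: A_def S_def\<close>)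
      then show ?case using ZS[OF elim(2)] by simp
    qed
    then obtain x1 where x1: "\<And>x. x \<ge> x1 \<Longrightarrow> (P2 has_real_derivative 0) (at x)" by (auto simp: eventually_at_top_linorder)
    have "\<exists>k. \<forall>x\<in>{x1..}. P2 x = k"
      by (rule has_field_derivative_zero_constant) (use x1 in \<open>auto intro: has_field_derivative_at_within\<close>)
    then obtain k where k: "\<And>x. x \<ge> x1 \<Longrightarrow> P2 x = k" by auto
    \<comment> \<open>The relation as a single term, so that the closeness of its two evaluations is
      available.\<close>
    define Pe where "Pe = ex_sum (\<lambda>i. Ml (c i) (ex_pow (Vr r) one_pair i)) (Suc n)"
    have "Ml (c i) (ex_pow (Vr r) one_pair i) \<in> Expr \<rho> (Suc r)" if "i \<le> Suc n" for i
      using Expr_mono[of r "Suc r" \<rho> \<rho>] c[OF that] copy_ringD(2)[OF ar] by (simp add: Expr_simps Expr_ex_pow)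
    then have Pe: "Pe \<in> Expr \<rho> (Suc r)" unfolding Pe_def by (rule Expr_ex_sum)
    have e1: "ev1 Y Pe x = (\<Sum>i\<le>Suc n. ev1 Y (c i) x * Y r x ^ i)" for x
      unfolding ev1_def Pe_def by (simp add: ev_ex_sum ev_ex_pow[where w = one_pair])
    have e2: "ev2 Z Pe x = P2 x" for x
      unfolding ev2_def Pe_def P2_def by (simp add: ev_ex_sum ev_ex_pow[where w = one_pair])
    have "negl (\<lambda>x. ev2 Z Pe x - ev1 Y Pe x)" by (rule ev2_near(2)[OF ar YK Zw' Zn' Pe])
    from neglD[OF this, of 1] have "eventually (\<lambda>x. \<bar>k\<bar> \<le> exp (- E x)) at_top"
      using rel eventually_ge_at_top[of x1] unfolding germ_zero_def
      by eventually_elim (simp only: e1 e2 k, simp)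
    moreover have "((\<lambda>x. exp (- E x)) \<longlongrightarrow> 0) at_top"
      by (rule filterlim_compose[OF exp_at_bot]) (use E_lim in \<open>simp add: filterlim_uminus_at_bot\<close>)
    ultimately have "\<bar>k\<bar> \<le> 0" by (intro tendsto_lowerbound[of "\<lambda>x. exp (- E x)" 0 at_top]) auto
    then have k0: "k = 0" by simp
    show ?thesis unfolding germ_zero_def using eventually_ge_at_top[of x1] by eventually_elim (simp add: k k0)
  qed
  have topZ: "germ_nonzero (ev2 Z (c (Suc n)))"
  proof (rule near_nonzero(1)[OF _ top])
    have cS: "c (Suc n) \<in> Expr \<rho> (Suc r)" using Expr_mono[of r "Suc r" \<rho> \<rho>] c by simp
    show "ev1 Y (c (Suc n)) \<in> K" by (rule ev1_in_K[OF ar YK cS])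
    show "negl (\<lambda>x. ev2 Z (c (Suc n)) x - ev1 Y (c (Suc n)) x)" by (rule ev2_near(2)[OF ar YK Zw' Zn' cS])
  qed
  have zp: "zero_pres \<rho> Y Z (Suc r)"
  proof (rule zero_pres_algebraic[OF zero_pres_all_transc[OF ar t] copy_ring_consts(1)[OF ar] copy_ringD(2)[OF ar] copy_ring_consts(2)[OF ar] c _ rel _ topZ])
    show "germ_zero (\<lambda>x. \<Sum>i\<le>Suc n. ev2 Z (c i) x * Z r x ^ i)" using P20 by (simp only: P2_def[abs_def])
  next
    fix N d i assume m: "N < Suc n" "\<And>i. i \<le> N \<Longrightarrow> d i \<in> Expr \<rho> r" "germ_zero (\<lambda>x. \<Sum>i\<le>N. ev1 Y (d i) x * Y r x ^ i)" "i \<le> N"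
    show "germ_zero (ev1 Y (d i))" by (rule min[OF m])
  qed simp_all
  have R: "copy_ring (adjoin \<rho> Y Z (Suc r))" by (rule copy_ring_adjoin[OF ar YK Zw' Zn' zp])
  note F = copy_ring_fracp[OF R] and sub = subset_fracp[OF R]
  \<comment> \<open>Only the derivative of the last variable leaves the ring; it is the quotient - A
    / S, whose denominator is nonzero.\<close>
  have vd: "(deriv (Y j), deriv (Z j)) \<in> fracp (adjoin \<rho> Y Z (Suc r))" if j: "j < Suc r" for j
  proof (cases "j < r")
    case True
    have 1: "(Y (Suc j), Z (Suc j)) \<in> fracp (adjoin \<rho> Y Z (Suc r))" using adjoin_var[of "Suc j" "Suc r" Y Z \<rho>] True sub by auto
    show ?thesis
    proof (rule copy_ringD(1)[OF F 1])
      show "eventually (\<lambda>x. Y (Suc j) x = deriv (Y j) x) at_top" by (simp add: Y_def)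
      show "eventually (\<lambda>x. Z (Suc j) x = deriv (Z j) x) at_top"
        using eventually_gt_at_top[of x0] by eventually_elim (simp add: DERIV_imp_deriv[OF Zd[OF True]])
    qed
  next
    case False
    then have jr: "j = r" using j by simp
    define A' where "A' = Ml (Cf (\<lambda>x. -1, \<lambda>x. -1)) A"
    have A': "A' \<in> Expr \<rho> (Suc r)" using A copy_ring_consts(2)[OF ar] by (simp add: A'_def Expr_simps)
    show ?thesis unfolding jr
    proof (rule fracpI)
      show "(ev1 Y A', ev2 Z A') \<in> adjoin \<rho> Y Z (Suc r)" by (rule adjoinI[OF A']) auto
      show "(ev1 Y S, ev2 Z S) \<in> adjoin \<rho> Y Z (Suc r)" by (rule adjoinI[OF S]) auto
      show "germ_nonzero (ev1 Y S)" by (rule S0)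
      show "eventually (\<lambda>x. deriv (Y r) x = ev1 Y A' x * inverse (ev1 Y S x)) at_top"
        using eq by eventually_elim (simp add: Y_def A'_def ev12_simps divide_inverse)
      show "eventually (\<lambda>x. deriv (Z r) x = ev2 Z A' x * inverse (ev2 Z S x)) at_top"
        using eventually_gt_at_top[of x0]
        by eventually_elim (simp add: DERIV_imp_deriv[OF Zr] A'_def ev12_simps divide_inverse)
    qed
  qed
  have "copy_field (fracp (adjoin \<rho> Y Z (Suc r)))"
    by (rule copy_field_fracp[OF R]) (rule adjoin_deriv[OF ar copy_field_deriv[OF f] R F sub vd])
  moreover have "\<rho> \<subseteq> fracp (adjoin \<rho> Y Z (Suc r))" using adjoin_base[of _ \<rho> Y Z "Suc r"] sub by blast
  moreover have "(Y 0, Z 0) \<in> fracp (adjoin \<rho> Y Z (Suc r))" using adjoin_var[of 0 "Suc r" Y Z \<rho>] sub by blast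
  ultimately show ?thesis unfolding Y_def by (intro exI[of _ "fracp (adjoin \<rho> (\<lambda>j. (deriv ^^ j) y) Z (Suc r))"] exI[of _ "Z 0"]) simp
  qed
qed

section \<open>Copying the whole field\<close>

lemma copy_field_maximal:
  assumes "copy_field \<rho>0"
  shows "\<exists>\<rho>. copy_field \<rho> \<and> \<rho>0 \<subseteq> \<rho> \<and> (\<forall>\<rho>'. copy_field \<rho>' \<and> \<rho> \<subseteq> \<rho>' \<longrightarrow> \<rho>' = \<rho>)"
proof -
  define F where "F = {\<rho>. copy_field \<rho> \<and> \<rho>0 \<subseteq> \<rho>}"
  have "\<exists>M\<in>F. \<forall>X\<in>F. M \<subseteq> X \<longrightarrow> X = M"
  proof (rule subset_Zorn_nonempty)
    show "F \<noteq> {}" using assms unfolding F_def by blast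
    fix C assume C: "C \<noteq> {}" "subset.chain F C"
    have sub: "C \<subseteq> F" and ch: "\<And>A B. A \<in> C \<Longrightarrow> B \<in> C \<Longrightarrow> A \<subseteq> B \<or> B \<subseteq> A"
      using C(2) by (simp_all add: subset_chain_def)
    have ad: "copy_field A" if "A \<in> C" for A using sub that unfolding F_def by blast
    have "copy_field (\<Union>C)" unfolding copy_field_def inv_closed_def
    proof (intro conjI allI impI)
      show "copy_ring (\<Union>C)" by (rule copy_ring_Union[OF C(1) ch copy_field_copy_ring[OF ad]])
      fix a b
      show "(\<lambda>x. inverse (a x), \<lambda>x. inverse (b x)) \<in> \<Union>C" if "(a, b) \<in> \<Union>C \<and> germ_nonzero a"
      proof -
        from that obtain A where "(a, b) \<in> A" "A \<in> C" by (elim conjE UnionE)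
        then show ?thesis using ad[of A] that unfolding copy_field_def inv_closed_def by (intro UnionI[of A]) simp_all
      qed
      show "(deriv a, deriv b) \<in> \<Union>C" if "(a, b) \<in> \<Union>C"
      proof -
        from that obtain A where "(a, b) \<in> A" "A \<in> C" by (elim UnionE)
        then show ?thesis using ad[of A] unfolding copy_field_def by (intro UnionI[of A]) simp_all
      qed
    qed
    moreover have "\<rho>0 \<subseteq> \<Union>C" using sub C(1) unfolding F_def by blast
    ultimately show "\<Union>C \<in> F" unfolding F_def by simp
  qed
  then obtain M where M: "M \<in> F" and max: "\<forall>X\<in>F. M \<subseteq> X \<longrightarrow> X = M" by (rule bexE)
  have "\<rho>' = M" if "copy_field \<rho>'" "M \<subseteq> \<rho>'" for \<rho>'
  proof -
    have "\<rho>' \<in> F" using M that unfolding F_def by blast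
    then show ?thesis using max that(2) by simp
  qed
  then show ?thesis using M unfolding F_def by (intro exI[of _ M]) simp
qed

text \<open>The starting point for Zorn's lemma: constants are analytic already and are copied to
  themselves.\<close>

definition const_pairs :: "rpair set" where
  "const_pairs = {(a, b). \<exists>q. (\<lambda>x. q) \<in> K \<and> eventually (\<lambda>x. a x = q) at_top \<and> eventually (\<lambda>x. b x = q) at_top}"

lemma const_pairsI: "(\<lambda>x. q) \<in> K \<Longrightarrow> eventually (\<lambda>x. a x = q) at_top \<Longrightarrow> eventually (\<lambda>x. b x = q) at_top \<Longrightarrow> (a, b) \<in> const_pairs"
  unfolding const_pairs_def by auto

lemma const_pairsE:
  assumes "(a, b) \<in> const_pairs"
  obtains q where "(\<lambda>x. q) \<in> K" "eventually (\<lambda>x. a x = q) at_top" "eventually (\<lambda>x. b x = q) at_top"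
  using assms unfolding const_pairs_def by auto

lemma copy_field_const_pairs: "copy_field const_pairs"
  unfolding copy_field_def inv_closed_def
proof (intro conjI allI impI, rule copy_ringI)
  show "one_pair \<in> const_pairs" by (rule const_pairsI[OF K1]) auto
next
  fix a b a' b' assume ab: "(a, b) \<in> const_pairs" and e: "eventually (\<lambda>x. a x = a' x) at_top" "eventually (\<lambda>x. b x = b' x) at_top"
  from ab obtain q where q: "(\<lambda>x. q) \<in> K" "eventually (\<lambda>x. a x = q) at_top" "eventually (\<lambda>x. b x = q) at_top" by (rule const_pairsE)
  show "(a', b') \<in> const_pairs"
    by (rule const_pairsI[OF q(1)]) (use q(2) e(1) in \<open>eventually_elim, simp\<close>, use q(3) e(2) in \<open>eventually_elim, simp\<close>)
next
  fix a b assume ab: "(a, b) \<in> const_pairs"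
  from ab obtain q where q: "(\<lambda>x. q) \<in> K" "eventually (\<lambda>x. a x = q) at_top" "eventually (\<lambda>x. b x = q) at_top" by (rule const_pairsE)
  have sym: "eventually (\<lambda>x. q = a x) at_top" "eventually (\<lambda>x. q = b x) at_top" using q(2,3) by (auto elim: eventually_mono)
  show "a \<in> K" by (rule Kcong[OF q(1) sym(1)])
  show "b \<in> germ_C_omega" by (rule germ_C_omega_cong[OF germ_C_omega_const sym(2)])
  show "negl (\<lambda>x. b x - a x)" by (rule negl_cong[OF negl_zero]) (use q(2,3) in \<open>eventually_elim, simp\<close>)
  show "(\<lambda>x. - a x, \<lambda>x. - b x) \<in> const_pairs"
    by (rule const_pairsI[OF Kminus[OF q(1)]]) (use q in \<open>auto elim: eventually_mono\<close>)
  show "(deriv a, deriv b) \<in> const_pairs"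
    by (rule const_pairsI[OF K0]) (use deriv_ev_cong[OF q(2)] deriv_ev_cong[OF q(3)] in simp_all)
  show "germ_zero b" if "germ_zero a"
  proof -
    have "eventually (\<lambda>x::real. q = 0) at_top" using that q(2) unfolding germ_zero_def by eventually_elim simp
    then show ?thesis using q(3) unfolding germ_zero_def by simp
  qed
next
  fix a b assume "(a, b) \<in> const_pairs \<and> germ_nonzero a"
  then obtain q where q: "(\<lambda>x. q) \<in> K" "eventually (\<lambda>x. a x = q) at_top" "eventually (\<lambda>x. b x = q) at_top" by (elim conjE const_pairsE)
  show "(\<lambda>x. inverse (a x), \<lambda>x. inverse (b x)) \<in> const_pairs"
    by (rule const_pairsI[OF Kinv[OF q(1)]]) (use q in \<open>auto elim: eventually_mono\<close>)
next
  fix a b c d assume ab: "(a, b) \<in> const_pairs" and cd: "(c, d) \<in> const_pairs"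
  from ab obtain q where q: "(\<lambda>x. q) \<in> K" "eventually (\<lambda>x. a x = q) at_top" "eventually (\<lambda>x. b x = q) at_top" by (rule const_pairsE)
  from cd obtain p where p: "(\<lambda>x. p) \<in> K" "eventually (\<lambda>x. c x = p) at_top" "eventually (\<lambda>x. d x = p) at_top" by (rule const_pairsE)
  show "(\<lambda>x. a x + c x, \<lambda>x. b x + d x) \<in> const_pairs"
    by (rule const_pairsI[OF Kadd[OF q(1) p(1)]]) (use q(2) p(2) in \<open>eventually_elim, simp\<close>, use q(3) p(3) in \<open>eventually_elim, simp\<close>)
  show "(\<lambda>x. a x * c x, \<lambda>x. b x * d x) \<in> const_pairs"
    by (rule const_pairsI[OF Kmult[OF q(1) p(1)]]) (use q(2) p(2) in \<open>eventually_elim, simp\<close>, use q(3) p(3) in \<open>eventually_elim, simp\<close>)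
qed

text \<open>A maximal copy is defined on all of \<open>K\<close>, since a missing germ could be
  added by the transcendental or by the algebraic extension.\<close>

lemma full_copy: "\<exists>\<rho>. copy_field \<rho> \<and> (\<forall>y\<in>K. \<exists>g. (y, g) \<in> \<rho>)"
proof -
  obtain \<rho> where \<rho>: "copy_field \<rho>" "\<forall>\<rho>'. copy_field \<rho>' \<and> \<rho> \<subseteq> \<rho>' \<longrightarrow> \<rho>' = \<rho>"
    using copy_field_maximal[OF copy_field_const_pairs] by (elim exE conjE)
  have "\<exists>g. (y, g) \<in> \<rho>" if y: "y \<in> K" for y
  proof -
    have "\<exists>\<rho>' g. copy_field \<rho>' \<and> \<rho> \<subseteq> \<rho>' \<and> (y, g) \<in> \<rho>'"
    proof (cases "\<forall>j. transc \<rho> (\<lambda>j. (deriv ^^ j) y) j")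
      case True
      obtain g where g: "g \<in> germ_C_omega" "\<forall>j. negl (\<lambda>x. (deriv ^^ j) g x - (deriv ^^ j) y x)"
        using approx_negl[OF KC[OF y]] by (rule bexE)
      have "\<exists>\<rho>'. copy_field \<rho>' \<and> \<rho> \<subseteq> \<rho>' \<and> (y, g) \<in> \<rho>'"
        by (rule extend_transcendental[OF \<rho>(1) y _ g(1)]) (use True g(2) in auto)
      then show ?thesis by auto
    next
      case False then show ?thesis by (rule extend_algebraic[OF \<rho>(1) y])
    qed
    then obtain \<rho>' g where r': "copy_field \<rho>'" "\<rho> \<subseteq> \<rho>'" "(y, g) \<in> \<rho>'" by (elim exE conjE)
    have "\<rho>' = \<rho>" using \<rho>(2) r'(1,2) by simp
    then show ?thesis using r'(3) by auto
  qed
  then show ?thesis using \<rho>(1) by blast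
qed

text \<open>This makes adjoinability applicable: the copies form an analytic Hardy field. The
  alternative zero or nonzero is inherited from \<open>K\<close>, as copying preserves both.\<close>

lemma hardy_field_Range:
  assumes f: "copy_field \<rho>" shows "hardy_field (Range \<rho>)" "Range \<rho> \<subseteq> germ_C_omega"
proof -
  note r = copy_field_copy_ring[OF f]
  show sub: "Range \<rho> \<subseteq> germ_C_omega"
  proof
    fix b assume "b \<in> Range \<rho>"
    then obtain a where "(a, b) \<in> \<rho>" by (rule RangeE)
    then show "b \<in> germ_C_omega" by (rule copy_ringD(7)[OF r])
  qed
  show "hardy_field (Range \<rho>)"
  proof (rule hardy_fieldI)
    show "(\<lambda>x. 0) \<in> Range \<rho>" by (rule RangeI[OF copy_ring_consts(1)[OF r]])
    show "(\<lambda>x. 1) \<in> Range \<rho>" by (rule RangeI[OF copy_ringD(2)[OF r]])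
  next
    fix b assume b: "b \<in> Range \<rho>"
    then show "b \<in> germ_C_lt_inf" using sub germ_C_omega_subset by auto
    from b obtain a where a: "(a, b) \<in> \<rho>" by (rule RangeE)
    show "b' \<in> Range \<rho>" if "eventually (\<lambda>x. b x = b' x) at_top" for b'
    proof -
      have "(a, b') \<in> \<rho>" by (rule copy_ringD(1)[OF r a _ that]) simp
      then show ?thesis by (rule RangeI)
    qed
    show "(\<lambda>x. - b x) \<in> Range \<rho>" by (rule RangeI[OF copy_ringD(5)[OF r a]])
    show "deriv b \<in> Range \<rho>" by (rule RangeI[OF copy_field_deriv[OF f a]])
    have aK: "a \<in> K" by (rule copy_ringD(6)[OF r a])
    show zn: "eventually (\<lambda>x. b x = 0) at_top \<or> eventually (\<lambda>x. b x \<noteq> 0) at_top"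
      using K_zn[OF aK] copy_ringD(9)[OF r a] copy_ring_nonzero[OF r a] unfolding germ_zero_def germ_nonzero_def by blast
    show "(\<lambda>x. inverse (b x)) \<in> Range \<rho>" if nz: "eventually (\<lambda>x. b x \<noteq> 0) at_top"
    proof -
      have "\<not> germ_zero a"
      proof
        assume "germ_zero a"
        then have "germ_zero b" by (rule copy_ringD(9)[OF r a])
        moreover have "germ_nonzero b" using nz by (simp add: germ_nonzero_def)
        ultimately show False by (rule germ_zero_nonzero_False)
      qed
      then have "germ_nonzero a" using K_zn[OF aK] by simp
      then have "(\<lambda>x. inverse (a x), \<lambda>x. inverse (b x)) \<in> \<rho>" using f a unfolding copy_field_def inv_closed_def by simp
      then show ?thesis by (rule RangeI)
    qed
  next
    fix b d assume "b \<in> Range \<rho>" "d \<in> Range \<rho>"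
    then obtain a c where ac: "(a, b) \<in> \<rho>" "(c, d) \<in> \<rho>" by (elim RangeE)
    show "(\<lambda>x. b x + d x) \<in> Range \<rho>" by (rule RangeI[OF copy_ringD(3)[OF r ac]])
    show "(\<lambda>x. b x * d x) \<in> Range \<rho>" by (rule RangeI[OF copy_ringD(4)[OF r ac]])
  qed
qed

end

section \<open>Gauges and bumps\<close>

text \<open>A diagonal construction: \<open>c n\<close> exceeds bounds for the functions of index up
  to n on the interval from n to n + 1, wherever such bounds are available, and \<open>E\<close> is
  the locally finite sum of \<open>c n\<close> times the squared positive part of x - n + 1. From n
  on both this square and its derivative are at least 1, so \<open>E\<close> and \<open>E'\<close>
  dominate together. The numbers \<alpha> n prescribe lower bounds at the integers.\<close>

lemma gauge_exists:
  fixes a :: "nat \<Rightarrow> real \<Rightarrow> real" and \<alpha> :: "nat \<Rightarrow> real"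
  assumes "\<And>i. eventually (\<lambda>x. isCont (a i) x) at_top"
  obtains E E' where "\<And>x. (E has_real_derivative E' x) (at x)" "filterlim E at_top at_top" "mono E"
    "\<And>i. eventually (\<lambda>x. \<bar>a i x\<bar> \<le> E x \<and> \<bar>a i x\<bar> \<le> E' x) at_top" "\<And>n. \<alpha> n \<le> E (real n)"
proof -
  have "\<exists>N B. \<forall>n. 0 \<le> B n \<and> (real n \<ge> N \<longrightarrow> (\<forall>x\<in>{real n..real (Suc n)}. \<bar>a i x\<bar> \<le> B n))" for i
  proof -
    obtain N where N: "\<And>x. x \<ge> N \<Longrightarrow> isCont (a i) x" using assms[of i] by (auto simp: eventually_at_top_linorder)
    have "\<exists>b. 0 \<le> b \<and> (real n \<ge> N \<longrightarrow> (\<forall>x\<in>{real n..real (Suc n)}. \<bar>a i x\<bar> \<le> b))" for n :: nat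
    proof (cases "real n \<ge> N")
      case True
      have "continuous_on {real n..real (Suc n)} (a i)" using N True by (intro continuous_at_imp_continuous_on) auto
      then have "bounded (a i ` {real n..real (Suc n)})" by (intro compact_imp_bounded compact_continuous_image) auto
      then obtain b where "b > 0" "\<forall>y\<in>a i ` {real n..real (Suc n)}. norm y \<le> b" unfolding bounded_pos by blast
      then show ?thesis by (intro exI[of _ b]) auto
    qed auto
    then show ?thesis by metis
  qed
  then obtain N B where NB: "\<And>i n. 0 \<le> B i n" "\<And>i n x. real n \<ge> N i \<Longrightarrow> x \<in> {real n..real (Suc n)} \<Longrightarrow> \<bar>a i x\<bar> \<le> B i n"
    by metis
  define c where "c n = (\<Sum>i\<le>n. B i n) + \<bar>\<alpha> n\<bar> + 1" for n
  have c1: "c n \<ge> 1" "c n \<ge> \<alpha> n" for n unfolding c_def using sum_nonneg[of "{..n}" "\<lambda>i. B i n"] NB(1) by (auto simp: add_increasing)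
  have cB: "c n \<ge> B i n" if "i \<le> n" for i n
    unfolding c_def using member_le_sum[of i "{..n}" "\<lambda>i. B i n"] NB(1) that by auto
  \<comment> \<open>Partial sums: at x \<le> m the terms of index above m vanish, so
    \<open>E\<close> agrees there with every partial sum of length at least m.\<close>
  define T T' where "T m x = (\<Sum>n\<le>m. c n * pos_pow 1 (x - real n + 1))"
    and "T' m x = (\<Sum>n\<le>m. c n * (2 * pos_pow 0 (x - real n + 1)))" for m :: nat and x
  have cpos: "c n \<ge> 0" for n using c1(1)[of n] by linarith
  have T_eq: "T m' x = T m x" if "x \<le> real m" "m \<le> m'" for m m' x
    unfolding T_def by (rule sum.mono_neutral_right) (use that in \<open>auto simp: not_le pos_pow_0\<close>)
  define E where "E x = T (nat \<lceil>x\<rceil>) x" for x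
  have ET: "E x = T m x" if "x \<le> real m" for x m
    unfolding E_def by (rule T_eq[symmetric]) (use that in \<open>auto simp: nat_le_iff ceiling_le_iff intro: real_nat_ceiling_ge\<close>)
  have Td: "(T m has_real_derivative T' m x) (at x)" for m x
  proof -
    have "((\<lambda>x. pos_pow 1 (x - real n + 1)) has_real_derivative 2 * pos_pow 0 (x - real n + 1)) (at x)" for n
      by (rule DERIV_chain2[where Db = 1, simplified]) (use pos_pow_has_derivative[of 0] in simp, auto intro!: derivative_eq_intros)
    then show ?thesis unfolding T_def[abs_def] T'_def by (intro DERIV_sum DERIV_cmult)
  qed
  have E': "(E has_real_derivative T' m x) (at x)" if "x < real m" for x m
    by (rule DERIV_ev_transfer[OF Td]) (use that in \<open>auto intro!: eventually_nhds_in_open[of "{..<real m}", THEN eventually_mono] ET[symmetric]\<close>)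
  define D where "D x = T' (nat \<lceil>x\<rceil> + 1) x" for x
  have ED: "(E has_real_derivative D x) (at x)" for x
    unfolding D_def by (rule E') (use real_nat_ceiling_ge[of x] in linarith)
  have low: "E x \<ge> c n \<and> D x \<ge> c n" if "x \<ge> real n" for x n
  proof -
    define m where "m = nat \<lceil>x\<rceil> + n + 1"
    have m: "x < real m" "n \<le> m" using real_nat_ceiling_ge[of x] by (auto simp: m_def)
    have "c n * pos_pow 1 (x - real n + 1) \<le> E x"
      unfolding ET[OF less_imp_le[OF m(1)]] T_def
      using m by (intro member_le_sum) (auto intro!: mult_nonneg_nonneg cpos pos_pow_nonneg)
    moreover have "c n * (2 * pos_pow 0 (x - real n + 1)) \<le> D x"
      unfolding DERIV_unique[OF ED E'[OF m(1)]] T'_def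
      using m by (intro member_le_sum) (auto intro!: mult_nonneg_nonneg cpos pos_pow_nonneg)
    moreover have "pos_pow 1 (x - real n + 1) \<ge> 1" "2 * pos_pow 0 (x - real n + 1) \<ge> 1"
      using that one_le_power[of "x - real n + 1" 2] unfolding pos_pow_def by (auto simp: power2_eq_square)
    then have "c n \<le> c n * pos_pow 1 (x - real n + 1)" "c n \<le> c n * (2 * pos_pow 0 (x - real n + 1))"
      using mult_left_mono[OF _ cpos, of 1 "pos_pow 1 (x - real n + 1)" n] mult_left_mono[OF _ cpos, of 1 "2 * pos_pow 0 (x - real n + 1)" n] by auto
    ultimately show ?thesis by linarith
  qed
  show ?thesis
  proof (rule that)
    show "(E has_real_derivative D x) (at x)" for x by (rule ED)
    have T'0: "T' m x \<ge> 0" for m x unfolding T'_def by (intro sum_nonneg mult_nonneg_nonneg cpos) (auto simp: pos_pow_nonneg)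
    show mE: "mono E"
      by (rule monoI, rule DERIV_nonneg_imp_nondecreasing) (use ED T'0 in \<open>auto simp: D_def\<close>)
    show "\<alpha> n \<le> E (real n)" for n using low[of n "real n"] c1(2)[of n] by simp
    show "eventually (\<lambda>x. \<bar>a i x\<bar> \<le> E x \<and> \<bar>a i x\<bar> \<le> D x) at_top" for i
      using eventually_ge_at_top[of "max 0 (max (N i) (real i)) + 1"]
    proof eventually_elim
      case (elim x)
      define n where "n = nat \<lfloor>x\<rfloor>"
      have x: "real n \<le> x" "x \<le> real (Suc n)" "real n \<ge> N i" "i \<le> n"
        using elim unfolding n_def by linarith+
      have "\<bar>a i x\<bar> \<le> B i n" by (rule NB(2)) (use x in auto)
      then show ?case using cB[OF x(4)] low[OF x(1)] by linarith
    qed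
    show "filterlim E at_top at_top"
    proof (rule filterlim_at_top_mono[OF filterlim_ident])
      show "eventually (\<lambda>x. x \<le> E x) at_top"
        using eventually_ge_at_top[of 1]
      proof eventually_elim
        case (elim x)
        define m where "m = nat \<lceil>x\<rceil>"
        have m: "x \<le> real m" using real_nat_ceiling_ge[of x] by (simp add: m_def)
        have "x - real 0 + 1 \<le> pos_pow 1 (x - real 0 + 1)"
          using elim unfolding pos_pow_def by (simp add: power2_eq_square self_le_power)
        also have "\<dots> \<le> c 0 * pos_pow 1 (x - real 0 + 1)"
          using c1(1)[of 0] pos_pow_nonneg[of 1 "x - real 0 + 1"] by (simp add: mult_le_cancel_right1)
        also have "\<dots> \<le> E x" unfolding ET[OF m] T_def
          by (rule member_le_sum[where f = "\<lambda>n. c n * pos_pow 1 (x - real n + 1)"]) (auto intro!: mult_nonneg_nonneg cpos pos_pow_nonneg)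
        finally show ?case by simp
      qed
    qed
  qed
qed

text \<open>Names for the elements of the differential field generated by a sequence; countability
  of this type is countability of the field up to equality of germs.\<close>

datatype fterm = FBase nat | FAdd fterm fterm | FMul fterm fterm | FNeg fterm | FInv fterm | FDer fterm | FOne | FZero

instance fterm :: countable by countable_datatype

primrec feval :: "(nat \<Rightarrow> real \<Rightarrow> real) \<Rightarrow> fterm \<Rightarrow> real \<Rightarrow> real" where
  "feval s (FBase n) = s n"
| "feval s (FAdd p q) = (\<lambda>x. feval s p x + feval s q x)"
| "feval s (FMul p q) = (\<lambda>x. feval s p x * feval s q x)"
| "feval s (FNeg p) = (\<lambda>x. - feval s p x)"
| "feval s (FInv p) = (\<lambda>x. inverse (feval s p x))"
| "feval s (FDer p) = deriv (feval s p)"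
| "feval s FOne = (\<lambda>x. 1)"
| "feval s FZero = (\<lambda>x. 0)"

text \<open>The values of all names form the field. Inverses cause no case distinction, because the
  inverse of the zero germ is the zero germ.\<close>

lemma countable_hardy_subfield:
  fixes s :: "nat \<Rightarrow> real \<Rightarrow> real"
  assumes H: "hardy_field H" and s: "\<And>n. s n \<in> H"
  obtains K d where "hardy_field K" "K \<subseteq> H" "\<And>n. s n \<in> K"
    "\<And>n. d n \<in> K" "\<And>f. f \<in> K \<Longrightarrow> \<exists>n::nat. eventually (\<lambda>x. f x = d n x) at_top"
proof -
  note HD = hardy_fieldD[OF H]
  have fH: "feval s t \<in> H" for t
    by (induction t) (use s HD(3-8) hardy_field_inverse[OF H] in simp_all)
  define K where "K = {f. \<exists>t. eventually (\<lambda>x. f x = feval s t x) at_top}"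
  have KI: "f \<in> K" if "eventually (\<lambda>x. f x = feval s t x) at_top" for f t using that unfolding K_def by blast
  have KE: "\<exists>t. eventually (\<lambda>x. f x = feval s t x) at_top" if "f \<in> K" for f using that unfolding K_def by simp
  have sub: "K \<subseteq> H"
  proof
    fix f assume "f \<in> K"
    then obtain t where "eventually (\<lambda>x. f x = feval s t x) at_top" using KE by blast
    then have "eventually (\<lambda>x. feval s t x = f x) at_top" by (auto elim: eventually_mono)
    then show "f \<in> H" by (rule HD(1)[OF fH])
  qed
  have KF: "feval s t \<in> K" for t by (rule KI[of _ t]) simp
  have "hardy_field K"
  proof (rule hardy_fieldI)
    fix f g assume "f \<in> K" and fg: "eventually (\<lambda>x. f x = g x) at_top"
    then obtain t where t: "eventually (\<lambda>x. f x = feval s t x) at_top" using KE by blast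
    show "g \<in> K" by (rule KI[of _ t]) (use fg t in \<open>eventually_elim, simp\<close>)
  next
    fix f assume f: "f \<in> K"
    then have fH': "f \<in> H" using sub by blast
    show "f \<in> germ_C_lt_inf" by (rule HD(2)[OF fH'])
    show "eventually (\<lambda>x. f x = 0) at_top \<or> eventually (\<lambda>x. f x \<noteq> 0) at_top" by (rule hardy_field_zero_or_nonzero[OF H fH'])
    obtain t where t: "eventually (\<lambda>x. f x = feval s t x) at_top" using KE[OF f] by blast
    show "(\<lambda>x. - f x) \<in> K" by (rule KI[of _ "FNeg t"]) (use t in \<open>eventually_elim, simp\<close>)
    show "(\<lambda>x. inverse (f x)) \<in> K" by (rule KI[of _ "FInv t"]) (use t in \<open>eventually_elim, simp\<close>)
    show "deriv f \<in> K" by (rule KI[of _ "FDer t"]) (use deriv_ev_cong[OF t] in simp)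
  next
    fix f g assume f: "f \<in> K" and g: "g \<in> K"
    obtain t u where t: "eventually (\<lambda>x. f x = feval s t x) at_top" "eventually (\<lambda>x. g x = feval s u x) at_top" using KE[OF f] KE[OF g] by blast
    show "(\<lambda>x. f x + g x) \<in> K" by (rule KI[of _ "FAdd t u"]) (use t in \<open>eventually_elim, simp\<close>)
    show "(\<lambda>x. f x * g x) \<in> K" by (rule KI[of _ "FMul t u"]) (use t in \<open>eventually_elim, simp\<close>)
  next
    show "(\<lambda>x. 0) \<in> K" by (rule KI[of _ FZero]) simp
    show "(\<lambda>x. 1) \<in> K" by (rule KI[of _ FOne]) simp
  qed
  moreover have "s n \<in> K" for n using KF[of "FBase n"] by simp
  moreover have "\<exists>n::nat. eventually (\<lambda>x. f x = feval s (from_nat n) x) at_top" if "f \<in> K" for f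
  proof -
    obtain t where "eventually (\<lambda>x. f x = feval s t x) at_top" using KE[OF \<open>f \<in> K\<close>] by blast
    then show ?thesis by (intro exI[of _ "to_nat t"]) simp
  qed
  ultimately show ?thesis using that[of K "\<lambda>n. feval s (from_nat n)"] sub KF by blast
qed

text \<open>Two demands are interleaved in one sequence: even indices enumerate \<open>K\<close>,
  odd ones list the further germs to be dominated.\<close>

lemma gauged_exists:
  fixes d b :: "nat \<Rightarrow> real \<Rightarrow> real" and \<alpha> :: "nat \<Rightarrow> real"
  assumes K: "hardy_field K" and d: "\<And>n. d n \<in> K" "\<And>f. f \<in> K \<Longrightarrow> \<exists>n. eventually (\<lambda>x. f x = d n x) at_top"
    and b: "\<And>i. eventually (\<lambda>x. isCont (b i) x) at_top"
  obtains E E' where "gauged K E E'" "\<And>i. eventually (\<lambda>x. \<bar>b i x\<bar> \<le> E x) at_top" "\<And>n. \<alpha> n \<le> E (real n)"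
proof -
  define a where "a i = (if even i then d (i div 2) else b (i div 2))" for i
  have "eventually (\<lambda>x. isCont (a i) x) at_top" for i
    unfolding a_def using b germ_C_lt_inf_isCont[OF hardy_fieldD(2)[OF K d(1)]] by simp
  then obtain E E' where E: "\<And>x. (E has_real_derivative E' x) (at x)" "filterlim E at_top at_top" "mono E"
    "\<And>i. eventually (\<lambda>x. \<bar>a i x\<bar> \<le> E x \<and> \<bar>a i x\<bar> \<le> E' x) at_top" "\<And>n. \<alpha> n \<le> E (real n)"
    by (rule gauge_exists[of a \<alpha>]) (rule that)
  show ?thesis
  proof (rule that)
    show "gauged K E E'"
    proof
      fix f assume "f \<in> K"
      then obtain n where "eventually (\<lambda>x. f x = d n x) at_top" using d(2) by blast
      then show "eventually (\<lambda>x. \<bar>f x\<bar> \<le> E x \<and> \<bar>f x\<bar> \<le> E' x) at_top"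
        using E(4)[of "2 * n"] by eventually_elim (simp add: a_def)
    qed (use K E(1-3) in auto)
    show "eventually (\<lambda>x. \<bar>b i x\<bar> \<le> E x) at_top" for i
      using E(4)[of "2 * i + 1"] by eventually_elim (simp add: a_def)
    show "\<alpha> n \<le> E (real n)" for n by (rule E(5))
  qed
qed

lemma derivs_const_le: "\<bar>(deriv ^^ i) (\<lambda>x::real. c :: real) x\<bar> \<le> \<bar>c\<bar>"
proof -
  have "(deriv ^^ i) (\<lambda>x::real. c :: real) = (if i = 0 then (\<lambda>x. c) else (\<lambda>x. 0))" by (induction i) (auto simp: fun_eq_iff)
  then show ?thesis by simp
qed

section \<open>A negligible function of alternating sign, analyticity of algebraic germs\<close>

context gauged begin

text \<open>Between n and n + 1 stands a bump of sign (-1)^n and amplitude exp (- n E (n + 2)), up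
  to normalisation; as \<open>E\<close> is monotone, this falls below every fixed power of exp (-
  E). The smoothness of the bumps grows with n, which places their sum in
  \<open>germ_C_lt_inf\<close>.\<close>

lemma alternating_bump:
  "\<exists>e\<in>germ_C_lt_inf. (\<forall>j. negl ((deriv ^^ j) e)) \<and> (\<forall>n::nat. (-1) ^ n * e (real n + 1 / 2) > 0)"
proof -
  define u where "u n x = pos_pow (Suc n) (1 * x + - real n) * pos_pow (Suc n) (-1 * x + real (Suc n))" for n and x :: real
  have u: "Cn_on (Suc n) UNIV (u n)" for n
    unfolding u_def by (intro Cn_on_mult Cn_on_pos_pow) auto
  have u0: "u n x = 0" if "x \<le> real n \<or> x \<ge> real (Suc n)" for n x
    using that unfolding u_def by (auto simp: pos_pow_0)
  have "\<exists>C\<ge>1. \<forall>j\<le>Suc n. \<forall>x\<in>{real n..real (Suc n)}. \<bar>(deriv ^^ j) (u n) x\<bar> \<le> C" for n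
    by (rule Cn_on_bounded_derivs[OF u])
  then obtain C where C: "\<And>n. C n \<ge> 1" "\<And>n j x. j \<le> Suc n \<Longrightarrow> x \<in> {real n..real (Suc n)} \<Longrightarrow> \<bar>(deriv ^^ j) (u n) x\<bar> \<le> C n"
    by metis
  have ub: "\<bar>(deriv ^^ j) (u n) x\<bar> \<le> C n" if "j \<le> Suc n" for j n x
  proof (cases "x \<in> {real n..real (Suc n)}")
    case True then show ?thesis using C(2)[OF that] by simp
  next
    case False
    have "(deriv ^^ j) (u n) x = 0"
      by (rule derivs_zero_outside[of "real n" "real (Suc n)"]) (use False u0 in auto)
    then show ?thesis using C(1)[of n] by simp
  qed
  \<comment> \<open>\<open>C n\<close> and the power of 2 normalise the derivatives up to order n +
    1; the remaining factor 1/2 allows for the two bumps that meet at an integer.\<close>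
  define c where "c n = (-1) ^ n * (exp (- (real n * E (real n + 2))) / (2 * 2 ^ Suc n * C n))" for n
  have cabs: "2 ^ Suc n * \<bar>c n\<bar> * C n = exp (- (real n * E (real n + 2))) / 2" for n
    using C(1)[of n] unfolding c_def by (simp add: abs_mult power_abs)
  define v where "v n x = c n * u n x" for n x
  have v: "Cn_on (Suc n) UNIV (v n)" for n
    unfolding v_def by (intro Cn_on_mult Cn_on_const u) auto
  have vb: "\<bar>(deriv ^^ j) (v n) x\<bar> \<le> exp (- (real n * E (real n + 2))) / 2" if "j \<le> Suc n" for j n x
  proof -
    have "\<bar>(deriv ^^ j) (\<lambda>x. c n * u n x) x\<bar> \<le> 2 ^ j * \<bar>c n\<bar> * C n"
      by (rule derivs_mult_bound[OF open_UNIV Cn_on_const[OF open_UNIV] u that]) (use derivs_const_le ub that in auto)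
    moreover have "2 ^ j * (\<bar>c n\<bar> * C n) \<le> 2 ^ Suc n * (\<bar>c n\<bar> * C n)"
      by (rule mult_right_mono) (use that C(1)[of n] in \<open>auto intro: power_increasing simp del: power_Suc\<close>)
    ultimately show ?thesis unfolding v_def cabs[symmetric] by (simp add: mult.assoc)
  qed
  define e where "e x = v (nat \<lfloor>x\<rfloor>) x" for x
  have e_eq: "e x = v k x + v (Suc k) x" if "x \<in> {real k<..<real k + 2}" for k x
  proof (cases "x < real k + 1")
    case True
    then have "nat \<lfloor>x\<rfloor> = k" using that by (simp add: nat_eq_iff floor_eq_iff)
    moreover have "v (Suc k) x = 0" using u0[of x "Suc k"] True by (simp add: v_def)
    ultimately show ?thesis by (simp add: e_def)
  next
    case False
    then have "nat \<lfloor>x\<rfloor> = Suc k" using that by (simp add: nat_eq_iff floor_eq_iff)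
    moreover have "v k x = 0" using u0[of x k] False by (simp add: v_def)
    ultimately show ?thesis by (simp add: e_def)
  qed
  have v2: "Cn_on (Suc k) UNIV (v k)" "Cn_on (Suc k) UNIV (v (Suc k))" for k
    using v Cn_on_le[OF _ v[of "Suc k"]] by simp_all
  have vS: "Cn_on (Suc k) {real k<..<real k + 2} (\<lambda>x. v k x + v (Suc k) x)" for k
    by (rule Cn_on_subset[OF Cn_on_add[OF open_UNIV v2]]) simp
  have eS: "Cn_on (Suc k) {real k<..<real k + 2} e" for k
    by (rule Cn_on_cong(1)[OF _ _ vS]) (use e_eq in auto)
  have ed: "(deriv ^^ j) e x = (deriv ^^ j) (v k) x + (deriv ^^ j) (v (Suc k)) x" if "x \<in> {real k<..<real k + 2}" "j \<le> Suc k" for k x j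
  proof -
    have "(deriv ^^ j) (\<lambda>x. v k x + v (Suc k) x) x = (deriv ^^ j) e x"
      by (rule Cn_on_cong(2)[OF _ _ vS that(1)]) (use e_eq in auto)
    then show ?thesis using derivs_add[OF open_UNIV v2(1) v2(2) that(2), of x] by simp
  qed
  \<comment> \<open>With k = ceiling x - 1 the point lies in the open interval from k to k + 2, also
    when \<open>x\<close> is an integer; there \<open>e\<close> is the sum of two consecutive
    bumps.\<close>
  define kk where "kk x = nat (\<lceil>x\<rceil> - 1)" for x :: real
  have kk: "x \<in> {real (kk x)<..<real (kk x) + 2} \<and> x \<le> real (kk x) + 2 \<and> n \<le> kk x" if "x > real n + 1" for x n
    using that unfolding kk_def by (auto simp: of_nat_nat le_nat_iff) linarith+
  have "e \<in> germ_C_lt_inf" unfolding germ_C_lt_inf_def germ_Cn_def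
  proof (intro INT_I CollectI exI)
    fix n :: nat
    show "Cn_on n {real n + 1<..} e"
      unfolding Cn_on_def
    proof (intro conjI allI impI ballI)
      fix i x assume i: "i < n" and x: "x \<in> {real n + 1<..}"
      show "((deriv ^^ i) e has_real_derivative (deriv ^^ Suc i) e x) (at x)"
        using eS[of "kk x"] kk[of n x] i x unfolding Cn_on_def by auto
    next
      have "isCont ((deriv ^^ n) e) x" if "x \<in> {real n + 1<..}" for x
      proof -
        have "Cn_on n {real (kk x)<..<real (kk x) + 2} e" using kk[of n x] that by (intro Cn_on_le[OF _ eS]) auto
        then have "continuous_on {real (kk x)<..<real (kk x) + 2} ((deriv ^^ n) e)" unfolding Cn_on_def by simp
        then show ?thesis using kk[of n x] that by (simp add: continuous_on_eq_continuous_at)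
      qed
      then show "continuous_on {real n + 1<..} ((deriv ^^ n) e)" by (intro continuous_at_imp_continuous_on) auto
    qed
  qed
  moreover have "negl ((deriv ^^ j) e)" for j
  proof (rule neglI)
    fix m :: nat
    show "eventually (\<lambda>x. \<bar>(deriv ^^ j) e x\<bar> \<le> exp (- real m * E x)) at_top"
      using E_ge[of 0] eventually_gt_at_top[of "real (j + m) + 1"]
    proof eventually_elim
      case (elim x)
      define k where "k = kk x"
      note kx = kk[OF elim(2), folded k_def]
      have le: "exp (- (real i * E (real i + 2))) \<le> exp (- real m * E x)" if "k \<le> i" for i
      proof -
        have "E x \<le> E (real i + 2)" using E_mono kx that by (intro monoD[OF E_mono]) simp
        then have "real m * E x \<le> real i * E (real i + 2)" using kx that elim(1) by (intro mult_mono) auto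
        then show ?thesis by simp
      qed
      have jk: "j \<le> Suc k" "j \<le> Suc (Suc k)" using kx by simp_all
      have "(deriv ^^ j) e x = (deriv ^^ j) (v k) x + (deriv ^^ j) (v (Suc k)) x" by (rule ed) (use kx jk in auto)
      then show ?case using vb[OF jk(1), of x] vb[OF jk(2), of x] le[of k] le[of "Suc k"] by linarith
    qed
  qed
  moreover have "(-1) ^ n * e (real n + 1 / 2) > 0" for n
  proof -
    have fl: "nat \<lfloor>real n + 1 / 2\<rfloor> = n" by linarith
    have "u n (real n + 1 / 2) > 0" unfolding u_def by (intro mult_pos_pos pos_pow_pos) auto
    moreover have "(-1) ^ n * c n > 0" using C(1)[of n] unfolding c_def by (simp add: mult.assoc[symmetric] power_add[symmetric] flip: mult_2)
    ultimately show ?thesis unfolding e_def fl v_def by (simp add: mult.assoc[symmetric])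
  qed
  ultimately show ?thesis by blast
qed

text \<open>The minimal equation of \<open>y\<close> itself, solved for the highest derivative, has
  analytic coefficients and a denominator without zeros from some point on; its solution is
  therefore analytic.\<close>

lemma algebraic_analytic:
  assumes f: "copy_field \<rho>" and y: "y \<in> K" and dm: "\<And>a b. (a, b) \<in> \<rho> \<Longrightarrow> a \<in> germ_C_omega"
    and nt: "\<not> (\<forall>j. transc \<rho> (\<lambda>j. (deriv ^^ j) y) j)"
  shows "y \<in> germ_C_omega"
proof -
  define Y where "Y = (\<lambda>j. (deriv ^^ j) y)"
  note ar = copy_field_copy_ring[OF f]
  have YK: "Y j \<in> K" for j unfolding Y_def by (rule K_derivs[OF y])
  have Yd: "ev_deriv (Y j) (Y (Suc j))" for j
    unfolding Y_def using germ_C_lt_inf_ev_deriv[OF KC[OF K_derivs[OF y]]] by simp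
  show ?thesis
  proof (rule minimal_relation[OF ar YK nt[folded Y_def]])
    fix r n c assume t: "\<And>j. j < r \<Longrightarrow> transc \<rho> Y j" and c: "\<And>i. i \<le> Suc n \<Longrightarrow> c i \<in> Expr \<rho> r"
      and rel: "germ_zero (\<lambda>x. \<Sum>i\<le>Suc n. ev1 Y (c i) x * Y r x ^ i)" and top: "germ_nonzero (ev1 Y (c (Suc n)))"
      and min: "\<And>N d. N < Suc n \<Longrightarrow> (\<And>i. i \<le> N \<Longrightarrow> d i \<in> Expr \<rho> r) \<Longrightarrow> germ_zero (\<lambda>x. \<Sum>i\<le>N. ev1 Y (d i) x * Y r x ^ i) \<Longrightarrow> (\<And>i. i \<le> N \<Longrightarrow> germ_zero (ev1 Y (d i)))"
    define A S where "A = relA c n r" and "S = relS c n r"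
    have A: "A \<in> Expr \<rho> (Suc r)" and S: "S \<in> Expr \<rho> (Suc r)" unfolding A_def S_def by (rule relA_relS_Ex[OF f c], assumption)+
    have S0: "germ_nonzero (ev1 Y S)" unfolding S_def
    proof (rule separant_nonzero[where Y = Y and c = c and n = n and r = r, OF ar YK c top])
      fix N d i assume m: "N < Suc n" "\<And>i. i \<le> N \<Longrightarrow> d i \<in> Expr \<rho> r" "germ_zero (\<lambda>x. \<Sum>i\<le>N. ev1 Y (d i) x * Y r x ^ i)" "i \<le> N"
      show "germ_zero (ev1 Y (d i))" by (rule min[OF m])
    qed
    have eq: "eventually (\<lambda>x. Y (Suc r) x = - ev1 Y A x / ev1 Y S x) at_top"
      unfolding A_def S_def by (rule relation_quotient[OF f c Yd rel S0[unfolded S_def]])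
    have e1: "ev1 Y e x = ev (\<lambda>c. c x) (\<lambda>j. Y j x) (map_ex fst e)" for e x
      by (simp add: ev1_def ev_map)
    have cm: "coefs (map_ex fst e) = fst ` coefs e" for e :: "rpair ex" by (rule ex.set_map)
    define C where "C = coefs (map_ex fst A) \<union> coefs (map_ex fst S)"
    have C: "finite C" "\<And>a. a \<in> C \<Longrightarrow> a \<in> germ_C_omega"
      using A S dm unfolding C_def cm by (auto simp: finite_coefs Expr_def)
    have "eventually (\<lambda>b. \<forall>a\<in>C. real_analytic_on {b<..} a) at_top"
    proof (rule eventually_ball_finite[OF C(1)], rule ballI)
      fix a assume "a \<in> C"
      then obtain b0 where "real_analytic_on {b0<..} a" using C(2) unfolding germ_C_omega_def by blast
      note ra = this
      show "eventually (\<lambda>b. real_analytic_on {b<..} a) at_top"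
        using eventually_ge_at_top[of b0]
      proof eventually_elim
        case (elim b)
        show ?case by (rule real_analytic_on_subset[OF ra]) (use elim in auto)
      qed
    qed
    moreover have "eventually (\<lambda>x. \<forall>j\<in>{..r}. (Y j has_real_derivative Y (Suc j) x) (at x)) at_top"
      using Yd unfolding ev_deriv_def by (intro eventually_ball_finite) auto
    ultimately have "eventually (\<lambda>x. (\<forall>a\<in>C. real_analytic_on {x<..} a) \<and> (\<forall>j\<in>{..r}. (Y j has_real_derivative Y (Suc j) x) (at x)) \<and>
       ev1 Y S x \<noteq> 0 \<and> Y (Suc r) x = - ev1 Y A x / ev1 Y S x) at_top"
      using eq S0 unfolding germ_nonzero_def by eventually_elim simp
    then obtain b where b: "\<And>x. x \<ge> b \<Longrightarrow> (\<forall>a\<in>C. real_analytic_on {x<..} a) \<and> (\<forall>j\<in>{..r}. (Y j has_real_derivative Y (Suc j) x) (at x)) \<and>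
       ev1 Y S x \<noteq> 0 \<and> Y (Suc r) x = - ev1 Y A x / ev1 Y S x" by (auto simp: eventually_at_top_linorder)
    have "real_analytic_on {b<..} (Y 0)"
    proof (rule rational_ode_analytic[where Y = Y and r = r and A = "map_ex fst A" and S = "map_ex fst S"])
      show "(Y j has_real_derivative Y (Suc j) x) (at x)" if "j < r" "x > b" for j x using b[of x] that by simp
      fix x assume "x > b"
      then show "(Y r has_real_derivative - ev (\<lambda>c. c x) (\<lambda>j. Y j x) (map_ex fst A) / ev (\<lambda>c. c x) (\<lambda>j. Y j x) (map_ex fst S)) (at x)"
        and "ev (\<lambda>c. c x) (\<lambda>j. Y j x) (map_ex fst S) \<noteq> 0"
        using conjunct1[OF conjunct2[OF b[of x]], THEN bspec, of r] b[of x] unfolding e1[symmetric] by auto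
    next
      show "vars (map_ex fst A) \<subseteq> {..r}" "vars (map_ex fst S) \<subseteq> {..r}" using A S by (auto simp: vars_map Expr_def)
      show "real_analytic_on {b<..} a" if "a \<in> coefs (map_ex fst A) \<union> coefs (map_ex fst S)" for a
        using b[of b] that unfolding C_def by blast
    qed simp
    then show ?thesis unfolding Y_def germ_C_omega_def by auto
  qed
qed

end

section \<open>From terms to sums of monomials\<close>

text \<open>A coefficient with an exponent vector. Lists of these lie between terms and the finite
  sums over exponent vectors in \<open>d_algebraic_over\<close>; repeated exponent vectors are
  allowed and collected by \<open>pcoef\<close>.\<close>

type_synonym pterm = "(real \<Rightarrow> real) \<times> (nat \<Rightarrow> nat)"

fun pval :: "(nat \<Rightarrow> real) \<Rightarrow> nat \<Rightarrow> real \<Rightarrow> pterm list \<Rightarrow> real" where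
  "pval v j x [] = 0"
| "pval v j x ((a, \<alpha>) # L) = a x * (\<Prod>i<j. v i ^ \<alpha> i) + pval v j x L"

fun pcoef :: "pterm list \<Rightarrow> (nat \<Rightarrow> nat) \<Rightarrow> real \<Rightarrow> real" where
  "pcoef [] \<gamma> x = 0"
| "pcoef ((a, \<alpha>) # L) \<gamma> x = (if \<alpha> = \<gamma> then a x else 0) + pcoef L \<gamma> x"

fun pmul :: "pterm list \<Rightarrow> pterm list \<Rightarrow> pterm list" where
  "pmul [] L' = []"
| "pmul ((a, \<alpha>) # L) L' = map (\<lambda>(b, \<beta>). (\<lambda>x. a x * b x, \<lambda>i. \<alpha> i + \<beta> i)) L' @ pmul L L'"

lemma pval_append: "pval v j x (L @ L') = pval v j x L + pval v j x L'"
  by (induction v j x L rule: pval.induct) auto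

lemma pval_scale: "pval v j x (map (\<lambda>(b, \<beta>). (\<lambda>x. a x * b x, \<lambda>i. \<alpha> i + \<beta> i)) L) = a x * (\<Prod>i<j. v i ^ \<alpha> i) * pval v j x L"
  by (induction v j x L rule: pval.induct) (auto simp: power_add prod.distrib algebra_simps)

lemma pval_pmul: "pval v j x (pmul L L') = pval v j x L * pval v j x L'"
  by (induction L L' rule: pmul.induct) (auto simp: pval_append pval_scale algebra_simps)

lemma pval_collect:
  "finite M \<Longrightarrow> snd ` set L \<subseteq> M \<Longrightarrow> pval v j x L = (\<Sum>\<gamma>\<in>M. pcoef L \<gamma> x * (\<Prod>i<j. v i ^ \<gamma> i))"
proof (induction v j x L rule: pval.induct)
  case (2 v j x a \<alpha> L)
  have "(\<Sum>\<gamma>\<in>M. pcoef ((a, \<alpha>) # L) \<gamma> x * (\<Prod>i<j. v i ^ \<gamma> i))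
    = (\<Sum>\<gamma>\<in>M. (if \<alpha> = \<gamma> then a x * (\<Prod>i<j. v i ^ \<gamma> i) else 0)) + (\<Sum>\<gamma>\<in>M. pcoef L \<gamma> x * (\<Prod>i<j. v i ^ \<gamma> i))"
    unfolding sum.distrib[symmetric] by (rule sum.cong) (auto simp: distrib_right)
  then show ?case using 2 by simp
qed simp

definition pterms :: "(real \<Rightarrow> real) set \<Rightarrow> nat \<Rightarrow> pterm list \<Rightarrow> bool" where
  "pterms H j L \<longleftrightarrow> (\<forall>(a, \<alpha>)\<in>set L. a \<in> H \<and> (\<forall>i\<ge>j. \<alpha> i = 0))"

lemma pterms_pmul:
  assumes H: "hardy_field H" shows "pterms H j L \<Longrightarrow> pterms H j L' \<Longrightarrow> pterms H j (pmul L L')"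
proof (induction L L' rule: pmul.induct)
  case (2 a \<alpha> L L')
  then show ?case using hardy_fieldD(6)[OF H] unfolding pterms_def by fastforce
qed (simp add: pterms_def)

lemma pcoef_in:
  assumes H: "hardy_field H" shows "pterms H j L \<Longrightarrow> pcoef L \<gamma> \<in> H"
proof (induction L)
  case Nil then show ?case using hardy_fieldD(3)[OF H] by simp
next
  case (Cons t L)
  obtain a \<alpha> where t: "t = (a, \<alpha>)" by (cases t)
  have "pcoef L \<gamma> \<in> H" "a \<in> H" using Cons unfolding t pterms_def by auto
  then show ?case using hardy_fieldD(5)[OF H] unfolding t by (cases "\<alpha> = \<gamma>") simp_all
qed

lemma polynomial_terms:
  assumes H: "hardy_field H" and dm: "\<And>a b. (a, b) \<in> \<rho> \<Longrightarrow> a \<in> H"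
  shows "e \<in> Expr \<rho> j \<Longrightarrow> \<exists>L. pterms H j L \<and> (\<forall>Y x. ev1 Y e x = pval (\<lambda>i. Y i x) j x L)"
proof (induction e)
  case (Cf c)
  then have "fst c \<in> H" using dm[of "fst c" "snd c"] by (simp add: Expr_simps)
  then show ?case by (intro exI[of _ "[(fst c, \<lambda>i. 0)]"]) (simp add: pterms_def ev12_simps)
next
  case (Vr k)
  then have k: "k < j" by (simp add: Expr_simps)
  have "(\<Prod>i<j. v i ^ (if i = k then 1 else 0)) = v k" for v :: "nat \<Rightarrow> real"
    using k prod.delta[of "{..<j}" k v] by (simp add: if_distrib[of "power _"] cong: if_cong)
  then show ?case using k hardy_fieldD(4)[OF H]
    by (intro exI[of _ "[(\<lambda>x. 1, \<lambda>i. if i = k then 1 else 0)]"]) (simp add: pterms_def ev12_simps)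
next
  case (Ad p q)
  then obtain L L' where "pterms H j L" "\<forall>Y x. ev1 Y p x = pval (\<lambda>i. Y i x) j x L" "pterms H j L'" "\<forall>Y x. ev1 Y q x = pval (\<lambda>i. Y i x) j x L'"
    by (auto simp: Expr_simps)
  then show ?case by (intro exI[of _ "L @ L'"]) (auto simp: pterms_def pval_append ev12_simps)
next
  case (Ml p q)
  then obtain L L' where L: "pterms H j L" "\<forall>Y x. ev1 Y p x = pval (\<lambda>i. Y i x) j x L" "pterms H j L'" "\<forall>Y x. ev1 Y q x = pval (\<lambda>i. Y i x) j x L'"
    by (auto simp: Expr_simps)
  then show ?case using pterms_pmul[OF H L(1,3)] by (intro exI[of _ "pmul L L'"]) (auto simp: pval_pmul ev12_simps)
qed

text \<open>Failure of \<open>transc\<close> is a relation for one variable over the lower ones; it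
  is rearranged into a sum over exponent vectors. It stays nontrivial, because a coefficient that is
  not eventually zero must contain a monomial whose collected coefficient is not eventually
  zero.\<close>

lemma algebraic_d_algebraic:
  assumes H: "hardy_field H" and dm: "\<And>a b. (a, b) \<in> \<rho> \<Longrightarrow> a \<in> H"
    and nt: "\<not> (\<forall>j. transc \<rho> (\<lambda>j. (deriv ^^ j) y) j)"
  shows "d_algebraic_over H y"
proof -
  define Y where "Y = (\<lambda>j. (deriv ^^ j) y)"
  obtain j n c i0 where c: "\<And>i. i \<le> n \<Longrightarrow> c i \<in> Expr \<rho> j" and rel: "germ_zero (\<lambda>x. \<Sum>i\<le>n. ev1 Y (c i) x * Y j x ^ i)"
    and i0: "i0 \<le> n" "\<not> germ_zero (ev1 Y (c i0))"
    using nt unfolding transc_def Y_def[symmetric] by blast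
  have "\<exists>L. pterms H j L \<and> (\<forall>Y x. ev1 Y (c i) x = pval (\<lambda>i. Y i x) j x L)" if "i \<le> n" for i
    by (rule polynomial_terms[OF H dm c[OF that]])
  then obtain L where L: "\<And>i. i \<le> n \<Longrightarrow> pterms H j (L i)" "\<And>i Y x. i \<le> n \<Longrightarrow> ev1 Y (c i) x = pval (\<lambda>i. Y i x) j x (L i)"
    by metis
  define N where "N i = snd ` set (L i)" for i
  have N: "finite (N i)" for i by (simp add: N_def)
  have N0: "\<alpha> l = 0" if "\<alpha> \<in> N i" "i \<le> n" "l \<ge> j" for \<alpha> i l
    using L(1)[OF that(2)] that unfolding N_def pterms_def by auto
  \<comment> \<open>The coefficient of index i only involves variables below \<open>j\<close>, so
    position \<open>j\<close> is free to store the exponent i; this keeps the vectors for distinct i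
    apart. \<open>C\<close> recovers i and the lower exponents from the vector.\<close>
  define M where "M = (\<Union>i\<in>{..n}. (\<lambda>\<alpha>. \<alpha>(j := i)) ` N i)"
  define C where "C \<gamma> = pcoef (L (\<gamma> j)) (\<gamma>(j := 0))" for \<gamma>
  have upd: "\<alpha>(j := 0) = \<alpha>" if "\<alpha> \<in> N i" "i \<le> n" for \<alpha> i using N0[OF that, of j] by (simp add: fun_upd_idem)
  have Cupd: "C (\<alpha>(j := i)) = pcoef (L i) \<alpha>" if "\<alpha> \<in> N i" "i \<le> n" for \<alpha> i
    unfolding C_def using upd[OF that] by simp
  have sumi: "ev1 Y (c i) x = (\<Sum>\<alpha>\<in>N i. pcoef (L i) \<alpha> x * (\<Prod>l<j. Y l x ^ \<alpha> l))" if "i \<le> n" for i x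
    unfolding L(2)[OF that] by (rule pval_collect) (use N in \<open>auto simp: N_def\<close>)
  have inj: "inj_on (\<lambda>\<alpha>. \<alpha>(j := i)) (N i)" if "i \<le> n" for i
    by (rule inj_on_inverseI[where g = "\<lambda>\<alpha>. \<alpha>(j := 0)"]) (use upd[OF _ that] in simp)
  have sumM: "(\<Sum>\<gamma>\<in>M. C \<gamma> x * (\<Prod>l\<le>j. Y l x ^ \<gamma> l)) = (\<Sum>i\<le>n. ev1 Y (c i) x * Y j x ^ i)" for x
  proof -
    have "(\<Sum>\<gamma>\<in>M. C \<gamma> x * (\<Prod>l\<le>j. Y l x ^ \<gamma> l)) = (\<Sum>i\<in>{..n}. \<Sum>\<gamma>\<in>(\<lambda>\<alpha>. \<alpha>(j := i)) ` N i. C \<gamma> x * (\<Prod>l\<le>j. Y l x ^ \<gamma> l))"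
      unfolding M_def by (rule sum.UNION_disjoint) (use N in \<open>auto dest: fun_cong[where x = j]\<close>)
    also have "\<dots> = (\<Sum>i\<in>{..n}. ev1 Y (c i) x * Y j x ^ i)"
    proof (rule sum.cong[OF refl])
      fix i assume "i \<in> {..n}"
      then have i: "i \<le> n" by simp
      have "(\<Sum>\<gamma>\<in>(\<lambda>\<alpha>. \<alpha>(j := i)) ` N i. C \<gamma> x * (\<Prod>l\<le>j. Y l x ^ \<gamma> l)) = (\<Sum>\<alpha>\<in>N i. C (\<alpha>(j := i)) x * (\<Prod>l\<le>j. Y l x ^ (\<alpha>(j := i)) l))"
        by (simp add: sum.reindex[OF inj[OF i]])
      also have "\<dots> = (\<Sum>\<alpha>\<in>N i. pcoef (L i) \<alpha> x * (\<Prod>l<j. Y l x ^ \<alpha> l) * Y j x ^ i)"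
      proof (rule sum.cong[OF refl])
        fix \<alpha> assume a: "\<alpha> \<in> N i"
        have "(\<Prod>l\<le>j. Y l x ^ (\<alpha>(j := i)) l) = (\<Prod>l<j. Y l x ^ \<alpha> l) * Y j x ^ i"
          unfolding lessThan_Suc_atMost[symmetric] prod.lessThan_Suc by simp
        then show "C (\<alpha>(j := i)) x * (\<Prod>l\<le>j. Y l x ^ (\<alpha>(j := i)) l) = pcoef (L i) \<alpha> x * (\<Prod>l<j. Y l x ^ \<alpha> l) * Y j x ^ i"
          unfolding Cupd[OF a i] by simp
      qed
      finally show "(\<Sum>\<gamma>\<in>(\<lambda>\<alpha>. \<alpha>(j := i)) ` N i. C \<gamma> x * (\<Prod>l\<le>j. Y l x ^ \<gamma> l)) = ev1 Y (c i) x * Y j x ^ i"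
        unfolding sumi[OF i] by (simp add: sum_distrib_right)
    qed
    finally show ?thesis .
  qed
  have "finite M" unfolding M_def using N by simp
  moreover have "\<forall>\<alpha>\<in>M. \<forall>i>j. \<alpha> i = 0" unfolding M_def using N0 by auto
  moreover have "\<forall>\<alpha>\<in>M. C \<alpha> \<in> H" unfolding M_def C_def using pcoef_in[OF H L(1)] by auto
  moreover have "\<exists>\<alpha>\<in>M. \<not> germ_eq (C \<alpha>) (\<lambda>x. 0)"
  proof (rule ccontr)
    assume "\<not> ?thesis"
    then have z: "germ_zero (C \<gamma>)" if "\<gamma> \<in> M" for \<gamma> using that unfolding germ_eq_def germ_zero_def by blast
    have "germ_zero (pcoef (L i0) \<alpha>)" if "\<alpha> \<in> N i0" for \<alpha>
      using z[of "\<alpha>(j := i0)"] Cupd[OF that i0(1)] that i0(1) unfolding M_def by auto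
    then have "germ_zero (\<lambda>x. \<Sum>\<alpha>\<in>N i0. pcoef (L i0) \<alpha> x * (\<Prod>l<j. Y l x ^ \<alpha> l))" by (intro germ_zero_sum[OF N])
    then show False using i0(2) sumi[OF i0(1)] by (simp add: germ_zero_def)
  qed
  moreover have "germ_eq (\<lambda>x. \<Sum>\<alpha>\<in>M. C \<alpha> x * (\<Prod>i\<le>j. ((deriv ^^ i) y x) ^ \<alpha> i)) (\<lambda>x. 0)"
    using rel unfolding germ_eq_def germ_zero_def sumM[symmetric] by (simp add: Y_def)
  ultimately show ?thesis unfolding d_algebraic_over_def by blast
qed

section \<open>Adjoinable germs\<close>

definition adjoinable :: "(real \<Rightarrow> real) \<Rightarrow> bool" where
  "adjoinable f \<longleftrightarrow> (\<forall>A. hardy_field A \<and> A \<subseteq> germ_C_omega \<longrightarrow> (\<exists>M. hardy_field M \<and> A \<subseteq> M \<and> f \<in> M))"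

section \<open>Sign changes and their stability\<close>

definition oscillates :: "(real \<Rightarrow> real) \<Rightarrow> bool" where
  "oscillates p \<longleftrightarrow> (\<forall>t. \<exists>u\<ge>t. p u > 0) \<and> (\<forall>t. \<exists>u\<ge>t. p u < 0)"

lemma oscillates_minus: "oscillates (\<lambda>x. - p x) \<longleftrightarrow> oscillates p"
  unfolding oscillates_def by auto

lemma oscillatesI_ev:
  assumes "eventually (\<lambda>x. p x = q x) at_top" "oscillates q" shows "oscillates p"
proof -
  obtain T where T: "\<And>x. x \<ge> T \<Longrightarrow> p x = q x" using assms(1) by (auto simp: eventually_at_top_linorder)
  have "\<exists>u\<ge>t. p u > 0" for t
  proof -
    obtain u where "u \<ge> max t T" "q u > 0" using assms(2) unfolding oscillates_def by blast
    then show ?thesis using T[of u] by auto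
  qed
  moreover have "\<exists>u\<ge>t. p u < 0" for t
  proof -
    obtain u where "u \<ge> max t T" "q u < 0" using assms(2) unfolding oscillates_def by blast
    then show ?thesis using T[of u] by auto
  qed
  ultimately show ?thesis unfolding oscillates_def by blast
qed

text \<open>Between a zero, a later positive value and a still later zero, the mean value theorem
  finds both signs of the derivative.\<close>

lemma derivative_oscillates:
  fixes p p' :: "real \<Rightarrow> real"
  assumes d: "\<And>x. x \<ge> T \<Longrightarrow> (p has_real_derivative p' x) (at x)" and nn: "\<And>x. x \<ge> T \<Longrightarrow> p x \<ge> 0"
    and z: "\<And>t. \<exists>x\<ge>t. p x = 0" and nz: "\<And>t. \<exists>x\<ge>t. p x \<noteq> 0"
  shows "oscillates p'"
proof -
  have "\<exists>u w. u \<ge> t \<and> w \<ge> t \<and> p' u > 0 \<and> p' w < 0" for t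
  proof -
    obtain a where a: "a \<ge> max t T" "p a = 0" using z by blast
    obtain b where b: "b \<ge> a" "p b \<noteq> 0" using nz by blast
    have b': "p b > 0" "a < b" using nn[of b] a b by (auto simp: less_le)
    obtain c where c: "c \<ge> b" "p c = 0" using z by blast
    have c': "b < c" using c b by (auto simp: less_le)
    obtain u where u: "a < u" "u < b" "p b - p a = (b - a) * p' u" using MVT2[OF b'(2), of p p'] d a by auto
    obtain w where w: "b < w" "w < c" "p c - p b = (c - b) * p' w" using MVT2[OF c', of p p'] d a b' by auto
    have "p' u > 0" using u(3) a b' by (metis diff_gt_0_iff_gt diff_zero zero_less_mult_pos)
    moreover have "(c - b) * p' w < 0" using w(3) c b' by simp
    then have "p' w < 0" using c' by (simp add: mult_less_0_iff)
    ultimately show ?thesis using u w a b' by (intro exI[of _ u] exI[of _ w]) auto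
  qed
  then show ?thesis unfolding oscillates_def by blast
qed

text \<open>If \<open>p\<close> keeps a weak sign but has both zeros and nonzero values arbitrarily
  far out, its derivative changes sign. The dichotomy is thereby reduced to the absence of sign
  changes, which, unlike zeros, are stable under small errors.\<close>

lemma not_zero_nonzero_oscillates:
  assumes p: "p \<in> germ_C_lt_inf" and n: "\<not> (eventually (\<lambda>x. p x = 0) at_top \<or> eventually (\<lambda>x. p x \<noteq> 0) at_top)"
  shows "oscillates p \<or> oscillates (deriv p)"
proof (cases "oscillates p")
  case False
  have z: "\<exists>x\<ge>t. p x = 0" and nz: "\<exists>x\<ge>t. p x \<noteq> 0" for t
    using n unfolding eventually_at_top_linorder by blast+
  obtain T0 where T0: "\<And>x. x \<ge> T0 \<Longrightarrow> (p has_real_derivative deriv p x) (at x)"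
    using germ_C_lt_inf_ev_deriv[OF p] unfolding ev_deriv_def eventually_at_top_linorder by blast
  from False consider T1 where "\<And>x. x \<ge> T1 \<Longrightarrow> p x \<le> 0" | T1 where "\<And>x. x \<ge> T1 \<Longrightarrow> p x \<ge> 0"
    unfolding oscillates_def by (meson linorder_not_less)
  then show ?thesis
  proof cases
    case 1
    have "oscillates (\<lambda>x. - deriv p x)"
      by (rule derivative_oscillates[of "max T0 T1" "\<lambda>x. - p x"]) (use T0 1 z nz in \<open>auto intro: DERIV_minus\<close>)
    then show ?thesis by (simp add: oscillates_minus)
  next
    case 2
    have "oscillates (deriv p)"
      by (rule derivative_oscillates[of "max T0 T1" p]) (use T0 2 z nz in auto)
    then show ?thesis ..
  qed
qed simp

lemma oscillates_sequences:
  assumes "oscillates p"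
  obtains u w :: "nat \<Rightarrow> real" where "\<And>n. u n \<ge> real n" "\<And>n. p (u n) > 0" "\<And>n. w n \<ge> real n" "\<And>n. p (w n) < 0"
proof -
  have "\<forall>n::nat. \<exists>u\<ge>real n. p u > 0" "\<forall>n::nat. \<exists>u\<ge>real n. p u < 0" using assms unfolding oscillates_def by auto
  then obtain u w where "\<forall>n::nat. u n \<ge> real n \<and> p (u n) > 0" "\<forall>n::nat. w n \<ge> real n \<and> p (w n) < 0"
    by (elim choice[THEN exE]) auto
  then show ?thesis by (intro that[of u w]) auto
qed

text \<open>At \<open>u n\<close> the error exp (- E) is smaller than p (u n), because u n \<ge> n,
  \<open>E\<close> is monotone and \<open>E\<close> is large at n; so \<open>h\<close> is positive
  where the error bound holds, and likewise negative at \<open>w n\<close>. The 1 in 1 - ln makes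
  the inequality strict.\<close>

lemma no_oscillation_near_hardy:
  fixes u w :: "nat \<Rightarrow> real"
  assumes M: "hardy_field M" and h: "h \<in> M" and near: "eventually (\<lambda>x. \<bar>p x - h x\<bar> \<le> exp (- E x)) at_top" and E: "mono E"
    and u: "\<And>n. u n \<ge> real n" "\<And>n. p (u n) > 0" "\<And>n. w n \<ge> real n" "\<And>n. p (w n) < 0"
    and big: "\<And>n. E (real n) \<ge> max (1 - ln (p (u n))) (1 - ln (- p (w n)))"
  shows False
proof -
  have le: "exp (- E x) < c" if "c > 0" "E (real n) \<ge> 1 - ln c" "x \<ge> real n" for x c n
  proof -
    have "E x \<ge> E (real n)" using E that(3) by (simp add: monoD)
    then have "exp (- E x) \<le> exp (ln c - 1)" using that(2) by simp
    also have "\<dots> < exp (ln c)" by simp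
    finally show ?thesis using that(1) by simp
  qed
  have sgn: "h (u n) > 0" if "\<bar>p (u n) - h (u n)\<bar> \<le> exp (- E (u n))" for n
    using le[OF u(2)[of n] _ u(1)[of n]] big[of n] that by auto
  have sgn': "h (w n) < 0" if "\<bar>p (w n) - h (w n)\<bar> \<le> exp (- E (w n))" for n
    using le[of "- p (w n)" n "w n"] u(3,4)[of n] big[of n] that by auto
  have "eventually (\<lambda>x. h x \<le> 0 \<and> \<bar>p x - h x\<bar> \<le> exp (- E x)) at_top \<or> eventually (\<lambda>x. h x \<ge> 0 \<and> \<bar>p x - h x\<bar> \<le> exp (- E x)) at_top"
    using hardy_field_sign[OF M h]
  proof (elim disjE)
    assume "eventually (\<lambda>x. h x = 0) at_top"
    then have "eventually (\<lambda>x. h x \<le> 0 \<and> \<bar>p x - h x\<bar> \<le> exp (- E x)) at_top" using near by eventually_elim simp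
    then show ?thesis ..
  next
    assume "eventually (\<lambda>x. h x > 0) at_top"
    then have "eventually (\<lambda>x. h x \<ge> 0 \<and> \<bar>p x - h x\<bar> \<le> exp (- E x)) at_top" using near by eventually_elim simp
    then show ?thesis ..
  next
    assume "eventually (\<lambda>x. h x < 0) at_top"
    then have "eventually (\<lambda>x. h x \<le> 0 \<and> \<bar>p x - h x\<bar> \<le> exp (- E x)) at_top" using near by eventually_elim simp
    then show ?thesis ..
  qed
  then show False
  proof
    assume "eventually (\<lambda>x. h x \<le> 0 \<and> \<bar>p x - h x\<bar> \<le> exp (- E x)) at_top"
    then obtain T where T: "\<And>x. x \<ge> T \<Longrightarrow> h x \<le> 0 \<and> \<bar>p x - h x\<bar> \<le> exp (- E x)" by (auto simp: eventually_at_top_linorder)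
    obtain n :: nat where "real n \<ge> T" using real_arch_simple by blast
    then show False using T[of "u n"] sgn[of n] u(1)[of n] by auto
  next
    assume "eventually (\<lambda>x. h x \<ge> 0 \<and> \<bar>p x - h x\<bar> \<le> exp (- E x)) at_top"
    then obtain T where T: "\<And>x. x \<ge> T \<Longrightarrow> h x \<ge> 0 \<and> \<bar>p x - h x\<bar> \<le> exp (- E x)" by (auto simp: eventually_at_top_linorder)
    obtain n :: nat where "real n \<ge> T" using real_arch_simple by blast
    then show False using T[of "w n"] sgn'[of n] u(3)[of n] by auto
  qed
qed

lemma hardy_field_ev:
  assumes M: "hardy_field M"
  shows "(\<And>c. c \<in> coefs e \<Longrightarrow> k c \<in> M) \<Longrightarrow> (\<And>j. Y j \<in> M) \<Longrightarrow> (\<lambda>x. ev (\<lambda>c. k c x) (\<lambda>j. Y j x) e) \<in> M"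
  by (induction e) (use hardy_fieldD(5,6)[OF M] in auto)

lemma hardy_field_derivs: "hardy_field M \<Longrightarrow> f \<in> M \<Longrightarrow> (deriv ^^ j) f \<in> M"
  by (induction j) (auto intro: hardy_fieldD(8))

context gauged begin

text \<open>The Lipschitz factor (E + 1)^N of the term is at most exp (N E), so coefficient errors
  of order N + 1 leave an error exp (- E). The variables are the same on both sides, since
  \<open>f\<close> and its derivatives are not copied.\<close>

lemma perturbed_expression:
  assumes c: "\<And>c. c \<in> coefs e \<Longrightarrow> negl (\<lambda>x. snd c x - fst c x)" "\<And>c. c \<in> coefs e \<Longrightarrow> eventually (\<lambda>x. \<bar>fst c x\<bar> \<le> E x) at_top"
    and Y: "\<And>j. eventually (\<lambda>x. \<bar>Y j x\<bar> \<le> E x) at_top"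
  shows "eventually (\<lambda>x. \<bar>ev1 Y e x - ev2 Y e x\<bar> \<le> exp (- E x)) at_top"
proof -
  obtain N where N: "lip_exp N e" using lip_exp_exists by blast
  have "eventually (\<lambda>x. \<forall>c\<in>coefs e. \<bar>fst c x\<bar> \<le> E x \<and> \<bar>snd c x - fst c x\<bar> \<le> exp (- real (Suc N) * E x)) at_top"
    by (rule eventually_ball_finite[OF finite_coefs]) (use c(2) neglD[OF c(1), of _ "Suc N"] in \<open>auto intro: eventually_conj\<close>)
  moreover have "eventually (\<lambda>x. \<forall>j\<in>vars e. \<bar>Y j x\<bar> \<le> E x) at_top"
    by (rule eventually_ball_finite[OF finite_vars]) (use Y in auto)
  ultimately show ?thesis using E_ge[of 1]
  proof eventually_elim
    case (elim x)
    define \<delta> where "\<delta> = exp (- real (Suc N) * E x)"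
    have "0 \<le> real (Suc N) * E x" using elim(3) by (intro mult_nonneg_nonneg) auto
    then have \<delta>: "\<delta> \<ge> 0" "\<delta> \<le> 1" unfolding \<delta>_def by (auto simp del: of_nat_Suc)
    have "\<bar>ev (\<lambda>c. fst c x) (\<lambda>j. Y j x) e - ev (\<lambda>c. snd c x) (\<lambda>j. Y j x) e\<bar> \<le> (E x + 1) ^ N * \<delta>"
    proof (rule lip_expD(3)[OF N _ \<delta>(1)])
      fix c assume "c \<in> coefs e"
      then have "\<bar>fst c x\<bar> \<le> E x" "\<bar>snd c x - fst c x\<bar> \<le> \<delta>" using elim(1) by (auto simp: \<delta>_def)
      then show "\<bar>fst c x\<bar> \<le> E x + 1 \<and> \<bar>snd c x\<bar> \<le> E x + 1 \<and> \<bar>fst c x - snd c x\<bar> \<le> \<delta>" using \<delta> by linarith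
    qed (use elim \<delta> in auto)
    also have "(E x + 1) ^ N * \<delta> \<le> exp (E x) ^ N * \<delta>"
      using exp_ge_add_one_self[of "E x"] elim(3) \<delta> by (intro mult_right_mono power_mono) (auto simp: add.commute)
    also have "exp (E x) ^ N * \<delta> = exp (- E x)"
      by (simp add: \<delta>_def exp_of_nat_mult[symmetric] exp_add[symmetric] algebra_simps)
    finally show ?case by (simp add: ev1_def ev2_def)
  qed
qed

end

section \<open>The field generated by an adjoinable germ\<close>

definition jet_ring :: "(real \<Rightarrow> real) set \<Rightarrow> (real \<Rightarrow> real) \<Rightarrow> (real \<Rightarrow> real) set" where
  "jet_ring H f = {h. \<exists>e. coefs e \<subseteq> H \<and> eventually (\<lambda>x. h x = fex e (\<lambda>j. (deriv ^^ j) f) x) at_top}"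

lemma finite_coefs_sequence:
  assumes H: "hardy_field H" and C: "finite C" "C \<subseteq> H"
  obtains s :: "nat \<Rightarrow> real \<Rightarrow> real" where "range s \<subseteq> H" "C \<subseteq> range s"
proof -
  \<comment> \<open>The zero germ is added so that the set to be enumerated is nonempty.\<close>
  define D where "D = insert (\<lambda>x. 0) C"
  have D: "countable D" "D \<noteq> {}" "D \<subseteq> H" using C hardy_fieldD(3)[OF H] by (auto simp: D_def countable_finite)
  show ?thesis
    by (rule that[of "from_nat_into D"]) (use D(3) range_from_nat_into[OF D(2,1)] in \<open>simp_all add: D_def subset_insertI\<close>)
qed

text \<open>The points of sign change are fixed before the gauge, which then dominates a countable
  field containing the coefficients, all derivatives of \<open>f\<close>, and the demands at these
  points. The copied expression lies in a Hardy field together with \<open>f\<close>, where it is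
  eventually zero or of one sign, yet it is forced to follow the signs of the original.\<close>

lemma jet_expression_not_oscillates:
  assumes H: "hardy_field H" and f: "f \<in> germ_C_lt_inf" "adjoinable f" and e: "coefs e \<subseteq> H"
  shows "\<not> oscillates (fex e (\<lambda>j. (deriv ^^ j) f))"
proof
  define Y where "Y = (\<lambda>j. (deriv ^^ j) f)"
  define p where "p = fex e Y"
  assume "oscillates (fex e (\<lambda>j. (deriv ^^ j) f))"
  then have "oscillates p" by (simp add: p_def Y_def)
  then obtain u w :: "nat \<Rightarrow> real" where uw: "\<And>n. u n \<ge> real n" "\<And>n. p (u n) > 0" "\<And>n. w n \<ge> real n" "\<And>n. p (w n) < 0"
    by (rule oscillates_sequences) (rule that)
  obtain s :: "nat \<Rightarrow> real \<Rightarrow> real" where s0: "range s \<subseteq> H" "coefs e \<subseteq> range s" by (rule finite_coefs_sequence[OF H finite_coefs e]) (rule that)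
  then have s: "\<And>n. s n \<in> H" "coefs e \<subseteq> range s" by auto
  obtain K d where KK: "hardy_field K" "K \<subseteq> H" "\<And>n. s n \<in> K" "\<And>n. d n \<in> K" "\<And>f. f \<in> K \<Longrightarrow> \<exists>n::nat. eventually (\<lambda>x. f x = d n x) at_top"
    by (rule countable_hardy_subfield[OF H s(1)]) (rule that)
  have Yc: "eventually (\<lambda>x. isCont (Y j) x) at_top" for j
    unfolding Y_def by (rule germ_C_lt_inf_isCont[OF germ_C_lt_inf_derivs[OF f(1)]])
  obtain E E' where E: "gauged K E E'" "\<And>i. eventually (\<lambda>x. \<bar>Y i x\<bar> \<le> E x) at_top"
     "\<And>n. max (1 - ln (p (u n))) (1 - ln (- p (w n))) \<le> E (real n)"
    by (rule gauged_exists[where K = K and d = d and b = Y and \<alpha> = "\<lambda>n. max (1 - ln (p (u n))) (1 - ln (- p (w n)))", OF KK(1,4,5) Yc])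
      (assumption, rule that)
  interpret gauged K E E' by (rule E(1))
  obtain \<rho> where r: "copy_field \<rho>" "\<forall>y\<in>K. \<exists>g. (y, g) \<in> \<rho>" using full_copy by (elim exE conjE)
  obtain star where star: "\<And>y. y \<in> K \<Longrightarrow> (y, star y) \<in> \<rho>" using r(2) by metis
  obtain M where M: "hardy_field M" "Range \<rho> \<subseteq> M" "f \<in> M"
    using f(2) hardy_field_Range[OF r(1)] unfolding adjoinable_def by blast
  \<comment> \<open>Every coefficient is paired with its copy, so \<open>ev1\<close> returns the
    given expression and \<open>ev2\<close> its counterpart in \<open>M\<close>.\<close>
  define pe where "pe = map_ex (\<lambda>a. (a, star a)) e"
  have ce: "c \<in> coefs pe \<Longrightarrow> c \<in> \<rho>" for c
    unfolding pe_def ex.set_map using s(2) KK(3) star by blast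
  have ev: "ev1 Y pe = p" unfolding pe_def p_def fex_def[abs_def] ev1_def by (simp add: ev_map fun_eq_iff)
  have "eventually (\<lambda>x. \<bar>ev1 Y pe x - ev2 Y pe x\<bar> \<le> exp (- E x)) at_top"
  proof (rule perturbed_expression[OF _ _ E(2)])
    fix c assume "c \<in> coefs pe"
    then have c: "(fst c, snd c) \<in> \<rho>" using ce by simp
    show "negl (\<lambda>x. snd c x - fst c x)" by (rule copy_ringD(8)[OF copy_field_copy_ring[OF r(1)] c])
    show "eventually (\<lambda>x. \<bar>fst c x\<bar> \<le> E x) at_top"
      using dom[OF copy_ringD(6)[OF copy_field_copy_ring[OF r(1)] c]] by eventually_elim simp
  qed
  moreover have "ev2 Y pe \<in> M" unfolding ev2_def[abs_def]
  proof (rule hardy_field_ev[OF M(1)])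
    fix c assume "c \<in> coefs pe"
    then have "(fst c, snd c) \<in> \<rho>" using ce by simp
    then have "snd c \<in> Range \<rho>" by (rule RangeI)
    then show "snd c \<in> M" using M(2) by blast
  next
    show "Y j \<in> M" for j unfolding Y_def by (rule hardy_field_derivs[OF M(1,3)])
  qed
  ultimately show False using no_oscillation_near_hardy[OF M(1) _ _ E_mono uw E(3)] unfolding ev by blast
qed

text \<open>Neither an expression nor its formal derivative oscillates, so every expression is
  eventually zero or eventually nonzero, as the construction of the fraction field requires.\<close>

lemma hardy_field_jets:
  assumes H: "hardy_field H" and f: "f \<in> germ_C_lt_inf" "adjoinable f"
  shows "hardy_field (fractions (jet_ring H f))" "jet_ring H f \<subseteq> fractions (jet_ring H f)"
proof -
  define Y where "Y = (\<lambda>j. (deriv ^^ j) f)"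
  note HD = hardy_fieldD[OF H]
  have RI: "h \<in> jet_ring H f" if "coefs e \<subseteq> H" "eventually (\<lambda>x. h x = fex e Y x) at_top" for h e
    using that unfolding jet_ring_def Y_def by blast
  have RE: "\<exists>e. coefs e \<subseteq> H \<and> eventually (\<lambda>x. h x = fex e Y x) at_top" if "h \<in> jet_ring H f" for h
    using that unfolding jet_ring_def Y_def by blast
  have YC: "Y j \<in> germ_C_lt_inf" for j unfolding Y_def by (rule germ_C_lt_inf_derivs[OF f(1)])
  have exC: "fex e Y \<in> germ_C_lt_inf" if "coefs e \<subseteq> H" for e
    using that by (induction e) (auto simp: fex_def[abs_def] intro: YC HD(2) germ_C_lt_inf_add germ_C_lt_inf_mult)
  have exd: "ev_deriv (fex e Y) (fex (Dx deriv (\<lambda>j. Vr (Suc j)) e) Y) \<and> coefs (Dx deriv (\<lambda>j. Vr (Suc j)) e) \<subseteq> H" if "coefs e \<subseteq> H" for e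
  proof
    have "eventually (\<lambda>x. \<forall>c\<in>coefs e. (c has_real_derivative deriv c x) (at x)) at_top"
      by (rule eventually_ball_finite[OF finite_coefs]) (use germ_C_lt_inf_ev_deriv HD(2) that in \<open>auto simp: ev_deriv_def\<close>)
    moreover have "eventually (\<lambda>x. \<forall>j\<in>vars e. (Y j has_real_derivative Y (Suc j) x) (at x)) at_top"
      by (rule eventually_ball_finite[OF finite_vars]) (use germ_C_lt_inf_ev_deriv[OF YC] in \<open>auto simp: ev_deriv_def Y_def\<close>)
    ultimately show "ev_deriv (fex e Y) (fex (Dx deriv (\<lambda>j. Vr (Suc j)) e) Y)"
      unfolding ev_deriv_def fex_def[abs_def]
      by eventually_elim (rule ev_has_real_derivative[where k = "\<lambda>c. c"], auto)
    show "coefs (Dx deriv (\<lambda>j. Vr (Suc j)) e) \<subseteq> H" using coefs_Dx[of deriv "\<lambda>j. Vr (Suc j)" e] that HD(8) by auto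
  qed
  have zn: "eventually (\<lambda>x. fex e Y x = 0) at_top \<or> eventually (\<lambda>x. fex e Y x \<noteq> 0) at_top" if e: "coefs e \<subseteq> H" for e
  proof (rule ccontr)
    assume "\<not> ?thesis"
    then consider "oscillates (fex e Y)" | "oscillates (deriv (fex e Y))" using not_zero_nonzero_oscillates[OF exC[OF e]] by blast
    then show False
    proof cases
      case 1
      then show ?thesis using jet_expression_not_oscillates[OF H f e] by (simp add: Y_def)
    next
      case 2
      define e' where "e' = Dx deriv (\<lambda>j. Vr (Suc j)) e"
      have e': "ev_deriv (fex e Y) (fex e' Y)" "coefs e' \<subseteq> H" using exd[OF e] unfolding e'_def by auto
      have "eventually (\<lambda>x. fex e' Y x = deriv (fex e Y) x) at_top" using ev_deriv_imp_deriv[OF e'(1)] by (auto elim: eventually_mono)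
      then have "oscillates (fex e' Y)" using 2 by (rule oscillatesI_ev)
      then show ?thesis using jet_expression_not_oscillates[OF H f e'(2)] by (simp add: Y_def)
    qed
  qed
    have sub: "jet_ring H f \<subseteq> germ_C_lt_inf"
    proof
      fix h assume "h \<in> jet_ring H f"
      then obtain e where e: "coefs e \<subseteq> H" "eventually (\<lambda>x. h x = fex e Y x) at_top" using RE by blast
      have "eventually (\<lambda>x. fex e Y x = h x) at_top" using e(2) by (auto elim: eventually_mono)
      then show "h \<in> germ_C_lt_inf" by (rule germ_C_lt_inf_cong[OF exC[OF e(1)]])
    qed
    have one: "(\<lambda>x. 1) \<in> jet_ring H f" by (rule RI[of "Cf (\<lambda>x. 1)"]) (use HD(4) in \<open>auto simp: fex_def\<close>)
    have add: "(\<lambda>x. g x + h x) \<in> jet_ring H f" and mult: "(\<lambda>x. g x * h x) \<in> jet_ring H f" if "g \<in> jet_ring H f" "h \<in> jet_ring H f" for g h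
    proof -
      note gh = that
      obtain e1 e2 where e: "coefs e1 \<subseteq> H" "eventually (\<lambda>x. g x = fex e1 Y x) at_top" "coefs e2 \<subseteq> H" "eventually (\<lambda>x. h x = fex e2 Y x) at_top"
        using RE[OF gh(1)] RE[OF gh(2)] by blast
      show "(\<lambda>x. g x + h x) \<in> jet_ring H f"
        by (rule RI[of "Ad e1 e2"]) (use e(1,3) in simp, use e(2,4) in \<open>eventually_elim, simp add: fex_def\<close>)
      show "(\<lambda>x. g x * h x) \<in> jet_ring H f"
        by (rule RI[of "Ml e1 e2"]) (use e(1,3) in simp, use e(2,4) in \<open>eventually_elim, simp add: fex_def\<close>)
    qed
    have neg: "(\<lambda>x. - g x) \<in> jet_ring H f" and der: "\<exists>h\<in>jet_ring H f. ev_deriv g h"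
      and zn': "eventually (\<lambda>x. g x = 0) at_top \<or> eventually (\<lambda>x. g x \<noteq> 0) at_top" if g: "g \<in> jet_ring H f" for g
    proof -
    obtain e where e: "coefs e \<subseteq> H" "eventually (\<lambda>x. g x = fex e Y x) at_top" using RE[OF g] by blast
    show "(\<lambda>x. - g x) \<in> jet_ring H f"
      by (rule RI[of "Ml (Cf (\<lambda>x. -1)) e"]) (use e(1) HD(7)[OF HD(4)] in simp, use e(2) in \<open>eventually_elim, simp add: fex_def\<close>)
    show "\<exists>h\<in>jet_ring H f. ev_deriv g h"
      using exd[OF e(1)] e(2) by (intro bexI[of _ "fex (Dx deriv (\<lambda>j. Vr (Suc j)) e) Y"] RI[of "Dx deriv (\<lambda>j. Vr (Suc j)) e"] ev_deriv_cong1[OF e(2)]) auto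
    show "eventually (\<lambda>x. g x = 0) at_top \<or> eventually (\<lambda>x. g x \<noteq> 0) at_top"
      using zn[OF e(1)]
    proof
      assume "eventually (\<lambda>x. fex e Y x = 0) at_top"
      then have "eventually (\<lambda>x. g x = 0) at_top" using e(2) by eventually_elim simp
      then show ?thesis ..
    next
      assume "eventually (\<lambda>x. fex e Y x \<noteq> 0) at_top"
      then have "eventually (\<lambda>x. g x \<noteq> 0) at_top" using e(2) by eventually_elim simp
      then show ?thesis ..
    qed
    qed
  show "hardy_field (fractions (jet_ring H f))" "jet_ring H f \<subseteq> fractions (jet_ring H f)"
    by (rule hardy_field_fractions[OF sub one add mult neg der zn'], assumption+)+
qed

lemma gauged_negl_mono:
  assumes g: "gauged L E1 E1'" "gauged K E2 E2'" and le: "eventually (\<lambda>x. E1 x \<le> E2 x) at_top" and n: "gauged.negl E2 d"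
  shows "gauged.negl E1 d"
proof -
  interpret a: gauged L E1 E1' by (rule g(1))
  interpret b: gauged K E2 E2' by (rule g(2))
  show ?thesis
  proof (rule a.neglI)
    fix n :: nat
    show "eventually (\<lambda>x. \<bar>d x\<bar> \<le> exp (- real n * E1 x)) at_top"
      using b.neglD[OF n, of n] le
    proof eventually_elim
      case (elim x)
      have "- real n * E2 x \<le> - real n * E1 x" using elim(2) by (simp add: mult_left_mono)
      then have "exp (- real n * E2 x) \<le> exp (- real n * E1 x)" by (simp only: exp_le_cancel_iff)
      then show ?case using elim(1) by linarith
    qed
  qed
qed

text \<open>Being negligible for the larger gauge is the stronger property. This transports a copy
  of a small field with a fast gauge to a larger field with a slower gauge, in which it can be
  extended by a further germ.\<close>

lemma gauged_copy_field_mono: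
  assumes g1: "gauged L E1 E1'" and g2: "gauged K E2 E2'" and sub: "K \<subseteq> L" and le: "eventually (\<lambda>x. E1 x \<le> E2 x) at_top"
    and r: "gauged.copy_field K E2 \<rho>"
  shows "gauged.copy_field L E1 \<rho>"
proof -
  interpret a: gauged L E1 E1' by (rule g1)
  interpret b: gauged K E2 E2' by (rule g2)
  have n: "a.negl d" if "b.negl d" for d by (rule gauged_negl_mono[OF g1 g2 le that])
  note ar = b.copy_field_copy_ring[OF r]
  have "a.copy_ring \<rho>"
  proof (rule a.copy_ringI)
    show "one_pair \<in> \<rho>" by (rule b.copy_ringD(2)[OF ar])
    fix p q assume pq: "(p, q) \<in> \<rho>"
    show "(p', q') \<in> \<rho>" if "eventually (\<lambda>x. p x = p' x) at_top" "eventually (\<lambda>x. q x = q' x) at_top" for p' q'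
      by (rule b.copy_ringD(1)[OF ar pq that])
    show "(\<lambda>x. - p x, \<lambda>x. - q x) \<in> \<rho>" by (rule b.copy_ringD(5)[OF ar pq])
    show "p \<in> L" using b.copy_ringD(6)[OF ar pq] sub by blast
    show "q \<in> germ_C_omega" by (rule b.copy_ringD(7)[OF ar pq])
    show "a.negl (\<lambda>x. q x - p x)" by (rule n[OF b.copy_ringD(8)[OF ar pq]])
    show "germ_zero q" if "germ_zero p" by (rule b.copy_ringD(9)[OF ar pq that])
    fix p' q' assume pq': "(p', q') \<in> \<rho>"
    show "(\<lambda>x. p x + p' x, \<lambda>x. q x + q' x) \<in> \<rho>" by (rule b.copy_ringD(3)[OF ar pq pq'])
    show "(\<lambda>x. p x * p' x, \<lambda>x. q x * q' x) \<in> \<rho>" by (rule b.copy_ringD(4)[OF ar pq pq'])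
  qed
  then show ?thesis using r unfolding a.copy_field_def b.copy_field_def a.inv_closed_def b.inv_closed_def by simp
qed

lemma gauged_subfield:
  assumes g: "gauged L E E'" and KL: "hardy_field K" "K \<subseteq> L" shows "gauged K E E'"
proof -
  interpret gauged L E E' by (rule g)
  show ?thesis by unfold_locales (use KL E_deriv E_lim E_mono dom in auto)
qed

lemma derivs_add_ev:
  assumes "f \<in> germ_C_lt_inf" "g \<in> germ_C_lt_inf"
  shows "eventually (\<lambda>x. (deriv ^^ j) (\<lambda>x. f x + g x) x = (deriv ^^ j) f x + (deriv ^^ j) g x) at_top"
proof (induction j)
  case (Suc j)
  have "ev_deriv (\<lambda>x. (deriv ^^ j) f x + (deriv ^^ j) g x) (\<lambda>x. (deriv ^^ Suc j) f x + (deriv ^^ Suc j) g x)"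
    using germ_C_lt_inf_ev_deriv[OF germ_C_lt_inf_derivs[OF assms(1), of j]] germ_C_lt_inf_ev_deriv[OF germ_C_lt_inf_derivs[OF assms(2), of j]]
    by (simp add: ev_deriv_add)
  from ev_deriv_imp_deriv[OF this] deriv_ev_cong[OF Suc] show ?case by eventually_elim simp
qed simp

text \<open>Packages a conclusion with two uses: it implies differential algebraicity over a Hardy
  field \<open>H\<close>, and analyticity of \<open>z\<close> if \<open>H\<close> consists of
  analytic germs.\<close>

definition copy_relation :: "(real \<Rightarrow> real) set \<Rightarrow> (real \<Rightarrow> real) \<Rightarrow> bool" where
  "copy_relation H z \<longleftrightarrow> (\<exists>K E E' \<rho>. gauged K E E' \<and> z \<in> K \<and> gauged.copy_field K E \<rho> \<and> (\<forall>a b. (a, b) \<in> \<rho> \<longrightarrow> a \<in> H) \<and>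
     \<not> (\<forall>j. transc \<rho> (\<lambda>j. (deriv ^^ j) z) j))"

text \<open>A factor of eventually constant sign cannot remove the alternation of signs at the
  midpoints n + 1/2.\<close>

lemma bump_product_oscillates:
  assumes e: "\<And>n::nat. (-1) ^ n * e (real n + 1 / 2) > (0::real)"
    and q: "eventually (\<lambda>x. q x > 0) at_top \<or> eventually (\<lambda>x. q x < 0) at_top"
  shows "oscillates (\<lambda>x. e x * q x)"
proof -
  have *: "oscillates (\<lambda>x. e x * q x)" if q: "eventually (\<lambda>x. q x > 0) at_top" for q
  proof -
    obtain T where T: "\<And>x. x \<ge> T \<Longrightarrow> q x > 0" using q by (auto simp: eventually_at_top_linorder)
    have ev: "e (real (2 * n) + 1 / 2) > 0" for n using e[of "2 * n"] by simp
    have od: "e (real (2 * n + 1) + 1 / 2) < 0" for n using e[of "2 * n + 1"] by simp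
    have "(\<exists>u\<ge>t. e u * q u > 0) \<and> (\<exists>u\<ge>t. e u * q u < 0)" for t
    proof -
      obtain n :: nat where n: "real n \<ge> max t T" using real_arch_simple by blast
      have 1: "real (2 * n) + 1 / 2 \<ge> max t T" "real (2 * n + 1) + 1 / 2 \<ge> max t T" using n by auto
      have "e (real (2 * n) + 1 / 2) * q (real (2 * n) + 1 / 2) > 0" by (rule mult_pos_pos[OF ev T]) (use 1 in linarith)
      moreover have "e (real (2 * n + 1) + 1 / 2) * q (real (2 * n + 1) + 1 / 2) < 0" by (rule mult_neg_pos[OF od T]) (use 1 in linarith)
      ultimately show ?thesis using 1 by (metis max.boundedE)
    qed
    then show ?thesis unfolding oscillates_def by blast
  qed
  from q show ?thesis
  proof
    assume "eventually (\<lambda>x. q x < 0) at_top"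
    then have "eventually (\<lambda>x. - q x > 0) at_top" by simp
    from *[OF this] have "oscillates (\<lambda>x. - (e x * q x))" by simp
    then show ?thesis by (simp only: oscillates_minus)
  qed (rule *)
qed

text \<open>Two gauges are needed: the bump \<open>e0\<close> is negligible for \<open>E1\<close>, whereas \<open>E2\<close> is chosen so large that errors
that are negligible for \<open>E2\<close> do not affect the sign of \<open>e0\<close> at its peaks.\<close>

lemma jet_field_copy_relation:
  assumes H: "hardy_field H" and f: "f \<in> germ_C_lt_inf" "adjoinable f" and z: "z \<in> fractions (jet_ring H f)"
  shows "copy_relation H z"
proof -
  define F where "F = fractions (jet_ring H f)"
  define Y where "Y = (\<lambda>j. (deriv ^^ j) f)"
  have F: "hardy_field F" and RF: "jet_ring H f \<subseteq> F" unfolding F_def by (rule hardy_field_jets[OF H f])+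
  note HD = hardy_fieldD[OF H]
  have RI: "h \<in> F" if "coefs e \<subseteq> H" "eventually (\<lambda>x. h x = fex e Y x) at_top" for h e
    using that RF unfolding jet_ring_def Y_def by blast
  have HF: "H \<subseteq> F" using RI[of "Cf _"] by (auto simp: fex_def)
  have fF: "f \<in> F" by (rule RI[of "Vr 0"]) (simp_all add: fex_def Y_def)
  from z obtain e1 e2 where e: "coefs e1 \<subseteq> H" "coefs e2 \<subseteq> H" and Q0: "eventually (\<lambda>x. fex e2 Y x \<noteq> 0) at_top"
    and zq: "eventually (\<lambda>x. z x = fex e1 Y x * inverse (fex e2 Y x)) at_top"
  proof -
    from z obtain p q where pq: "p \<in> jet_ring H f" "q \<in> jet_ring H f" "eventually (\<lambda>x. q x \<noteq> 0) at_top" "eventually (\<lambda>x. z x = p x * inverse (q x)) at_top"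
      unfolding fractions_def by blast
    from pq(1,2) obtain e1 e2 where e: "coefs e1 \<subseteq> H" "eventually (\<lambda>x. p x = fex e1 Y x) at_top" "coefs e2 \<subseteq> H" "eventually (\<lambda>x. q x = fex e2 Y x) at_top"
      unfolding jet_ring_def Y_def by blast
    have "eventually (\<lambda>x. fex e2 Y x \<noteq> 0) at_top" using e(4) pq(3) by eventually_elim simp
    moreover have "eventually (\<lambda>x. z x = fex e1 Y x * inverse (fex e2 Y x)) at_top" using e(2,4) pq(4) by eventually_elim simp
    ultimately show ?thesis by (rule that[OF e(1,3)])
  qed
  obtain s :: "nat \<Rightarrow> real \<Rightarrow> real" where s: "range s \<subseteq> H" "coefs e1 \<union> coefs e2 \<subseteq> range s"
    by (rule finite_coefs_sequence[OF H, of "coefs e1 \<union> coefs e2"]) (use e finite_coefs in \<open>auto intro: that\<close>)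
  have s': "s n \<in> H" for n using s(1) by blast
  obtain K d where KK: "hardy_field K" "K \<subseteq> H" "\<And>n. s n \<in> K" "\<And>n. d n \<in> K" "\<And>f. f \<in> K \<Longrightarrow> \<exists>n::nat. eventually (\<lambda>x. f x = d n x) at_top"
    by (rule countable_hardy_subfield[OF H s']) (rule that)
  \<comment> \<open>The field \<open>L\<close> generated by \<open>f\<close>, \<open>z\<close> and
    an enumeration of \<open>K\<close> is large enough for extending a copy by \<open>z\<close>, and
    still countable.\<close>
  define t where "t n = (if n = 0 then f else if n = 1 then z else d (n - 2))" for n
  have tF: "t n \<in> F" for n using fF z KK(2,4) HF unfolding t_def F_def by auto
  obtain L b where LL: "hardy_field L" "L \<subseteq> F" "\<And>n. t n \<in> L" "\<And>n. b n \<in> L" "\<And>f. f \<in> L \<Longrightarrow> \<exists>n::nat. eventually (\<lambda>x. f x = b n x) at_top"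
    by (rule countable_hardy_subfield[OF F tF]) (rule that)
  have fL: "f \<in> L" and zL: "z \<in> L" and dL: "d n \<in> L" for n using LL(3)[of 0] LL(3)[of 1] LL(3)[of "n + 2"] by (simp_all add: t_def)
  have KL: "K \<subseteq> L"
  proof
    fix a assume "a \<in> K"
    then obtain n where "eventually (\<lambda>x. a x = d n x) at_top" using KK(5) by blast
    then have "eventually (\<lambda>x. d n x = a x) at_top" by (auto elim: eventually_mono)
    then show "a \<in> L" by (rule hardy_fieldD(1)[OF LL(1) dL])
  qed
  obtain E1 E1' where g1: "gauged L E1 E1'"
  proof (rule gauged_exists[where K = L and d = b and b = "\<lambda>_ _. 0" and \<alpha> = "\<lambda>_. 0", OF LL(1,4,5)])
    fix E E' assume "gauged L E E'"
    then show thesis by (rule that)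
  qed auto
  interpret a: gauged L E1 E1' by (rule g1)
  obtain e0 where e0: "e0 \<in> germ_C_lt_inf" "\<And>j. a.negl ((deriv ^^ j) e0)" "\<And>n::nat. (-1) ^ n * e0 (real n + 1 / 2) > 0"
    using a.alternating_bump by blast
  define y where "y x = z x + e0 x" for x
  have zC: "z \<in> germ_C_lt_inf" by (rule a.KC[OF zL])
  have yC: "y \<in> germ_C_lt_inf" unfolding y_def[abs_def] by (rule germ_C_lt_inf_add[OF zC e0(1)])
  \<comment> \<open>As \<open>z\<close> is the quotient of the two expressions, this difference
    reduces to minus the bump times the denominator.\<close>
  define p where "p x = fex e1 Y x + (-1) * (y x * fex e2 Y x)" for x
  have "fex e2 Y \<in> F" by (rule RI[OF e(2)]) simp
  then have "eventually (\<lambda>x. fex e2 Y x > 0) at_top \<or> eventually (\<lambda>x. fex e2 Y x < 0) at_top"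
    by (intro ev_nonzero_sign Q0 germ_C_lt_inf_isCont hardy_fieldD(2)[OF F])
  from bump_product_oscillates[OF e0(3) this] have "oscillates (\<lambda>x. - (e0 x * fex e2 Y x))" by (simp only: oscillates_minus)
  moreover have "eventually (\<lambda>x. p x = - (e0 x * fex e2 Y x)) at_top"
    using zq Q0 by eventually_elim (simp add: p_def y_def field_simps)
  ultimately have "oscillates p" by (rule oscillatesI_ev[rotated])
  then obtain u w :: "nat \<Rightarrow> real" where uw: "\<And>n. u n \<ge> real n" "\<And>n. p (u n) > 0" "\<And>n. w n \<ge> real n" "\<And>n. p (w n) < 0"
    by (rule oscillates_sequences) (rule that)
  \<comment> \<open>Index 0 makes the second gauge exceed the first; the other indices bound
    \<open>y\<close> and the derivatives of \<open>f\<close> in the perturbed expression.\<close>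
  define bb where "bb n = (if n = 0 then E1 else if n = 1 then y else Y (n - 2))" for n
  have YL: "Y j \<in> L" for j unfolding Y_def by (rule a.K_derivs[OF fL])
  have bbc: "eventually (\<lambda>x. isCont (bb n) x) at_top" for n
    unfolding bb_def using a.E_deriv germ_C_lt_inf_isCont[OF yC] germ_C_lt_inf_isCont[OF a.KC[OF YL]]
    by (auto intro: DERIV_isCont always_eventually)
  obtain E2 E2' where g2: "gauged L E2 E2'" and bb: "\<And>n. eventually (\<lambda>x. \<bar>bb n x\<bar> \<le> E2 x) at_top"
     and big: "\<And>n. max (1 - ln (p (u n))) (1 - ln (- p (w n))) \<le> E2 (real n)"
    by (rule gauged_exists[where K = L and d = b and b = bb and \<alpha> = "\<lambda>n. max (1 - ln (p (u n))) (1 - ln (- p (w n)))", OF LL(1,4,5) bbc])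
      (assumption, rule that)
  have E12: "eventually (\<lambda>x. E1 x \<le> E2 x) at_top" using bb[of 0] by eventually_elim (simp add: bb_def)
  have g2K: "gauged K E2 E2'" by (rule gauged_subfield[OF g2 KK(1) KL])
  interpret c: gauged L E2 E2' by (rule g2)
  interpret k: gauged K E2 E2' by (rule g2K)
  obtain \<rho> where r: "k.copy_field \<rho>" "\<forall>y\<in>K. \<exists>g. (y, g) \<in> \<rho>" using k.full_copy by (elim exE conjE)
  obtain star where star: "\<And>y. y \<in> K \<Longrightarrow> (y, star y) \<in> \<rho>" using r(2) by metis
  \<comment> \<open>\<open>g\<close> approximates \<open>y\<close> up to the fine gauge, and thereby
    \<open>z\<close> up to the coarse one, for which the bump is negligible.\<close>
  obtain g where g: "g \<in> germ_C_omega" "\<And>j. c.negl (\<lambda>x. (deriv ^^ j) g x - (deriv ^^ j) y x)" using c.approx_negl[OF yC] by blast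
  have ra: "a.copy_field \<rho>" by (rule gauged_copy_field_mono[OF g1 g2K KL E12 r(1)])
  have rc: "c.copy_field \<rho>" by (rule gauged_copy_field_mono[OF g2 g2K KL _ r(1)]) simp
  have gz: "a.negl (\<lambda>x. (deriv ^^ j) g x - (deriv ^^ j) z x)" for j
  proof (rule a.negl_cong[OF a.negl_add[OF gauged_negl_mono[OF g1 g2 E12 g(2)[of j]] e0(2)[of j]]])
    show "eventually (\<lambda>x. (deriv ^^ j) g x - (deriv ^^ j) y x + (deriv ^^ j) e0 x = (deriv ^^ j) g x - (deriv ^^ j) z x) at_top"
      using derivs_add_ev[OF zC e0(1), of j] unfolding y_def[abs_def] by eventually_elim simp
  qed
  have nt: "\<not> (\<forall>j. transc \<rho> (\<lambda>j. (deriv ^^ j) z) j)"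
  proof
    assume tr: "\<forall>j. transc \<rho> (\<lambda>j. (deriv ^^ j) z) j"
    have "\<exists>\<rho>'. a.copy_field \<rho>' \<and> \<rho> \<subseteq> \<rho>' \<and> (z, g) \<in> \<rho>'"
      by (rule a.extend_transcendental[OF ra zL _ g(1) gz]) (use tr in simp)
    then obtain \<rho>' where r': "a.copy_field \<rho>'" "\<rho> \<subseteq> \<rho>'" "(z, g) \<in> \<rho>'" by (elim exE conjE)
    obtain M where M: "hardy_field M" "Range \<rho>' \<subseteq> M" "f \<in> M"
      using f(2) a.hardy_field_Range[OF r'(1)] unfolding adjoinable_def by blast
    define \<sigma> where "\<sigma> a = (a, star a)" for a
    define pe where "pe = Ad (map_ex \<sigma> e1) (Ml (Cf (\<lambda>x. -1, \<lambda>x. -1)) (Ml (Cf (y, g)) (map_ex \<sigma> e2)))"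
    have "\<sigma> ` (coefs e1 \<union> coefs e2) \<subseteq> \<rho>" unfolding \<sigma>_def using s(2) KK(3) star by blast
    moreover have m1: "(\<lambda>x. -1, \<lambda>x. -1) \<in> \<rho>" by (rule k.copy_ring_consts(2)[OF k.copy_field_copy_ring[OF r(1)]])
    ultimately have ce: "c \<in> \<rho> \<or> c = (y, g)" if "c \<in> coefs pe" for c
      using that unfolding pe_def by (auto simp: ex.set_map)
    have ev: "ev1 Y pe = p"
      unfolding pe_def p_def[abs_def] fex_def[abs_def] ev1_def[abs_def] by (simp add: ev_map \<sigma>_def fun_eq_iff)
    have "eventually (\<lambda>x. \<bar>ev1 Y pe x - ev2 Y pe x\<bar> \<le> exp (- E2 x)) at_top"
    proof (rule c.perturbed_expression)
      show "eventually (\<lambda>x. \<bar>Y j x\<bar> \<le> E2 x) at_top" for j using bb[of "j + 2"] by (simp add: bb_def)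
      fix c assume "c \<in> coefs pe"
      then have "(fst c, snd c) \<in> \<rho> \<or> c = (y, g)" using ce by simp
      then have "c.negl (\<lambda>x. snd c x - fst c x) \<and> eventually (\<lambda>x. \<bar>fst c x\<bar> \<le> E2 x) at_top"
      proof
        assume c: "(fst c, snd c) \<in> \<rho>"
        have "eventually (\<lambda>x. \<bar>fst c x\<bar> \<le> E2 x) at_top"
          using c.dom[OF c.copy_ringD(6)[OF c.copy_field_copy_ring[OF rc] c]] by eventually_elim simp
        then show ?thesis using c.copy_ringD(8)[OF c.copy_field_copy_ring[OF rc] c] by blast
      next
        assume c: "c = (y, g)"
        show ?thesis unfolding c using g(2)[of 0] bb[of 1] by (simp add: bb_def)
      qed
      then show "c.negl (\<lambda>x. snd c x - fst c x)" "eventually (\<lambda>x. \<bar>fst c x\<bar> \<le> E2 x) at_top" by auto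
    qed
    moreover have "ev2 Y pe \<in> M" unfolding ev2_def[abs_def]
    proof (rule hardy_field_ev[OF M(1)])
      fix c assume "c \<in> coefs pe"
      then have "(fst c, snd c) \<in> \<rho>' \<or> c = (y, g)" using ce[of c] r'(2) unfolding prod.collapse by blast
      then have "snd c \<in> Range \<rho>'"
      proof
        assume "(fst c, snd c) \<in> \<rho>'" then show ?thesis by (rule RangeI)
      next
        assume "c = (y, g)" then show ?thesis using RangeI[OF r'(3)] by simp
      qed
      then show "snd c \<in> M" using M(2) by blast
    next
      show "Y j \<in> M" for j unfolding Y_def by (rule hardy_field_derivs[OF M(1,3)])
    qed
    ultimately show False using no_oscillation_near_hardy[OF M(1) _ _ c.E_mono uw big] unfolding ev by blast
  qed
  have "a \<in> H" if "(a, b) \<in> \<rho>" for a b using k.copy_ringD(6)[OF k.copy_field_copy_ring[OF r(1)] that] KK(2) by blast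
  then show ?thesis unfolding copy_relation_def using g1 zL ra nt by blast
qed

lemma adjoinable_d_algebraic:
  assumes H: "hardy_field H" and f: "f \<in> germ_C_lt_inf" "adjoinable f" and z: "z \<in> fractions (jet_ring H f)"
  shows "d_algebraic_over H z"
proof -
  from jet_field_copy_relation[OF assms] obtain \<rho> where r: "\<forall>a b. (a, b) \<in> \<rho> \<longrightarrow> a \<in> H" "\<not> (\<forall>j. transc \<rho> (\<lambda>j. (deriv ^^ j) z) j)"
    unfolding copy_relation_def by (elim exE conjE) (rule that)
  show ?thesis by (rule algebraic_d_algebraic[OF H _ r(2)]) (use r(1) in blast)
qed

lemma jet_field_members:
  assumes H: "hardy_field H" and f: "f \<in> germ_C_lt_inf" "adjoinable f"
  shows "H \<subseteq> fractions (jet_ring H f)" "f \<in> fractions (jet_ring H f)"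
proof -
  note R = hardy_field_jets(2)[OF H f]
  show "H \<subseteq> fractions (jet_ring H f)"
  proof
    fix h assume "h \<in> H"
    then have "h \<in> jet_ring H f" unfolding jet_ring_def by (intro CollectI exI[of _ "Cf h"]) (simp add: fex_def)
    then show "h \<in> fractions (jet_ring H f)" using R by blast
  qed
  have "f \<in> jet_ring H f" unfolding jet_ring_def by (intro CollectI exI[of _ "Vr 0"]) (simp add: fex_def)
  then show "f \<in> fractions (jet_ring H f)" using R by blast
qed

text \<open>The field generated by \<open>H\<close> and \<open>f\<close> is a differentially
  algebraic Hardy field extension of \<open>H\<close>, so d-maximality makes the two equal.\<close>

lemma adjoinable_mem_d_maximal:
  assumes H: "d_maximal_hardy_field H" and f: "f \<in> germ_C_lt_inf" "adjoinable f"
  shows "f \<in> H"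
proof -
  have h: "hardy_field H" using H by (simp add: d_maximal_hardy_field_def)
  have "fractions (jet_ring H f) = H"
    using H hardy_field_jets(1)[OF h f] jet_field_members(1)[OF h f] adjoinable_d_algebraic[OF h f]
    unfolding d_maximal_hardy_field_def by blast
  then show ?thesis using jet_field_members(2)[OF h f] by simp
qed

section \<open>Analyticity and comparison of the four intersections\<close>

text \<open>A concrete analytic Hardy field. It gives adjoinability an instance, which shows that an
  adjoinable germ is in \<open>germ_C_lt_inf\<close>, and it supplies the coefficients of the
  equation that makes the germ analytic.\<close>

definition rational_germs :: "(real \<Rightarrow> real) set" where
  "rational_germs = {f. \<exists>q\<in>\<rat>. eventually (\<lambda>x. f x = q) at_top}"

lemma rational_germs_subset: "rational_germs \<subseteq> germ_C_omega"
proof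
  fix f assume "f \<in> rational_germs"
  then obtain q where "eventually (\<lambda>x. f x = q) at_top" unfolding rational_germs_def by blast
  then have "eventually (\<lambda>x. q = f x) at_top" by (auto elim: eventually_mono)
  then show "f \<in> germ_C_omega" by (rule germ_C_omega_cong[OF germ_C_omega_const])
qed

lemma hardy_field_rational_germs: "hardy_field rational_germs"
proof (rule hardy_fieldI)
  fix f assume f: "f \<in> rational_germs"
  then obtain q where q: "q \<in> \<rat>" "eventually (\<lambda>x. f x = q) at_top" unfolding rational_germs_def by blast
  show "f \<in> germ_C_lt_inf" using f rational_germs_subset germ_C_omega_subset by blast
  show "(\<lambda>x. - f x) \<in> rational_germs" unfolding rational_germs_def
    by (intro CollectI bexI[of _ "- q"]) (use q in \<open>auto elim: eventually_mono\<close>)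
  show "(\<lambda>x. inverse (f x)) \<in> rational_germs" unfolding rational_germs_def
    by (intro CollectI bexI[of _ "inverse q"]) (use q in \<open>auto elim: eventually_mono\<close>)
  show "deriv f \<in> rational_germs" unfolding rational_germs_def
    by (intro CollectI bexI[of _ 0]) (use deriv_ev_cong[OF q(2)] in auto)
  show "eventually (\<lambda>x. f x = 0) at_top \<or> eventually (\<lambda>x. f x \<noteq> 0) at_top"
  proof (cases "q = 0")
    case False
    have "eventually (\<lambda>x. f x \<noteq> 0) at_top" using q(2) by eventually_elim (simp add: False)
    then show ?thesis ..
  qed (use q(2) in simp)
  show "g \<in> rational_germs" if "eventually (\<lambda>x. f x = g x) at_top" for g
  proof -
    have "eventually (\<lambda>x. g x = q) at_top" using that q(2) by eventually_elim simp
    then show ?thesis using q(1) unfolding rational_germs_def by blast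
  qed
  fix g assume "g \<in> rational_germs"
  then obtain p where p: "p \<in> \<rat>" "eventually (\<lambda>x. g x = p) at_top" unfolding rational_germs_def by blast
  have "eventually (\<lambda>x. f x + g x = q + p) at_top" "eventually (\<lambda>x. f x * g x = q * p) at_top"
    using q(2) p(2) by (eventually_elim, simp)+
  then show "(\<lambda>x. f x + g x) \<in> rational_germs" "(\<lambda>x. f x * g x) \<in> rational_germs"
    unfolding rational_germs_def using q(1) p(1) Rats_add Rats_mult by blast+
qed (auto simp: rational_germs_def)

lemma adjoinable_C_lt_inf: "adjoinable f \<Longrightarrow> f \<in> germ_C_lt_inf"
  using hardy_field_rational_germs rational_germs_subset hardy_fieldD(2) unfolding adjoinable_def by blast

lemma adjoinable_analytic:
  assumes f: "adjoinable f" shows "f \<in> germ_C_omega"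
proof -
  note fC = adjoinable_C_lt_inf[OF f]
  obtain K E E' \<rho> where g: "gauged K E E'" "f \<in> K" "gauged.copy_field K E \<rho>" "\<forall>a b. (a, b) \<in> \<rho> \<longrightarrow> a \<in> rational_germs"
    "\<not> (\<forall>j. transc \<rho> (\<lambda>j. (deriv ^^ j) f) j)"
    using jet_field_copy_relation[OF hardy_field_rational_germs fC f jet_field_members(2)[OF hardy_field_rational_germs fC f]]
    unfolding copy_relation_def by (elim exE conjE) (rule that)
  interpret gauged K E E' by (rule g(1))
  show ?thesis by (rule algebraic_analytic[OF g(3,2) _ g(5)]) (use g(4) rational_germs_subset in blast)
qed

text \<open>Above a given analytic Hardy field there is a maximal one within the class
  \<open>U\<close>, and this contains \<open>f\<close> by assumption.\<close>

lemma adjoinableI: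
  assumes U: "germ_C_omega \<subseteq> U"
    and f: "\<And>M. hardy_field M \<Longrightarrow> M \<subseteq> U \<Longrightarrow> (\<And>H. hardy_field H \<Longrightarrow> H \<subseteq> U \<Longrightarrow> M \<subseteq> H \<Longrightarrow> H = M) \<Longrightarrow> f \<in> M"
  shows "adjoinable f"
  unfolding adjoinable_def
proof (intro allI impI, elim conjE)
  fix A assume A: "hardy_field A" "A \<subseteq> germ_C_omega"
  have AU: "A \<subseteq> U" using A(2) U by blast
  show "\<exists>M. hardy_field M \<and> A \<subseteq> M \<and> f \<in> M"
  proof (rule hardy_field_maximal_extension[OF A(1) AU])
    fix M assume M: "hardy_field M" "M \<subseteq> U" "A \<subseteq> M" "\<And>H. hardy_field H \<Longrightarrow> H \<subseteq> U \<Longrightarrow> M \<subseteq> H \<Longrightarrow> H = M"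
    have "f \<in> M" by (rule f[OF M(1,2,4)])
    then show ?thesis using M(1,3) by blast
  qed
qed

lemma hardy_field_Int:
  assumes M: "hardy_field M"
    and cong: "\<And>f g. f \<in> U \<Longrightarrow> eventually (\<lambda>x. f x = g x) at_top \<Longrightarrow> g \<in> U"
    and const: "\<And>c. (\<lambda>x. c) \<in> U"
    and add: "\<And>f g. f \<in> U \<Longrightarrow> g \<in> U \<Longrightarrow> (\<lambda>x. f x + g x) \<in> U"
    and mult: "\<And>f g. f \<in> U \<Longrightarrow> g \<in> U \<Longrightarrow> (\<lambda>x. f x * g x) \<in> U"
    and der: "\<And>f. f \<in> U \<Longrightarrow> deriv f \<in> U"
    and inv: "\<And>f. f \<in> U \<Longrightarrow> eventually (\<lambda>x. f x \<noteq> 0) at_top \<Longrightarrow> (\<lambda>x. inverse (f x)) \<in> U"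
  shows "hardy_field (M \<inter> U)"
proof (rule hardy_fieldI)
  note MD = hardy_fieldD[OF M]
  show "(\<lambda>x. 0) \<in> M \<inter> U" "(\<lambda>x. 1) \<in> M \<inter> U" using MD(3,4) const by auto
  fix f assume f: "f \<in> M \<inter> U"
  then have fM: "f \<in> M" and fU: "f \<in> U" by auto
  show "g \<in> M \<inter> U" if "eventually (\<lambda>x. f x = g x) at_top" for g using MD(1)[OF fM that] cong[OF fU that] by simp
  show "f \<in> germ_C_lt_inf" by (rule MD(2)[OF fM])
  show "(\<lambda>x. - f x) \<in> M \<inter> U" using MD(7)[OF fM] mult[OF const[of "-1"] fU] by simp
  show "deriv f \<in> M \<inter> U" using MD(8)[OF fM] der[OF fU] by simp
  show "eventually (\<lambda>x. f x = 0) at_top \<or> eventually (\<lambda>x. f x \<noteq> 0) at_top" by (rule hardy_field_zero_or_nonzero[OF M fM])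
  show "(\<lambda>x. inverse (f x)) \<in> M \<inter> U" if "eventually (\<lambda>x. f x \<noteq> 0) at_top"
    using hardy_field_inverse[OF M fM] inv[OF fU that] by simp
  fix g assume "g \<in> M \<inter> U"
  then have gM: "g \<in> M" and gU: "g \<in> U" by auto
  show "(\<lambda>x. f x + g x) \<in> M \<inter> U" using MD(5)[OF fM gM] add[OF fU gU] by simp
  show "(\<lambda>x. f x * g x) \<in> M \<inter> U" using MD(6)[OF fM gM] mult[OF fU gU] by simp
qed

lemma maximal_imp_d_maximal: "maximal_hardy_field H \<Longrightarrow> d_maximal_hardy_field H"
  unfolding maximal_hardy_field_def d_maximal_hardy_field_def by blast

text \<open>A maximal Hardy field \<open>M\<close> above \<open>H\<close> is d-maximal and so
  contains \<open>f\<close>. The Hardy field \<open>M \<inter> U\<close> lies between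
  \<open>H\<close> and \<open>U\<close>, hence equals \<open>H\<close>, and \<open>f\<close> belongs
  to it because it is analytic.\<close>

lemma adjoinable_mem_maximal_within:
  assumes f: "adjoinable f" and U: "germ_C_omega \<subseteq> U" "U \<subseteq> germ_C_lt_inf" "\<And>M. hardy_field M \<Longrightarrow> hardy_field (M \<inter> U)"
    and H: "hardy_field H" "H \<subseteq> U" "\<And>H'. hardy_field H' \<Longrightarrow> H' \<subseteq> U \<Longrightarrow> H \<subseteq> H' \<Longrightarrow> H' = H"
  shows "f \<in> H"
proof -
  have "H \<subseteq> germ_C_lt_inf" using H(2) U(2) by blast
  then show ?thesis
  proof (rule hardy_field_maximal_extension[OF H(1)])
    fix M assume M: "hardy_field M" "M \<subseteq> germ_C_lt_inf" "H \<subseteq> M" "\<And>H'. hardy_field H' \<Longrightarrow> H' \<subseteq> germ_C_lt_inf \<Longrightarrow> M \<subseteq> H' \<Longrightarrow> H' = M"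
    have "maximal_hardy_field M" unfolding maximal_hardy_field_def using M(1,4) hardy_fieldD(2) by blast
    then have "f \<in> M" by (rule adjoinable_mem_d_maximal[OF maximal_imp_d_maximal adjoinable_C_lt_inf[OF f] f])
    moreover have "M \<inter> U = H" by (rule H(3)[OF U(3)[OF M(1)]]) (use H(2) M(3) in auto)
    ultimately show ?thesis using adjoinable_analytic[OF f] U(1) by blast
  qed
qed

theorem theoremA:
  shows "\<Inter>{H. maximal_hardy_field H} = \<Inter>{H. maximal_smooth_hardy_field H}
       \<and> \<Inter>{H. maximal_smooth_hardy_field H} = \<Inter>{H. maximal_analytic_hardy_field H}
       \<and> \<Inter>{H. maximal_analytic_hardy_field H} = \<Inter>{H. d_maximal_hardy_field H}"
proof -
  have omega_inf: "germ_C_omega \<subseteq> germ_C_inf" by (rule germ_C_omega_subset_C_inf)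
  have inf: "hardy_field (M \<inter> germ_C_inf)" if "hardy_field M" for M
    by (rule hardy_field_Int[OF that germ_C_inf_cong _ germ_C_inf_add germ_C_inf_mult germ_C_inf_deriv germ_C_inf_inverse])
      (use omega_inf germ_C_omega_const in auto)
  have omega: "hardy_field (M \<inter> germ_C_omega)" if "hardy_field M" for M
    by (rule hardy_field_Int[OF that germ_C_omega_cong germ_C_omega_const germ_C_omega_add germ_C_omega_mult germ_C_omega_deriv germ_C_omega_inverse])
  have d: "adjoinable f \<Longrightarrow> f \<in> \<Inter>{H. d_maximal_hardy_field H}" for f
    using adjoinable_mem_d_maximal adjoinable_C_lt_inf by blast
  have d_max: "\<Inter>{H. d_maximal_hardy_field H} \<subseteq> \<Inter>{H. maximal_hardy_field H}"
    using maximal_imp_d_maximal by blast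
  have max: "adjoinable f" if "f \<in> \<Inter>{H. maximal_hardy_field H}" for f
  proof (rule adjoinableI[OF germ_C_omega_subset])
    fix M assume M: "hardy_field M" "M \<subseteq> germ_C_lt_inf" "\<And>H. hardy_field H \<Longrightarrow> H \<subseteq> germ_C_lt_inf \<Longrightarrow> M \<subseteq> H \<Longrightarrow> H = M"
    have "maximal_hardy_field M" unfolding maximal_hardy_field_def using M(1,3) hardy_fieldD(2) by blast
    then show "f \<in> M" using that by blast
  qed
  have smooth: "adjoinable f" if "f \<in> \<Inter>{H. maximal_smooth_hardy_field H}" for f
  proof (rule adjoinableI[OF omega_inf])
    fix M assume M: "hardy_field M" "M \<subseteq> germ_C_inf" "\<And>H. hardy_field H \<Longrightarrow> H \<subseteq> germ_C_inf \<Longrightarrow> M \<subseteq> H \<Longrightarrow> H = M"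
    have "maximal_smooth_hardy_field M" unfolding maximal_smooth_hardy_field_def smooth_hardy_field_def using M by blast
    then show "f \<in> M" using that by blast
  qed
  have analytic: "adjoinable f" if "f \<in> \<Inter>{H. maximal_analytic_hardy_field H}" for f
  proof (rule adjoinableI[OF subset_refl])
    fix M assume M: "hardy_field M" "M \<subseteq> germ_C_omega" "\<And>H. hardy_field H \<Longrightarrow> H \<subseteq> germ_C_omega \<Longrightarrow> M \<subseteq> H \<Longrightarrow> H = M"
    have "maximal_analytic_hardy_field M" unfolding maximal_analytic_hardy_field_def analytic_hardy_field_def using M by blast
    then show "f \<in> M" using that by blast
  qed
  have smooth': "f \<in> \<Inter>{H. maximal_smooth_hardy_field H}" if f: "adjoinable f" for f
  proof (intro InterI)
    fix H assume "H \<in> {H. maximal_smooth_hardy_field H}"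
    then show "f \<in> H" unfolding maximal_smooth_hardy_field_def smooth_hardy_field_def
      by (intro adjoinable_mem_maximal_within[OF f omega_inf germ_C_inf_subset inf]) auto
  qed
  have analytic': "f \<in> \<Inter>{H. maximal_analytic_hardy_field H}" if f: "adjoinable f" for f
  proof (intro InterI)
    fix H assume "H \<in> {H. maximal_analytic_hardy_field H}"
    then show "f \<in> H" unfolding maximal_analytic_hardy_field_def analytic_hardy_field_def
      by (intro adjoinable_mem_maximal_within[OF f subset_refl germ_C_omega_subset omega]) auto
  qed
  \<comment> \<open>All four intersections are identified with one set, whose description mentions
    no kind of maximality.\<close>
  have "\<Inter>{H. d_maximal_hardy_field H} = {f. adjoinable f}" using d d_max max by blast
  moreover have "\<Inter>{H. maximal_hardy_field H} = {f. adjoinable f}" using d d_max max by blast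
  moreover have "\<Inter>{H. maximal_smooth_hardy_field H} = {f. adjoinable f}" using smooth smooth' by blast
  moreover have "\<Inter>{H. maximal_analytic_hardy_field H} = {f. adjoinable f}" using analytic analytic' by blast
  ultimately show ?thesis by simp
qed

end
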